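(* The following are equivalent properties of a finitely complete (locally small) category $\mathcal C$: (1) $\mathcal C$ is $\Phi_{\mathrm{adh}}$-exact; (2) $\mathcal C$ is adhesive; (3) $\mathcal C$ admits pushouts along monomorphisms which are stable under pullback; moreover, every such pushout square is a pullback.
   Context: All categories are ordinary locally small categories ($\mathcal V=\mathbf{Set}$); lex means finite-limit-preserving between finitely complete categories. A class of lex-weights $\Phi$ is a collection of functors $\phi:\mathcal K^{op}\to\mathbf{Set}$ with each $\mathcal K$ small and finitely complete. A $\Phi$-lex-colimit is a weighted colimit $\phi\star D$ with $\phi:\mathcal K^{op}\to\mathbf{Set}$ in $\Phi$ and $D$ a lex functor with domain $\mathcal K$. $\mathcal P\mathcal C$ is the category of small presheaves on $\mathcal C$ (presheaves that are left Kan extensions of their restriction to some small full subcategory); it is finitely complete if $\mathcal C$ is. For finitely complete $\mathcal C$, $\Phi_l\mathcal C$ is the smallest full replete subcategory of $\mathcal P\mathcal C$ containing the representables and closed under finite limits and $\Phi$-lex-colimits, and $W:\mathcal C\to\Phi_l\mathcal C$ is the restricted Yoneda embedding. $\mathcal C$ is $\Phi$-exact if it is finitely complete and $W$ has a finite-limit-preserving left adjoint. $\Phi_{\mathrm{adh}}$ consists of the single functor $\phi:\mathcal K^{op}\to\mathbf{Set}$, where $\mathcal K$ is the free category with finite limits generated by a span $m:A\leftarrowtail C\to B:f$ with $m$ monomorphic, and $\phi$ is the pushout in $[\mathcal K^{op},\mathbf{Set}]$ of $\mathcal K(-,m)$ and $\mathcal K(-,f)$. A finitely complete category with pushouts along monomorphisms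 (pushouts of spans with at least one leg monic) is adhesive if for any commutative cube whose bottom face is a pushout along a monomorphism and whose two rear faces are pullbacks (the rear faces being the vertical faces containing the vertical edge over the source object of the span in the bottom face), the top face is a pushout if and only if the two front vertical faces are pullbacks. *)

theory Defs
  imports "HOL-Library.FuncSet" "HOL-Library.Equipollence"
begin

section \<open>Smallness\<close>

text \<open>
  The elements of the type 'u play the role of the class of all sets, and a collection (of any
  type) is small if it is strictly smaller than UNIV :: 'u set (limitation of size).  The condition
  below says that the cardinality of 'u is uncountable and regular: infinity and replacement/union.
  If 'u has strongly inaccessible cardinality, the small subsets of 'u are (up to bijection) the
  sets of a Grothendieck universe.  Closure under power sets is not required, so that, e.g.,
  a type of cardinality aleph-1 also qualifies.
\<close>

definition set_universe :: "'u itself \<Rightarrow> bool" where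
  "set_universe _ \<longleftrightarrow>
     (UNIV :: nat set) \<prec> (UNIV :: 'u set) \<and>
     (\<forall>(I :: 'u set) (F :: 'u \<Rightarrow> 'u set).
        I \<prec> (UNIV :: 'u set) \<and> (\<forall>i\<in>I. F i \<prec> (UNIV :: 'u set)) \<longrightarrow> (\<Union>i\<in>I. F i) \<prec> (UNIV :: 'u set))"


section \<open>Categories, functors, natural transformations\<close>

text \<open>
  Hom-sets for different pairs of objects need not be disjoint; hence composition and the action
  of functors on arrows carry the objects as arguments.  Comp C a b c g f is the composite of
  f : a --> b and g : b --> c.
\<close>

record ('o, 'm) cat =
  Obj :: "'o set"
  Hom :: "'o \<Rightarrow> 'o \<Rightarrow> 'm set"
  Ident :: "'o \<Rightarrow> 'm"
  Comp :: "'o \<Rightarrow> 'o \<Rightarrow> 'o \<Rightarrow> 'm \<Rightarrow> 'm \<Rightarrow> 'm"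

definition category :: "('o, 'm) cat \<Rightarrow> bool" where
  "category C \<longleftrightarrow>
     (\<forall>a\<in>Obj C. Ident C a \<in> Hom C a a) \<and>
     (\<forall>a\<in>Obj C. \<forall>b\<in>Obj C. \<forall>c\<in>Obj C. \<forall>f\<in>Hom C a b. \<forall>g\<in>Hom C b c. Comp C a b c g f \<in> Hom C a c) \<and>
     (\<forall>a\<in>Obj C. \<forall>b\<in>Obj C. \<forall>f\<in>Hom C a b.
        Comp C a a b f (Ident C a) = f \<and> Comp C a b b (Ident C b) f = f) \<and>
     (\<forall>a\<in>Obj C. \<forall>b\<in>Obj C. \<forall>c\<in>Obj C. \<forall>d\<in>Obj C. \<forall>f\<in>Hom C a b. \<forall>g\<in>Hom C b c. \<forall>h\<in>Hom C c d.
        Comp C a b d (Comp C b c d h g) f = Comp C a c d h (Comp C a b c g f))"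

definition locally_small :: "('o, 'u) cat \<Rightarrow> bool" where
  "locally_small C \<longleftrightarrow> category C \<and> (\<forall>a\<in>Obj C. \<forall>b\<in>Obj C. Hom C a b \<prec> (UNIV :: 'u set))"

definition small_category :: "('o, 'u) cat \<Rightarrow> bool" where
  "small_category C \<longleftrightarrow> locally_small C \<and> Obj C \<prec> (UNIV :: 'u set)"

definition finite_category :: "('o, 'm) cat \<Rightarrow> bool" where
  "finite_category C \<longleftrightarrow>
     category C \<and> finite (Obj C) \<and> (\<forall>a\<in>Obj C. \<forall>b\<in>Obj C. finite (Hom C a b))"

definition op_cat :: "('o, 'm) cat \<Rightarrow> ('o, 'm) cat" where
  "op_cat C = \<lparr>Obj = Obj C, Hom = (\<lambda>a b. Hom C b a), Ident = Ident C,
               Comp = (\<lambda>a b c g f. Comp C c b a f g)\<rparr>"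

definition full_subcat :: "('o, 'm) cat \<Rightarrow> 'o set \<Rightarrow> ('o, 'm) cat" where
  "full_subcat C S = C\<lparr>Obj := Obj C \<inter> S\<rparr>"

definition is_iso :: "('o, 'm) cat \<Rightarrow> 'o \<Rightarrow> 'o \<Rightarrow> 'm \<Rightarrow> bool" where
  "is_iso C a b f \<longleftrightarrow> f \<in> Hom C a b \<and>
     (\<exists>g\<in>Hom C b a. Comp C a b a g f = Ident C a \<and> Comp C b a b f g = Ident C b)"

definition is_mono :: "('o, 'm) cat \<Rightarrow> 'o \<Rightarrow> 'o \<Rightarrow> 'm \<Rightarrow> bool" where
  "is_mono C a b m \<longleftrightarrow> m \<in> Hom C a b \<and>
     (\<forall>x\<in>Obj C. \<forall>u\<in>Hom C x a. \<forall>v\<in>Hom C x a. Comp C x a b m u = Comp C x a b m v \<longrightarrow> u = v)"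

text \<open>
  Only the values of a functor on objects and arrows of its domain are meaningful; functors that
  agree there are naturally isomorphic, but need not be equal as records.
\<close>

record ('o1, 'm1, 'o2, 'm2) func =
  omap :: "'o1 \<Rightarrow> 'o2"
  amap :: "'o1 \<Rightarrow> 'o1 \<Rightarrow> 'm1 \<Rightarrow> 'm2"

definition is_functor ::
  "('o1, 'm1) cat \<Rightarrow> ('o2, 'm2) cat \<Rightarrow> ('o1, 'm1, 'o2, 'm2) func \<Rightarrow> bool" where
  "is_functor C D F \<longleftrightarrow> category C \<and> category D \<and>
     (\<forall>a\<in>Obj C. omap F a \<in> Obj D) \<and>
     (\<forall>a\<in>Obj C. \<forall>b\<in>Obj C. \<forall>f\<in>Hom C a b. amap F a b f \<in> Hom D (omap F a) (omap F b)) \<and>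
     (\<forall>a\<in>Obj C. amap F a a (Ident C a) = Ident D (omap F a)) \<and>
     (\<forall>a\<in>Obj C. \<forall>b\<in>Obj C. \<forall>c\<in>Obj C. \<forall>f\<in>Hom C a b. \<forall>g\<in>Hom C b c.
        amap F a c (Comp C a b c g f) =
          Comp D (omap F a) (omap F b) (omap F c) (amap F b c g) (amap F a b f))"

definition id_func :: "('o, 'm, 'o, 'm) func" where
  "id_func = \<lparr>omap = (\<lambda>a. a), amap = (\<lambda>a b f. f)\<rparr>"

definition comp_func ::
  "('o2, 'm2, 'o3, 'm3) func \<Rightarrow> ('o1, 'm1, 'o2, 'm2) func \<Rightarrow> ('o1, 'm1, 'o3, 'm3) func" where
  "comp_func G F = \<lparr>omap = (\<lambda>a. omap G (omap F a)),
                    amap = (\<lambda>a b f. amap G (omap F a) (omap F b) (amap F a b f))\<rparr>"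

definition nat_trans ::
  "('o1, 'm1) cat \<Rightarrow> ('o2, 'm2) cat \<Rightarrow> ('o1, 'm1, 'o2, 'm2) func \<Rightarrow> ('o1, 'm1, 'o2, 'm2) func
     \<Rightarrow> ('o1 \<Rightarrow> 'm2) \<Rightarrow> bool" where
  "nat_trans C D F G \<alpha> \<longleftrightarrow> \<alpha> \<in> extensional (Obj C) \<and>
     (\<forall>a\<in>Obj C. \<alpha> a \<in> Hom D (omap F a) (omap G a)) \<and>
     (\<forall>a\<in>Obj C. \<forall>b\<in>Obj C. \<forall>f\<in>Hom C a b.
        Comp D (omap F a) (omap F b) (omap G b) (\<alpha> b) (amap F a b f) =
        Comp D (omap F a) (omap G a) (omap G b) (amap G a b f) (\<alpha> a))"

definition fun_cat ::
  "('o1, 'm1) cat \<Rightarrow> ('o2, 'm2) cat \<Rightarrow> (('o1, 'm1, 'o2, 'm2) func, 'o1 \<Rightarrow> 'm2) cat" where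
  "fun_cat C D =
     \<lparr>Obj = {F. is_functor C D F},
      Hom = (\<lambda>F G. {\<alpha>. nat_trans C D F G \<alpha>}),
      Ident = (\<lambda>F. \<lambda>a\<in>Obj C. Ident D (omap F a)),
      Comp = (\<lambda>F G H \<beta> \<alpha>. \<lambda>a\<in>Obj C. Comp D (omap F a) (omap G a) (omap H a) (\<beta> a) (\<alpha> a))\<rparr>"

definition is_equivalence ::
  "('o1, 'm1) cat \<Rightarrow> ('o2, 'm2) cat \<Rightarrow> ('o1, 'm1, 'o2, 'm2) func \<Rightarrow> bool" where
  "is_equivalence C D F \<longleftrightarrow> is_functor C D F \<and>
     (\<forall>a\<in>Obj C. \<forall>b\<in>Obj C. bij_betw (amap F a b) (Hom C a b) (Hom D (omap F a) (omap F b))) \<and>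
     (\<forall>d\<in>Obj D. \<exists>a\<in>Obj C. \<exists>i. is_iso D (omap F a) d i)"

definition adjunction ::
  "('o1, 'm1) cat \<Rightarrow> ('o2, 'm2) cat \<Rightarrow> ('o1, 'm1, 'o2, 'm2) func \<Rightarrow> ('o2, 'm2, 'o1, 'm1) func
     \<Rightarrow> ('o1 \<Rightarrow> 'm1) \<Rightarrow> ('o2 \<Rightarrow> 'm2) \<Rightarrow> bool" where
  "adjunction A B L R \<eta> \<epsilon> \<longleftrightarrow> is_functor A B L \<and> is_functor B A R \<and>
     nat_trans A A id_func (comp_func R L) \<eta> \<and>
     nat_trans B B (comp_func L R) id_func \<epsilon> \<and>
     (\<forall>a\<in>Obj A. Comp B (omap L a) (omap L (omap R (omap L a))) (omap L a)
                  (\<epsilon> (omap L a)) (amap L a (omap R (omap L a)) (\<eta> a)) = Ident B (omap L a)) \<and>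
     (\<forall>b\<in>Obj B. Comp A (omap R b) (omap R (omap L (omap R b))) (omap R b)
                  (amap R (omap L (omap R b)) b (\<epsilon> b)) (\<eta> (omap R b)) = Ident A (omap R b))"


section \<open>Finite limits, squares\<close>

definition is_cone ::
  "('j, 'n) cat \<Rightarrow> ('o, 'm) cat \<Rightarrow> ('j, 'n, 'o, 'm) func \<Rightarrow> 'o \<Rightarrow> ('j \<Rightarrow> 'm) \<Rightarrow> bool" where
  "is_cone J C D x \<pi> \<longleftrightarrow> x \<in> Obj C \<and>
     (\<forall>j\<in>Obj J. \<pi> j \<in> Hom C x (omap D j)) \<and>
     (\<forall>i\<in>Obj J. \<forall>j\<in>Obj J. \<forall>u\<in>Hom J i j.
        Comp C x (omap D i) (omap D j) (amap D i j u) (\<pi> i) = \<pi> j)"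

definition is_limit ::
  "('j, 'n) cat \<Rightarrow> ('o, 'm) cat \<Rightarrow> ('j, 'n, 'o, 'm) func \<Rightarrow> 'o \<Rightarrow> ('j \<Rightarrow> 'm) \<Rightarrow> bool" where
  "is_limit J C D x \<pi> \<longleftrightarrow> is_cone J C D x \<pi> \<and>
     (\<forall>y \<rho>. is_cone J C D y \<rho> \<longrightarrow>
        (\<exists>!h. h \<in> Hom C y x \<and> (\<forall>j\<in>Obj J. Comp C y x (omap D j) (\<pi> j) h = \<rho> j)))"

text \<open>Every finite category is isomorphic to one with objects and arrows in nat.\<close>

definition finitely_complete :: "('o, 'm) cat \<Rightarrow> bool" where
  "finitely_complete C \<longleftrightarrow> category C \<and>
     (\<forall>(J :: (nat, nat) cat) D. finite_category J \<and> is_functor J C D \<longrightarrow> (\<exists>x \<pi>. is_limit J C D x \<pi>))"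

definition lex ::
  "('o1, 'm1) cat \<Rightarrow> ('o2, 'm2) cat \<Rightarrow> ('o1, 'm1, 'o2, 'm2) func \<Rightarrow> bool" where
  "lex C E F \<longleftrightarrow> finitely_complete C \<and> finitely_complete E \<and> is_functor C E F \<and>
     (\<forall>(J :: (nat, nat) cat) D x \<pi>. finite_category J \<and> is_functor J C D \<and> is_limit J C D x \<pi> \<longrightarrow>
        is_limit J E (comp_func F D) (omap F x) (\<lambda>j. amap F x (omap D j) (\<pi> j)))"

text \<open>
  In the next three definitions the square consists of p : P --> A, q : P --> B, f : A --> D and
  g : B --> D.
\<close>

definition comm_square ::
  "('o, 'm) cat \<Rightarrow> 'o \<Rightarrow> 'o \<Rightarrow> 'o \<Rightarrow> 'o \<Rightarrow> 'm \<Rightarrow> 'm \<Rightarrow> 'm \<Rightarrow> 'm \<Rightarrow> bool" where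
  "comm_square C P A B D p q f g \<longleftrightarrow>
     P \<in> Obj C \<and> A \<in> Obj C \<and> B \<in> Obj C \<and> D \<in> Obj C \<and>
     p \<in> Hom C P A \<and> q \<in> Hom C P B \<and> f \<in> Hom C A D \<and> g \<in> Hom C B D \<and>
     Comp C P A D f p = Comp C P B D g q"

definition is_pullback ::
  "('o, 'm) cat \<Rightarrow> 'o \<Rightarrow> 'o \<Rightarrow> 'o \<Rightarrow> 'o \<Rightarrow> 'm \<Rightarrow> 'm \<Rightarrow> 'm \<Rightarrow> 'm \<Rightarrow> bool" where
  "is_pullback C P A B D p q f g \<longleftrightarrow> comm_square C P A B D p q f g \<and>
     (\<forall>Q u v. comm_square C Q A B D u v f g \<longrightarrow>
        (\<exists>!h. h \<in> Hom C Q P \<and> Comp C Q P A p h = u \<and> Comp C Q P B q h = v))"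

definition is_pushout ::
  "('o, 'm) cat \<Rightarrow> 'o \<Rightarrow> 'o \<Rightarrow> 'o \<Rightarrow> 'o \<Rightarrow> 'm \<Rightarrow> 'm \<Rightarrow> 'm \<Rightarrow> 'm \<Rightarrow> bool" where
  "is_pushout C P A B D p q f g \<longleftrightarrow> comm_square C P A B D p q f g \<and>
     (\<forall>E u v. comm_square C P A B E p q u v \<longrightarrow>
        (\<exists>!h. h \<in> Hom C D E \<and> Comp C A D E h f = u \<and> Comp C B D E h g = v))"


section \<open>Presheaves\<close>

definition Set_cat :: "('u set, 'u \<Rightarrow> 'u) cat" where
  "Set_cat = \<lparr>Obj = {X. X \<prec> (UNIV :: 'u set)}, Hom = (\<lambda>X Y. X \<rightarrow>\<^sub>E Y),
              Ident = (\<lambda>X. \<lambda>x\<in>X. x), Comp = (\<lambda>X Y Z g f. compose X g f)\<rparr>"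

type_synonym ('o, 'u) presheaf = "('o, 'u, 'u set, 'u \<Rightarrow> 'u) func"

definition presheaf_cat :: "('o, 'u) cat \<Rightarrow> (('o, 'u) presheaf, 'o \<Rightarrow> 'u \<Rightarrow> 'u) cat" where
  "presheaf_cat C = fun_cat (op_cat C) Set_cat"

definition representable :: "('o, 'u) cat \<Rightarrow> 'o \<Rightarrow> ('o, 'u) presheaf" where
  "representable C c = \<lparr>omap = (\<lambda>a. Hom C a c),
                        amap = (\<lambda>a b f. \<lambda>g\<in>Hom C a c. Comp C b a c g f)\<rparr>"

definition yoneda :: "('o, 'u) cat \<Rightarrow> ('o, 'u, ('o, 'u) presheaf, 'o \<Rightarrow> 'u \<Rightarrow> 'u) func" where
  "yoneda C = \<lparr>omap = representable C,
               amap = (\<lambda>c d f. \<lambda>a\<in>Obj C. \<lambda>g\<in>Hom C a c. Comp C a c d f g)\<rparr>"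

text \<open>
  (L, \<eta>) is the left Kan extension of F : A --> E along I : A --> B.
\<close>

definition is_left_kan_extension ::
  "('o1, 'm1) cat \<Rightarrow> ('o2, 'm2) cat \<Rightarrow> ('o3, 'm3) cat \<Rightarrow> ('o1, 'm1, 'o2, 'm2) func
     \<Rightarrow> ('o1, 'm1, 'o3, 'm3) func \<Rightarrow> ('o2, 'm2, 'o3, 'm3) func \<Rightarrow> ('o1 \<Rightarrow> 'm3) \<Rightarrow> bool" where
  "is_left_kan_extension A B E I F L \<eta> \<longleftrightarrow>
     is_functor A B I \<and> is_functor A E F \<and> is_functor B E L \<and> nat_trans A E F (comp_func L I) \<eta> \<and>
     (\<forall>G \<alpha>. is_functor B E G \<and> nat_trans A E F (comp_func G I) \<alpha> \<longrightarrow>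
        (\<exists>!\<beta>. nat_trans B E L G \<beta> \<and>
           (\<forall>a\<in>Obj A. Comp E (omap F a) (omap L (omap I a)) (omap G (omap I a)) (\<beta> (omap I a)) (\<eta> a)
                        = \<alpha> a)))"

definition small_presheaf :: "('o, 'u) cat \<Rightarrow> ('o, 'u) presheaf \<Rightarrow> bool" where
  "small_presheaf C P \<longleftrightarrow> is_functor (op_cat C) Set_cat P \<and>
     (\<exists>S \<subseteq> Obj C. S \<prec> (UNIV :: 'u set) \<and>
        is_left_kan_extension (op_cat (full_subcat C S)) (op_cat C) Set_cat id_func
          (comp_func P id_func) P (\<lambda>a\<in>S. Ident Set_cat (omap P a)))"

definition small_presheaf_cat :: "('o, 'u) cat \<Rightarrow> (('o, 'u) presheaf, 'o \<Rightarrow> 'u \<Rightarrow> 'u) cat" where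
  "small_presheaf_cat C = full_subcat (presheaf_cat C) {P. small_presheaf C P}"


section \<open>Lex-weights and exactness\<close>

text \<open>A weight is a pair of a category K and a functor from the opposite of K to sets.\<close>

type_synonym 'u weight = "('u, 'u) cat \<times> ('u, 'u) presheaf"

definition lex_weight :: "'u weight \<Rightarrow> bool" where
  "lex_weight w \<longleftrightarrow> small_category (fst w) \<and> finitely_complete (fst w) \<and>
     is_functor (op_cat (fst w)) Set_cat (snd w)"

text \<open>
  A weighted cocone is a natural transformation \<gamma> from \<phi> to E(D-, x), written out because the
  hom-sets of E need not consist of elements of 'u.  A weighted colimit is a universal one.
\<close>

definition weighted_cocone ::
  "('k, 'u) cat \<Rightarrow> ('k, 'u) presheaf \<Rightarrow> ('o, 'm) cat \<Rightarrow> ('k, 'u, 'o, 'm) func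
     \<Rightarrow> 'o \<Rightarrow> ('k \<Rightarrow> 'u \<Rightarrow> 'm) \<Rightarrow> bool" where
  "weighted_cocone K \<phi> E D x \<gamma> \<longleftrightarrow> x \<in> Obj E \<and>
     (\<forall>k\<in>Obj K. \<forall>s\<in>omap \<phi> k. \<gamma> k s \<in> Hom E (omap D k) x) \<and>
     (\<forall>k\<in>Obj K. \<forall>l\<in>Obj K. \<forall>f\<in>Hom K k l. \<forall>s\<in>omap \<phi> l.
        \<gamma> k (amap \<phi> l k f s) = Comp E (omap D k) (omap D l) x (\<gamma> l s) (amap D k l f))"

definition is_weighted_colimit ::
  "('k, 'u) cat \<Rightarrow> ('k, 'u) presheaf \<Rightarrow> ('o, 'm) cat \<Rightarrow> ('k, 'u, 'o, 'm) func
     \<Rightarrow> 'o \<Rightarrow> ('k \<Rightarrow> 'u \<Rightarrow> 'm) \<Rightarrow> bool" where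
  "is_weighted_colimit K \<phi> E D x \<gamma> \<longleftrightarrow> weighted_cocone K \<phi> E D x \<gamma> \<and>
     (\<forall>y \<delta>. weighted_cocone K \<phi> E D y \<delta> \<longrightarrow>
        (\<exists>!h. h \<in> Hom E x y \<and> (\<forall>k\<in>Obj K. \<forall>s\<in>omap \<phi> k. Comp E (omap D k) x y h (\<gamma> k s) = \<delta> k s)))"

definition replete :: "('o, 'm) cat \<Rightarrow> 'o set \<Rightarrow> bool" where
  "replete E S \<longleftrightarrow> (\<forall>x\<in>S. \<forall>y\<in>Obj E. (\<exists>i. is_iso E x y i) \<longrightarrow> y \<in> S)"

definition closed_under_finite_limits :: "('o, 'm) cat \<Rightarrow> 'o set \<Rightarrow> bool" where
  "closed_under_finite_limits E S \<longleftrightarrow>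
     (\<forall>(J :: (nat, nat) cat) D x \<pi>. finite_category J \<and> is_functor J E D \<and>
        (\<forall>j\<in>Obj J. omap D j \<in> S) \<and> is_limit J E D x \<pi> \<longrightarrow> x \<in> S)"

definition closed_under_lex_colimits :: "'u weight set \<Rightarrow> ('o, 'm) cat \<Rightarrow> 'o set \<Rightarrow> bool" where
  "closed_under_lex_colimits \<Phi> E S \<longleftrightarrow>
     (\<forall>K \<phi> D x \<gamma>. (K, \<phi>) \<in> \<Phi> \<and> lex K E D \<and> (\<forall>k\<in>Obj K. omap D k \<in> S) \<and>
        is_weighted_colimit K \<phi> E D x \<gamma> \<longrightarrow> x \<in> S)"

definition Phi_l :: "'u weight set \<Rightarrow> ('o, 'u) cat \<Rightarrow> (('o, 'u) presheaf, 'o \<Rightarrow> 'u \<Rightarrow> 'u) cat" where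
  "Phi_l \<Phi> C = full_subcat (small_presheaf_cat C)
     (\<Inter>{S. S \<subseteq> Obj (small_presheaf_cat C) \<and> representable C ` Obj C \<subseteq> S \<and>
           replete (small_presheaf_cat C) S \<and>
           closed_under_finite_limits (small_presheaf_cat C) S \<and>
           closed_under_lex_colimits \<Phi> (small_presheaf_cat C) S})"

definition Phi_exact :: "'u weight set \<Rightarrow> ('o, 'u) cat \<Rightarrow> bool" where
  "Phi_exact \<Phi> C \<longleftrightarrow> finitely_complete C \<and>
     (\<exists>L \<eta> \<epsilon>. adjunction (Phi_l \<Phi> C) C L (yoneda C) \<eta> \<epsilon> \<and> lex (Phi_l \<Phi> C) C L)"


section \<open>The weight for adhesive categories\<close>

text \<open>
  A span (A, X, B, m, f) consists of m : X --> A, assumed monic, and f : X --> B.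
\<close>

definition mono_span_cat :: "('o, 'm) cat \<Rightarrow> ('o \<times> 'o \<times> 'o \<times> 'm \<times> 'm, 'm \<times> 'm \<times> 'm) cat" where
  "mono_span_cat E =
     \<lparr>Obj = {(A, X, B, m, f). A \<in> Obj E \<and> X \<in> Obj E \<and> B \<in> Obj E \<and> is_mono E X A m \<and> f \<in> Hom E X B},
      Hom = (\<lambda>(A, X, B, m, f) (A', X', B', m', f').
               {(a, x, b). a \<in> Hom E A A' \<and> x \<in> Hom E X X' \<and> b \<in> Hom E B B' \<and>
                  Comp E X A A' a m = Comp E X X' A' m' x \<and>
                  Comp E X B B' b f = Comp E X X' B' f' x}),
      Ident = (\<lambda>(A, X, B, m, f). (Ident E A, Ident E X, Ident E B)),
      Comp = (\<lambda>(A, X, B, m, f) (A', X', B', m', f') (A'', X'', B'', m'', f'') (a', x', b') (a, x, b).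
                (Comp E A A' A'' a' a, Comp E X X' X'' x' x, Comp E B B' B'' b' b))\<rparr>"

definition lex_fun_cat ::
  "('o1, 'm1) cat \<Rightarrow> ('o2, 'm2) cat \<Rightarrow> (('o1, 'm1, 'o2, 'm2) func, 'o1 \<Rightarrow> 'm2) cat" where
  "lex_fun_cat K E = full_subcat (fun_cat K E) {F. lex K E F}"

definition eval_span ::
  "'o1 \<times> 'o1 \<times> 'o1 \<times> 'm1 \<times> 'm1 \<Rightarrow>
   (('o1, 'm1, 'o2, 'm2) func, 'o1 \<Rightarrow> 'm2, 'o2 \<times> 'o2 \<times> 'o2 \<times> 'm2 \<times> 'm2, 'm2 \<times> 'm2 \<times> 'm2) func" where
  "eval_span = (\<lambda>(A, X, B, m, f).
     \<lparr>omap = (\<lambda>F. (omap F A, omap F X, omap F B, amap F X A m, amap F X B f)),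
      amap = (\<lambda>F G \<tau>. (\<tau> A, \<tau> X, \<tau> B))\<rparr>)"

text \<open>
  K is the free category with finite limits on the span s with one monic leg: evaluation at s is
  an equivalence from lex functors K --> E to such spans in E, for each finitely complete E
  (locally small, with a class of objects).  This determines K up to equivalence.
\<close>

definition free_lex_on_mono_span ::
  "('u, 'u) cat \<Rightarrow> 'u \<times> 'u \<times> 'u \<times> 'u \<times> 'u \<Rightarrow> bool" where
  "free_lex_on_mono_span K s \<longleftrightarrow>
     locally_small K \<and> finitely_complete K \<and> s \<in> Obj (mono_span_cat K) \<and>
     (\<forall>E :: ('u, 'u) cat. locally_small E \<and> finitely_complete E \<longrightarrow>
        is_equivalence (lex_fun_cat K E) (mono_span_cat E) (eval_span s))"

definition is_adh_weight :: "'u weight \<Rightarrow> bool" where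
  "is_adh_weight w \<longleftrightarrow> lex_weight w \<and>
     (\<exists>A X B m f i j. free_lex_on_mono_span (fst w) (A, X, B, m, f) \<and>
        is_pushout (presheaf_cat (fst w))
          (representable (fst w) X) (representable (fst w) A) (representable (fst w) B) (snd w)
          (amap (yoneda (fst w)) X A m) (amap (yoneda (fst w)) X B f) i j)"


section \<open>Adhesive categories\<close>

definition pushout_along_mono ::
  "('o, 'm) cat \<Rightarrow> 'o \<Rightarrow> 'o \<Rightarrow> 'o \<Rightarrow> 'o \<Rightarrow> 'm \<Rightarrow> 'm \<Rightarrow> 'm \<Rightarrow> 'm \<Rightarrow> bool" where
  "pushout_along_mono C X A B D m f g n \<longleftrightarrow>
     is_pushout C X A B D m f g n \<and> (is_mono C X A m \<or> is_mono C X B f)"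

definition has_pushouts_along_monos :: "('o, 'm) cat \<Rightarrow> bool" where
  "has_pushouts_along_monos C \<longleftrightarrow>
     (\<forall>X\<in>Obj C. \<forall>A\<in>Obj C. \<forall>B\<in>Obj C. \<forall>m\<in>Hom C X A. \<forall>f\<in>Hom C X B.
        is_mono C X A m \<or> is_mono C X B f \<longrightarrow> (\<exists>D g n. is_pushout C X A B D m f g n))"

text \<open>
  A cube with bottom face X, A, B, D, top face X', A', B', D' and vertical edges x, a, b, d.  The
  rear faces are those on X' X A' A and X' X B' B, the front faces those on A' A D' D and B' B D' D.
\<close>

definition comm_cube ::
  "('o, 'm) cat \<Rightarrow> 'o \<Rightarrow> 'o \<Rightarrow> 'o \<Rightarrow> 'o \<Rightarrow> 'm \<Rightarrow> 'm \<Rightarrow> 'm \<Rightarrow> 'm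
     \<Rightarrow> 'o \<Rightarrow> 'o \<Rightarrow> 'o \<Rightarrow> 'o \<Rightarrow> 'm \<Rightarrow> 'm \<Rightarrow> 'm \<Rightarrow> 'm \<Rightarrow> 'm \<Rightarrow> 'm \<Rightarrow> 'm \<Rightarrow> 'm \<Rightarrow> bool" where
  "comm_cube C X A B D m f g n X' A' B' D' m' f' g' n' x a b d \<longleftrightarrow>
     comm_square C X A B D m f g n \<and> comm_square C X' A' B' D' m' f' g' n' \<and>
     comm_square C X' A' X A m' x a m \<and> comm_square C X' B' X B f' x b f \<and>
     comm_square C A' D' A D g' a d g \<and> comm_square C B' D' B D n' b d n"

definition adhesive :: "('o, 'm) cat \<Rightarrow> bool" where
  "adhesive C \<longleftrightarrow> finitely_complete C \<and> has_pushouts_along_monos C \<and>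
     (\<forall>X A B D m f g n X' A' B' D' m' f' g' n' x a b d.
        comm_cube C X A B D m f g n X' A' B' D' m' f' g' n' x a b d \<and>
        pushout_along_mono C X A B D m f g n \<and>
        is_pullback C X' A' X A m' x a m \<and> is_pullback C X' B' X B f' x b f \<longrightarrow>
        (is_pushout C X' A' B' D' m' f' g' n' \<longleftrightarrow>
           is_pullback C A' D' A D g' a d g \<and> is_pullback C B' D' B D n' b d n))"

text \<open>
  Pulling back a pushout square along d : D' --> D gives a cube whose four vertical faces are
  pullbacks.
\<close>

definition stable_pushouts_along_monos :: "('o, 'm) cat \<Rightarrow> bool" where
  "stable_pushouts_along_monos C \<longleftrightarrow>
     (\<forall>X A B D m f g n X' A' B' D' m' f' g' n' x a b d.
        comm_cube C X A B D m f g n X' A' B' D' m' f' g' n' x a b d \<and>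
        pushout_along_mono C X A B D m f g n \<and>
        is_pullback C X' A' X A m' x a m \<and> is_pullback C X' B' X B f' x b f \<and>
        is_pullback C A' D' A D g' a d g \<and> is_pullback C B' D' B D n' b d n \<longrightarrow>
        is_pushout C X' A' B' D' m' f' g' n')"

definition pushouts_along_monos_are_pullbacks :: "('o, 'm) cat \<Rightarrow> bool" where
  "pushouts_along_monos_are_pullbacks C \<longleftrightarrow>
     (\<forall>X A B D m f g n. pushout_along_mono C X A B D m f g n \<longrightarrow> is_pullback C X A B D m f g n)"

end

theory Submission
  imports Defs
begin

text \<open>
  Stable pushouts along monomorphisms make the pairs of coprojections into the covers of a
  subcanonical topology.  If these pushouts are also pullbacks, the kernel pair of a coprojection
  is locally the union of the diagonal and the kernel pair of the other leg, and adhesiveness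
  becomes a local verification.  In this situation the presheaves that are locally isomorphic to a
  representable are closed under finite limits and under pushouts of lex spans; the local
  isomorphisms are the components of the unit of a reflection, which is lex because local
  isomorphisms are stable under finite limits.  Conversely, pushouts of representables along
  monomorphisms formed in presheaves are stable and are pullbacks, and a lex reflection transports
  both properties to C.
\<close>

section \<open>Small sets\<close>

text \<open>The reflection is therefore never constructed on all small presheaves: it is defined
  only where a representable is known to be the answer, and the closure defining
  \<open>Phi_l\<close> is shown to stay inside that class. Covers are generated by finitely many
  pushout steps, hence an inductive predicate, and gluing arrows into an object of \<open>C\<close>
  becomes an induction. The weight is tested only against categories with objects of type
  \<open>'u\<close>; spans in \<open>C\<close> are reached by moving a small subcategory closed
  under finite limits into that type. Smallness of presheaves is handled by closing the generating
  set under finite limits: the Kan extension is then a pointwise filtered colimit and commutes with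
  pullbacks. Pushouts of presheaves are controlled by one pointwise injective leg, which lets a
  single zigzag decide equality of elements.\<close>

lemma universe_infinite:
  assumes "set_universe TYPE('u)" shows "infinite (UNIV :: 'u set)"
proof -
  have "(UNIV :: nat set) \<lesssim> (UNIV :: 'u set)"
    using assms by (intro lesspoll_imp_lepoll) (simp add: set_universe_def)
  then obtain f :: "nat \<Rightarrow> 'u" where "inj f" unfolding lepoll_def by blast
  then show ?thesis using finite_imageD[of f UNIV] finite_subset[OF subset_UNIV] by auto
qed

lemma small_finite:
  assumes "set_universe TYPE('u)" "finite A" shows "A \<prec> (UNIV :: 'u set)"
  using finite_lesspoll_infinite[OF universe_infinite[OF assms(1)] assms(2)] .

lemma small_image: "A \<prec> U \<Longrightarrow> f ` A \<prec> U"
  by (rule lesspoll_trans1[OF image_lepoll])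

lemma small_subset: "A \<subseteq> B \<Longrightarrow> B \<prec> U \<Longrightarrow> A \<prec> U"
  by (rule lesspoll_trans1[OF subset_imp_lepoll])

text \<open>The axiom in \<open>set_universe\<close> indexes unions by subsets of \<open>'u\<close>.
  An injection \<open>e\<close> moves an index set of any type into \<open>'u\<close>, and the
  family is read back along the inverse of \<open>e\<close> on \<open>I\<close>.\<close>

lemma small_UN_universe:
  fixes F :: "'a \<Rightarrow> 'u set"
  assumes U: "set_universe TYPE('u)" and I: "I \<prec> (UNIV :: 'u set)"
    and F: "\<And>i. i \<in> I \<Longrightarrow> F i \<prec> (UNIV :: 'u set)"
  shows "(\<Union>i\<in>I. F i) \<prec> (UNIV :: 'u set)"
proof -
  obtain e :: "'a \<Rightarrow> 'u" where e: "inj_on e I"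
    using lesspoll_imp_lepoll[OF I] unfolding lepoll_def by blast
  have "e ` I \<prec> (UNIV :: 'u set)"
    using I by (rule small_image)
  moreover have "\<forall>i\<in>e ` I. F (inv_into I e i) \<prec> (UNIV :: 'u set)"
    using F by (simp add: inv_into_into)
  ultimately have "(\<Union>i\<in>e ` I. F (inv_into I e i)) \<prec> (UNIV :: 'u set)"
    using U[unfolded set_universe_def, THEN conjunct2, THEN spec, of "e ` I", THEN spec,
        of "\<lambda>i. F (inv_into I e i)"] by blast
  moreover have "(\<Union>i\<in>e ` I. F (inv_into I e i)) = (\<Union>i\<in>I. F i)"
    using e by simp
  ultimately show ?thesis by simp
qed

text \<open>An infinite type absorbs pairing, so \<open>pr\<close> codes pairs inside
  \<open>'u\<close>. The dependent sum then embeds into a small union of small subsets of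
  \<open>'u\<close>.\<close>

lemma small_Sigma:
  fixes F :: "'a \<Rightarrow> 'b set"
  assumes U: "set_universe TYPE('u)" and I: "I \<prec> (UNIV :: 'u set)"
    and F: "\<And>i. i \<in> I \<Longrightarrow> F i \<prec> (UNIV :: 'u set)"
  shows "Sigma I F \<prec> (UNIV :: 'u set)"
proof -
  obtain pr :: "'u \<times> 'u \<Rightarrow> 'u" where pr: "inj pr"
    using card_of_Times_same_infinite[OF universe_infinite[OF U]]
    unfolding card_of_ordIso[symmetric] bij_betw_def UNIV_Times_UNIV by blast
  obtain e :: "'a \<Rightarrow> 'u" where e: "inj_on e I"
    using lesspoll_imp_lepoll[OF I] unfolding lepoll_def by blast
  have "\<forall>i\<in>I. \<exists>d :: 'b \<Rightarrow> 'u. inj_on d (F i)"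
    using lesspoll_imp_lepoll[OF F] unfolding lepoll_def by blast
  then obtain d :: "'a \<Rightarrow> 'b \<Rightarrow> 'u" where d: "\<And>i. i \<in> I \<Longrightarrow> inj_on (d i) (F i)"
    by metis
  have "inj_on (\<lambda>(i, x). pr (e i, d i x)) (Sigma I F)"
  proof (rule inj_onI, clarsimp)
    fix i x j y assume *: "i \<in> I" "x \<in> F i" "j \<in> I" "y \<in> F j" "pr (e i, d i x) = pr (e j, d j y)"
    then have ij: "e i = e j" "d i x = d j y" using injD[OF pr] by blast+
    then have "i = j" using e * by (auto dest: inj_onD)
    then show "i = j \<and> x = y" using ij d * by (auto dest: inj_onD)
  qed
  moreover have "(\<lambda>(i, x). pr (e i, d i x)) ` Sigma I F \<subseteq> (\<Union>i\<in>I. (\<lambda>x. pr (e i, d i x)) ` F i)"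
    by auto
  ultimately have "Sigma I F \<lesssim> (\<Union>i\<in>I. (\<lambda>x. pr (e i, d i x)) ` F i)"
    unfolding lepoll_def by blast
  moreover have "(\<Union>i\<in>I. (\<lambda>x. pr (e i, d i x)) ` F i) \<prec> (UNIV :: 'u set)"
    by (rule small_UN_universe[OF U I]) (rule small_image[OF F])
  ultimately show ?thesis by (rule lesspoll_trans1)
qed

lemma small_UN:
  fixes F :: "'a \<Rightarrow> 'b set"
  assumes "set_universe TYPE('u)" "I \<prec> (UNIV :: 'u set)"
    "\<And>i. i \<in> I \<Longrightarrow> F i \<prec> (UNIV :: 'u set)"
  shows "(\<Union>i\<in>I. F i) \<prec> (UNIV :: 'u set)"
proof -
  have "snd ` Sigma I F \<prec> (UNIV :: 'u set)"
    by (rule small_image[OF small_Sigma[OF assms]])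
  moreover have "snd ` Sigma I F = (\<Union>i\<in>I. F i)" by force
  ultimately show ?thesis by (simp only:)
qed

lemma small_Un:
  fixes A B :: "'b set"
  assumes U: "set_universe TYPE('u)" and "A \<prec> (UNIV :: 'u set)" "B \<prec> (UNIV :: 'u set)"
  shows "A \<union> B \<prec> (UNIV :: 'u set)"
proof -
  have "(\<Union>b\<in>UNIV :: bool set. if b then A else B) \<prec> (UNIV :: 'u set)"
    by (rule small_UN[OF U small_finite[OF U]]) (use assms in auto)
  moreover have "A \<union> B = (\<Union>b\<in>UNIV :: bool set. if b then A else B)" by auto
  ultimately show ?thesis by simp
qed

lemma small_Plus:
  fixes A :: "'a set" and B :: "'b set"
  assumes "set_universe TYPE('u)" "A \<prec> (UNIV :: 'u set)" "B \<prec> (UNIV :: 'u set)"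
  shows "A <+> B \<prec> (UNIV :: 'u set)"
  unfolding Plus_def by (rule small_Un[OF assms(1) small_image[OF assms(2)] small_image[OF assms(3)]])

section \<open>Categories, pullbacks, pushouts\<close>

text \<open>\<open>Hom\<close> is unconstrained at arguments outside \<open>Obj\<close>, so
  membership in a hom-set does not make its ends objects. Bundling the three facts lets one premise
  discharge all typing conditions.\<close>

definition arr :: "('o, 'm) cat \<Rightarrow> 'o \<Rightarrow> 'o \<Rightarrow> 'm \<Rightarrow> bool" where
  "arr C a b f \<longleftrightarrow> a \<in> Obj C \<and> b \<in> Obj C \<and> f \<in> Hom C a b"

lemma arrD: "arr C a b f \<Longrightarrow> a \<in> Obj C" "arr C a b f \<Longrightarrow> b \<in> Obj C" "arr C a b f \<Longrightarrow> f \<in> Hom C a b"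
  by (auto simp: arr_def)

lemma comm_square_arr:
  "comm_square C P A B D p q f g \<longleftrightarrow> arr C P A p \<and> arr C P B q \<and> arr C A D f \<and> arr C B D g \<and>
     Comp C P A D f p = Comp C P B D g q"
  by (auto simp: comm_square_def arr_def)

lemma mono_cancel:
  "is_mono C X A m \<Longrightarrow> arr C x X u \<Longrightarrow> arr C x X v \<Longrightarrow>
     Comp C x X A m u = Comp C x X A m v \<Longrightarrow> u = v"
  by (auto simp: is_mono_def arr_def)

lemma pb_arr:
  assumes "is_pullback C P A B D p q f g"
  shows "arr C P A p" "arr C P B q" "arr C A D f" "arr C B D g"
    "Comp C P A D f p = Comp C P B D g q"
  using assms by (auto simp: is_pullback_def comm_square_arr)

lemma pb_obj:
  assumes "is_pullback C P A B D p q f g"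
  shows "P \<in> Obj C" "A \<in> Obj C" "B \<in> Obj C" "D \<in> Obj C"
  using assms by (auto simp: is_pullback_def comm_square_def)

lemma pb_ex:
  assumes "is_pullback C P A B D p q f g" "arr C Q A u" "arr C Q B v"
    "Comp C Q A D f u = Comp C Q B D g v"
  obtains h where "arr C Q P h" "Comp C Q P A p h = u" "Comp C Q P B q h = v"
proof -
  have "comm_square C Q A B D u v f g"
    using assms by (auto simp: comm_square_arr dest: pb_arr)
  then show ?thesis
    using assms(1,2) that unfolding is_pullback_def comm_square_arr arr_def by blast
qed

lemma po_arr:
  assumes "is_pushout C P A B D p q f g"
  shows "arr C P A p" "arr C P B q" "arr C A D f" "arr C B D g"
    "Comp C P A D f p = Comp C P B D g q"
  using assms by (auto simp: is_pushout_def comm_square_arr)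

lemma po_obj:
  assumes "is_pushout C P A B D p q f g"
  shows "P \<in> Obj C" "A \<in> Obj C" "B \<in> Obj C" "D \<in> Obj C"
  using assms by (auto simp: is_pushout_def comm_square_def)

lemma po_ex:
  assumes "is_pushout C P A B D p q f g" "arr C A E u" "arr C B E v"
    "Comp C P A E u p = Comp C P B E v q"
  obtains h where "arr C D E h" "Comp C A D E h f = u" "Comp C B D E h g = v"
proof -
  have "comm_square C P A B E p q u v"
    using assms by (auto simp: comm_square_arr dest: po_arr)
  then show ?thesis
    using assms(1,2) that unfolding is_pushout_def comm_square_arr arr_def by blast
qed

lemma is_pushout_swap: "is_pushout C P A B D p q f g \<longleftrightarrow> is_pushout C P B A D q p g f"
proof -
  have *: "is_pushout C P B A D q p g f" if "is_pushout C P A B D p q f g" for A B p q f g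
    using that unfolding is_pushout_def comm_square_def
    by (auto 0 0) (metis (no_types, lifting))+
  show ?thesis using * by blast
qed

lemma is_pullback_swap: "is_pullback C P A B D p q f g \<longleftrightarrow> is_pullback C P B A D q p g f"
proof -
  have *: "is_pullback C P B A D q p g f" if "is_pullback C P A B D p q f g" for A B p q f g
    using that unfolding is_pullback_def comm_square_def
    by (auto 0 0) (metis (no_types, lifting))+
  show ?thesis using * by blast
qed

locale cat =
  fixes C :: "('o, 'm) cat"
  assumes category: "category C"
begin

lemma arr_id [simp, intro]: "a \<in> Obj C \<Longrightarrow> arr C a a (Ident C a)"
  using category by (auto simp: category_def arr_def)

lemma arr_comp [simp, intro]:
  "arr C a b f \<Longrightarrow> arr C b c g \<Longrightarrow> arr C a c (Comp C a b c g f)"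
  using category by (auto simp: category_def arr_def)

lemma id_right [simp]: "arr C a b f \<Longrightarrow> Comp C a a b f (Ident C a) = f"
  using category by (auto simp: category_def arr_def)

lemma id_left [simp]: "arr C a b f \<Longrightarrow> Comp C a b b (Ident C b) f = f"
  using category by (auto simp: category_def arr_def)

lemma assoc:
  "arr C a b f \<Longrightarrow> arr C b c g \<Longrightarrow> arr C c d h \<Longrightarrow>
     Comp C a b d (Comp C b c d h g) f = Comp C a c d h (Comp C a b c g f)"
  using category unfolding category_def arr_def by blast

text \<open>Composites are kept bracketed to the right. This is a commuting square precomposed with
  an arrow in that normal form, the shape in which squares serve as rewrite steps
  throughout.\<close>

lemma comp_eq_extend:
  assumes "Comp C a b d g f = Comp C a c d k h"
    "arr C x a e" "arr C a b f" "arr C b d g" "arr C a c h" "arr C c d k"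
  shows "Comp C x b d g (Comp C x a b f e) = Comp C x c d k (Comp C x a c h e)"
  using assms by (metis assoc)

lemma pb_uniq:
  assumes "is_pullback C P A B D p q f g" "arr C Q P h" "arr C Q P h'"
    "Comp C Q P A p h = Comp C Q P A p h'" "Comp C Q P B q h = Comp C Q P B q h'"
  shows "h = h'"
proof -
  note pb_arr[OF assms(1), simp]
  have "Comp C Q A D f (Comp C Q P A p h) = Comp C Q B D g (Comp C Q P B q h)"
    by (rule comp_eq_extend) (use assms in auto)
  then have "comm_square C Q A B D (Comp C Q P A p h) (Comp C Q P B q h) f g"
    using assms(2) by (simp add: comm_square_arr)
  then have "\<exists>!k. k \<in> Hom C Q P \<and> Comp C Q P A p k = Comp C Q P A p h \<and> Comp C Q P B q k = Comp C Q P B q h"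
    using assms(1) unfolding is_pullback_def by blast
  then show ?thesis
    using assms(2-) by (metis arrD(3))
qed

lemma po_uniq:
  assumes "is_pushout C P A B D p q f g" "arr C D E h" "arr C D E h'"
    "Comp C A D E h f = Comp C A D E h' f" "Comp C B D E h g = Comp C B D E h' g"
  shows "h = h'"
proof -
  note po_arr[OF assms(1), simp]
  have "Comp C P A E (Comp C A D E h f) p = Comp C P B E (Comp C B D E h g) q"
    using assms(2) by (simp add: assoc)
  then have "comm_square C P A B E p q (Comp C A D E h f) (Comp C B D E h g)"
    using assms(2) by (simp add: comm_square_arr)
  then have "\<exists>!k. k \<in> Hom C D E \<and> Comp C A D E k f = Comp C A D E h f \<and> Comp C B D E k g = Comp C B D E h g"
    using assms(1) unfolding is_pushout_def by blast
  then show ?thesis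
    using assms(2-) by (metis arrD(3))
qed

lemma pbI:
  assumes "arr C P A p" "arr C P B q" "arr C A D f" "arr C B D g"
    "Comp C P A D f p = Comp C P B D g q"
    "\<And>Q u v. arr C Q A u \<Longrightarrow> arr C Q B v \<Longrightarrow> Comp C Q A D f u = Comp C Q B D g v \<Longrightarrow>
       \<exists>h. arr C Q P h \<and> Comp C Q P A p h = u \<and> Comp C Q P B q h = v"
    "\<And>Q h h'. arr C Q P h \<Longrightarrow> arr C Q P h' \<Longrightarrow> Comp C Q P A p h = Comp C Q P A p h' \<Longrightarrow>
       Comp C Q P B q h = Comp C Q P B q h' \<Longrightarrow> h = h'"
  shows "is_pullback C P A B D p q f g"
  unfolding is_pullback_def
proof (intro conjI allI impI)
  show "comm_square C P A B D p q f g" using assms(1-5) by (simp add: comm_square_arr)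
next
  fix Q u v assume "comm_square C Q A B D u v f g"
  then have uv: "arr C Q A u" "arr C Q B v" "Comp C Q A D f u = Comp C Q B D g v"
    by (auto simp: comm_square_arr)
  then obtain h where h: "arr C Q P h" "Comp C Q P A p h = u" "Comp C Q P B q h = v"
    using assms(6) by blast
  show "\<exists>!h. h \<in> Hom C Q P \<and> Comp C Q P A p h = u \<and> Comp C Q P B q h = v"
  proof (rule ex1I[of _ h])
    show "h \<in> Hom C Q P \<and> Comp C Q P A p h = u \<and> Comp C Q P B q h = v" using h by (auto dest: arrD)
    fix h' assume h': "h' \<in> Hom C Q P \<and> Comp C Q P A p h' = u \<and> Comp C Q P B q h' = v"
    then have "arr C Q P h'" using h by (auto simp: arr_def)
    then show "h' = h" using assms(7)[of Q h' h] h h' by simp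
  qed
qed

lemma poI:
  assumes "arr C P A p" "arr C P B q" "arr C A D f" "arr C B D g"
    "Comp C P A D f p = Comp C P B D g q"
    "\<And>E u v. arr C A E u \<Longrightarrow> arr C B E v \<Longrightarrow> Comp C P A E u p = Comp C P B E v q \<Longrightarrow>
       \<exists>h. arr C D E h \<and> Comp C A D E h f = u \<and> Comp C B D E h g = v"
    "\<And>E h h'. arr C D E h \<Longrightarrow> arr C D E h' \<Longrightarrow> Comp C A D E h f = Comp C A D E h' f \<Longrightarrow>
       Comp C B D E h g = Comp C B D E h' g \<Longrightarrow> h = h'"
  shows "is_pushout C P A B D p q f g"
  unfolding is_pushout_def
proof (intro conjI allI impI)
  show "comm_square C P A B D p q f g" using assms(1-5) by (simp add: comm_square_arr)
next
  fix E u v assume "comm_square C P A B E p q u v"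
  then have uv: "arr C A E u" "arr C B E v" "Comp C P A E u p = Comp C P B E v q"
    by (auto simp: comm_square_arr)
  then obtain h where h: "arr C D E h" "Comp C A D E h f = u" "Comp C B D E h g = v"
    using assms(6) by blast
  show "\<exists>!h. h \<in> Hom C D E \<and> Comp C A D E h f = u \<and> Comp C B D E h g = v"
  proof (rule ex1I[of _ h])
    show "h \<in> Hom C D E \<and> Comp C A D E h f = u \<and> Comp C B D E h g = v" using h by (auto dest: arrD)
    fix h' assume h': "h' \<in> Hom C D E \<and> Comp C A D E h' f = u \<and> Comp C B D E h' g = v"
    then have "arr C D E h'" using h by (auto simp: arr_def)
    then show "h' = h" using assms(7)[of E h' h] h h' by simp
  qed
qed

lemma monoI:
  assumes "arr C X A m"
    "\<And>x u v. arr C x X u \<Longrightarrow> arr C x X v \<Longrightarrow> Comp C x X A m u = Comp C x X A m v \<Longrightarrow> u = v"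
  shows "is_mono C X A m"
  using assms by (auto simp: is_mono_def arr_def)

lemma pb_mono:
  assumes "is_pullback C P A B D p q f g" "is_mono C A D f" shows "is_mono C P B q"
proof (rule monoI)
  note pb_arr[OF assms(1), simp]
  show "arr C P B q" by simp
  fix x u v assume uv [simp]: "arr C x P u" "arr C x P v" and e: "Comp C x P B q u = Comp C x P B q v"
  have "Comp C x A D f (Comp C x P A p u) = Comp C x B D g (Comp C x P B q u)"
    "Comp C x A D f (Comp C x P A p v) = Comp C x B D g (Comp C x P B q v)"
    by (rule comp_eq_extend; use pb_arr[OF assms(1)] uv in simp)+
  then have *: "Comp C x A D f (Comp C x P A p u) = Comp C x A D f (Comp C x P A p v)"
    by (simp add: e)
  have "Comp C x P A p u = Comp C x P A p v"
    by (rule mono_cancel[OF assms(2) _ _ *]) simp_all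
  then show "u = v" using pb_uniq[OF assms(1) uv] e by blast
qed

text \<open>Monicity becomes the assertion that one particular square is a pullback. This is what
  lets a functor preserving finite limits carry monomorphisms to monomorphisms.\<close>

lemma mono_kernel_pair:
  assumes "arr C X A m"
  shows "is_mono C X A m \<longleftrightarrow> is_pullback C X X X A (Ident C X) (Ident C X) m m"
proof
  note arrD[OF assms, simp]
  assume m: "is_mono C X A m"
  show "is_pullback C X X X A (Ident C X) (Ident C X) m m"
  proof (rule pbI)
    fix Q u v assume "arr C Q X u" "arr C Q X v" "Comp C Q X A m u = Comp C Q X A m v"
    then have "u = v" by (rule mono_cancel[OF m])
    then show "\<exists>h. arr C Q X h \<and> Comp C Q X X (Ident C X) h = u \<and> Comp C Q X X (Ident C X) h = v"
      using \<open>arr C Q X u\<close> by (intro exI[of _ u]) simp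
  qed (use assms in auto)
next
  assume pb: "is_pullback C X X X A (Ident C X) (Ident C X) m m"
  show "is_mono C X A m"
  proof (rule monoI[OF assms])
    fix x u v assume "arr C x X u" "arr C x X v" "Comp C x X A m u = Comp C x X A m v"
    then obtain h where "arr C x X h" "Comp C x X X (Ident C X) h = u" "Comp C x X X (Ident C X) h = v"
      by (rule pb_ex[OF pb])
    then show "u = v" by simp
  qed
qed

section \<open>Isomorphisms and transport of squares along them\<close>

definition iso :: "'o \<Rightarrow> 'o \<Rightarrow> 'm \<Rightarrow> bool" where
  "iso a b f \<longleftrightarrow> arr C a b f \<and> is_iso C a b f"

lemma isoE:
  assumes "iso a b f"
  obtains g where "arr C a b f" "arr C b a g" "Comp C a b a g f = Ident C a" "Comp C b a b f g = Ident C b"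
  using assms by (auto simp: iso_def is_iso_def arr_def)

lemma isoI:
  assumes "arr C a b f" "arr C b a g" "Comp C a b a g f = Ident C a" "Comp C b a b f g = Ident C b"
  shows "iso a b f"
  using assms by (auto simp: iso_def is_iso_def arr_def)

lemma iso_arr: "iso a b f \<Longrightarrow> arr C a b f"
  by (simp add: iso_def)

text \<open>With \<open>k\<close> the inverse of \<open>f\<close>, the inverse of \<open>q\<close>
  is induced by \<open>k\<close> after \<open>g\<close> together with the identity of
  \<open>B\<close>. The uniqueness half of the pullback property then shows that it is
  two-sided.\<close>

lemma pb_of_iso:
  assumes pb: "is_pullback C P A B D p q f g" and f: "iso A D f"
  shows "iso P B q"
proof -
  note pb_arr(1-4)[OF pb, simp]
  obtain k where k [simp]: "arr C D A k" and kf: "Comp C A D A k f = Ident C A"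
    and fk: "Comp C D A D f k = Ident C D" by (rule isoE[OF f])
  note pb_obj[OF pb, simp]
  have "Comp C B A D f (Comp C B D A k g) = Comp C B B D g (Ident C B)"
    by (simp add: assoc[symmetric] fk)
  then obtain r where r [simp]: "arr C B P r" and pr: "Comp C B P A p r = Comp C B D A k g"
    and qr: "Comp C B P B q r = Ident C B"
    by (rule pb_ex[OF pb, rotated 2]) auto
  have "Comp C P B P r q = Ident C P"
  proof (rule pb_uniq[OF pb])
    have "Comp C P P A p (Comp C P B P r q) = Comp C P B A (Comp C B P A p r) q"
      by (simp add: assoc)
    also have "\<dots> = Comp C P D A k (Comp C P B D g q)" by (simp add: pr assoc)
    also have "\<dots> = Comp C P A A (Comp C A D A k f) p"
      by (simp add: pb_arr(5)[OF pb, symmetric] assoc)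
    finally show "Comp C P P A p (Comp C P B P r q) = Comp C P P A p (Ident C P)" by (simp add: kf)
    show "Comp C P P B q (Comp C P B P r q) = Comp C P P B q (Ident C P)"
      by (simp add: assoc[symmetric] qr)
  qed auto
  then show ?thesis using qr by (intro isoI[of _ _ _ r]) auto
qed

lemma pb_transport:
  assumes pb: "is_pullback C P A B D p q f g"
    and iso: "iso P P' i" "iso A A' a" "iso B B' b" "iso D D' d"
    and arrs: "arr C P' A' p'" "arr C P' B' q'" "arr C A' D' f'" "arr C B' D' g'"
    and nat: "Comp C P P' A' p' i = Comp C P A A' a p" "Comp C P P' B' q' i = Comp C P B B' b q"
      "Comp C A A' D' f' a = Comp C A D D' d f" "Comp C B B' D' g' b = Comp C B D D' d g"
  shows "is_pullback C P' A' B' D' p' q' f' g'"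
proof -
  note pb_arr(1-4)[OF pb, simp] arrs[simp]
  obtain i' where i [simp]: "arr C P P' i" "arr C P' P i'" and ii: "Comp C P P' P i' i = Ident C P"
    "Comp C P' P P' i i' = Ident C P'" by (rule isoE[OF iso(1)])
  obtain a' where a [simp]: "arr C A A' a" "arr C A' A a'" and aa: "Comp C A A' A a' a = Ident C A"
    "Comp C A' A A' a a' = Ident C A'" by (rule isoE[OF iso(2)])
  obtain b' where b [simp]: "arr C B B' b" "arr C B' B b'" and bb: "Comp C B B' B b' b = Ident C B"
    "Comp C B' B B' b b' = Ident C B'" by (rule isoE[OF iso(3)])
  obtain d' where d [simp]: "arr C D D' d" "arr C D' D d'" and dd: "Comp C D D' D d' d = Ident C D"
    "Comp C D' D D' d d' = Ident C D'" by (rule isoE[OF iso(4)])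
  have [simp]: "P \<in> Obj C" "A \<in> Obj C" "B \<in> Obj C" "D \<in> Obj C" "P' \<in> Obj C" "A' \<in> Obj C" "B' \<in> Obj C" "D' \<in> Obj C"
    by (fact pb_obj[OF pb] arrD(2)[OF iso_arr[OF iso(1)]] arrD(2)[OF iso_arr[OF iso(2)]]
      arrD(2)[OF iso_arr[OF iso(3)]] arrD(2)[OF iso_arr[OF iso(4)]])+
  \<comment> \<open>Inverting the given isomorphisms turns the naturality hypotheses into formulas
    for \<open>p'\<close> and \<open>q'\<close>, and moves \<open>f\<close> and \<open>g\<close>
    across to \<open>f'\<close> and \<open>g'\<close>.\<close>
  have p': "p' = Comp C P' P A' (Comp C P A A' a p) i'"
  proof -
    have "p' = Comp C P' P' A' p' (Comp C P' P P' i i')" by (simp add: ii)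
    also have "\<dots> = Comp C P' P A' (Comp C P P' A' p' i) i'" by (simp add: assoc)
    finally show ?thesis by (simp add: nat)
  qed
  have q': "q' = Comp C P' P B' (Comp C P B B' b q) i'"
  proof -
    have "q' = Comp C P' P' B' q' (Comp C P' P P' i i')" by (simp add: ii)
    also have "\<dots> = Comp C P' P B' (Comp C P P' B' q' i) i'" by (simp add: assoc)
    finally show ?thesis by (simp add: nat)
  qed
  have f': "Comp C A' A D f a' = Comp C A' D' D d' f'"
  proof -
    have "Comp C A' A D f a' = Comp C A' A D (Comp C A D D (Comp C D D' D d' d) f) a'" by (simp add: dd)
    also have "\<dots> = Comp C A' D' D d' (Comp C A' A D' (Comp C A D D' d f) a')" by (simp add: assoc)
    also have "\<dots> = Comp C A' D' D d' (Comp C A' A D' (Comp C A A' D' f' a) a')" by (simp add: nat)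
    also have "\<dots> = Comp C A' D' D d' f'" by (simp add: assoc aa)
    finally show ?thesis .
  qed
  have g': "Comp C B' B D g b' = Comp C B' D' D d' g'"
  proof -
    have "Comp C B' B D g b' = Comp C B' B D (Comp C B D D (Comp C D D' D d' d) g) b'" by (simp add: dd)
    also have "\<dots> = Comp C B' D' D d' (Comp C B' B D' (Comp C B D D' d g) b')" by (simp add: assoc)
    also have "\<dots> = Comp C B' D' D d' (Comp C B' B D' (Comp C B B' D' g' b) b')" by (simp add: nat)
    also have "\<dots> = Comp C B' D' D d' g'" by (simp add: assoc bb)
    finally show ?thesis .
  qed
  show ?thesis
  proof (rule pbI)
    have "Comp C P' A' D' f' p' = Comp C P' P D' (Comp C P A D' (Comp C A A' D' f' a) p) i'"
      by (simp add: p' assoc)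
    also have "\<dots> = Comp C P' P D' (Comp C P D D' d (Comp C P A D f p)) i'" by (simp add: nat assoc)
    also have "\<dots> = Comp C P' P D' (Comp C P D D' d (Comp C P B D g q)) i'" by (simp add: pb_arr(5)[OF pb])
    also have "\<dots> = Comp C P' P D' (Comp C P B D' (Comp C B B' D' g' b) q) i'" by (simp add: nat assoc)
    also have "\<dots> = Comp C P' B' D' g' q'" by (simp add: q' assoc)
    finally show "Comp C P' A' D' f' p' = Comp C P' B' D' g' q'" .
  next
    fix Q u v assume [simp]: "arr C Q A' u" "arr C Q B' v" and e: "Comp C Q A' D' f' u = Comp C Q B' D' g' v"
    have "Comp C Q A D f (Comp C Q A' A a' u) = Comp C Q A' D (Comp C A' A D f a') u" by (simp add: assoc)
    also have "\<dots> = Comp C Q D' D d' (Comp C Q A' D' f' u)" by (simp add: f' assoc)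
    also have "\<dots> = Comp C Q B' D (Comp C B' B D g b') v" by (simp add: e g' assoc)
    also have "\<dots> = Comp C Q B D g (Comp C Q B' B b' v)" by (simp add: assoc)
    finally obtain h where h [simp]: "arr C Q P h" and ph: "Comp C Q P A p h = Comp C Q A' A a' u"
      and qh: "Comp C Q P B q h = Comp C Q B' B b' v"
      by (rule pb_ex[OF pb, rotated 2]) auto
    have "Comp C Q P' A' p' (Comp C Q P P' i h) = Comp C Q P A' (Comp C P P' A' p' i) h" by (simp add: assoc)
    also have "\<dots> = Comp C Q A A' a (Comp C Q P A p h)" by (simp add: nat assoc)
    also have "\<dots> = u" by (simp add: ph assoc[symmetric] aa)
    finally have 1: "Comp C Q P' A' p' (Comp C Q P P' i h) = u" .
    have "Comp C Q P' B' q' (Comp C Q P P' i h) = Comp C Q P B' (Comp C P P' B' q' i) h" by (simp add: assoc)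
    also have "\<dots> = Comp C Q B B' b (Comp C Q P B q h)" by (simp add: nat assoc)
    also have "\<dots> = v" by (simp add: qh assoc[symmetric] bb)
    finally show "\<exists>h. arr C Q P' h \<and> Comp C Q P' A' p' h = u \<and> Comp C Q P' B' q' h = v"
      using 1 by (intro exI[of _ "Comp C Q P P' i h"]) simp
  next
    fix Q h h' assume [simp]: "arr C Q P' h" "arr C Q P' h'"
      and e: "Comp C Q P' A' p' h = Comp C Q P' A' p' h'" "Comp C Q P' B' q' h = Comp C Q P' B' q' h'"
    have *: "Comp C Q A A' a (Comp C Q P A p (Comp C Q P' P i' k)) = Comp C Q P' A' p' k" 
            "Comp C Q B B' b (Comp C Q P B q (Comp C Q P' P i' k)) = Comp C Q P' B' q' k"
      if [simp]: "arr C Q P' k" for k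
      by (simp_all add: p' q' assoc)
    have "Comp C Q P A p (Comp C Q P' P i' h) = Comp C Q A' A a' (Comp C Q A A' a (Comp C Q P A p (Comp C Q P' P i' h)))"
      by (simp add: assoc[symmetric, of _ A _ A'] aa)
    also have "\<dots> = Comp C Q A' A a' (Comp C Q A A' a (Comp C Q P A p (Comp C Q P' P i' h')))"
      by (simp add: * e)
    also have "\<dots> = Comp C Q P A p (Comp C Q P' P i' h')"
      by (simp add: assoc[symmetric, of _ A _ A'] aa)
    finally have 1: "Comp C Q P A p (Comp C Q P' P i' h) = Comp C Q P A p (Comp C Q P' P i' h')" .
    have "Comp C Q P B q (Comp C Q P' P i' h) = Comp C Q B' B b' (Comp C Q B B' b (Comp C Q P B q (Comp C Q P' P i' h)))"
      by (simp add: assoc[symmetric, of _ B _ B'] bb)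
    also have "\<dots> = Comp C Q B' B b' (Comp C Q B B' b (Comp C Q P B q (Comp C Q P' P i' h')))"
      by (simp add: * e)
    also have "\<dots> = Comp C Q P B q (Comp C Q P' P i' h')"
      by (simp add: assoc[symmetric, of _ B _ B'] bb)
    finally have 2: "Comp C Q P B q (Comp C Q P' P i' h) = Comp C Q P B q (Comp C Q P' P i' h')" .
    have "Comp C Q P' P i' h = Comp C Q P' P i' h'"
      by (rule pb_uniq[OF pb _ _ 1 2]) simp_all
    then have "Comp C Q P P' i (Comp C Q P' P i' h) = Comp C Q P P' i (Comp C Q P' P i' h')" by simp
    then show "h = h'" by (simp add: assoc[symmetric, of _ P' _ P] ii)
  qed auto
qed

end

section \<open>Opposite categories and duality\<close>

lemma Comp_op [simp]: "Comp (op_cat C) a b c g f = Comp C c b a f g"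
  and Ident_op [simp]: "Ident (op_cat C) a = Ident C a"
  and Obj_op [simp]: "Obj (op_cat C) = Obj C"
  and Hom_op [simp]: "Hom (op_cat C) a b = Hom C b a"
  by (simp_all add: op_cat_def)

lemma arr_op [simp]: "arr (op_cat C) a b f \<longleftrightarrow> arr C b a f"
  by (auto simp: arr_def)

lemma category_op:
  assumes "category C" shows "category (op_cat C)"
proof -
  interpret cat C by unfold_locales fact
  have "Comp C d b a f (Comp C d c b g h) = Comp C d c a (Comp C c b a f g) h"
    if "arr C b a f" "arr C c b g" "arr C d c h" for a b c d f g h
    using that by (simp add: assoc)
  moreover have "Comp C c b a f g \<in> Hom C c a" if "arr C b a f" "arr C c b g" for a b c f g
    using that arrD(3)[OF arr_comp] by blast
  ultimately show ?thesis
    unfolding category_def by (simp add: arr_def arrD(3)[OF arr_id] id_left[unfolded arr_def] id_right[unfolded arr_def])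
qed

lemma is_pushout_op: "is_pushout C P A B D p q f g \<longleftrightarrow> is_pullback (op_cat C) D A B P f g p q"
  unfolding is_pushout_def is_pullback_def comm_square_arr by (simp add: conj_ac)

context cat begin

text \<open>Obtained by applying \<open>pb_transport\<close> in the opposite category. The reversal
  of arrows is why the isomorphisms here run from the new square to the old one.\<close>

lemma po_transport:
  assumes "is_pushout C P A B D p q f g"
    and iso: "iso P' P i" "iso A' A a" "iso B' B b" "iso D' D d"
    and "arr C P' A' p'" "arr C P' B' q'" "arr C A' D' f'" "arr C B' D' g'"
    and "Comp C P' A' A a p' = Comp C P' P A p i" "Comp C P' B' B b q' = Comp C P' P B q i"
      "Comp C A' D' D d f' = Comp C A' A D f a" "Comp C B' D' D d g' = Comp C B' B D g b"
  shows "is_pushout C P' A' B' D' p' q' f' g'"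
proof -
  interpret op: cat "op_cat C" by unfold_locales (rule category_op[OF category])
  have i: "op.iso y x h" if "iso x y h" for x y h
    using that by (auto simp: iso_def op.iso_def is_iso_def)
  have "is_pullback (op_cat C) D A B P f g p q"
    using assms(1) by (simp add: is_pushout_op)
  then have "is_pullback (op_cat C) D' A' B' P' f' g' p' q'"
    by (rule op.pb_transport[OF _ i[OF iso(4)] i[OF iso(2)] i[OF iso(3)] i[OF iso(1)]])
      (use assms(6-) in simp_all)
  then show ?thesis by (simp add: is_pushout_op)
qed

end

section \<open>Finite limits\<close>

lemma functor_cat: "is_functor C D F \<Longrightarrow> category C" "is_functor C D F \<Longrightarrow> category D"
  by (simp_all add: is_functor_def)

lemma functor_obj: "is_functor C D F \<Longrightarrow> a \<in> Obj C \<Longrightarrow> omap F a \<in> Obj D"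
  by (simp add: is_functor_def)

lemma functor_arr: "is_functor C D F \<Longrightarrow> arr C a b f \<Longrightarrow> arr D (omap F a) (omap F b) (amap F a b f)"
  by (simp add: is_functor_def arr_def)

lemma functor_id: "is_functor C D F \<Longrightarrow> a \<in> Obj C \<Longrightarrow> amap F a a (Ident C a) = Ident D (omap F a)"
  by (simp add: is_functor_def)

lemma functor_comp:
  "is_functor C D F \<Longrightarrow> arr C a b f \<Longrightarrow> arr C b c g \<Longrightarrow>
     amap F a c (Comp C a b c g f) = Comp D (omap F a) (omap F b) (omap F c) (amap F b c g) (amap F a b f)"
  by (simp add: is_functor_def arr_def)

lemma functorI:
  assumes "category C" "category D" "\<And>a. a \<in> Obj C \<Longrightarrow> omap F a \<in> Obj D"
    "\<And>a b f. arr C a b f \<Longrightarrow> arr D (omap F a) (omap F b) (amap F a b f)"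
    "\<And>a. a \<in> Obj C \<Longrightarrow> amap F a a (Ident C a) = Ident D (omap F a)"
    "\<And>a b c f g. arr C a b f \<Longrightarrow> arr C b c g \<Longrightarrow>
     amap F a c (Comp C a b c g f) = Comp D (omap F a) (omap F b) (omap F c) (amap F b c g) (amap F a b f)"
  shows "is_functor C D F"
  using assms by (simp add: is_functor_def arr_def)

lemma functor_comp_func:
  assumes F: "is_functor C D F" and G: "is_functor D E G" shows "is_functor C E (comp_func G F)"
proof (rule functorI)
  show "category C" "category E" using F G by (auto dest: functor_cat)
qed (simp_all add: comp_func_def functor_obj[OF F] functor_obj[OF G] functor_arr[OF F] functor_arr[OF G]
    functor_id[OF F] functor_id[OF G] functor_comp[OF F] functor_comp[OF G])

lemma comp_func_simps [simp]:
  "omap (comp_func G F) a = omap G (omap F a)"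
  "amap (comp_func G F) a b f = amap G (omap F a) (omap F b) (amap F a b f)"
  by (simp_all add: comp_func_def)

lemma cone_arr:
  assumes "is_functor J C D"
  shows "is_cone J C D x \<pi> \<longleftrightarrow> x \<in> Obj C \<and> (\<forall>j\<in>Obj J. arr C x (omap D j) (\<pi> j)) \<and>
     (\<forall>i j u. arr J i j u \<longrightarrow> Comp C x (omap D i) (omap D j) (amap D i j u) (\<pi> i) = \<pi> j)"
  using functor_obj[OF assms] by (auto simp: is_cone_def arr_def)

lemma lim_cone: "is_limit J C D x \<pi> \<Longrightarrow> is_cone J C D x \<pi>"
  by (simp add: is_limit_def)

lemma lim_ex:
  assumes "is_limit J C D x \<pi>" "is_cone J C D y \<rho>"
  obtains h where "arr C y x h" "\<And>j. j \<in> Obj J \<Longrightarrow> Comp C y x (omap D j) (\<pi> j) h = \<rho> j"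
proof -
  have "\<exists>!h. h \<in> Hom C y x \<and> (\<forall>j\<in>Obj J. Comp C y x (omap D j) (\<pi> j) h = \<rho> j)"
    using assms unfolding is_limit_def by blast
  then obtain h where "h \<in> Hom C y x" "\<forall>j\<in>Obj J. Comp C y x (omap D j) (\<pi> j) h = \<rho> j" by blast
  moreover have "x \<in> Obj C" "y \<in> Obj C" using assms by (auto simp: is_limit_def is_cone_def)
  ultimately show ?thesis using that[of h] by (simp add: arr_def)
qed

context cat begin

lemma cone_comp:
  assumes D: "is_functor J C D" and c: "is_cone J C D x \<pi>" and h: "arr C y x h"
  shows "is_cone J C D y (\<lambda>j. Comp C y x (omap D j) (\<pi> j) h)"
  using c h unfolding cone_arr[OF D] by (auto simp: arrD functor_arr[OF D] assoc[symmetric] dest: arrD)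

lemma lim_uniq:
  assumes D: "is_functor J C D" and lim: "is_limit J C D x \<pi>" and h: "arr C y x h" "arr C y x h'"
    and eq: "\<And>j. j \<in> Obj J \<Longrightarrow> Comp C y x (omap D j) (\<pi> j) h = Comp C y x (omap D j) (\<pi> j) h'"
  shows "h = h'"
proof -
  have "\<exists>!k. k \<in> Hom C y x \<and>
      (\<forall>j\<in>Obj J. Comp C y x (omap D j) (\<pi> j) k = Comp C y x (omap D j) (\<pi> j) h)"
    using lim cone_comp[OF D lim_cone[OF lim] h(1)] unfolding is_limit_def by blast
  then show ?thesis using h eq unfolding arr_def by (metis (no_types, lifting))
qed

lemma limI:
  assumes D: "is_functor J C D" and c: "is_cone J C D x \<pi>"
    and ex: "\<And>y \<rho>. is_cone J C D y \<rho> \<Longrightarrow>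
       \<exists>h. arr C y x h \<and> (\<forall>j\<in>Obj J. Comp C y x (omap D j) (\<pi> j) h = \<rho> j)"
    and uniq: "\<And>y h h'. arr C y x h \<Longrightarrow> arr C y x h' \<Longrightarrow>
       (\<And>j. j \<in> Obj J \<Longrightarrow> Comp C y x (omap D j) (\<pi> j) h = Comp C y x (omap D j) (\<pi> j) h') \<Longrightarrow> h = h'"
  shows "is_limit J C D x \<pi>"
  unfolding is_limit_def
proof (intro conjI allI impI)
  show "is_cone J C D x \<pi>" by fact
  fix y \<rho> assume \<rho>: "is_cone J C D y \<rho>"
  then obtain h where h: "arr C y x h" "\<And>j. j \<in> Obj J \<Longrightarrow> Comp C y x (omap D j) (\<pi> j) h = \<rho> j"
    using ex by blast
  show "\<exists>!h. h \<in> Hom C y x \<and> (\<forall>j\<in>Obj J. Comp C y x (omap D j) (\<pi> j) h = \<rho> j)"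
  proof (rule ex1I[of _ h])
    show "h \<in> Hom C y x \<and> (\<forall>j\<in>Obj J. Comp C y x (omap D j) (\<pi> j) h = \<rho> j)"
      using h by (auto dest: arrD)
    fix k assume k: "k \<in> Hom C y x \<and> (\<forall>j\<in>Obj J. Comp C y x (omap D j) (\<pi> j) k = \<rho> j)"
    show "k = h"
      by (rule uniq[of y]) (use h k in \<open>auto simp: arr_def\<close>)
  qed
qed

lemma lim_transport:
  assumes D: "is_functor J C D" and lim: "is_limit J C D x \<pi>" and h: "iso y x h"
    and \<rho>: "\<And>j. j \<in> Obj J \<Longrightarrow> \<rho> j = Comp C y x (omap D j) (\<pi> j) h"
  shows "is_limit J C D y \<rho>"
proof -
  obtain k where k [simp]: "arr C y x h" "arr C x y k" and kh: "Comp C y x y k h = Ident C y"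
    and hk: "Comp C x y x h k = Ident C x" by (rule isoE[OF h])
  have xy [simp]: "x \<in> Obj C" "y \<in> Obj C" by (rule arrD(2)[OF k(1)], rule arrD(1)[OF k(1)])
  have \<pi> [simp]: "arr C x (omap D j) (\<pi> j)" if "j \<in> Obj J" for j
    using lim_cone[OF lim] that by (simp add: cone_arr[OF D])
  have \<rho>': "Comp C z y (omap D j) (\<rho> j) l = Comp C z x (omap D j) (\<pi> j) (Comp C z y x h l)"
    if "j \<in> Obj J" "arr C z y l" for z j l using that by (simp add: \<rho> assoc)
  show ?thesis
  proof (rule limI[OF D])
    show "is_cone J C D y \<rho>"
      using cone_comp[OF D lim_cone[OF lim] k(1)] \<rho> by (simp add: is_cone_def)
  next
    fix z \<sigma> assume "is_cone J C D z \<sigma>"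
    then obtain l where l [simp]: "arr C z x l" and e: "\<And>j. j \<in> Obj J \<Longrightarrow> Comp C z x (omap D j) (\<pi> j) l = \<sigma> j"
      by (rule lim_ex[OF lim]) blast
    have "Comp C z y x h (Comp C z x y k l) = l" by (simp add: assoc[symmetric] hk)
    then show "\<exists>h. arr C z y h \<and> (\<forall>j\<in>Obj J. Comp C z y (omap D j) (\<rho> j) h = \<sigma> j)"
      by (intro exI[of _ "Comp C z x y k l"]) (simp add: \<rho>' e)
  next
    fix z l l' assume [simp]: "arr C z y l" "arr C z y l'"
      and e: "\<And>j. j \<in> Obj J \<Longrightarrow> Comp C z y (omap D j) (\<rho> j) l = Comp C z y (omap D j) (\<rho> j) l'"
    have "Comp C z y x h l = Comp C z y x h l'"
      by (rule lim_uniq[OF D lim, of z]) (use e in \<open>simp_all add: \<rho>'\<close>)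
    then have "Comp C z x y k (Comp C z y x h l) = Comp C z x y k (Comp C z y x h l')" by simp
    then show "l = l'" by (simp add: assoc[symmetric] kh)
  qed
qed

lemma lim_iso:
  assumes D: "is_functor J C D" and x: "is_limit J C D x \<pi>" and y: "is_limit J C D y \<rho>"
  obtains h where "iso y x h" "\<And>j. j \<in> Obj J \<Longrightarrow> \<rho> j = Comp C y x (omap D j) (\<pi> j) h"
proof -
  have o [simp]: "x \<in> Obj C" "y \<in> Obj C" using x y by (auto simp: is_limit_def is_cone_def)
  have [simp]: "arr C x (omap D j) (\<pi> j)" "arr C y (omap D j) (\<rho> j)" if "j \<in> Obj J" for j
    using lim_cone[OF x] lim_cone[OF y] that by (simp_all add: cone_arr[OF D])
  obtain h where h [simp]: "arr C y x h" and e: "\<And>j. j \<in> Obj J \<Longrightarrow> Comp C y x (omap D j) (\<pi> j) h = \<rho> j"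
    by (rule lim_ex[OF x lim_cone[OF y]]) blast
  obtain k where k [simp]: "arr C x y k" and e': "\<And>j. j \<in> Obj J \<Longrightarrow> Comp C x y (omap D j) (\<rho> j) k = \<pi> j"
    by (rule lim_ex[OF y lim_cone[OF x]]) blast
  have "Comp C x y x h k = Ident C x"
    by (rule lim_uniq[OF D x, of x]) (simp_all add: assoc[symmetric] e e')
  moreover have "Comp C y x y k h = Ident C y"
    by (rule lim_uniq[OF D y, of y]) (simp_all add: assoc[symmetric] e e')
  ultimately have "iso y x h" by (intro isoI[of _ _ _ k]) simp_all
  then show ?thesis using that e by metis
qed

end

section \<open>Pullbacks as limits over the cospan shape\<close>

definition cospan_shape :: "(nat, nat) cat" where
  "cospan_shape = \<lparr>Obj = {0, 1, 2}, Hom = (\<lambda>i j. if i = j \<or> j = 2 then {0} else {}),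
     Ident = (\<lambda>i. 0), Comp = (\<lambda>i j k g f. 0)\<rparr>"

text \<open>\<open>finitely_complete\<close> and \<open>lex\<close> speak about diagrams over
  categories with objects and arrows in \<open>nat\<close>, so a cospan has to be presented over
  such a shape. The shape is a poset with the common codomain at \<open>2\<close>, and
  \<open>0\<close> codes every arrow.\<close>

definition cospan :: "('o, 'm) cat \<Rightarrow> 'o \<Rightarrow> 'o \<Rightarrow> 'o \<Rightarrow> 'm \<Rightarrow> 'm \<Rightarrow> (nat, nat, 'o, 'm) func" where
  "cospan C A B D f g =
     \<lparr>omap = (\<lambda>i. if i = 0 then A else if i = 1 then B else D),
      amap = (\<lambda>i j u. if i = 0 \<and> j = 2 then f else if i = 1 \<and> j = 2 then g
                else Ident C (if i = 0 then A else if i = 1 then B else D))\<rparr>"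

lemma cospan_simps [simp]:
  "omap (cospan C A B D f g) 0 = A" "omap (cospan C A B D f g) (Suc 0) = B" "omap (cospan C A B D f g) 2 = D"
  "amap (cospan C A B D f g) 0 2 u = f" "amap (cospan C A B D f g) (Suc 0) 2 u = g"
  "amap (cospan C A B D f g) 0 0 u = Ident C A" "amap (cospan C A B D f g) (Suc 0) (Suc 0) u = Ident C B"
  "amap (cospan C A B D f g) 2 2 u = Ident C D"
  by (simp_all add: cospan_def)

lemma cospan_shape_Obj [simp]: "Obj cospan_shape = {0, Suc 0, 2}"
  by (simp add: cospan_shape_def)

lemma cospan_shape_arr:
  "arr cospan_shape i j u \<longleftrightarrow> u = 0 \<and> i \<in> {0, Suc 0, 2} \<and> (j = 2 \<or> j = i)"
  by (auto simp: arr_def cospan_shape_def)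

lemma finite_cospan_shape: "finite_category cospan_shape"
  by (auto simp: finite_category_def category_def cospan_shape_def)

context cat begin

lemma cospan_functor:
  assumes f: "arr C A D f" and g: "arr C B D g"
  shows "is_functor cospan_shape C (cospan C A B D f g)"
proof (rule functorI)
  note [simp] = arrD[OF f] arrD[OF g] f g
  show "category cospan_shape" using finite_cospan_shape by (simp add: finite_category_def)
  show "category C" by (rule category)
  show "omap (cospan C A B D f g) a \<in> Obj C" if "a \<in> Obj cospan_shape" for a using that by auto
  show "arr C (omap (cospan C A B D f g) a) (omap (cospan C A B D f g) b) (amap (cospan C A B D f g) a b u)"
    if "arr cospan_shape a b u" for a b u using that by (auto simp: cospan_shape_arr)
  show "amap (cospan C A B D f g) a a (Ident cospan_shape a) = Ident C (omap (cospan C A B D f g) a)"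
    if "a \<in> Obj cospan_shape" for a using that by auto
  show "amap (cospan C A B D f g) a c (Comp cospan_shape a b c v u) =
    Comp C (omap (cospan C A B D f g) a) (omap (cospan C A B D f g) b) (omap (cospan C A B D f g) c)
      (amap (cospan C A B D f g) b c v) (amap (cospan C A B D f g) a b u)"
    if "arr cospan_shape a b u" "arr cospan_shape b c v" for a b c u v
    using that by (auto simp: cospan_shape_arr)
qed

lemma pb_of_limit:
  assumes D: "is_functor cospan_shape C D" and lim: "is_limit cospan_shape C D x \<pi>"
  shows "is_pullback C x (omap D 0) (omap D 1) (omap D 2) (\<pi> 0) (\<pi> 1) (amap D 0 2 0) (amap D 1 2 0)"
proof -
  have a: "arr cospan_shape 0 2 0" "arr cospan_shape (Suc 0) 2 0" by (simp_all add: cospan_shape_arr)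
  note fa = functor_arr[OF D a(1)] functor_arr[OF D a(2)]
  have x: "x \<in> Obj C" and \<pi> [simp]: "arr C x (omap D 0) (\<pi> 0)" "arr C x (omap D (Suc 0)) (\<pi> (Suc 0))"
    "arr C x (omap D 2) (\<pi> 2)"
    and nat: "\<And>i j u. arr cospan_shape i j u \<Longrightarrow> Comp C x (omap D i) (omap D j) (amap D i j u) (\<pi> i) = \<pi> j"
    using lim_cone[OF lim] by (simp_all add: cone_arr[OF D])
  show ?thesis
  proof (rule pbI)
    fix Q u v assume uv [simp]: "arr C Q (omap D 0) u" "arr C Q (omap D 1) v"
      and e: "Comp C Q (omap D 0) (omap D 2) (amap D 0 2 0) u = Comp C Q (omap D 1) (omap D 2) (amap D 1 2 0) v"
    define \<rho> where "\<rho> i = (if i = 0 then u else if i = Suc 0 then v else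
      Comp C Q (omap D 0) (omap D 2) (amap D 0 2 0) u)" for i :: nat
    have "is_cone cospan_shape C D Q \<rho>"
      unfolding cone_arr[OF D]
    proof (intro conjI allI impI ballI)
      show "Q \<in> Obj C" by (rule arrD(1)[OF uv(1)])
      show "arr C Q (omap D j) (\<rho> j)" if "j \<in> Obj cospan_shape" for j
        using that uv fa by (auto simp: \<rho>_def)
      fix i j w assume w: "arr cospan_shape i j w"
      then consider "i = j" | "i = 0" "j = 2" "w = 0" | "i = Suc 0" "j = 2" "w = 0"
        by (auto simp: cospan_shape_arr)
      then show "Comp C Q (omap D i) (omap D j) (amap D i j w) (\<rho> i) = \<rho> j"
      proof cases
        case 1
        have "w = Ident cospan_shape i" using w by (simp add: cospan_shape_arr) (simp add: cospan_shape_def)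
        moreover have "i \<in> Obj cospan_shape" by (rule arrD(1)[OF w])
        ultimately show ?thesis using 1 uv fa by (auto simp: functor_id[OF D] \<rho>_def)
      qed (use e in \<open>auto simp: \<rho>_def\<close>)
    qed
    then obtain h where h: "arr C Q x h" "\<And>j. j \<in> Obj cospan_shape \<Longrightarrow> Comp C Q x (omap D j) (\<pi> j) h = \<rho> j"
      by (rule lim_ex[OF lim]) blast
    show "\<exists>h. arr C Q x h \<and> Comp C Q x (omap D 0) (\<pi> 0) h = u \<and> Comp C Q x (omap D 1) (\<pi> 1) h = v"
      using h(1) h(2)[of 0] h(2)[of "Suc 0"] by (auto simp: \<rho>_def)
  next
    fix Q h h' assume h: "arr C Q x h" "arr C Q x h'"
      and e: "Comp C Q x (omap D 0) (\<pi> 0) h = Comp C Q x (omap D 0) (\<pi> 0) h'"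
        "Comp C Q x (omap D 1) (\<pi> 1) h = Comp C Q x (omap D 1) (\<pi> 1) h'"
    have "Comp C Q x (omap D 2) (\<pi> 2) h = Comp C Q x (omap D 2) (\<pi> 2) h'"
      using e(1) h fa by (simp add: nat[OF a(1), symmetric] assoc)
    then have "Comp C Q x (omap D j) (\<pi> j) h = Comp C Q x (omap D j) (\<pi> j) h'" if "j \<in> Obj cospan_shape" for j
      using e that by auto
    then show "h = h'" by (rule lim_uniq[OF D lim h])
  qed (use fa nat[OF a(1)] nat[OF a(2)] in simp_all)
qed

text \<open>The leg of the cone at the common codomain is forced to be \<open>f\<close> after
  \<open>p\<close>. Together with \<open>pb_of_limit\<close> this converts preservation of limit
  cones into preservation of pullback squares.\<close>

lemma limit_of_pb:
  assumes pb: "is_pullback C P A B D p q f g"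
  shows "is_limit cospan_shape C (cospan C A B D f g) P
    (\<lambda>i. if i = 0 then p else if i = 1 then q else Comp C P A D f p)"
proof -
  note [simp] = pb_arr(1-4)[OF pb] pb_obj[OF pb]
  note F = cospan_functor[OF pb_arr(3,4)[OF pb]]
  show ?thesis
  proof (rule limI[OF F])
    show "is_cone cospan_shape C (cospan C A B D f g) P (\<lambda>i. if i = 0 then p else if i = 1 then q else Comp C P A D f p)"
      by (auto simp: cone_arr[OF F] cospan_shape_arr pb_arr(5)[OF pb])
  next
    fix y \<rho> assume "is_cone cospan_shape C (cospan C A B D f g) y \<rho>"
    then have \<rho>: "arr C y A (\<rho> 0)" "arr C y B (\<rho> (Suc 0))"
      and nat: "\<And>i j u. arr cospan_shape i j u \<Longrightarrow> Comp C y (omap (cospan C A B D f g) i) (omap (cospan C A B D f g) j)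
        (amap (cospan C A B D f g) i j u) (\<rho> i) = \<rho> j"
      by (auto simp: cone_arr[OF F])
    have "Comp C y A D f (\<rho> 0) = \<rho> 2" "Comp C y B D g (\<rho> (Suc 0)) = \<rho> 2"
      using nat[of 0 2 0] nat[of "Suc 0" 2 0] by (simp_all add: cospan_shape_arr)
    then obtain h where "arr C y P h" "Comp C y P A p h = \<rho> 0" "Comp C y P B q h = \<rho> (Suc 0)"
      using pb_ex[OF pb \<rho>] by metis
    then show "\<exists>h. arr C y P h \<and> (\<forall>j\<in>Obj cospan_shape. Comp C y P (omap (cospan C A B D f g) j)
          (if j = 0 then p else if j = 1 then q else Comp C P A D f p) h = \<rho> j)"
      using \<open>Comp C y A D f (\<rho> 0) = \<rho> 2\<close> by (intro exI[of _ h]) (simp add: assoc)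
  next
    fix y h h' assume h: "arr C y P h" "arr C y P h'"
      and e: "\<And>j. j \<in> Obj cospan_shape \<Longrightarrow> Comp C y P (omap (cospan C A B D f g) j)
          (if j = 0 then p else if j = 1 then q else Comp C P A D f p) h =
        Comp C y P (omap (cospan C A B D f g) j)
          (if j = 0 then p else if j = 1 then q else Comp C P A D f p) h'"
    show "h = h'" using pb_uniq[OF pb h] e[of 0] e[of "Suc 0"] by simp
  qed
qed

end

locale fc_cat = cat +
  assumes fc: "finitely_complete C"
begin

lemma pullback_ex:
  assumes "arr C A D f" "arr C B D g"
  obtains P p q where "is_pullback C P A B D p q f g"
proof -
  note F = cospan_functor[OF assms]
  obtain x \<pi> where "is_limit cospan_shape C (cospan C A B D f g) x \<pi>"
    using fc F finite_cospan_shape unfolding finitely_complete_def by blast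
  from pb_of_limit[OF F this] show ?thesis using that by simp
qed

lemma terminal_ex: "\<exists>t\<in>Obj C. \<forall>y\<in>Obj C. \<exists>!h. h \<in> Hom C y t"
proof -
  \<comment> \<open>A terminal object is the limit of the empty diagram.\<close>
  define J :: "(nat, nat) cat" where "J = \<lparr>Obj = {}, Hom = (\<lambda>i j. {}), Ident = (\<lambda>i. 0), Comp = (\<lambda>i j k g f. 0)\<rparr>"
  define D :: "(nat, nat, 'a, 'b) func" where "D = \<lparr>omap = undefined, amap = undefined\<rparr>"
  have "finite_category J" "is_functor J C D"
    using category by (simp_all add: finite_category_def is_functor_def category_def J_def)
  then obtain x \<pi> where "is_limit J C D x \<pi>"
    using fc unfolding finitely_complete_def by blast
  then have "x \<in> Obj C" "\<forall>y\<in>Obj C. \<exists>!h. h \<in> Hom C y x"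
    by (auto simp: is_limit_def is_cone_def J_def)
  then show ?thesis by blast
qed

end

lemma lex_functor: "lex C E F \<Longrightarrow> is_functor C E F"
  by (simp add: lex_def)

lemma lex_pb:
  assumes F: "lex C E F" and pb: "is_pullback C P A B D p q f g"
  shows "is_pullback E (omap F P) (omap F A) (omap F B) (omap F D)
    (amap F P A p) (amap F P B q) (amap F A D f) (amap F B D g)"
proof -
  interpret C: cat C using F by unfold_locales (simp add: lex_def is_functor_def)
  interpret E: cat E using F by unfold_locales (simp add: lex_def is_functor_def)
  note J = C.cospan_functor[OF pb_arr(3,4)[OF pb]]
  note J' = functor_comp_func[OF J lex_functor[OF F]]
  have "is_limit cospan_shape E (comp_func F (cospan C A B D f g)) (omap F P)
    (\<lambda>j. amap F P (omap (cospan C A B D f g) j) (if j = 0 then p else if j = 1 then q else Comp C P A D f p))"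
    using F C.limit_of_pb[OF pb] J finite_cospan_shape unfolding lex_def by blast
  from E.pb_of_limit[OF J' this] show ?thesis by simp
qed

lemma lex_mono:
  assumes F: "lex C E F" and m: "is_mono C X A m" and a: "arr C X A m"
  shows "is_mono E (omap F X) (omap F A) (amap F X A m)"
proof -
  interpret C: cat C using F by unfold_locales (simp add: lex_def is_functor_def)
  interpret E: cat E using F by unfold_locales (simp add: lex_def is_functor_def)
  show ?thesis
    using lex_pb[OF F] C.mono_kernel_pair[OF a] m E.mono_kernel_pair[OF functor_arr[OF lex_functor[OF F] a]]
      functor_id[OF lex_functor[OF F] arrD(1)[OF a]] by metis
qed

lemma lex_comp:
  assumes F: "lex C D F" and G: "lex D E G" shows "lex C E (comp_func G F)"
  unfolding lex_def
proof (intro conjI allI impI)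
  show "finitely_complete C" "finitely_complete E" using F G by (simp_all add: lex_def)
  show "is_functor C E (comp_func G F)" by (rule functor_comp_func[OF lex_functor[OF F] lex_functor[OF G]])
  fix J :: "(nat, nat) cat" and H x \<pi>
  assume H: "finite_category J \<and> is_functor J C H \<and> is_limit J C H x \<pi>"
  then have "is_limit J D (comp_func F H) (omap F x) (\<lambda>j. amap F x (omap H j) (\<pi> j))"
    using F unfolding lex_def by blast
  then have "is_limit J E (comp_func G (comp_func F H)) (omap G (omap F x))
      (\<lambda>j. amap G (omap F x) (omap (comp_func F H) j) (amap F x (omap H j) (\<pi> j)))"
    using G H functor_comp_func[OF _ lex_functor[OF F]] unfolding lex_def by blast
  then show "is_limit J E (comp_func (comp_func G F) H) (omap (comp_func G F) x)
      (\<lambda>j. amap (comp_func G F) x (omap H j) (\<pi> j))"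
    by (simp add: comp_func_def)
qed

section \<open>Sets of objects closed under finite limits\<close>

definition fl_closed :: "('o, 'm) cat \<Rightarrow> 'o set \<Rightarrow> bool" where
  "fl_closed C S \<longleftrightarrow> S \<subseteq> Obj C \<and> (\<exists>t\<in>S. \<forall>y\<in>Obj C. \<exists>!h. h \<in> Hom C y t) \<and>
     (\<forall>A\<in>S. \<forall>B\<in>S. \<forall>D\<in>S. \<forall>f g. arr C A D f \<and> arr C B D g \<longrightarrow>
        (\<exists>P\<in>S. \<exists>p q. is_pullback C P A B D p q f g))"

text \<open>\<open>fl_closed\<close> asks that some terminal object and some pullback of each cospan
  in \<open>S\<close> lie in \<open>S\<close>, not all isomorphic copies of them, so
  \<open>S\<close> can be small. The limits found in this locale have their vertex in
  \<open>S\<close> but are universal among all objects of \<open>C\<close>.\<close>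

locale fl_sub = cat +
  fixes S
  assumes fl: "fl_closed C S"
begin

lemma sub_obj [simp]: "x \<in> S \<Longrightarrow> x \<in> Obj C"
  using fl by (auto simp: fl_closed_def)

lemma sub_pb:
  assumes "A \<in> S" "B \<in> S" "D \<in> S" "arr C A D f" "arr C B D g"
  obtains P p q where "P \<in> S" "is_pullback C P A B D p q f g"
  using assms fl unfolding fl_closed_def by metis

lemma sub_terminal:
  obtains t where "t \<in> S" "\<And>y. y \<in> Obj C \<Longrightarrow> \<exists>h. arr C y t h" "\<And>y h h'. arr C y t h \<Longrightarrow> arr C y t h' \<Longrightarrow> h = h'"
proof -
  obtain t where t: "t \<in> S" and t': "\<forall>y\<in>Obj C. \<exists>!h. h \<in> Hom C y t"
    using fl unfolding fl_closed_def by (elim conjE bexE)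
  note ex1 = bspec[OF t']
  show ?thesis
  proof (rule that[OF t])
    show "\<exists>h. arr C y t h" if "y \<in> Obj C" for y
      using ex1_implies_ex[OF ex1[OF that]] t that unfolding arr_def by auto
    show "h = h'" if "arr C y t h" "arr C y t h'" for y h h'
      using ex1[OF arrD(1)[OF that(1)]] arrD(3)[OF that(1)] arrD(3)[OF that(2)] by auto
  qed
qed

lemma sub_product:
  assumes A [simp]: "A \<in> S" and B [simp]: "B \<in> S"
  obtains P p q where "P \<in> S" "arr C P A p" "arr C P B q"
    "\<And>Q u v. arr C Q A u \<Longrightarrow> arr C Q B v \<Longrightarrow> \<exists>h. arr C Q P h \<and> Comp C Q P A p h = u \<and> Comp C Q P B q h = v"
    "\<And>Q h h'. arr C Q P h \<Longrightarrow> arr C Q P h' \<Longrightarrow> Comp C Q P A p h = Comp C Q P A p h' \<Longrightarrow>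
       Comp C Q P B q h = Comp C Q P B q h' \<Longrightarrow> h = h'"
proof -
  obtain t where t [simp]: "t \<in> S" and ex: "\<And>y. y \<in> Obj C \<Longrightarrow> \<exists>h. arr C y t h"
    and un: "\<And>y h h'. arr C y t h \<Longrightarrow> arr C y t h' \<Longrightarrow> h = h'" by (rule sub_terminal) blast
  obtain f g where [simp]: "arr C A t f" "arr C B t g" using ex A B sub_obj by meson
  obtain P p q where P: "P \<in> S" and pb: "is_pullback C P A B t p q f g"
    by (rule sub_pb[of A B t f g]) auto
  show ?thesis
  proof (rule that[OF P])
    fix Q u v assume uv: "arr C Q A u" "arr C Q B v"
    have "Comp C Q A t f u = Comp C Q B t g v" by (rule un[of Q]) (use uv in auto)
    then obtain h where "arr C Q P h" "Comp C Q P A p h = u" "Comp C Q P B q h = v"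
      by (rule pb_ex[OF pb uv])
    then show "\<exists>h. arr C Q P h \<and> Comp C Q P A p h = u \<and> Comp C Q P B q h = v" by blast
  qed (use pb_arr[OF pb] pb_uniq[OF pb] in blast)+
qed

text \<open>The equalizer of \<open>f\<close> and \<open>g\<close> is the pullback of their pairing
  \<open>k\<close> along the diagonal \<open>d\<close>, both arrows into the product
  \<open>P\<close> of \<open>B\<close> with itself.\<close>

lemma sub_equalizer:
  assumes A [simp]: "A \<in> S" and B [simp]: "B \<in> S" and f [simp]: "arr C A B f" and g [simp]: "arr C A B g"
  obtains E e where "E \<in> S" "arr C E A e" "Comp C E A B f e = Comp C E A B g e"
    "\<And>Q u. arr C Q A u \<Longrightarrow> Comp C Q A B f u = Comp C Q A B g u \<Longrightarrow> \<exists>h. arr C Q E h \<and> Comp C Q E A e h = u"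
    "\<And>Q h h'. arr C Q E h \<Longrightarrow> arr C Q E h' \<Longrightarrow> Comp C Q E A e h = Comp C Q E A e h' \<Longrightarrow> h = h'"
proof -
  obtain P p q where P [simp]: "P \<in> S" "arr C P B p" "arr C P B q"
    and ex: "\<And>Q u v. arr C Q B u \<Longrightarrow> arr C Q B v \<Longrightarrow> \<exists>h. arr C Q P h \<and> Comp C Q P B p h = u \<and> Comp C Q P B q h = v"
    and un: "\<And>Q h h'. arr C Q P h \<Longrightarrow> arr C Q P h' \<Longrightarrow> Comp C Q P B p h = Comp C Q P B p h' \<Longrightarrow>
       Comp C Q P B q h = Comp C Q P B q h' \<Longrightarrow> h = h'"
    by (rule sub_product[OF B B]) blast
  obtain d where d [simp]: "arr C B P d" "Comp C B P B p d = Ident C B" "Comp C B P B q d = Ident C B"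
    using ex[of B "Ident C B" "Ident C B"] by auto
  obtain k where k [simp]: "arr C A P k" "Comp C A P B p k = f" "Comp C A P B q k = g"
    using ex[OF f g] by auto
  obtain E e b where E [simp]: "E \<in> S" and pb: "is_pullback C E A B P e b k d"
    by (rule sub_pb[of A B P k d]) auto
  note [simp] = pb_arr(1,2)[OF pb]
  have pe: "Comp C Q A B f u = Comp C Q P B p (Comp C Q A P k u)" "Comp C Q A B g u = Comp C Q P B q (Comp C Q A P k u)"
    if "arr C Q A u" for Q u using that by (simp_all add: assoc[symmetric])
  have pd: "Comp C Q P B p (Comp C Q B P d v) = v" "Comp C Q P B q (Comp C Q B P d v) = v"
    if "arr C Q B v" for Q v using that by (simp_all add: assoc[symmetric])
  show ?thesis
  proof (rule that[of E e])
    show "Comp C E A B f e = Comp C E A B g e"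
      by (simp only: pe[OF pb_arr(1)[OF pb]] pb_arr(5)[OF pb] pd[OF pb_arr(2)[OF pb]])
    fix Q u assume u [simp]: "arr C Q A u" and e: "Comp C Q A B f u = Comp C Q A B g u"
    have "Comp C Q A P k u = Comp C Q B P d (Comp C Q A B f u)"
      by (rule un[of Q]) (use e in \<open>simp_all add: pd pe(1)[symmetric] pe(2)[symmetric]\<close>)
    then obtain h where "arr C Q E h" "Comp C Q E A e h = u" by (rule pb_ex[OF pb, rotated 2]) auto
    then show "\<exists>h. arr C Q E h \<and> Comp C Q E A e h = u" by blast
  next
    fix Q h h' assume h [simp]: "arr C Q E h" "arr C Q E h'" and e: "Comp C Q E A e h = Comp C Q E A e h'"
    have "Comp C Q B P d (Comp C Q E B b h) = Comp C Q B P d (Comp C Q E B b h')"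
      using arg_cong[OF e, of "Comp C Q A P k"] by (simp add: assoc[symmetric] pb_arr(5)[OF pb])
    then have "Comp C Q P B p (Comp C Q B P d (Comp C Q E B b h)) = Comp C Q P B p (Comp C Q B P d (Comp C Q E B b h'))"
      by simp
    then have "Comp C Q E B b h = Comp C Q E B b h'" by (simp add: pd)
    then show "h = h'" by (rule pb_uniq[OF pb h e])
  qed auto
qed

text \<open>Induction on the index set: the empty product is a terminal object, and a new factor is
  attached by a binary product, through whose first projection the old projections are
  routed.\<close>

lemma sub_finite_product:
  assumes "finite I" "d ` I \<subseteq> S"
  shows "\<exists>x\<in>S. \<exists>\<pi>. (\<forall>i\<in>I. arr C x (d i) (\<pi> i)) \<and>
    (\<forall>y\<in>Obj C. \<forall>\<rho>. (\<forall>i\<in>I. arr C y (d i) (\<rho> i)) \<longrightarrow> (\<exists>h. arr C y x h \<and> (\<forall>i\<in>I. Comp C y x (d i) (\<pi> i) h = \<rho> i))) \<and>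
    (\<forall>y h h'. arr C y x h \<and> arr C y x h' \<and> (\<forall>i\<in>I. Comp C y x (d i) (\<pi> i) h = Comp C y x (d i) (\<pi> i) h') \<longrightarrow> h = h')"
  using assms
proof (induction I)
  case empty
  obtain t where "t \<in> S" "\<And>y. y \<in> Obj C \<Longrightarrow> \<exists>h. arr C y t h" "\<And>y h h'. arr C y t h \<Longrightarrow> arr C y t h' \<Longrightarrow> h = h'"
    by (rule sub_terminal) blast
  then show ?case by (intro bexI[of _ t]) auto
next
  case (insert j I)
  have "d ` I \<subseteq> S" using insert.prems by simp
  from insert.IH[OF this] obtain x \<pi> where x: "x \<in> S" and \<pi>: "\<forall>i\<in>I. arr C x (d i) (\<pi> i)"
    and ex: "\<forall>y\<in>Obj C. \<forall>\<rho>. (\<forall>i\<in>I. arr C y (d i) (\<rho> i)) \<longrightarrow>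
      (\<exists>h. arr C y x h \<and> (\<forall>i\<in>I. Comp C y x (d i) (\<pi> i) h = \<rho> i))"
    and un: "\<forall>y h h'. arr C y x h \<and> arr C y x h' \<and>
      (\<forall>i\<in>I. Comp C y x (d i) (\<pi> i) h = Comp C y x (d i) (\<pi> i) h') \<longrightarrow> h = h'"
    by (elim bexE exE conjE)
  note [simp] = x \<pi>[rule_format]
  have dj: "d j \<in> S" using insert by simp
  obtain P p q where P [simp]: "P \<in> S" "arr C P x p" "arr C P (d j) q"
    and pex: "\<And>Q u v. arr C Q x u \<Longrightarrow> arr C Q (d j) v \<Longrightarrow> \<exists>h. arr C Q P h \<and> Comp C Q P x p h = u \<and> Comp C Q P (d j) q h = v"
    and pun: "\<And>Q h h'. arr C Q P h \<Longrightarrow> arr C Q P h' \<Longrightarrow> Comp C Q P x p h = Comp C Q P x p h' \<Longrightarrow>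
       Comp C Q P (d j) q h = Comp C Q P (d j) q h' \<Longrightarrow> h = h'"
    by (rule sub_product[OF x dj]) blast
  define \<sigma> where "\<sigma> i = (if i = j then q else Comp C P x (d i) (\<pi> i) p)" for i
  have \<sigma>I: "Comp C y P (d i) (\<sigma> i) h = Comp C y x (d i) (\<pi> i) (Comp C y P x p h)" if "i \<in> I" "arr C y P h" for i y h
    using that insert.hyps by (auto simp: \<sigma>_def assoc)
  have \<sigma>j: "\<sigma> j = q" by (simp add: \<sigma>_def)
  show ?case
  proof (intro bexI[of _ P] exI[of _ \<sigma>] conjI allI ballI impI)
    show "arr C P (d i) (\<sigma> i)" if "i \<in> insert j I" for i using that by (auto simp: \<sigma>_def)
    show "P \<in> S" by simp
  next
    fix y \<rho> assume y: "y \<in> Obj C" and \<rho>: "\<forall>i\<in>insert j I. arr C y (d i) (\<rho> i)"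
    obtain h where h: "arr C y x h" "\<And>i. i \<in> I \<Longrightarrow> Comp C y x (d i) (\<pi> i) h = \<rho> i"
      using ex[rule_format, OF y, of \<rho>] \<rho> by auto
    obtain k where k: "arr C y P k" "Comp C y P x p k = h" "Comp C y P (d j) q k = \<rho> j"
      using pex[OF h(1), of "\<rho> j"] \<rho> by auto
    show "\<exists>h. arr C y P h \<and> (\<forall>i\<in>insert j I. Comp C y P (d i) (\<sigma> i) h = \<rho> i)"
      using k h(2) by (intro exI[of _ k]) (auto simp: \<sigma>I \<sigma>j)
  next
    fix y h h' assume a: "arr C y P h \<and> arr C y P h' \<and>
      (\<forall>i\<in>insert j I. Comp C y P (d i) (\<sigma> i) h = Comp C y P (d i) (\<sigma> i) h')"
    have "Comp C y P x p h = Comp C y P x p h'"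
    proof (rule un[rule_format, of y], intro conjI ballI)
      fix i assume "i \<in> I"
      then show "Comp C y x (d i) (\<pi> i) (Comp C y P x p h) = Comp C y x (d i) (\<pi> i) (Comp C y P x p h')"
        using a by (simp add: \<sigma>I[symmetric])
    qed (use a in auto)
    moreover have "Comp C y P (d j) q h = Comp C y P (d j) q h'" using a by (auto simp: \<sigma>j)
    ultimately show "h = h'" using a pun[of y h h'] by blast
  qed
qed

text \<open>A limit is cut out of the product over \<open>Obj J\<close> by imposing the arrows of
  \<open>J\<close> one at a time. The induction runs over the set \<open>U\<close> of arrows whose
  naturality has already been imposed, and each further arrow costs one equalizer.\<close>

lemma finite_limit_in:
  fixes J :: "('j, 'n) cat"
  assumes J: "finite_category J" and D: "is_functor J C D" and DS: "\<And>j. j \<in> Obj J \<Longrightarrow> omap D j \<in> S"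
  shows "\<exists>x\<in>S. \<exists>\<pi>. is_limit J C D x \<pi>"
proof -
  define cone where "cone U y \<rho> \<longleftrightarrow> y \<in> Obj C \<and> (\<forall>j\<in>Obj J. arr C y (omap D j) (\<rho> j)) \<and>
    (\<forall>(i, j, u)\<in>U. Comp C y (omap D i) (omap D j) (amap D i j u) (\<rho> i) = \<rho> j)"
    for U :: "('j \<times> 'j \<times> 'n) set" and y \<rho>
  have "\<exists>x\<in>S. \<exists>\<pi>. cone U x \<pi> \<and>
    (\<forall>y \<rho>. cone U y \<rho> \<longrightarrow> (\<exists>h. arr C y x h \<and> (\<forall>i\<in>Obj J. Comp C y x (omap D i) (\<pi> i) h = \<rho> i))) \<and>
    (\<forall>y h h'. arr C y x h \<and> arr C y x h' \<and> (\<forall>i\<in>Obj J. Comp C y x (omap D i) (\<pi> i) h = Comp C y x (omap D i) (\<pi> i) h') \<longrightarrow> h = h')"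
    if "finite U" "U \<subseteq> {(i, j, u). arr J i j u}" for U
    using that
  proof (induction U)
    case empty
    have "finite (Obj J)" using J by (simp add: finite_category_def)
    moreover have "omap D ` Obj J \<subseteq> S" using DS by auto
    ultimately show ?case
      using sub_finite_product[of "Obj J" "omap D"] unfolding cone_def
      by (elim meta_allE meta_impE) (assumption, assumption, elim bexE exE conjE,
        intro bexI exI conjI, auto)
  next
    case (insert t U)
    obtain a b w where t: "t = (a, b, w)" by (cases t)
    with insert have w: "arr J a b w" by auto
    note [simp] = arrD(1,2)[OF w] functor_arr[OF D w]
    have "U \<subseteq> {(i, j, u). arr J i j u}" using insert.prems by simp
    from insert.IH[OF this] obtain x \<pi> where x [simp]: "x \<in> S" and c: "cone U x \<pi>"
      and ex: "\<forall>y \<rho>. cone U y \<rho> \<longrightarrow> (\<exists>h. arr C y x h \<and> (\<forall>i\<in>Obj J. Comp C y x (omap D i) (\<pi> i) h = \<rho> i))"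
      and un: "\<forall>y h h'. arr C y x h \<and> arr C y x h' \<and>
        (\<forall>i\<in>Obj J. Comp C y x (omap D i) (\<pi> i) h = Comp C y x (omap D i) (\<pi> i) h') \<longrightarrow> h = h'"
      by (elim bexE exE conjE)
    have \<pi> [simp]: "arr C x (omap D j) (\<pi> j)" if "j \<in> Obj J" for j using c that by (simp add: cone_def)
    have bS: "omap D b \<in> S" by (simp add: DS)
    have f: "arr C x (omap D b) (Comp C x (omap D a) (omap D b) (amap D a b w) (\<pi> a))" by simp
    obtain E e where E [simp]: "E \<in> S" "arr C E x e"
      and eq: "Comp C E x (omap D b) (Comp C x (omap D a) (omap D b) (amap D a b w) (\<pi> a)) e = Comp C E x (omap D b) (\<pi> b) e"
      and eex: "\<And>Q u. arr C Q x u \<Longrightarrow> Comp C Q x (omap D b) (Comp C x (omap D a) (omap D b) (amap D a b w) (\<pi> a)) u =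
        Comp C Q x (omap D b) (\<pi> b) u \<Longrightarrow> \<exists>h. arr C Q E h \<and> Comp C Q E x e h = u"
      and eun: "\<And>Q h h'. arr C Q E h \<Longrightarrow> arr C Q E h' \<Longrightarrow> Comp C Q E x e h = Comp C Q E x e h' \<Longrightarrow> h = h'"
      by (rule sub_equalizer[OF x bS f \<pi>[OF arrD(2)[OF w]]]) blast
    define \<sigma> where "\<sigma> i = Comp C E x (omap D i) (\<pi> i) e" for i
    have UJ: "arr J i j u" if "(i, j, u) \<in> U" for i j u using insert that by auto
    show ?case
    proof (intro bexI[of _ E] exI[of _ \<sigma>] conjI allI impI)
      have "Comp C E (omap D i) (omap D j) (amap D i j u) (\<sigma> i) = \<sigma> j" if "(i, j, u) \<in> insert t U" for i j u
      proof (cases "(i, j, u) \<in> U")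
        case True
        note [simp] = arrD(1,2)[OF UJ[OF True]] functor_arr[OF D UJ[OF True]]
        have "Comp C x (omap D i) (omap D j) (amap D i j u) (\<pi> i) = \<pi> j"
          using c True unfolding cone_def by auto
        then show ?thesis by (simp add: \<sigma>_def assoc[symmetric])
      next
        case False
        then have "i = a" "j = b" "u = w" using that t by auto
        then show ?thesis using eq by (simp add: \<sigma>_def assoc)
      qed
      then show "cone (insert t U) E \<sigma>" unfolding cone_def by (auto simp: \<sigma>_def)
      show "E \<in> S" by simp
    next
      fix y \<rho> assume \<rho>: "cone (insert t U) y \<rho>"
      then have "cone U y \<rho>" by (auto simp: cone_def)
      then obtain h where h [simp]: "arr C y x h" and \<pi>h: "\<And>i. i \<in> Obj J \<Longrightarrow> Comp C y x (omap D i) (\<pi> i) h = \<rho> i"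
        using ex[rule_format, of y \<rho>] by blast
      have "Comp C y x (omap D b) (Comp C x (omap D a) (omap D b) (amap D a b w) (\<pi> a)) h =
        Comp C y x (omap D b) (\<pi> b) h"
        using \<rho> by (simp add: assoc \<pi>h t cone_def)
      then obtain k where "arr C y E k" "Comp C y E x e k = h" using eex[OF h] by blast
      then show "\<exists>h. arr C y E h \<and> (\<forall>i\<in>Obj J. Comp C y E (omap D i) (\<sigma> i) h = \<rho> i)"
        by (intro exI[of _ k]) (simp add: \<sigma>_def assoc \<pi>h)
    next
      fix y h h' assume a: "arr C y E h \<and> arr C y E h' \<and>
        (\<forall>i\<in>Obj J. Comp C y E (omap D i) (\<sigma> i) h = Comp C y E (omap D i) (\<sigma> i) h')"
      then have [simp]: "arr C y E h" "arr C y E h'" by auto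
      have "\<forall>i\<in>Obj J. Comp C y x (omap D i) (\<pi> i) (Comp C y E x e h) =
          Comp C y x (omap D i) (\<pi> i) (Comp C y E x e h')"
        using a by (simp add: \<sigma>_def assoc)
      then have "Comp C y E x e h = Comp C y E x e h'"
        using un[rule_format, of y "Comp C y E x e h" "Comp C y E x e h'"] a by simp
      then show "h = h'" using eun a by blast
    qed
  qed
  moreover have "finite {(i, j, u). arr J i j u}"
  proof (rule finite_subset)
    show "{(i, j, u). arr J i j u} \<subseteq> (\<Union>i\<in>Obj J. \<Union>j\<in>Obj J. (\<lambda>u. (i, j, u)) ` Hom J i j)"
      by (auto simp: arr_def)
    show "finite (\<Union>i\<in>Obj J. \<Union>j\<in>Obj J. (\<lambda>u. (i, j, u)) ` Hom J i j)"
      using J by (simp add: finite_category_def)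
  qed
  ultimately obtain x \<pi> where x: "x \<in> S" "cone {(i, j, u). arr J i j u} x \<pi>"
    and ex: "\<And>y \<rho>. cone {(i, j, u). arr J i j u} y \<rho> \<Longrightarrow> \<exists>h. arr C y x h \<and> (\<forall>i\<in>Obj J. Comp C y x (omap D i) (\<pi> i) h = \<rho> i)"
    and un: "\<And>y h h'. arr C y x h \<Longrightarrow> arr C y x h' \<Longrightarrow>
      (\<And>i. i \<in> Obj J \<Longrightarrow> Comp C y x (omap D i) (\<pi> i) h = Comp C y x (omap D i) (\<pi> i) h') \<Longrightarrow> h = h'"
    by (metis (no_types, lifting) subset_refl)
  have cone: "cone {(i, j, u). arr J i j u} y \<rho> \<longleftrightarrow> is_cone J C D y \<rho>" for y \<rho>
    unfolding cone_def cone_arr[OF D] by auto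
  have "is_limit J C D x \<pi>"
  proof (rule limI[OF D])
    show "is_cone J C D x \<pi>" using x(2) by (simp only: cone)
    show "\<exists>h. arr C y x h \<and> (\<forall>j\<in>Obj J. Comp C y x (omap D j) (\<pi> j) h = \<rho> j)" if "is_cone J C D y \<rho>" for y \<rho>
      using ex[unfolded cone, OF that] .
  qed (rule un)
  then show ?thesis using x by blast
qed

lemma sub_finitely_complete:
  assumes "S = Obj C" shows "finitely_complete C"
  unfolding finitely_complete_def
proof (intro conjI allI impI)
  fix J :: "(nat, nat) cat" and D assume "finite_category J \<and> is_functor J C D"
  then show "\<exists>x \<pi>. is_limit J C D x \<pi>"
    using finite_limit_in[of J D] functor_obj[of J C D] assms by blast
qed (rule category)

end

text \<open>A terminal object is added, and then chosen pullbacks of all cospans are adjoined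
  countably often; local smallness keeps each stage small. A cospan with objects in the union has
  them all in one stage, so its pullback appears in the next.\<close>

lemma small_fl_hull:
  fixes C :: "('o, 'u) cat"
  assumes U: "set_universe TYPE('u)" and C: "locally_small C" "finitely_complete C"
    and S: "S \<subseteq> Obj C" "S \<prec> (UNIV :: 'u set)"
  obtains T where "S \<subseteq> T" "T \<prec> (UNIV :: 'u set)" "fl_closed C T"
proof -
  interpret fc_cat C using C by unfold_locales (auto simp: locally_small_def)
  obtain t where t: "t \<in> Obj C" "\<forall>y\<in>Obj C. \<exists>!h. h \<in> Hom C y t" using terminal_ex by blast
  define pbo where "pbo A B D f g = (SOME P. \<exists>p q. is_pullback C P A B D p q f g)" for A B D f g
  have pbo: "\<exists>p q. is_pullback C (pbo A B D f g) A B D p q f g" if "arr C A D f" "arr C B D g" for A B D f g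
    unfolding pbo_def by (rule someI_ex) (rule pullback_ex[OF that], blast)
  define step where "step S = S \<union> (\<Union>A\<in>S. \<Union>B\<in>S. \<Union>D\<in>S. \<Union>f\<in>Hom C A D. pbo A B D f ` Hom C B D)" for S
  have stepI: "pbo A B D f g \<in> step S"
    if "A \<in> S" "B \<in> S" "D \<in> S" "arr C A D f" "arr C B D g" for A B D f g S
    using that unfolding step_def arr_def by blast
  define T where "T n = (step ^^ n) (insert t S)" for n
  have T: "T n \<subseteq> Obj C \<and> T n \<prec> (UNIV :: 'u set)" for n
  proof (induction n)
    case 0
    have "insert t S \<prec> (UNIV :: 'u set)"
      using small_Un[OF U small_finite[OF U, of "{t}"] S(2)] by simp
    then show ?case using t S by (simp add: T_def)
  next
    case (Suc n)
    have h: "Hom C A D \<prec> (UNIV :: 'u set)" if "A \<in> T n" "D \<in> T n" for A D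
      using C Suc that unfolding locally_small_def by blast
    have "step (T n) \<prec> (UNIV :: 'u set)"
      unfolding step_def by (intro small_Un[OF U] small_UN[OF U] small_image h) (use Suc in auto)
    moreover have "pbo A B D f g \<in> Obj C" if "A \<in> T n" "B \<in> T n" "D \<in> T n" "f \<in> Hom C A D" "g \<in> Hom C B D" for A B D f g
      using pbo[of A D f B g] that Suc pb_obj(1) by (metis arr_def in_mono)
    ultimately show ?case using Suc by (auto simp: T_def step_def)
  qed
  have mono: "T m \<subseteq> T n" if "m \<le> n" for m n
    using that by (induction n rule: dec_induct) (auto simp: T_def step_def)
  \<comment> \<open>The stages are indexed by the natural numbers, so their union is small because
    \<open>'u\<close> is uncountable and regular.\<close>
  have "(UNIV :: nat set) \<prec> (UNIV :: 'u set)" using U by (simp add: set_universe_def)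
  then have small: "(\<Union>n. T n) \<prec> (UNIV :: 'u set)"
    by (intro small_UN[OF U]) (use T in auto)
  show ?thesis
  proof (rule that[OF _ small])
    have "S \<subseteq> T 0" by (auto simp: T_def)
    then show "S \<subseteq> (\<Union>n. T n)" by blast
    show "fl_closed C (\<Union>n. T n)"
      unfolding fl_closed_def
    proof (intro conjI ballI allI impI)
      show "(\<Union>n. T n) \<subseteq> Obj C" using T by blast
      have "t \<in> T 0" by (simp add: T_def)
      then show "\<exists>t\<in>\<Union>n. T n. \<forall>y\<in>Obj C. \<exists>!h. h \<in> Hom C y t" using t by blast
      fix A B D f g assume "A \<in> (\<Union>n. T n)" "B \<in> (\<Union>n. T n)" "D \<in> (\<Union>n. T n)"
        and fg: "arr C A D f \<and> arr C B D g"
      then obtain a b d where "A \<in> T a" "B \<in> T b" "D \<in> T d" by blast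
      then have in_T: "A \<in> T (max a (max b d))" "B \<in> T (max a (max b d))" "D \<in> T (max a (max b d))"
        using mono[of a "max a (max b d)"] mono[of b "max a (max b d)"] mono[of d "max a (max b d)"]
        by (auto simp: le_max_iff_disj)
      then have "pbo A B D f g \<in> T (Suc (max a (max b d)))"
        using stepI[of A _ B D f g] fg by (simp add: T_def)
      then show "\<exists>P\<in>\<Union>n. T n. \<exists>p q. is_pullback C P A B D p q f g"
        using pbo[of A D f B g] fg by blast
    qed
  qed
qed

text \<open>The objects of \<open>S\<close> are renamed by elements of \<open>'u\<close> while
  arrows, identities and composition are reused, so \<open>G\<close> acts as the identity on arrows.
  It reflects limits with vertex in \<open>S\<close> because it is full and faithful. It also
  preserves limits: any limit in \<open>E\<close> is isomorphic in \<open>E\<close> to the one that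
  \<open>finite_limit_in\<close> places in \<open>S\<close>, and limit cones transport along
  isomorphisms.\<close>

lemma small_copy:
  fixes C :: "('o, 'u) cat"
  assumes C: "locally_small C" "finitely_complete C" and S: "S \<prec> (UNIV :: 'u set)" "fl_closed C S"
  obtains E :: "('u, 'u) cat" and G where "locally_small E" "lex E C G"
    "omap G ` Obj E = S" "\<And>a b f. amap G a b f = f"
    "\<And>a b. Hom E a b = Hom C (omap G a) (omap G b)"
    "\<And>a b c f g. Comp E a b c g f = Comp C (omap G a) (omap G b) (omap G c) g f"
    "\<And>a. Ident E a = Ident C (omap G a)"
proof -
  interpret fl_sub C S using C S by unfold_locales (auto simp: locally_small_def)
  obtain e :: "'o \<Rightarrow> 'u" where e: "inj_on e S"
    using lesspoll_imp_lepoll[OF S(1)] unfolding lepoll_def by blast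
  define r where "r = inv_into S e"
  have r: "r (e s) = s" if "s \<in> S" for s using e that by (simp add: r_def)
  define E :: "('u, 'u) cat" where "E = \<lparr>Obj = e ` S, Hom = (\<lambda>a b. Hom C (r a) (r b)),
    Ident = (\<lambda>a. Ident C (r a)), Comp = (\<lambda>a b c g f. Comp C (r a) (r b) (r c) g f)\<rparr>"
  define G :: "('u, 'u, 'o, 'u) func" where "G = \<lparr>omap = r, amap = (\<lambda>a b f. f)\<rparr>"
  have E [simp]: "Obj E = e ` S" "Hom E a b = Hom C (r a) (r b)" "Ident E a = Ident C (r a)"
    "Comp E a b c g f = Comp C (r a) (r b) (r c) g f" for a b c g f by (simp_all add: E_def)
  have G [simp]: "omap G a = r a" "amap G a b f = f" for a b f by (simp_all add: G_def)
  have arr_E [simp]: "arr E a b f \<longleftrightarrow> a \<in> e ` S \<and> b \<in> e ` S \<and> arr C (r a) (r b) f" for a b f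
    using r sub_obj by (auto simp: arr_def)
  have rS [simp]: "r a \<in> S" if "a \<in> e ` S" for a using that r by auto
  have cat_E: "category E"
  proof -
    have "Ident E a \<in> Hom E a a" if "a \<in> Obj E" for a
      using arr_id[of "r a"] that by (simp add: arr_def)
    moreover have "Comp E a b c g f \<in> Hom E a c" if "arr E a b f" "arr E b c g" for a b c f g
      using arr_comp[of "r a" "r b" f "r c" g] that by (simp add: arr_def)
    moreover have "Comp E a b d (Comp E b c d h g) f = Comp E a c d h (Comp E a b c g f)"
      if "arr E a b f" "arr E b c g" "arr E c d h" for a b c d f g h
      using that by (simp add: assoc)
    moreover have "Comp E a a b f (Ident E a) = f" "Comp E a b b (Ident E b) f = f" if "arr E a b f" for a b f
      using that by simp_all
    ultimately show ?thesis unfolding category_def arr_def by blast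
  qed
  interpret E: cat E by unfold_locales (rule cat_E)
  have G_functor: "is_functor E C G"
    by (rule functorI[OF cat_E category]) simp_all
  have cone: "is_cone J E D a \<pi> \<longleftrightarrow> a \<in> e ` S \<and> is_cone J C (comp_func G D) (r a) \<pi>"
    if "is_functor J E D" for J :: "('j, 'n) cat" and D a \<pi>
    unfolding cone_arr[OF that] cone_arr[OF functor_comp_func[OF that G_functor]]
    using functor_obj[OF that] by (cases "a \<in> e ` S") (simp_all add: r_def[symmetric])
  have lift: "\<exists>a\<in>e ` S. \<exists>\<pi>. is_limit J C (comp_func G D) (r a) \<pi>"
    if "finite_category J" "is_functor J E D" for J :: "(nat, nat) cat" and D
  proof -
    have "\<exists>x\<in>S. \<exists>\<pi>. is_limit J C (comp_func G D) x \<pi>"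
      by (rule finite_limit_in[OF that(1) functor_comp_func[OF that(2) G_functor]])
        (use functor_obj[OF that(2)] in simp)
    then show ?thesis by (simp add: r)
  qed
  have refl: "is_limit J E D a \<pi>"
    if D: "is_functor J E D" and a: "a \<in> e ` S" and lim: "is_limit J C (comp_func G D) (r a) \<pi>"
    for J :: "(nat, nat) cat" and D a \<pi>
  proof (rule E.limI[OF D])
    note D' = functor_comp_func[OF D G_functor]
    show "is_cone J E D a \<pi>" using a lim_cone[OF lim] by (simp add: cone[OF D])
    fix b \<rho> assume "is_cone J E D b \<rho>"
    then have b: "b \<in> e ` S" and \<rho>: "is_cone J C (comp_func G D) (r b) \<rho>" by (simp_all add: cone[OF D])
    obtain h where "arr C (r b) (r a) h" "\<And>j. j \<in> Obj J \<Longrightarrow> Comp C (r b) (r a) (r (omap D j)) (\<pi> j) h = \<rho> j"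
      using lim_ex[OF lim \<rho>] by auto
    then show "\<exists>h. arr E b a h \<and> (\<forall>j\<in>Obj J. Comp E b a (omap D j) (\<pi> j) h = \<rho> j)"
      using a b by auto
  next
    fix b h h' assume "arr E b a h" "arr E b a h'"
      "\<And>j. j \<in> Obj J \<Longrightarrow> Comp E b a (omap D j) (\<pi> j) h = Comp E b a (omap D j) (\<pi> j) h'"
    then show "h = h'" using a by (intro lim_uniq[OF functor_comp_func[OF D G_functor] lim, of "r b" h h']) simp_all
  qed
  have fc_E: "finitely_complete E"
    unfolding finitely_complete_def using lift refl cat_E by blast
  have "lex E C G"
    unfolding lex_def
  proof (intro conjI allI impI)
    fix J :: "(nat, nat) cat" and D a \<pi>
    assume a: "finite_category J \<and> is_functor J E D \<and> is_limit J E D a \<pi>"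
    then have D: "is_functor J E D" and lim: "is_limit J E D a \<pi>" by auto
    note D' = functor_comp_func[OF D G_functor]
    obtain b \<rho> where b: "b \<in> e ` S" "is_limit J C (comp_func G D) (r b) \<rho>" using lift a by blast
    obtain h where h: "E.iso a b h" "\<And>j. j \<in> Obj J \<Longrightarrow> \<pi> j = Comp E a b (omap D j) (\<rho> j) h"
      using E.lim_iso[OF D refl[OF D b] lim] by blast
    have "iso (r a) (r b) h"
      using h(1) by (auto simp: E.iso_def iso_def is_iso_def arr_def)
    then show "is_limit J C (comp_func G D) (omap G a) (\<lambda>j. amap G a (omap D j) (\<pi> j))"
      using lim_transport[OF D' b(2)] h(2) by simp
  qed (use C fc_E G_functor in auto)
  moreover have "locally_small E"
    using C cat_E unfolding locally_small_def by simp
  moreover have "omap G ` Obj E = S" using r by force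
  ultimately show ?thesis by (intro that[of E G]) simp_all
qed

section \<open>Stable pushouts as covers\<close>

context cat begin

lemma comp_tri:
  assumes "Comp C a b c g f = k" "arr C a b f" "arr C b c g" "arr C z a e"
  shows "Comp C z b c g (Comp C z a b f e) = Comp C z a c k e"
  using assms by (simp add: assoc[symmetric])

lemma pb_square:
  assumes "is_pullback C P A B D p q f g" "arr C Z P e"
  shows "Comp C Z A D f (Comp C Z P A p e) = Comp C Z B D g (Comp C Z P B q e)"
  using pb_arr[OF assms(1)] assms(2) by (intro comp_eq_extend)

lemma po_square:
  assumes "is_pushout C P A B D p q f g" "arr C Z P e"
  shows "Comp C Z A D f (Comp C Z P A p e) = Comp C Z B D g (Comp C Z P B q e)"
  using po_arr[OF assms(1)] assms(2) by (intro comp_eq_extend)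

text \<open>A pair \<open>u\<close>, \<open>v\<close> agreeing over \<open>B\<close> agrees over
  \<open>D\<close> after \<open>n\<close>, so the front face over \<open>A\<close> turns
  \<open>n'\<close> after \<open>u\<close> and \<open>m\<close> after \<open>v\<close> into an arrow
  to \<open>A'\<close>. The known rear face lifts that arrow together with \<open>v\<close> to
  \<open>X'\<close>, and the front face over \<open>B\<close> checks the result.\<close>

lemma rear_pullback:
  assumes pbA: "is_pullback C A' D' A D g' a d g" and pbB: "is_pullback C B' D' B D n' b d n"
    and pbX: "is_pullback C X' A' X A m' x a m" and f': "arr C X' B' f'" and f: "arr C X B f"
    and e: "Comp C X' B' D' n' f' = Comp C X' A' D' g' m'" "Comp C X' B' B b f' = Comp C X' X B f x"
      "Comp C X A D g m = Comp C X B D n f"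
  shows "is_pullback C X' B' X B f' x b f"
proof (rule pbI)
  note [simp] = pb_arr(1-4)[OF pbA] pb_arr(1-4)[OF pbB] pb_arr(1-4)[OF pbX] f' f
  show "arr C X' B' f'" "arr C X' X x" "arr C B' B b" "arr C X B f" "Comp C X' B' B b f' = Comp C X' X B f x"
    using e by simp_all
  fix Q u v assume [simp]: "arr C Q B' u" "arr C Q X v" and uv: "Comp C Q B' B b u = Comp C Q X B f v"
  have "Comp C Q D' D d (Comp C Q B' D' n' u) = Comp C Q A D g (Comp C Q X A m v)"
    by (simp add: pb_square[OF pbB] uv comp_tri[OF e(3)] assoc)
  then obtain w where w [simp]: "arr C Q A' w" "Comp C Q A' D' g' w = Comp C Q B' D' n' u"
    "Comp C Q A' A a w = Comp C Q X A m v" by (rule pb_ex[OF pbA, rotated 2]) auto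
  obtain h where h [simp]: "arr C Q X' h" "Comp C Q X' A' m' h = w" "Comp C Q X' X x h = v"
    by (rule pb_ex[OF pbX w(1) _ w(3)]) auto
  have "Comp C Q X' B' f' h = u"
    by (rule pb_uniq[OF pbB, of Q]) (simp_all add: comp_tri[OF e(1)] comp_tri[OF e(2)] uv assoc)
  then show "\<exists>h. arr C Q X' h \<and> Comp C Q X' B' f' h = u \<and> Comp C Q X' X x h = v"
    by (intro exI[of _ h]) simp
next
  note [simp] = pb_arr(1-4)[OF pbA] pb_arr(1-4)[OF pbB] pb_arr(1-4)[OF pbX] f' f
  fix Q h h' assume h [simp]: "arr C Q X' h" "arr C Q X' h'" and eq: "Comp C Q X' B' f' h = Comp C Q X' B' f' h'"
    "Comp C Q X' X x h = Comp C Q X' X x h'"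
  have 1: "Comp C Q A' D' g' (Comp C Q X' A' m' k) = Comp C Q B' D' n' (Comp C Q X' B' f' k)"
    if "arr C Q X' k" for k
    using that comp_eq_extend[OF e(1), of Q k] by simp
  have "Comp C Q X' A' m' h = Comp C Q X' A' m' h'"
    by (rule pb_uniq[OF pbA, of Q]) (simp_all add: 1 pb_square[OF pbX] eq)
  then show "h = h'" by (rule pb_uniq[OF pbX h _ eq(2)])
qed

end

section \<open>The topology of stable pushouts\<close>

locale adh = fc_cat +
  assumes po: "has_pushouts_along_monos C"
    and stable: "stable_pushouts_along_monos C"
    and po_pb: "pushouts_along_monos_are_pullbacks C"
begin

lemma po_is_pb:
  assumes "is_pushout C X A B D m f g n" "is_mono C X A m" shows "is_pullback C X A B D m f g n"
  using assms po_pb unfolding pushouts_along_monos_are_pullbacks_def pushout_along_mono_def by blast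

lemma po_exists:
  assumes "arr C X A m" "arr C X B f" "is_mono C X A m"
  obtains D g n where "is_pushout C X A B D m f g n"
  using assms po unfolding has_pushouts_along_monos_def arr_def by blast

text \<open>Only three vertical faces are supplied as pullbacks; the face on \<open>f'\<close>
  follows from \<open>rear_pullback\<close>, and \<open>f'\<close> itself is tied to the cube by the
  two equations \<open>e\<close>.\<close>

lemma po_stable:
  assumes p: "is_pushout C X A B D m f g n" and m: "is_mono C X A m"
    and pbA: "is_pullback C A' D' A D g' a d g" and pbB: "is_pullback C B' D' B D n' b d n"
    and pbX: "is_pullback C X' A' X A m' x a m" and f': "arr C X' B' f'"
    and e: "Comp C X' B' D' n' f' = Comp C X' A' D' g' m'" "Comp C X' B' B b f' = Comp C X' X B f x"
  shows "is_pushout C X' A' B' D' m' f' g' n'"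
proof -
  have rear: "is_pullback C X' B' X B f' x b f"
    by (rule rear_pullback[OF pbA pbB pbX f' _ e]) (use po_arr[OF p] in auto)
  have "comm_cube C X A B D m f g n X' A' B' D' m' f' g' n' x a b d"
    using po_arr[OF p] pb_arr[OF pbA] pb_arr[OF pbB] pb_arr[OF pbX] pb_arr[OF rear] e
    unfolding comm_cube_def comm_square_arr by simp
  moreover have "pushout_along_mono C X A B D m f g n"
    using p m by (simp add: pushout_along_mono_def)
  ultimately show ?thesis
    using stable pbA pbB pbX rear unfolding stable_pushouts_along_monos_def by blast
qed

text \<open>The coprojections \<open>g\<close> and \<open>n\<close> are pulled back along
  \<open>d\<close>, then \<open>m\<close> along the result; the remaining edge \<open>f'\<close> is
  induced into the pullback of \<open>n\<close>. This feeds the inductive step of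
  \<open>cov_pull\<close>.\<close>

lemma po_pullback:
  assumes p: "is_pushout C X A B D m f g n" and m: "is_mono C X A m" and d: "arr C D' D d"
  obtains X' A' B' m' f' g' n' a b where "is_pushout C X' A' B' D' m' f' g' n'" "is_mono C X' A' m'"
    "arr C A' A a" "arr C B' B b" "Comp C A' D' D d g' = Comp C A' A D g a" "Comp C B' D' D d n' = Comp C B' B D n b"
proof -
  note pa [simp] = po_arr(1-4)[OF p] d
  obtain A' g' a where pbA: "is_pullback C A' D' A D g' a d g" using pullback_ex[OF d pa(3)] by blast
  obtain B' n' b where pbB: "is_pullback C B' D' B D n' b d n" using pullback_ex[OF d pa(4)] by blast
  obtain X' m' x where pbX: "is_pullback C X' A' X A m' x a m" using pullback_ex[OF pb_arr(2)[OF pbA] pa(1)] by blast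
  note [simp] = pb_arr(1-4)[OF pbA] pb_arr(1-4)[OF pbB] pb_arr(1-4)[OF pbX]
  have "Comp C X' D' D d (Comp C X' A' D' g' m') = Comp C X' B D n (Comp C X' X B f x)"
    by (simp add: pb_square[OF pbA] pb_arr(5)[OF pbX] po_square[OF p])
  then obtain f' where "arr C X' B' f'" "Comp C X' B' D' n' f' = Comp C X' A' D' g' m'"
    "Comp C X' B' B b f' = Comp C X' X B f x"
    by (rule pb_ex[OF pbB, rotated 2]) auto
  then have "is_pushout C X' A' B' D' m' f' g' n'" by (rule po_stable[OF p m pbA pbB pbX])
  moreover have "is_mono C X' A' m'"
    using pb_mono[OF _ m] pbX is_pullback_swap by metis
  ultimately show ?thesis
    by (rule that[OF _ _ pb_arr(2)[OF pbA] pb_arr(2)[OF pbB] pb_arr(5)[OF pbA] pb_arr(5)[OF pbB]])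
qed

text \<open>
  The Grothendieck topology generated by the pairs of coprojections of pushouts along
  monomorphisms; since pushouts are stable, one kind of step suffices.
\<close>

inductive cov :: "'a \<Rightarrow> ('a \<Rightarrow> 'b \<Rightarrow> bool) \<Rightarrow> bool" where
  base: "Z \<in> Obj C \<Longrightarrow> (\<And>x k. arr C x Z k \<Longrightarrow> R x k) \<Longrightarrow> cov Z R"
| step: "is_pushout C X A B D m f g n \<Longrightarrow> is_mono C X A m \<Longrightarrow>
    cov A (\<lambda>x k. R x (Comp C x A D g k)) \<Longrightarrow> cov B (\<lambda>x k. R x (Comp C x B D n k)) \<Longrightarrow> cov D R"

lemma cov_mono:
  "cov Z R \<Longrightarrow> (\<And>x k. arr C x Z k \<Longrightarrow> R x k \<Longrightarrow> R' x k) \<Longrightarrow> cov Z R'"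
proof (induction arbitrary: R' rule: cov.induct)
  case (base Z R)
  then show ?case by (intro cov.base) auto
next
  case (step X A B D m f g n R)
  note pa = po_arr[OF step.hyps(1)]
  show ?case
    by (rule cov.step[OF step.hyps(1,2)]; rule step.IH) (use pa step.prems in auto)
qed

text \<open>Stability of covers. A pushout step pulls back to a pushout step by
  \<open>po_pullback\<close>, so the pulled-back cover has a derivation of the same shape.\<close>

lemma cov_pull:
  "cov Z R \<Longrightarrow> arr C W Z h \<Longrightarrow> cov W (\<lambda>x k. R x (Comp C x W Z h k))"
proof (induction arbitrary: W h rule: cov.induct)
  case (base Z R)
  show ?case by (rule cov.base[OF arrD(1)[OF base.prems]]) (use base in auto)
next
  case (step X A B D m f g n R)
  note p = step.hyps(1)
  note [simp] = po_arr(1-4)[OF p] step.prems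
  obtain X' A' B' m' f' g' n' a b where p': "is_pushout C X' A' B' W m' f' g' n'" "is_mono C X' A' m'"
    and ab: "arr C A' A a" "arr C B' B b" and e: "Comp C A' W D h g' = Comp C A' A D g a" "Comp C B' W D h n' = Comp C B' B D n b"
    by (rule po_pullback[OF step.hyps(1,2) step.prems])
  note [simp] = po_arr(1-4)[OF p'(1)] ab
  show ?case
  proof (rule cov.step[OF p'])
    show "cov A' (\<lambda>x k. R x (Comp C x W D h (Comp C x A' W g' k)))"
      by (rule cov_mono[OF step.IH(1)[OF ab(1)]]) (simp add: comp_eq_extend[OF e(1)])
    show "cov B' (\<lambda>x k. R x (Comp C x W D h (Comp C x B' W n' k)))"
      by (rule cov_mono[OF step.IH(2)[OF ab(2)]]) (simp add: comp_eq_extend[OF e(2)])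
  qed
qed

text \<open>Transitivity: a cover may be refined piecewise. In the base case \<open>Q\<close> holds
  of every arrow, in particular of the identity, and the premise at the identity is the
  claim.\<close>

lemma cov_bind:
  "cov Z Q \<Longrightarrow> (\<And>x k. arr C x Z k \<Longrightarrow> Q x k \<Longrightarrow> cov x (\<lambda>y l. R y (Comp C y x Z k l))) \<Longrightarrow> cov Z R"
proof (induction arbitrary: R rule: cov.induct)
  case (base Z Q)
  have "cov Z (\<lambda>y l. R y (Comp C y Z Z (Ident C Z) l))"
    by (rule base.prems) (use base.hyps in auto)
  then show ?case by (rule cov_mono) simp
next
  case (step X A B D m f g n Q)
  note [simp] = po_arr(1-4)[OF step.hyps(1)]
  show ?case
  proof (rule cov.step[OF step.hyps(1,2)])
    show "cov A (\<lambda>x k. R x (Comp C x A D g k))"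
    proof (rule step.IH(1))
      fix x k assume [simp]: "arr C x A k" and q: "Q x (Comp C x A D g k)"
      have "cov x (\<lambda>y l. R y (Comp C y x D (Comp C x A D g k) l))" by (rule step.prems[OF _ q]) simp
      then show "cov x (\<lambda>y l. R y (Comp C y A D g (Comp C y x A k l)))" by (rule cov_mono) (simp add: assoc)
    qed
    show "cov B (\<lambda>x k. R x (Comp C x B D n k))"
    proof (rule step.IH(2))
      fix x k assume [simp]: "arr C x B k" and q: "Q x (Comp C x B D n k)"
      have "cov x (\<lambda>y l. R y (Comp C y x D (Comp C x B D n k) l))" by (rule step.prems[OF _ q]) simp
      then show "cov x (\<lambda>y l. R y (Comp C y B D n (Comp C y x B k l)))" by (rule cov_mono) (simp add: assoc)
    qed
  qed
qed

text \<open>Representables are separated: the coprojections of a pushout are jointly epic, and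
  induction extends this to all covers.\<close>

lemma cov_eq:
  "cov Z Q \<Longrightarrow> arr C Z E u \<Longrightarrow> arr C Z E v \<Longrightarrow>
    (\<And>x k. arr C x Z k \<Longrightarrow> Q x k \<Longrightarrow> Comp C x Z E u k = Comp C x Z E v k) \<Longrightarrow> u = v"
proof (induction arbitrary: u v rule: cov.induct)
  case (base Z Q)
  have "Comp C Z Z E u (Ident C Z) = Comp C Z Z E v (Ident C Z)"
    by (rule base.prems) (use base.hyps in auto)
  then show ?case using base.prems by simp
next
  case (step X A B D m f g n Q)
  note [simp] = po_arr(1-4)[OF step.hyps(1)] step.prems(1,2)
  show ?case
  proof (rule po_uniq[OF step.hyps(1) step.prems(1,2)])
    show "Comp C A D E u g = Comp C A D E v g"
      by (rule step.IH(1)) (use step.prems(3) in \<open>simp_all add: assoc\<close>)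
    show "Comp C B D E u n = Comp C B D E v n"
      by (rule step.IH(2)) (use step.prems(3) in \<open>simp_all add: assoc\<close>)
  qed
qed

text \<open>Every generalized element of the vertex of a pushout comes locally from one of the two
  feet. In this form the topology enters the arguments by elements below.\<close>

lemma cov_coprojections:
  assumes p: "is_pushout C X A B D m f g n" and m: "is_mono C X A m" and u: "arr C Z D u"
  shows "cov Z (\<lambda>x k. (\<exists>l. arr C x A l \<and> Comp C x A D g l = Comp C x Z D u k) \<or>
    (\<exists>l. arr C x B l \<and> Comp C x B D n l = Comp C x Z D u k))"
proof -
  have "cov D (\<lambda>x k. (\<exists>l. arr C x A l \<and> Comp C x A D g l = k) \<or> (\<exists>l. arr C x B l \<and> Comp C x B D n l = k))"
    by (rule cov.step[OF p m]; rule cov.base) (use po_arr[OF p] in \<open>auto dest: arrD\<close>)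
  from cov_pull[OF this u] show ?thesis .
qed

text \<open>Gluing: representable presheaves are sheaves for this topology.\<close>

lemma cov_glue:
  "cov Z Q \<Longrightarrow> (\<And>x k. arr C x Z k \<Longrightarrow> Q x k \<Longrightarrow> arr C x E (t x k)) \<Longrightarrow>
    (\<And>x k y l. arr C x Z k \<Longrightarrow> arr C y x l \<Longrightarrow> Q x k \<Longrightarrow>
      Q y (Comp C y x Z k l) \<and> t y (Comp C y x Z k l) = Comp C y x E (t x k) l) \<Longrightarrow>
    \<exists>w. arr C Z E w \<and> (\<forall>x k. arr C x Z k \<longrightarrow> Q x k \<longrightarrow> Comp C x Z E w k = t x k)"
proof (induction arbitrary: t rule: cov.induct)
  case (base Z Q)
  have i [simp]: "Q Z (Ident C Z)" "arr C Z Z (Ident C Z)" using base.hyps by auto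
  show ?case
  proof (intro exI[of _ "t Z (Ident C Z)"] conjI allI impI)
    show "arr C Z E (t Z (Ident C Z))" by (rule base.prems) simp_all
    show "Comp C x Z E (t Z (Ident C Z)) k = t x k" if k: "arr C x Z k" for x k
      using base.prems(2)[OF i(2) k i(1)] k by simp
  qed
next
  case (step X A B D m f g n Q)
  note p = step.hyps(1)
  note [simp] = po_arr(1-4)[OF p] po_obj[OF p]
  note t_arr = step.prems(1)
  have Q_sieve: "Q y (Comp C y x D k l)" and t_nat: "t y (Comp C y x D k l) = Comp C y x E (t x k) l"
    if "arr C x D k" "arr C y x l" "Q x k" for x k y l
    using step.prems(2)[OF that] by simp_all
  have "\<exists>w. arr C A E w \<and> (\<forall>x k. arr C x A k \<longrightarrow> Q x (Comp C x A D g k) \<longrightarrow> Comp C x A E w k = t x (Comp C x A D g k))"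
    by (rule step.IH(1)) (use t_arr Q_sieve t_nat in \<open>simp_all add: assoc[symmetric]\<close>)
  then obtain a where a [simp]: "arr C A E a"
    and at: "\<And>x k. arr C x A k \<Longrightarrow> Q x (Comp C x A D g k) \<Longrightarrow> Comp C x A E a k = t x (Comp C x A D g k)"
    by blast
  have "\<exists>w. arr C B E w \<and> (\<forall>x k. arr C x B k \<longrightarrow> Q x (Comp C x B D n k) \<longrightarrow> Comp C x B E w k = t x (Comp C x B D n k))"
    by (rule step.IH(2)) (use t_arr Q_sieve t_nat in \<open>simp_all add: assoc[symmetric]\<close>)
  then obtain b where b [simp]: "arr C B E b"
    and bt: "\<And>x k. arr C x B k \<Longrightarrow> Q x (Comp C x B D n k) \<Longrightarrow> Comp C x B E b k = t x (Comp C x B D n k)"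
    by blast
  have covD: "cov D Q" using cov.step[OF step.hyps] .
  \<comment> \<open>\<open>a\<close> and \<open>b\<close> are not compared directly. The cover of
    \<open>D\<close> is pulled back to \<open>X\<close>, and on each of its members both composites
    are values of \<open>t\<close>.\<close>
  have "Comp C X A E a m = Comp C X B E b f"
  proof (rule cov_eq[OF cov_pull[OF covD, of X "Comp C X A D g m"]])
    fix x k assume [simp]: "arr C x X k" and q: "Q x (Comp C x X D (Comp C X A D g m) k)"
    have q': "Q x (Comp C x A D g (Comp C x X A m k))" using q by (simp add: assoc)
    have "Comp C x A E a (Comp C x X A m k) = Comp C x B E b (Comp C x X B f k)"
      using at[OF _ q'] bt[of x "Comp C x X B f k"] q' by (simp add: po_square[OF p])
    then show "Comp C x X E (Comp C X A E a m) k = Comp C x X E (Comp C X B E b f) k" by (simp add: assoc)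
  qed simp_all
  then obtain w where w [simp]: "arr C D E w" "Comp C A D E w g = a" "Comp C B D E w n = b"
    by (rule po_ex[OF p a b])
  \<comment> \<open>An arrow \<open>k\<close> need not factor through a coprojection. The two sides
    are compared on the cover of its domain where it does.\<close>
  have "Comp C x D E w k = t x k" if k [simp]: "arr C x D k" and q: "Q x k" for x k
  proof (rule cov_eq[OF cov_coprojections[OF p step.hyps(2) k]])
    fix y l assume l [simp]: "arr C y x l" and
      "(\<exists>h. arr C y A h \<and> Comp C y A D g h = Comp C y x D k l) \<or> (\<exists>h. arr C y B h \<and> Comp C y B D n h = Comp C y x D k l)"
    then consider h where "arr C y A h" "Comp C y A D g h = Comp C y x D k l"
      | h where "arr C y B h" "Comp C y B D n h = Comp C y x D k l" by blast
    then have "Comp C y D E w (Comp C y x D k l) = t y (Comp C y x D k l)"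
    proof cases
      case 1
      then have "Comp C y A E a h = t y (Comp C y A D g h)" using at Q_sieve[OF k l q] by simp
      then show ?thesis using 1 comp_tri[OF w(2), of y h] by simp
    next
      case 2
      then have "Comp C y B E b h = t y (Comp C y B D n h)" using bt Q_sieve[OF k l q] by simp
      then show ?thesis using 2 comp_tri[OF w(3), of y h] by simp
    qed
    then show "Comp C y x E (Comp C x D E w k) l = Comp C y x E (t x k) l"
      using t_nat[OF k l q] by (simp add: assoc)
  qed (use t_arr[OF k q] in simp_all)
  then show ?case using w(1) by blast
qed

end

section \<open>Monicity and kernel pairs of coprojections\<close>

context adh begin

text \<open>Pull the pushout back along \<open>n\<close>. Since the square is a pullback and
  \<open>m\<close> is monic, the span acquires an identity leg, so the opposite coprojection
  \<open>p1\<close>, a projection of the kernel pair of \<open>n\<close>, gets a left inverse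
  \<open>h\<close>. Comparing with the diagonal \<open>e\<close>, every element of the kernel pair
  is diagonal.\<close>

lemma po_mono:
  assumes p: "is_pushout C X A B D m f g n" and m: "is_mono C X A m"
  shows "is_mono C B D n"
proof -
  note pb = po_is_pb[OF p m]
  note [simp] = po_arr(1-4)[OF p] po_obj[OF p]
  obtain B2 p1 p2 where pb2: "is_pullback C B2 B B D p1 p2 n n" using pullback_ex[OF po_arr(4,4)[OF p]] by blast
  note [simp] = pb_arr(1,2)[OF pb2] pb_obj(1)[OF pb2]
  obtain f' where f' [simp]: "arr C X B2 f'" "Comp C X B2 B p1 f' = f" "Comp C X B2 B p2 f' = f"
    by (rule pb_ex[OF pb2 po_arr(2,2)[OF p] refl]) blast
  have "is_pushout C X X B2 B (Ident C X) f' f p1"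
    by (rule po_stable[OF p m pb[unfolded is_pullback_swap[of C X A B]] pb2
      iffD1[OF mono_kernel_pair[OF po_arr(1)[OF p]] m]]) simp_all
  then obtain h where h: "arr C B B2 h" "Comp C B2 B B2 h p1 = Ident C B2"
    by (rule po_ex[where E = B2 and u = f' and v = "Ident C B2"]) simp_all
  obtain e where e [simp]: "arr C B B2 e" "Comp C B B2 B p1 e = Ident C B" "Comp C B B2 B p2 e = Ident C B"
    by (rule pb_ex[OF pb2, of B "Ident C B" "Ident C B"]) auto
  show ?thesis
  proof (rule monoI)
    fix Z u v assume u [simp]: "arr C Z B u" and v [simp]: "arr C Z B v" and uv: "Comp C Z B D n u = Comp C Z B D n v"
    obtain w where w [simp]: "arr C Z B2 w" "Comp C Z B2 B p1 w = u" "Comp C Z B2 B p2 w = v"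
      by (rule pb_ex[OF pb2 u v uv])
    have "w = Comp C Z B B2 h u" using comp_tri[OF h(2), of Z w] h(1) by simp
    also have "\<dots> = Comp C Z B B2 e u"
      using comp_tri[OF h(2), of Z "Comp C Z B B2 e u"] h(1) by (simp add: comp_tri[OF e(2)])
    finally show "u = v" using w(3) by (simp add: comp_tri[OF e(3)])
  qed simp
qed

text \<open>
  The kernel pair of the coprojection g is locally the union of the diagonal of A and the kernel
  pair of f.  The union P of these two subobjects of the kernel pair A2 embeds into A2 (by local
  considerations), and both P and A2 have the pushout A along the projections; hence the
  square from P to A is a pushout along a monomorphism and therefore a pullback, which gives a
  section of P --> A2.
\<close>

lemma po_kernel:
  assumes p: "is_pushout C X A B D m f g n" and m: "is_mono C X A m"
    and u: "arr C Z A u" and v: "arr C Z A v" and uv: "Comp C Z A D g u = Comp C Z A D g v"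
  shows "cov Z (\<lambda>x k. Comp C x Z A u k = Comp C x Z A v k \<or>
    (\<exists>c c'. arr C x X c \<and> arr C x X c' \<and> Comp C x X A m c = Comp C x Z A u k \<and>
       Comp C x X A m c' = Comp C x Z A v k \<and> Comp C x X B f c = Comp C x X B f c'))"
proof -
  note pb = po_is_pb[OF p m]
  note pa [simp] = po_arr(1-4)[OF p] po_obj[OF p]
  obtain A2 p1 p2 where pbA: "is_pullback C A2 A A D p1 p2 g g" using pullback_ex[OF po_arr(3,3)[OF p]] by blast
  obtain X2 q1 q2 where pbX: "is_pullback C X2 X X B q1 q2 f f" using pullback_ex[OF po_arr(2,2)[OF p]] by blast
  note [simp] = pb_arr(1,2)[OF pbA] pb_arr(1,2)[OF pbX] pb_obj(1)[OF pbA] pb_obj(1)[OF pbX]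
  obtain dA where dA [simp]: "arr C A A2 dA" "Comp C A A2 A p1 dA = Ident C A" "Comp C A A2 A p2 dA = Ident C A"
    by (rule pb_ex[OF pbA, of A "Ident C A" "Ident C A"]) auto
  obtain dX where dX [simp]: "arr C X X2 dX" "Comp C X X2 X q1 dX = Ident C X" "Comp C X X2 X q2 dX = Ident C X"
    by (rule pb_ex[OF pbX, of X "Ident C X" "Ident C X"]) auto
  have "Comp C X2 A D g (Comp C X2 X A m q1) = Comp C X2 A D g (Comp C X2 X A m q2)"
    by (simp add: po_square[OF p] pb_arr(5)[OF pbX])
  then obtain i where i [simp]: "arr C X2 A2 i" "Comp C X2 A2 A p1 i = Comp C X2 X A m q1"
    "Comp C X2 A2 A p2 i = Comp C X2 X A m q2"
    by (rule pb_ex[OF pbA, rotated 2]) auto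
  have d1: "Comp C Q A2 A p1 (Comp C Q A A2 dA s) = s" "Comp C Q A2 A p2 (Comp C Q A A2 dA s) = s"
    if "arr C Q A s" for Q s using that by (simp_all add: comp_tri[OF dA(2)] comp_tri[OF dA(3)])
  have d2: "Comp C Q X2 X q1 (Comp C Q X X2 dX s) = s" "Comp C Q X2 X q2 (Comp C Q X X2 dX s) = s"
    if "arr C Q X s" for Q s using that by (simp_all add: comp_tri[OF dX(2)] comp_tri[OF dX(3)])
  have i1: "Comp C Q A2 A p1 (Comp C Q X2 A2 i s) = Comp C Q X A m (Comp C Q X2 X q1 s)"
    "Comp C Q A2 A p2 (Comp C Q X2 A2 i s) = Comp C Q X A m (Comp C Q X2 X q2 s)"
    if "arr C Q X2 s" for Q s using that by (simp_all add: comp_tri[OF i(2)] comp_tri[OF i(3)] assoc)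
  \<comment> \<open>The kernel pair \<open>X2\<close> of \<open>f\<close> is the part of
    \<open>A2\<close> whose first coordinate lies in \<open>X\<close>: the second coordinate then
    lies in \<open>X\<close> too, with the same image in \<open>B\<close>, because the original
    square is a pullback.\<close>
  have pbi: "is_pullback C X2 A2 X A i q1 p1 m"
  proof (rule pbI)
    fix Q s c assume s [simp]: "arr C Q A2 s" and c [simp]: "arr C Q X c" and e: "Comp C Q A2 A p1 s = Comp C Q X A m c"
    have "Comp C Q A D g (Comp C Q A2 A p2 s) = Comp C Q B D n (Comp C Q X B f c)"
      using pb_square[OF pbA s] by (simp add: e po_square[OF p])
    then obtain c' where c' [simp]: "arr C Q X c'" "Comp C Q X A m c' = Comp C Q A2 A p2 s" "Comp C Q X B f c' = Comp C Q X B f c"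
      by (rule pb_ex[OF pb, rotated 2]) auto
    obtain h where h [simp]: "arr C Q X2 h" "Comp C Q X2 X q1 h = c" "Comp C Q X2 X q2 h = c'"
      by (rule pb_ex[OF pbX, of Q c c']) auto
    have "Comp C Q X2 A2 i h = s"
      by (rule pb_uniq[OF pbA, of Q]) (simp_all add: i1 e)
    then show "\<exists>h. arr C Q X2 h \<and> Comp C Q X2 A2 i h = s \<and> Comp C Q X2 X q1 h = c"
      by (intro exI[of _ h]) simp
  next
    fix Q h h' assume h [simp]: "arr C Q X2 h" "arr C Q X2 h'" and e: "Comp C Q X2 A2 i h = Comp C Q X2 A2 i h'"
      "Comp C Q X2 X q1 h = Comp C Q X2 X q1 h'"
    have *: "Comp C Q X A m (Comp C Q X2 X q2 h) = Comp C Q X A m (Comp C Q X2 X q2 h')"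
      using arg_cong[OF e(1), of "Comp C Q A2 A p2"] by (simp add: i1)
    have "Comp C Q X2 X q2 h = Comp C Q X2 X q2 h'"
      by (rule mono_cancel[OF m _ _ *]) simp_all
    then show "h = h'" by (rule pb_uniq[OF pbX h e(2)])
  qed simp_all
  \<comment> \<open>The original pushout pulled back along \<open>g\<close> itself.\<close>
  have po1: "is_pushout C X2 A2 X A i q2 p2 m"
    by (rule po_stable[OF p m iffD1[OF is_pullback_swap pbA] pb pbi])
      (simp_all add: pb_arr(5)[OF pbX])
  have dm: "Comp C X A A2 dA m = Comp C X X2 A2 i dX"
    by (rule pb_uniq[OF pbA, of X]) (simp_all add: d1 i1)
  obtain P iA j where poP: "is_pushout C X A X2 P m dX iA j" using po_exists[OF _ dX(1) m] pa by blast
  note [simp] = po_arr(3,4)[OF poP] po_obj(4)[OF poP]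
  obtain h where h [simp]: "arr C P A2 h" "Comp C A P A2 h iA = dA" "Comp C X2 P A2 h j = i"
    by (rule po_ex[OF poP dA(1) i(1) dm])
  have h1: "Comp C Q P A2 h (Comp C Q A P iA s) = Comp C Q A A2 dA s" if "arr C Q A s" for Q s
    using that by (simp add: comp_tri[OF h(2)])
  have h2: "Comp C Q P A2 h (Comp C Q X2 P j s) = Comp C Q X2 A2 i s" if "arr C Q X2 s" for Q s
    using that by (simp add: comp_tri[OF h(3)])
  \<comment> \<open>Elements of \<open>P\<close> coming from \<open>A\<close> or \<open>X2\<close>
    are separated by \<open>h\<close>. In the mixed case a diagonal element of \<open>A2\<close>
    that lies in \<open>X2\<close> has equal coordinates in \<open>X\<close>, so it comes from
    \<open>dX\<close>, along which the two parts were glued in \<open>P\<close>.\<close>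
  have cases: "s = t"
    if s [simp]: "arr C Q P s" and t [simp]: "arr C Q P t" and e: "Comp C Q P A2 h s = Comp C Q P A2 h t"
      and s': "(\<exists>l. arr C Q A l \<and> Comp C Q A P iA l = s) \<or> (\<exists>l. arr C Q X2 l \<and> Comp C Q X2 P j l = s)"
      and t': "(\<exists>l. arr C Q A l \<and> Comp C Q A P iA l = t) \<or> (\<exists>l. arr C Q X2 l \<and> Comp C Q X2 P j l = t)" for Q s t
  proof -
    have mixed: "Comp C Q A P iA a = Comp C Q X2 P j b"
      if [simp]: "arr C Q A a" "arr C Q X2 b" and e: "Comp C Q A A2 dA a = Comp C Q X2 A2 i b" for a b
    proof -
      have a: "a = Comp C Q X A m (Comp C Q X2 X q1 b)" "a = Comp C Q X A m (Comp C Q X2 X q2 b)"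
        using arg_cong[OF e, of "Comp C Q A2 A p1"] arg_cong[OF e, of "Comp C Q A2 A p2"] by (simp_all add: d1 i1)
      have "Comp C Q X2 X q1 b = Comp C Q X2 X q2 b"
        by (rule mono_cancel[OF m _ _ trans[OF a(1)[symmetric] a(2)]]) simp_all
      then have "b = Comp C Q X X2 dX (Comp C Q X2 X q1 b)"
        by (intro pb_uniq[OF pbX, of Q b "Comp C Q X X2 dX (Comp C Q X2 X q1 b)"]) (simp_all add: d2)
      then have "Comp C Q X2 P j b = Comp C Q X2 P j (Comp C Q X X2 dX (Comp C Q X2 X q1 b))" by simp
      also have "\<dots> = Comp C Q A P iA a" by (simp add: po_square[OF poP, symmetric] a(1)[symmetric])
      finally show ?thesis ..
    qed
    have AA: "a = b" if [simp]: "arr C Q A a" "arr C Q A b" and e: "Comp C Q A A2 dA a = Comp C Q A A2 dA b" for a b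
      using arg_cong[OF e, of "Comp C Q A2 A p1"] by (simp add: d1)
    have XX: "a = b" if [simp]: "arr C Q X2 a" "arr C Q X2 b" and e: "Comp C Q X2 A2 i a = Comp C Q X2 A2 i b" for a b
    proof -
      have *: "Comp C Q X A m (Comp C Q X2 X q1 a) = Comp C Q X A m (Comp C Q X2 X q1 b)"
        "Comp C Q X A m (Comp C Q X2 X q2 a) = Comp C Q X A m (Comp C Q X2 X q2 b)"
        using arg_cong[OF e, of "Comp C Q A2 A p1"] arg_cong[OF e, of "Comp C Q A2 A p2"] by (simp_all add: i1)
      have "Comp C Q X2 X q1 a = Comp C Q X2 X q1 b" by (rule mono_cancel[OF m _ _ *(1)]) simp_all
      moreover have "Comp C Q X2 X q2 a = Comp C Q X2 X q2 b" by (rule mono_cancel[OF m _ _ *(2)]) simp_all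
      ultimately show ?thesis by (rule pb_uniq[OF pbX that(1,2)])
    qed
    from s' t' show ?thesis
    proof (elim disjE exE conjE)
      fix a b assume a: "arr C Q A a" "Comp C Q A P iA a = s" and b: "arr C Q A b" "Comp C Q A P iA b = t"
      then have "Comp C Q A A2 dA a = Comp C Q A A2 dA b" using e h1 by metis
      then show "s = t" using AA[OF a(1) b(1)] a b by simp
    next
      fix a b assume a: "arr C Q A a" "Comp C Q A P iA a = s" and b: "arr C Q X2 b" "Comp C Q X2 P j b = t"
      then have "Comp C Q A A2 dA a = Comp C Q X2 A2 i b" using e h1 h2 by metis
      then show "s = t" using mixed[OF a(1) b(1)] a b by simp
    next
      fix a b assume a: "arr C Q X2 a" "Comp C Q X2 P j a = s" and b: "arr C Q A b" "Comp C Q A P iA b = t"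
      then have "Comp C Q A A2 dA b = Comp C Q X2 A2 i a" using e h1 h2 by metis
      then show "s = t" using mixed[OF b(1) a(1)] a b by simp
    next
      fix a b assume a: "arr C Q X2 a" "Comp C Q X2 P j a = s" and b: "arr C Q X2 b" "Comp C Q X2 P j b = t"
      then have "Comp C Q X2 A2 i a = Comp C Q X2 A2 i b" using e h2 by metis
      then show "s = t" using XX[OF a(1) b(1)] a b by simp
    qed
  qed
  have h_mono: "is_mono C P A2 h"
  proof (rule monoI[OF h(1)])
    fix Q s t assume s [simp]: "arr C Q P s" and t [simp]: "arr C Q P t" and e: "Comp C Q P A2 h s = Comp C Q P A2 h t"
    show "s = t"
    proof (rule cov_eq[OF cov_coprojections[OF poP m s] s t])
      fix x k assume k [simp]: "arr C x Q k" and ks: "(\<exists>l. arr C x A l \<and> Comp C x A P iA l = Comp C x Q P s k) \<or>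
           (\<exists>l. arr C x X2 l \<and> Comp C x X2 P j l = Comp C x Q P s k)"
      have tk: "arr C x P (Comp C x Q P t k)" by simp
      show "Comp C x Q P s k = Comp C x Q P t k"
      proof (rule cov_eq[OF cov_coprojections[OF poP m tk] _ tk])
        fix y l assume l [simp]: "arr C y x l" and t': "(\<exists>r. arr C y A r \<and> Comp C y A P iA r = Comp C y x P (Comp C x Q P t k) l) \<or>
           (\<exists>r. arr C y X2 r \<and> Comp C y X2 P j r = Comp C y x P (Comp C x Q P t k) l)"
        have A: "(\<exists>r. arr C y A r \<and> Comp C y A P iA r = Comp C y x P (Comp C x Q P s k) l) \<or>
           (\<exists>r. arr C y X2 r \<and> Comp C y X2 P j r = Comp C y x P (Comp C x Q P s k) l)"
          using ks
        proof (elim disjE exE conjE)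
          fix r assume r: "arr C x A r" "Comp C x A P iA r = Comp C x Q P s k"
          then show ?thesis by (intro disjI1 exI[of _ "Comp C y x A r l"]) (simp add: assoc[symmetric])
        next
          fix r assume r: "arr C x X2 r" "Comp C x X2 P j r = Comp C x Q P s k"
          then show ?thesis by (intro disjI2 exI[of _ "Comp C y x X2 r l"]) (simp add: assoc[symmetric])
        qed
        have B: "Comp C y P A2 h (Comp C y x P (Comp C x Q P s k) l) = Comp C y P A2 h (Comp C y x P (Comp C x Q P t k) l)"
          using comp_eq_extend[OF e k] by (simp add: assoc[symmetric] e)
        show "Comp C y x P (Comp C x Q P s k) l = Comp C y x P (Comp C x Q P t k) l"
          by (rule cases[OF _ _ B A t']) simp_all
      qed simp
    qed
  qed
  \<comment> \<open>A map \<open>s\<close> on \<open>A2\<close> that agrees on \<open>P\<close> with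
    \<open>r\<close> after \<open>p2\<close> factors through \<open>p2\<close> by the pushout
    \<open>po1\<close>; restriction to the diagonal identifies the factor with
    \<open>r\<close>.\<close>
  have "is_pushout C P A2 A A h (Comp C P A2 A p2 h) p2 (Ident C A)"
  proof (rule poI)
    fix E s r assume s [simp]: "arr C A2 E s" and r [simp]: "arr C A E r"
      and e: "Comp C P A2 E s h = Comp C P A E r (Comp C P A2 A p2 h)"
    have "Comp C X2 A2 E s i = Comp C X2 P E (Comp C P A2 E s h) j" by (simp add: assoc)
    also have "\<dots> = Comp C X2 X E (Comp C X A E r m) q2" by (simp add: e assoc)
    finally obtain w where w [simp]: "arr C A E w" "Comp C A2 A E w p2 = s"
      by (rule po_ex[OF po1 s, rotated]) auto
    have "w = Comp C A A2 E s dA" by (simp add: w(2)[symmetric] assoc del: w(2))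
    also have "\<dots> = Comp C A P E (Comp C P A2 E s h) iA" by (simp add: assoc)
    also have "\<dots> = r" by (simp add: e assoc)
    finally show "\<exists>h. arr C A E h \<and> Comp C A2 A E h p2 = s \<and> Comp C A A E h (Ident C A) = r"
      using w by (intro exI[of _ w]) simp
  qed simp_all
  \<comment> \<open>The pair of the identity of \<open>A2\<close> and \<open>p2\<close> lifts
    through this pullback and splits \<open>h\<close>. Every element of \<open>A2\<close> thus lifts
    to \<open>P\<close>, where the coprojections form a cover.\<close>
  from po_is_pb[OF this h_mono] obtain r where r [simp]: "arr C A2 P r" "Comp C A2 P A2 h r = Ident C A2"
    by (rule pb_ex[where u = "Ident C A2" and v = p2]) auto
  obtain w where w [simp]: "arr C Z A2 w" "Comp C Z A2 A p1 w = u" "Comp C Z A2 A p2 w = v"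
    by (rule pb_ex[OF pbA u v uv])
  have rw: "arr C Z P (Comp C Z A2 P r w)" by simp
  note [simp] = u v
  show ?thesis
  proof (rule cov_mono[OF cov_coprojections[OF poP m rw]], elim disjE exE conjE)
    fix x k l assume [simp]: "arr C x Z k" "arr C x A l" and e: "Comp C x A P iA l = Comp C x Z P (Comp C Z A2 P r w) k"
    have "Comp C x Z A2 w k = Comp C x A A2 dA l"
      using arg_cong[OF e, of "Comp C x P A2 h"] by (simp add: h1 assoc comp_tri[OF r(2)])
    then have "Comp C x A2 A p1 (Comp C x Z A2 w k) = l" "Comp C x A2 A p2 (Comp C x Z A2 w k) = l"
      by (simp_all add: d1)
    then have "Comp C x Z A u k = Comp C x Z A v k"
      by (simp add: comp_tri[OF w(2)] comp_tri[OF w(3)])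
    then show "Comp C x Z A u k = Comp C x Z A v k \<or>
       (\<exists>c c'. arr C x X c \<and> arr C x X c' \<and> Comp C x X A m c = Comp C x Z A u k \<and>
         Comp C x X A m c' = Comp C x Z A v k \<and> Comp C x X B f c = Comp C x X B f c')" ..
  next
    fix x k l assume [simp]: "arr C x Z k" "arr C x X2 l" and e: "Comp C x X2 P j l = Comp C x Z P (Comp C Z A2 P r w) k"
    have "Comp C x Z A2 w k = Comp C x X2 A2 i l"
      using arg_cong[OF e, of "Comp C x P A2 h"] by (simp add: h2 assoc comp_tri[OF r(2)])
    then have "Comp C x A2 A p1 (Comp C x Z A2 w k) = Comp C x X A m (Comp C x X2 X q1 l)"
      "Comp C x A2 A p2 (Comp C x Z A2 w k) = Comp C x X A m (Comp C x X2 X q2 l)"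
      by (simp_all add: i1)
    then show "Comp C x Z A u k = Comp C x Z A v k \<or>
       (\<exists>c c'. arr C x X c \<and> arr C x X c' \<and> Comp C x X A m c = Comp C x Z A u k \<and>
         Comp C x X A m c' = Comp C x Z A v k \<and> Comp C x X B f c = Comp C x X B f c')"
      by (intro disjI2 exI[of _ "Comp C x X2 X q1 l"] exI[of _ "Comp C x X2 X q2 l"])
        (simp add: comp_tri[OF w(2)] comp_tri[OF w(3)] pb_square[OF pbX])
  qed
qed

end

section \<open>Adhesive categories\<close>

context adh begin

text \<open>Gluing for solutions of a relation \<open>W\<close> instead of a given family.
  Uniqueness over each arrow makes arbitrarily chosen solutions compatible, so they amalgamate; the
  amalgam is then known to satisfy \<open>W\<close> locally.\<close>

lemma cov_glue_unique:
  assumes c: "cov Z (\<lambda>x k. \<exists>w. arr C x E w \<and> W x k w)"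
    and un: "\<And>x k w w'. arr C x Z k \<Longrightarrow> arr C x E w \<Longrightarrow> arr C x E w' \<Longrightarrow> W x k w \<Longrightarrow> W x k w' \<Longrightarrow> w = w'"
    and nat: "\<And>x k y l w. arr C x Z k \<Longrightarrow> arr C y x l \<Longrightarrow> arr C x E w \<Longrightarrow> W x k w \<Longrightarrow>
      W y (Comp C y x Z k l) (Comp C y x E w l)"
  obtains w where "arr C Z E w" "cov Z (\<lambda>x k. W x k (Comp C x Z E w k))"
proof -
  define t where "t x k = (SOME w. arr C x E w \<and> W x k w)" for x k
  have t: "arr C x E (t x k) \<and> W x k (t x k)" if "\<exists>w. arr C x E w \<and> W x k w" for x k
    unfolding t_def using that by (rule someI_ex)
  have "\<exists>w. arr C Z E w \<and> (\<forall>x k. arr C x Z k \<longrightarrow> (\<exists>w. arr C x E w \<and> W x k w) \<longrightarrow> Comp C x Z E w k = t x k)"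
  proof (rule cov_glue[OF c])
    fix x k y l assume k: "arr C x Z k" and l: "arr C y x l" and ex: "\<exists>w. arr C x E w \<and> W x k w"
    have W: "arr C y E (Comp C y x E (t x k) l)" "W y (Comp C y x Z k l) (Comp C y x E (t x k) l)"
      using t[OF ex] nat[OF k l] l by auto
    then have ex': "\<exists>w. arr C y E w \<and> W y (Comp C y x Z k l) w" by blast
    have "t y (Comp C y x Z k l) = Comp C y x E (t x k) l"
      by (rule un[of y "Comp C y x Z k l"]) (use k l W t[OF ex'] in auto)
    then show "(\<exists>w. arr C y E w \<and> W y (Comp C y x Z k l) w) \<and> t y (Comp C y x Z k l) = Comp C y x E (t x k) l"
      using ex' by simp
  qed (use t in blast)
  then obtain w where w: "arr C Z E w"
    and wt: "\<And>x k. arr C x Z k \<Longrightarrow> \<exists>w. arr C x E w \<and> W x k w \<Longrightarrow> Comp C x Z E w k = t x k" by blast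
  have "cov Z (\<lambda>x k. W x k (Comp C x Z E w k))"
    by (rule cov_mono[OF c]) (use wt t in simp)
  then show ?thesis by (rule that[OF w])
qed

text \<open>Local equality of arrows into \<open>P\<close> is equality, so local lifts are unique
  and glue. The projections of the glued arrow are correct because they are correct on a
  cover.\<close>

lemma pb_local:
  assumes a: "arr C P A p" "arr C P B q" "arr C A D f" "arr C B D g"
    and comm: "Comp C P A D f p = Comp C P B D g q"
    and ex: "\<And>Q u v. arr C Q A u \<Longrightarrow> arr C Q B v \<Longrightarrow> Comp C Q A D f u = Comp C Q B D g v \<Longrightarrow>
      cov Q (\<lambda>x k. \<exists>h. arr C x P h \<and> Comp C x P A p h = Comp C x Q A u k \<and> Comp C x P B q h = Comp C x Q B v k)"
    and un: "\<And>Q h h'. arr C Q P h \<Longrightarrow> arr C Q P h' \<Longrightarrow> Comp C Q P A p h = Comp C Q P A p h' \<Longrightarrow>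
       Comp C Q P B q h = Comp C Q P B q h' \<Longrightarrow> cov Q (\<lambda>x k. Comp C x Q P h k = Comp C x Q P h' k)"
  shows "is_pullback C P A B D p q f g"
proof (rule pbI[OF a comm])
  have un': "h = h'" if "arr C Q P h" "arr C Q P h'" "Comp C Q P A p h = Comp C Q P A p h'"
    "Comp C Q P B q h = Comp C Q P B q h'" for Q h h'
    by (rule cov_eq[OF un[OF that] that(1,2)])
  then show "h = h'" if "arr C Q P h" "arr C Q P h'" "Comp C Q P A p h = Comp C Q P A p h'"
    "Comp C Q P B q h = Comp C Q P B q h'" for Q h h' using that .
  note [simp] = a
  fix Q u v assume u [simp]: "arr C Q A u" and v [simp]: "arr C Q B v" and e: "Comp C Q A D f u = Comp C Q B D g v"
  obtain w where w [simp]: "arr C Q P w" and c: "cov Q (\<lambda>x k. Comp C x P A p (Comp C x Q P w k) = Comp C x Q A u k \<and>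
    Comp C x P B q (Comp C x Q P w k) = Comp C x Q B v k)"
  proof (rule cov_glue_unique[OF ex[OF u v e]])
    fix x k y l w assume "arr C x Q k" "arr C y x l" "arr C x P w"
      "Comp C x P A p w = Comp C x Q A u k \<and> Comp C x P B q w = Comp C x Q B v k"
    then show "Comp C y P A p (Comp C y x P w l) = Comp C y Q A u (Comp C y x Q k l) \<and>
       Comp C y P B q (Comp C y x P w l) = Comp C y Q B v (Comp C y x Q k l)"
      by (simp add: assoc[symmetric])
  qed (use un' in auto)
  have "Comp C Q P A p w = u" by (rule cov_eq[OF c, of A]) (simp_all add: assoc)
  moreover have "Comp C Q P B q w = v" by (rule cov_eq[OF c, of B]) (simp_all add: assoc)
  ultimately show "\<exists>h. arr C Q P h \<and> Comp C Q P A p h = u \<and> Comp C Q P B q h = v"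
    using w by blast
qed

text \<open>Elements of \<open>D'\<close> come locally from \<open>A'\<close> or \<open>B'\<close>.
  Over \<open>B\<close>, an element from \<open>A'\<close> is moved to \<open>X'\<close>, and from
  there to \<open>B'\<close>, by the pullback property of the lower pushout and the rear face;
  monicity of \<open>n\<close> and \<open>n'\<close> settles the rest. Over \<open>A\<close>, two
  elements with equal image in \<open>D\<close> need not be equal. There \<open>po_kernel\<close>
  reduces the difference to a pair in \<open>X\<close> with equal image in \<open>B\<close>, which
  the rear faces lift to \<open>X'\<close>.\<close>

lemma po_front:
  assumes p: "is_pushout C X A B D m f g n" and m: "is_mono C X A m"
    and p': "is_pushout C X' A' B' D' m' f' g' n'"
    and pbA: "is_pullback C X' A' X A m' x a m" and pbB: "is_pullback C X' B' X B f' x b f"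
    and d: "arr C D' D d" and eA: "Comp C A' D' D d g' = Comp C A' A D g a"
    and eB: "Comp C B' D' D d n' = Comp C B' B D n b"
  shows "is_pullback C A' D' A D g' a d g" "is_pullback C B' D' B D n' b d n"
proof -
  note [simp] = po_arr(1-4)[OF p] po_arr(1-4)[OF p'] pb_arr(1-3)[OF pbA] pb_arr(2,3)[OF pbB] d
    po_obj[OF p] po_obj[OF p']
  have m': "is_mono C X' A' m'" using pb_mono[OF iffD1[OF is_pullback_swap pbA] m] .
  note pb = po_is_pb[OF p m] and pb' = po_is_pb[OF p' m']
  note n = po_mono[OF p m] and n' = po_mono[OF p' m']
  have sA: "Comp C Q D' D d (Comp C Q A' D' g' s) = Comp C Q A D g (Comp C Q A' A a s)" if "arr C Q A' s" for Q s
    by (rule comp_eq_extend[OF eA that]) simp_all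
  have sB: "Comp C Q D' D d (Comp C Q B' D' n' s) = Comp C Q B D n (Comp C Q B' B b s)" if "arr C Q B' s" for Q s
    by (rule comp_eq_extend[OF eB that]) simp_all
  have n_cancel: "s = t" if "arr C Q B s" "arr C Q B t" "Comp C Q B D n s = Comp C Q B D n t" for Q s t
    using mono_cancel[OF n that] .
  show "is_pullback C B' D' B D n' b d n"
  proof (rule pb_local)
    fix Q u v assume u [simp]: "arr C Q D' u" and v [simp]: "arr C Q B v" and e: "Comp C Q D' D d u = Comp C Q B D n v"
    show "cov Q (\<lambda>x k. \<exists>h. arr C x B' h \<and> Comp C x B' D' n' h = Comp C x Q D' u k \<and> Comp C x B' B b h = Comp C x Q B v k)"
    proof (rule cov_mono[OF cov_coprojections[OF p' m' u]], elim disjE exE conjE)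
      fix z k w assume k [simp]: "arr C z Q k" and w [simp]: "arr C z A' w" and gw: "Comp C z A' D' g' w = Comp C z Q D' u k"
      have "Comp C z A D g (Comp C z A' A a w) = Comp C z B D n (Comp C z Q B v k)"
        using comp_eq_extend[OF e k] by (simp add: sA[symmetric] gw)
      then obtain c where c [simp]: "arr C z X c" "Comp C z X A m c = Comp C z A' A a w" "Comp C z X B f c = Comp C z Q B v k"
        by (rule pb_ex[OF pb, rotated 2]) auto
      obtain c' where c' [simp]: "arr C z X' c'" "Comp C z X' A' m' c' = w" "Comp C z X' X x c' = c"
        by (rule pb_ex[OF pbA w c(1)]) auto
      show "\<exists>h. arr C z B' h \<and> Comp C z B' D' n' h = Comp C z Q D' u k \<and> Comp C z B' B b h = Comp C z Q B v k"
        using gw by (intro exI[of _ "Comp C z X' B' f' c'"]) (simp add: po_square[OF p', symmetric] pb_square[OF pbB])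
    next
      fix z k w assume k [simp]: "arr C z Q k" and w [simp]: "arr C z B' w" and nw: "Comp C z B' D' n' w = Comp C z Q D' u k"
      have "Comp C z B' B b w = Comp C z Q B v k"
        by (rule n_cancel[of z]) (use comp_eq_extend[OF e k] in \<open>simp_all add: sB[symmetric] nw\<close>)
      then show "\<exists>h. arr C z B' h \<and> Comp C z B' D' n' h = Comp C z Q D' u k \<and> Comp C z B' B b h = Comp C z Q B v k"
        using nw w by blast
    qed
  next
    fix Q h h' assume h: "arr C Q B' h" "arr C Q B' h'" "Comp C Q B' D' n' h = Comp C Q B' D' n' h'"
    have "h = h'" by (rule mono_cancel[OF n' h])
    then show "cov Q (\<lambda>x k. Comp C x Q B' h k = Comp C x Q B' h' k)"
      using h(1) by (intro cov.base) (auto dest: arrD)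
  qed (use eB in simp_all)
  show "is_pullback C A' D' A D g' a d g"
  proof (rule pb_local)
    fix Q u v assume u [simp]: "arr C Q D' u" and v [simp]: "arr C Q A v" and e: "Comp C Q D' D d u = Comp C Q A D g v"
    show "cov Q (\<lambda>x k. \<exists>h. arr C x A' h \<and> Comp C x A' D' g' h = Comp C x Q D' u k \<and> Comp C x A' A a h = Comp C x Q A v k)"
    proof (rule cov_bind[OF cov_coprojections[OF p' m' u]], elim disjE exE conjE)
      fix z k w assume k [simp]: "arr C z Q k" and w [simp]: "arr C z A' w" and gw: "Comp C z A' D' g' w = Comp C z Q D' u k"
      have gaw: "Comp C z A D g (Comp C z A' A a w) = Comp C z A D g (Comp C z Q A v k)"
        using comp_eq_extend[OF e k] by (simp add: sA[symmetric] gw)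
      have aw: "arr C z A (Comp C z A' A a w)" "arr C z A (Comp C z Q A v k)" by simp_all
      show "cov z (\<lambda>y l. \<exists>h. arr C y A' h \<and> Comp C y A' D' g' h = Comp C y Q D' u (Comp C y z Q k l) \<and>
        Comp C y A' A a h = Comp C y Q A v (Comp C y z Q k l))"
      proof (rule cov_mono[OF po_kernel[OF p m aw gaw]], elim disjE exE conjE)
        fix y l assume l [simp]: "arr C y z l"
          and wv: "Comp C y z A (Comp C z A' A a w) l = Comp C y z A (Comp C z Q A v k) l"
        show "\<exists>h. arr C y A' h \<and> Comp C y A' D' g' h = Comp C y Q D' u (Comp C y z Q k l) \<and>
          Comp C y A' A a h = Comp C y Q A v (Comp C y z Q k l)"
          using wv comp_eq_extend[OF gw l] by (intro exI[of _ "Comp C y z A' w l"]) (simp add: assoc)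
      next
        fix y l c c' assume [simp]: "arr C y z l" "arr C y X c" "arr C y X c'"
          and c: "Comp C y X A m c = Comp C y z A (Comp C z A' A a w) l"
            "Comp C y X A m c' = Comp C y z A (Comp C z Q A v k) l" "Comp C y X B f c = Comp C y X B f c'"
        \<comment> \<open>\<open>r\<close> places \<open>w\<close> over \<open>X'\<close>. Then
          \<open>r'\<close> is the element over \<open>c'\<close> with the same image in
          \<open>B'\<close>, so replacing \<open>w\<close> by \<open>m'\<close> after
          \<open>r'\<close> keeps the image in \<open>D'\<close> and changes the image in
          \<open>A\<close> to the required one.\<close>
        obtain r where r [simp]: "arr C y X' r" "Comp C y X' A' m' r = Comp C y z A' w l" "Comp C y X' X x r = c"
          by (rule pb_ex[OF pbA, of y "Comp C y z A' w l" c]) (simp_all add: c(1) assoc)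
        obtain r' where r' [simp]: "arr C y X' r'" "Comp C y X' B' f' r' = Comp C y X' B' f' r" "Comp C y X' X x r' = c'"
          by (rule pb_ex[OF pbB, of y "Comp C y X' B' f' r" c']) (simp_all add: pb_square[OF pbB] c)
        have "Comp C y A' D' g' (Comp C y X' A' m' r') = Comp C y Q D' u (Comp C y z Q k l)"
          using comp_eq_extend[OF gw, of y l] by (simp add: po_square[OF p'] assoc) (simp add: po_square[OF p', symmetric])
        moreover have "Comp C y A' A a (Comp C y X' A' m' r') = Comp C y Q A v (Comp C y z Q k l)"
          using c(2) by (simp add: pb_square[OF pbA] assoc)
        ultimately show "\<exists>h. arr C y A' h \<and> Comp C y A' D' g' h = Comp C y Q D' u (Comp C y z Q k l) \<and>
          Comp C y A' A a h = Comp C y Q A v (Comp C y z Q k l)"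
          by (intro exI[of _ "Comp C y X' A' m' r'"]) simp
      qed
    next
      fix z k w assume k [simp]: "arr C z Q k" and w [simp]: "arr C z B' w" and nw: "Comp C z B' D' n' w = Comp C z Q D' u k"
      have "Comp C z A D g (Comp C z Q A v k) = Comp C z B D n (Comp C z B' B b w)"
        using comp_eq_extend[OF e k] by (simp add: sB[symmetric] nw)
      then obtain c where c [simp]: "arr C z X c" "Comp C z X A m c = Comp C z Q A v k" "Comp C z X B f c = Comp C z B' B b w"
        by (rule pb_ex[OF pb, rotated 2]) auto
      obtain c' where c' [simp]: "arr C z X' c'" "Comp C z X' B' f' c' = w" "Comp C z X' X x c' = c"
        by (rule pb_ex[OF pbB w c(1)]) auto
      have 1: "Comp C z A' D' g' (Comp C z X' A' m' c') = Comp C z Q D' u k"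
        by (simp add: po_square[OF p'] nw)
      have 2: "Comp C z A' A a (Comp C z X' A' m' c') = Comp C z Q A v k"
        by (simp add: pb_square[OF pbA])
      show "cov z (\<lambda>y l. \<exists>h. arr C y A' h \<and> Comp C y A' D' g' h = Comp C y Q D' u (Comp C y z Q k l) \<and>
        Comp C y A' A a h = Comp C y Q A v (Comp C y z Q k l))"
      proof (rule cov.base)
        fix y l assume l [simp]: "arr C y z l"
        show "\<exists>h. arr C y A' h \<and> Comp C y A' D' g' h = Comp C y Q D' u (Comp C y z Q k l) \<and>
          Comp C y A' A a h = Comp C y Q A v (Comp C y z Q k l)"
          using comp_eq_extend[OF 1 l] comp_eq_extend[OF 2 l]
          by (intro exI[of _ "Comp C y z A' (Comp C z X' A' m' c') l"]) simp
      qed (rule arrD(1)[OF k])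
    qed
  next
    fix Q h h' assume h [simp]: "arr C Q A' h" "arr C Q A' h'" and eg: "Comp C Q A' D' g' h = Comp C Q A' D' g' h'"
      and ea: "Comp C Q A' A a h = Comp C Q A' A a h'"
    \<comment> \<open>Where the two elements are not already equal, they come from \<open>c\<close>
      and \<open>c'\<close> in \<open>X'\<close> with equal image in \<open>B'\<close>. Their images
      in \<open>X\<close> agree because \<open>m\<close> is monic, so the rear face over
      \<open>B\<close> makes \<open>c\<close> and \<open>c'\<close> equal.\<close>
    show "cov Q (\<lambda>x k. Comp C x Q A' h k = Comp C x Q A' h' k)"
    proof (rule cov_mono[OF po_kernel[OF p' m' h eg]], elim disjE exE conjE)
      fix y k c c' assume k [simp]: "arr C y Q k" and c [simp]: "arr C y X' c" "arr C y X' c'"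
        "Comp C y X' A' m' c = Comp C y Q A' h k" "Comp C y X' A' m' c' = Comp C y Q A' h' k"
        and ef: "Comp C y X' B' f' c = Comp C y X' B' f' c'"
      have *: "Comp C y X A m (Comp C y X' X x c) = Comp C y X A m (Comp C y X' X x c')"
        using pb_square[OF pbA c(1)] pb_square[OF pbA c(2)] comp_eq_extend[OF ea k] by simp
      have "Comp C y X' X x c = Comp C y X' X x c'"
        by (rule mono_cancel[OF m _ _ *]) simp_all
      then have "c = c'" by (rule pb_uniq[OF pbB c(1,2) ef])
      then show "Comp C y Q A' h k = Comp C y Q A' h' k" using c(3,4) by simp
    qed
  qed (use eA in simp_all)
qed

text \<open>One half of the cube condition is \<open>po_front\<close>, the other is the stability
  assumption. When the monic leg is the second one, the cube is reflected.\<close>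

lemma is_adhesive: "adhesive C"
proof -
  have main: "is_pushout C X' A' B' D' m' f' g' n' \<longleftrightarrow>
      is_pullback C A' D' A D g' a d g \<and> is_pullback C B' D' B D n' b d n"
    if cube: "comm_cube C X A B D m f g n X' A' B' D' m' f' g' n' x a b d"
      and p: "is_pushout C X A B D m f g n" and m: "is_mono C X A m"
      and r: "is_pullback C X' A' X A m' x a m" "is_pullback C X' B' X B f' x b f"
    for X A B D m f g n X' A' B' D' m' f' g' n' x a b d
  proof
    have *: "arr C D' D d" "Comp C A' D' D d g' = Comp C A' A D g a" "Comp C B' D' D d n' = Comp C B' B D n b"
      using cube by (simp_all add: comm_cube_def comm_square_arr)
    show "is_pullback C A' D' A D g' a d g \<and> is_pullback C B' D' B D n' b d n"
      if "is_pushout C X' A' B' D' m' f' g' n'" using po_front[OF p m that r *] by blast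
    show "is_pushout C X' A' B' D' m' f' g' n'"
      if "is_pullback C A' D' A D g' a d g \<and> is_pullback C B' D' B D n' b d n"
      using stable cube p m r that unfolding stable_pushouts_along_monos_def pushout_along_mono_def by blast
  qed
  show ?thesis
    unfolding adhesive_def
  proof (intro conjI allI impI)
    fix X A B D m f g n X' A' B' D' m' f' g' n' x a b d
    assume h: "comm_cube C X A B D m f g n X' A' B' D' m' f' g' n' x a b d \<and>
        pushout_along_mono C X A B D m f g n \<and>
        is_pullback C X' A' X A m' x a m \<and> is_pullback C X' B' X B f' x b f"
    then consider "is_mono C X A m" | "is_mono C X B f" by (auto simp: pushout_along_mono_def)
    then show "is_pushout C X' A' B' D' m' f' g' n' \<longleftrightarrow>
        is_pullback C A' D' A D g' a d g \<and> is_pullback C B' D' B D n' b d n"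
    proof cases
      case 1
      show ?thesis by (rule main) (use h 1 in \<open>auto simp: pushout_along_mono_def\<close>)
    next
      case 2
      have "comm_cube C X B A D f m n g X' B' A' D' f' m' n' g' x b a d"
        using h by (auto simp: comm_cube_def comm_square_arr)
      moreover have "is_pushout C X B A D f m n g"
        using h is_pushout_swap unfolding pushout_along_mono_def by metis
      ultimately have "is_pushout C X' B' A' D' f' m' n' g' \<longleftrightarrow>
        is_pullback C B' D' B D n' b d n \<and> is_pullback C A' D' A D g' a d g"
        by (rule main) (use h 2 in auto)
      then show ?thesis using is_pushout_swap[of C X' A'] by auto
    qed
  qed (use fc po in auto)
qed

end

text \<open>Apply the cube condition with the trivial pushout of \<open>f\<close> along an identity
  as top face and \<open>n\<close> as the edge over \<open>D\<close>. The rear faces are the kernel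
  pair square of \<open>m\<close>, a pullback because \<open>m\<close> is monic, and a trivial
  pullback; one front face is the given square reflected.\<close>

lemma adhesive_po_pb:
  assumes "adhesive C" shows "pushouts_along_monos_are_pullbacks C"
proof -
  have fc: "finitely_complete C" using assms by (simp add: adhesive_def)
  interpret cat C using fc by unfold_locales (simp add: finitely_complete_def)
  have main: "is_pullback C X A B D m f g n" if p: "is_pushout C X A B D m f g n" and m: "is_mono C X A m"
    for X A B D m f g n
  proof -
    note [simp] = po_arr(1-4)[OF p] po_obj[OF p]
    have cube: "comm_cube C X A B D m f g n X X B B (Ident C X) f f (Ident C B) (Ident C X) m (Ident C B) n"
      using po_arr(5)[OF p] by (simp add: comm_cube_def comm_square_arr)
    have r1: "is_pullback C X X X A (Ident C X) (Ident C X) m m"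
      using mono_kernel_pair m by simp
    have r2: "is_pullback C X B X B f (Ident C X) (Ident C B) f"
    proof (rule pbI)
      fix Q u v assume "arr C Q B u" "arr C Q X v" "Comp C Q B B (Ident C B) u = Comp C Q X B f v"
      then show "\<exists>h. arr C Q X h \<and> Comp C Q X B f h = u \<and> Comp C Q X X (Ident C X) h = v"
        by (intro exI[of _ v]) simp
    qed simp_all
    have t: "is_pushout C X X B B (Ident C X) f f (Ident C B)"
    proof (rule poI)
      fix E u v assume "arr C X E u" "arr C B E v" "Comp C X X E u (Ident C X) = Comp C X B E v f"
      then show "\<exists>h. arr C B E h \<and> Comp C X B E h f = u \<and> Comp C B B E h (Ident C B) = v"
        by (intro exI[of _ v]) simp
    qed simp_all
    have "pushout_along_mono C X A B D m f g n" using p m by (simp add: pushout_along_mono_def)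
    then have "is_pullback C X B A D f m n g"
      using assms cube r1 r2 t unfolding adhesive_def by blast
    then show ?thesis by (rule iffD1[OF is_pullback_swap])
  qed
  show ?thesis
    unfolding pushouts_along_monos_are_pullbacks_def
  proof (intro allI impI)
    fix X A B D m f g n assume h: "pushout_along_mono C X A B D m f g n"
    then consider "is_mono C X A m" | "is_mono C X B f" by (auto simp: pushout_along_mono_def)
    then show "is_pullback C X A B D m f g n"
    proof cases
      case 1
      then show ?thesis using main h by (simp add: pushout_along_mono_def)
    next
      case 2
      have "is_pushout C X B A D f m n g" using h is_pushout_swap unfolding pushout_along_mono_def by metis
      then show ?thesis by (rule iffD1[OF is_pullback_swap main[OF _ 2]])
    qed
  qed
qed

text \<open>Stability is the half of the cube condition that derives a pushout from pullback front
  faces. The pullback property comes from \<open>adhesive_po_pb\<close>, and the converse is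
  \<open>is_adhesive\<close>.\<close>

lemma adhesive_iff_stable:
  assumes fc: "finitely_complete C"
  shows "adhesive C \<longleftrightarrow> has_pushouts_along_monos C \<and> stable_pushouts_along_monos C \<and>
    pushouts_along_monos_are_pullbacks C"
proof
  assume a: "adhesive C"
  then have "stable_pushouts_along_monos C"
    unfolding stable_pushouts_along_monos_def adhesive_def by blast
  then show "has_pushouts_along_monos C \<and> stable_pushouts_along_monos C \<and> pushouts_along_monos_are_pullbacks C"
    using a adhesive_po_pb by (auto simp: adhesive_def)
next
  assume "has_pushouts_along_monos C \<and> stable_pushouts_along_monos C \<and> pushouts_along_monos_are_pullbacks C"
  then interpret adh C using fc by unfold_locales (auto simp: finitely_complete_def)
  show "adhesive C" by (rule is_adhesive)
qed

section \<open>Presheaves\<close>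

abbreviation presheaf :: "('o, 'u) cat \<Rightarrow> ('o, 'u) presheaf \<Rightarrow> bool" where
  "presheaf C P \<equiv> is_functor (op_cat C) Set_cat P"

abbreviation psh_trans :: "('o, 'u) cat \<Rightarrow> ('o, 'u) presheaf \<Rightarrow> ('o, 'u) presheaf \<Rightarrow> ('o \<Rightarrow> 'u \<Rightarrow> 'u) \<Rightarrow> bool" where
  "psh_trans C P Q \<alpha> \<equiv> nat_trans (op_cat C) Set_cat P Q \<alpha>"

lemma Set_cat_simps [simp]:
  "Obj (Set_cat :: ('u set, 'u \<Rightarrow> 'u) cat) = {X. X \<prec> (UNIV :: 'u set)}"
  "Hom Set_cat X Y = X \<rightarrow>\<^sub>E Y" "Ident Set_cat X = (\<lambda>x\<in>X. x)" "Comp Set_cat X Y Z g f = compose X g f"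
  by (simp_all add: Set_cat_def)

lemma category_Set: "category (Set_cat :: ('u set, 'u \<Rightarrow> 'u) cat)"
  unfolding category_def
proof (intro conjI ballI)
  fix X Y Z W :: "'u set" and f g h :: "'u \<Rightarrow> 'u"
  show "Ident Set_cat X \<in> Hom Set_cat X X" by auto
  assume "f \<in> Hom Set_cat X Y"
  then have f: "f \<in> X \<rightarrow>\<^sub>E Y" by simp
  show "Comp Set_cat X X Y f (Ident Set_cat X) = f" "Comp Set_cat X Y Y (Ident Set_cat Y) f = f"
    using f by (auto simp: compose_def PiE_iff fun_eq_iff extensional_def)
  assume "g \<in> Hom Set_cat Y Z"
  then have g: "g \<in> Y \<rightarrow>\<^sub>E Z" by simp
  show "Comp Set_cat X Y Z g f \<in> Hom Set_cat X Z"
    using f g by (auto simp: compose_def)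
  assume "h \<in> Hom Set_cat Z W"
  show "Comp Set_cat X Y W (Comp Set_cat Y Z W h g) f = Comp Set_cat X Z W h (Comp Set_cat X Y Z g f)"
    using f by (auto simp: compose_def fun_eq_iff)
qed

lemma psh_small: "presheaf C P \<Longrightarrow> a \<in> Obj C \<Longrightarrow> omap P a \<prec> (UNIV :: 'u set)"
  for C :: "('o, 'u) cat"
  using functor_obj[of "op_cat C" Set_cat P a] by simp

lemma psh_hom: "presheaf C P \<Longrightarrow> arr C b a f \<Longrightarrow> amap P a b f \<in> omap P a \<rightarrow>\<^sub>E omap P b"
  using functor_arr[of "op_cat C" Set_cat P a b f] by (simp add: arr_def)

lemma psh_in: "presheaf C P \<Longrightarrow> arr C b a f \<Longrightarrow> p \<in> omap P a \<Longrightarrow> amap P a b f p \<in> omap P b"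
  by (rule PiE_mem[OF psh_hom])

lemma psh_id: "presheaf C P \<Longrightarrow> a \<in> Obj C \<Longrightarrow> p \<in> omap P a \<Longrightarrow> amap P a a (Ident C a) p = p"
  using functor_id[of "op_cat C" Set_cat P a] by simp

lemma psh_comp:
  "presheaf C P \<Longrightarrow> arr C b a f \<Longrightarrow> arr C c b g \<Longrightarrow> p \<in> omap P a \<Longrightarrow>
    amap P b c g (amap P a b f p) = amap P a c (Comp C c b a f g) p"
  using functor_comp[of "op_cat C" Set_cat P a b f c g] by (simp add: compose_def)

lemma psh_comp':
  "presheaf C P \<Longrightarrow> arr C b a f \<Longrightarrow> arr C c b g \<Longrightarrow> p \<in> omap P a \<Longrightarrow>
    amap P a c (Comp C c b a f g) p = amap P b c g (amap P a b f p)"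
  by (simp add: psh_comp)

lemma presheafI:
  fixes C :: "('o, 'u) cat"
  assumes "category C" "\<And>a. a \<in> Obj C \<Longrightarrow> omap P a \<prec> (UNIV :: 'u set)"
    "\<And>a b f. arr C b a f \<Longrightarrow> amap P a b f \<in> omap P a \<rightarrow>\<^sub>E omap P b"
    "\<And>a p. a \<in> Obj C \<Longrightarrow> p \<in> omap P a \<Longrightarrow> amap P a a (Ident C a) p = p"
    "\<And>a b c f g p. arr C b a f \<Longrightarrow> arr C c b g \<Longrightarrow> p \<in> omap P a \<Longrightarrow>
      amap P a c (Comp C c b a f g) p = amap P b c g (amap P a b f p)"
  shows "presheaf C P"
proof -
  interpret cat C by unfold_locales fact
  have ext: "amap P a b f \<in> extensional (omap P a)" if "arr C b a f" for a b f
    using assms(3)[OF that] by (simp add: PiE_def)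
  show ?thesis
  proof (rule functorI[OF category_op[OF assms(1)] category_Set])
    fix a b f assume f: "arr (op_cat C) a b f"
    then show "arr Set_cat (omap P a) (omap P b) (amap P a b f)"
      using assms(2,3) arrD(1)[OF f] arrD(2)[OF f] by (simp add: arr_def[of Set_cat])
  next
    fix a assume a: "a \<in> Obj (op_cat C)"
    then have "amap P a a (Ident C a) = (\<lambda>x\<in>omap P a. x)"
      using ext[OF arr_id, of a] assms(4) by (intro extensionalityI[of _ "omap P a"]) auto
    then show "amap P a a (Ident (op_cat C) a) = Ident Set_cat (omap P a)" by simp
  next
    fix a b c f g assume "arr (op_cat C) a b f" "arr (op_cat C) b c g"
    then have fg: "arr C b a f" "arr C c b g" by simp_all
    have "amap P a c (Comp C c b a f g) = compose (omap P a) (amap P b c g) (amap P a b f)"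
      using ext[OF arr_comp[OF fg(2,1)]] assms(5)[OF fg]
      by (intro extensionalityI[of _ "omap P a"]) (auto simp: compose_def)
    then show "amap P a c (Comp (op_cat C) a b c g f) =
       Comp Set_cat (omap P a) (omap P b) (omap P c) (amap P b c g) (amap P a b f)" by simp
  qed (use assms(2) in simp)
qed

lemma tr_hom: "psh_trans C P Q \<alpha> \<Longrightarrow> a \<in> Obj C \<Longrightarrow> \<alpha> a \<in> omap P a \<rightarrow>\<^sub>E omap Q a"
  by (simp add: nat_trans_def)

lemma tr_in: "psh_trans C P Q \<alpha> \<Longrightarrow> a \<in> Obj C \<Longrightarrow> p \<in> omap P a \<Longrightarrow> \<alpha> a p \<in> omap Q a"
  by (rule PiE_mem[OF tr_hom])

lemma tr_nat:
  assumes "psh_trans C P Q \<alpha>" "arr C b a f" "p \<in> omap P a"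
  shows "\<alpha> b (amap P a b f p) = amap Q a b f (\<alpha> a p)"
proof -
  have "compose (omap P a) (\<alpha> b) (amap P a b f) = compose (omap P a) (amap Q a b f) (\<alpha> a)"
    using assms(1,2) unfolding nat_trans_def arr_def by simp
  from fun_cong[OF this, of p] show ?thesis using assms(3) by (simp add: compose_def)
qed

lemma tr_eqI:
  assumes "psh_trans C P Q \<alpha>" "psh_trans C P Q \<beta>"
    "\<And>a p. a \<in> Obj C \<Longrightarrow> p \<in> omap P a \<Longrightarrow> \<alpha> a p = \<beta> a p"
  shows "\<alpha> = \<beta>"
proof (rule extensionalityI[of _ "Obj C"])
  show "\<alpha> \<in> extensional (Obj C)" "\<beta> \<in> extensional (Obj C)" using assms by (simp_all add: nat_trans_def)
  show "\<alpha> a = \<beta> a" if "a \<in> Obj C" for a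
    using tr_hom[OF assms(1) that] tr_hom[OF assms(2) that] assms(3)[OF that]
    by (intro extensionalityI[of _ "omap P a"]) (auto simp: PiE_def)
qed

lemma trI:
  assumes "presheaf C P" "\<alpha> \<in> extensional (Obj C)" "\<And>a. a \<in> Obj C \<Longrightarrow> \<alpha> a \<in> omap P a \<rightarrow>\<^sub>E omap Q a"
    "\<And>a b f p. arr C b a f \<Longrightarrow> p \<in> omap P a \<Longrightarrow> \<alpha> b (amap P a b f p) = amap Q a b f (\<alpha> a p)"
  shows "psh_trans C P Q \<alpha>"
  unfolding nat_trans_def
proof (intro conjI ballI)
  fix a b f assume "a \<in> Obj (op_cat C)" "b \<in> Obj (op_cat C)" "f \<in> Hom (op_cat C) a b"
  then have f: "arr C b a f" by (simp add: arr_def)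
  have "compose (omap P a) (\<alpha> b) (amap P a b f) = compose (omap P a) (amap Q a b f) (\<alpha> a)"
    using assms(4)[OF f] by (auto simp: compose_def)
  then show "Comp Set_cat (omap P a) (omap P b) (omap Q b) (\<alpha> b) (amap P a b f) =
          Comp Set_cat (omap P a) (omap Q a) (omap Q b) (amap Q a b f) (\<alpha> a)" by simp
qed (use assms in simp_all)

text \<open>Arrows of the presheaf category are extensional in both arguments. The two restrictions
  bring a family of functions into that form, so that equality of arrows can be checked on
  elements.\<close>

definition mk_tr :: "('o, 'u) cat \<Rightarrow> ('o, 'u) presheaf \<Rightarrow> ('o \<Rightarrow> 'u \<Rightarrow> 'u) \<Rightarrow> 'o \<Rightarrow> 'u \<Rightarrow> 'u" where
  "mk_tr C P t = (\<lambda>a\<in>Obj C. \<lambda>p\<in>omap P a. t a p)"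

lemma mk_tr [simp]: "a \<in> Obj C \<Longrightarrow> p \<in> omap P a \<Longrightarrow> mk_tr C P t a p = t a p"
  by (simp add: mk_tr_def)

lemma mk_trI:
  assumes P: "presheaf C P" and t: "\<And>a p. a \<in> Obj C \<Longrightarrow> p \<in> omap P a \<Longrightarrow> t a p \<in> omap Q a"
    and nat: "\<And>a b f p. arr C b a f \<Longrightarrow> p \<in> omap P a \<Longrightarrow> t b (amap P a b f p) = amap Q a b f (t a p)"
  shows "psh_trans C P Q (mk_tr C P t)"
proof (rule trI[OF P])
  fix a b f p assume f: "arr C b a f" and p: "p \<in> omap P a"
  show "mk_tr C P t b (amap P a b f p) = amap Q a b f (mk_tr C P t a p)"
    using nat[OF f p] psh_in[OF P f p] p arrD(1,2)[OF f] by simp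
qed (use t in \<open>auto simp: mk_tr_def\<close>)

section \<open>Presheaf categories and their full subcategories\<close>

lemma full_subcat_simps [simp]:
  "Obj (full_subcat D S) = Obj D \<inter> S" "Hom (full_subcat D S) = Hom D"
  "Ident (full_subcat D S) = Ident D" "Comp (full_subcat D S) = Comp D"
  by (simp_all add: full_subcat_def)

lemma full_subcat_full_subcat: "full_subcat (full_subcat D S) T = full_subcat D (S \<inter> T)"
  by (simp add: full_subcat_def Int_assoc)

lemma category_full_subcat: "category D \<Longrightarrow> category (full_subcat D S)"
  unfolding category_def by simp

lemma presheaf_cat_simps [simp]:
  "Obj (presheaf_cat C) = {P. presheaf C P}" "Hom (presheaf_cat C) P Q = {\<alpha>. psh_trans C P Q \<alpha>}"
  by (simp_all add: presheaf_cat_def fun_cat_def)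

lemma presheaf_cat_Ident: "Ident (presheaf_cat C) P = mk_tr C P (\<lambda>a p. p)"
  by (simp add: presheaf_cat_def fun_cat_def mk_tr_def)

lemma presheaf_cat_Comp: "Comp (presheaf_cat C) P Q R \<beta> \<alpha> = mk_tr C P (\<lambda>a p. \<beta> a (\<alpha> a p))"
  by (simp add: presheaf_cat_def fun_cat_def mk_tr_def compose_def)

lemma arr_psh: "arr (full_subcat (presheaf_cat C) T) P Q \<alpha> \<longleftrightarrow>
    presheaf C P \<and> P \<in> T \<and> presheaf C Q \<and> Q \<in> T \<and> psh_trans C P Q \<alpha>"
  by (auto simp: arr_def)

lemma tr_comp:
  assumes "presheaf C P" "psh_trans C P Q \<alpha>" "psh_trans C Q R \<beta>"
  shows "psh_trans C P R (Comp (presheaf_cat C) P Q' R' \<beta> \<alpha>)"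
  unfolding presheaf_cat_Comp
proof (rule mk_trI[OF assms(1)])
  fix a b f p assume f: "arr C b a f" and p: "p \<in> omap P a"
  show "\<beta> b (\<alpha> b (amap P a b f p)) = amap R a b f (\<beta> a (\<alpha> a p))"
    using tr_nat[OF assms(2) f p] tr_nat[OF assms(3) f tr_in[OF assms(2) arrD(2)[OF f] p]] by simp
qed (rule tr_in[OF assms(3) _ tr_in[OF assms(2)]])

lemma tr_ident: "presheaf C P \<Longrightarrow> psh_trans C P P (Ident (presheaf_cat C) P)"
  unfolding presheaf_cat_Ident by (rule mk_trI) auto

lemma category_presheaf: "category (presheaf_cat C)"
proof -
  have *: "mk_tr C P (\<lambda>a p. p) \<in> {\<alpha>. psh_trans C P P \<alpha>}" if "presheaf C P" for P
    using tr_ident[OF that] by (simp add: presheaf_cat_Ident)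
  have "Comp (presheaf_cat C) P P Q \<alpha> (Ident (presheaf_cat C) P) = \<alpha>"
    "Comp (presheaf_cat C) P Q Q (Ident (presheaf_cat C) Q) \<alpha> = \<alpha>"
    if P: "presheaf C P" "presheaf C Q" and \<alpha>: "psh_trans C P Q \<alpha>" for P Q \<alpha>
  proof -
    show "Comp (presheaf_cat C) P P Q \<alpha> (Ident (presheaf_cat C) P) = \<alpha>"
      by (rule tr_eqI[OF tr_comp[OF P(1) tr_ident[OF P(1)] \<alpha>] \<alpha>]) (simp add: presheaf_cat_Comp presheaf_cat_Ident)
    show "Comp (presheaf_cat C) P Q Q (Ident (presheaf_cat C) Q) \<alpha> = \<alpha>"
      by (rule tr_eqI[OF tr_comp[OF P(1) \<alpha> tr_ident[OF P(2)]] \<alpha>])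
        (use tr_in[OF \<alpha>] in \<open>simp add: presheaf_cat_Comp presheaf_cat_Ident\<close>)
  qed
  moreover have "Comp (presheaf_cat C) P Q S (Comp (presheaf_cat C) Q R S \<gamma> \<beta>) \<alpha> =
      Comp (presheaf_cat C) P R S \<gamma> (Comp (presheaf_cat C) P Q R \<beta> \<alpha>)"
    if P: "presheaf C P" "presheaf C Q" and \<alpha>: "psh_trans C P Q \<alpha>" "psh_trans C Q R \<beta>" "psh_trans C R S \<gamma>"
    for P Q R S \<alpha> \<beta> \<gamma>
    by (rule tr_eqI[OF tr_comp[OF P(1) \<alpha>(1) tr_comp[OF P(2) \<alpha>(2,3)]] tr_comp[OF P(1) tr_comp[OF P(1) \<alpha>(1,2)] \<alpha>(3)]])
      (use tr_in[OF \<alpha>(1)] in \<open>simp add: presheaf_cat_Comp\<close>)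
  ultimately show ?thesis
    unfolding category_def by (simp add: tr_ident tr_comp)
qed

lemma category_psh: "category (full_subcat (presheaf_cat C) T)"
  by (intro category_full_subcat category_presheaf)

section \<open>Quotients, pushouts and pullbacks of presheaves\<close>

text \<open>
  Elements of a presheaf have type 'u, so quotients and products of presheaves have to be encoded.
\<close>

lemma presheaf_quotient:
  fixes C :: "('o, 'u) cat" and Z :: "'o \<Rightarrow> 'z set"
  assumes C: "category C" and small: "\<And>a. a \<in> Obj C \<Longrightarrow> Z a \<prec> (UNIV :: 'u set)"
    and act: "\<And>a b f z. arr C b a f \<Longrightarrow> z \<in> Z a \<Longrightarrow> act a b f z \<in> Z b"
    and refl: "\<And>a z. a \<in> Obj C \<Longrightarrow> z \<in> Z a \<Longrightarrow> E a z z"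
    and sym: "\<And>a z z'. a \<in> Obj C \<Longrightarrow> z \<in> Z a \<Longrightarrow> z' \<in> Z a \<Longrightarrow> E a z z' \<Longrightarrow> E a z' z"
    and trans: "\<And>a z z' z''. a \<in> Obj C \<Longrightarrow> z \<in> Z a \<Longrightarrow> z' \<in> Z a \<Longrightarrow> z'' \<in> Z a \<Longrightarrow>
      E a z z' \<Longrightarrow> E a z' z'' \<Longrightarrow> E a z z''"
    and cong: "\<And>a b f z z'. arr C b a f \<Longrightarrow> z \<in> Z a \<Longrightarrow> z' \<in> Z a \<Longrightarrow> E a z z' \<Longrightarrow> E b (act a b f z) (act a b f z')"
    and act_id: "\<And>a z. a \<in> Obj C \<Longrightarrow> z \<in> Z a \<Longrightarrow> act a a (Ident C a) z = z"
    and act_comp: "\<And>a b c f g z. arr C b a f \<Longrightarrow> arr C c b g \<Longrightarrow> z \<in> Z a \<Longrightarrow>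
      act b c g (act a b f z) = act a c (Comp C c b a f g) z"
  obtains G :: "('o, 'u) presheaf" and q where "presheaf C G"
    "\<And>a. a \<in> Obj C \<Longrightarrow> omap G a = q a ` Z a"
    "\<And>a z z'. a \<in> Obj C \<Longrightarrow> z \<in> Z a \<Longrightarrow> z' \<in> Z a \<Longrightarrow> q a z = q a z' \<longleftrightarrow> E a z z'"
    "\<And>a b f z. arr C b a f \<Longrightarrow> z \<in> Z a \<Longrightarrow> amap G a b f (q a z) = q b (act a b f z)"
proof -
  interpret cat C by unfold_locales fact
  have "\<exists>e :: 'z \<Rightarrow> 'u. inj_on e (Z a)" if "a \<in> Obj C" for a
    using lesspoll_imp_lepoll[OF small[OF that]] unfolding lepoll_def by blast
  then obtain e :: "'o \<Rightarrow> 'z \<Rightarrow> 'u" where e: "\<And>a. a \<in> Obj C \<Longrightarrow> inj_on (e a) (Z a)" by metis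
  \<comment> \<open>The predicate under \<open>SOME\<close> depends only on the class of
    \<open>z\<close>, so equivalent elements receive the same representative; its image under the
    injection \<open>e\<close> is the code of the class.\<close>
  define r where "r a z = (SOME z'. z' \<in> Z a \<and> E a z z')" for a z
  have r: "r a z \<in> Z a \<and> E a z (r a z)" if "a \<in> Obj C" "z \<in> Z a" for a z
    unfolding r_def by (rule someI[of _ z]) (use that refl in blast)
  have r_eq: "r a z = r a z'" if "a \<in> Obj C" "z \<in> Z a" "z' \<in> Z a" "E a z z'" for a z z'
  proof -
    have "(\<lambda>w. w \<in> Z a \<and> E a z w) = (\<lambda>w. w \<in> Z a \<and> E a z' w)"
      using that sym trans by (intro ext) blast
    then show ?thesis by (simp add: r_def)
  qed
  define q where "q a z = e a (r a z)" for a z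
  have q: "q a z = q a z' \<longleftrightarrow> E a z z'" if "a \<in> Obj C" "z \<in> Z a" "z' \<in> Z a" for a z z'
  proof
    assume "q a z = q a z'"
    then have "r a z = r a z'" using inj_onD[OF e[OF that(1)]] r that unfolding q_def by blast
    then show "E a z z'" using r[OF that(1,2)] r[OF that(1,3)] sym trans that by metis
  qed (simp add: q_def r_eq[OF that])
  define G :: "('o, 'u) presheaf" where "G = \<lparr>omap = (\<lambda>a. q a ` Z a),
    amap = (\<lambda>a b f. \<lambda>x\<in>q a ` Z a. q b (act a b f (SOME z. z \<in> Z a \<and> q a z = x)))\<rparr>"
  have G_omap: "omap G a = q a ` Z a" for a by (simp add: G_def)
  have G_amap: "amap G a b f (q a z) = q b (act a b f z)" if f: "arr C b a f" and z: "z \<in> Z a" for a b f z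
  proof -
    note o = arrD(1,2)[OF f]
    define w where "w = (SOME w. w \<in> Z a \<and> q a w = q a z)"
    have w: "w \<in> Z a \<and> q a w = q a z" unfolding w_def by (rule someI[of _ z]) (use z in blast)
    have "amap G a b f (q a z) = q b (act a b f w)" using z by (simp add: G_def w_def)
    also have "\<dots> = q b (act a b f z)"
      using cong[OF f _ z, of w] w q[OF o(2) _ z, of w] q[OF o(1) act[OF f, of w] act[OF f z]] by simp
    finally show ?thesis .
  qed
  have "presheaf C G"
  proof (rule presheafI[OF C])
    show "omap G a \<prec> (UNIV :: 'u set)" if "a \<in> Obj C" for a
      unfolding G_omap by (rule small_image[OF small[OF that]])
    show "amap G a b f \<in> omap G a \<rightarrow>\<^sub>E omap G b" if f: "arr C b a f" for a b f
    proof (rule PiE_I)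
      show "amap G a b f x \<in> omap G b" if "x \<in> omap G a" for x
        using that G_amap[OF f] act[OF f] by (auto simp: G_omap)
      show "amap G a b f x = undefined" if "x \<notin> omap G a" for x
        using that by (simp add: G_def)
    qed
    show "amap G a a (Ident C a) p = p" if "a \<in> Obj C" "p \<in> omap G a" for a p
      using that G_amap[OF arr_id] act_id by (auto simp: G_omap)
    show "amap G a c (Comp C c b a f g) p = amap G b c g (amap G a b f p)"
      if f: "arr C b a f" and g: "arr C c b g" and p: "p \<in> omap G a" for a b c f g p
    proof -
      obtain z where z: "z \<in> Z a" "p = q a z" using p by (auto simp: G_omap)
      show ?thesis
        using G_amap[OF arr_comp[OF g f] z(1)] G_amap[OF f z(1)] G_amap[OF g act[OF f z(1)]] act_comp[OF f g z(1)]
        by (simp add: z(2))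
    qed
  qed
  then show ?thesis using G_omap q G_amap by (rule that)
qed

text \<open>Pushouts of sets described by elements. The last three clauses describe equality in the
  pushout when \<open>\<alpha>\<close> is pointwise injective: elements are identified through a
  single pair from \<open>R\<close> with equal image under \<open>\<beta>\<close>, and the leg
  opposite to \<open>\<alpha>\<close> is injective.\<close>

definition pw_pushout where
  "pw_pushout C R P Q T \<alpha> \<beta> i j \<longleftrightarrow>
     presheaf C R \<and> presheaf C P \<and> presheaf C Q \<and> presheaf C T \<and>
     psh_trans C R P \<alpha> \<and> psh_trans C R Q \<beta> \<and> psh_trans C P T i \<and> psh_trans C Q T j \<and>
     (\<forall>a\<in>Obj C. (\<forall>r\<in>omap R a. i a (\<alpha> a r) = j a (\<beta> a r)) \<and>
       (\<forall>t\<in>omap T a. (\<exists>p\<in>omap P a. t = i a p) \<or> (\<exists>q\<in>omap Q a. t = j a q)) \<and>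
       (\<forall>q\<in>omap Q a. \<forall>q'\<in>omap Q a. j a q = j a q' \<longrightarrow> q = q') \<and>
       (\<forall>p\<in>omap P a. \<forall>q\<in>omap Q a. i a p = j a q \<longrightarrow> (\<exists>r\<in>omap R a. \<alpha> a r = p \<and> \<beta> a r = q)) \<and>
       (\<forall>p\<in>omap P a. \<forall>p'\<in>omap P a. i a p = i a p' \<longrightarrow> p = p' \<or>
          (\<exists>r\<in>omap R a. \<exists>r'\<in>omap R a. \<alpha> a r = p \<and> \<alpha> a r' = p' \<and> \<beta> a r = \<beta> a r')))"

lemma pw_pushoutD:
  assumes "pw_pushout C R P Q T \<alpha> \<beta> i j"
  shows "presheaf C R" "presheaf C P" "presheaf C Q" "presheaf C T"
    "psh_trans C R P \<alpha>" "psh_trans C R Q \<beta>" "psh_trans C P T i" "psh_trans C Q T j"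
    "\<And>a r. a \<in> Obj C \<Longrightarrow> r \<in> omap R a \<Longrightarrow> i a (\<alpha> a r) = j a (\<beta> a r)"
  using assms unfolding pw_pushout_def by simp_all

lemma pw_pushout_cases:
  assumes "pw_pushout C R P Q T \<alpha> \<beta> i j" "a \<in> Obj C" "t \<in> omap T a"
  obtains p where "p \<in> omap P a" "t = i a p" | q where "q \<in> omap Q a" "t = j a q"
  using assms unfolding pw_pushout_def by blast

lemma pw_pushout_jj:
  assumes "pw_pushout C R P Q T \<alpha> \<beta> i j" "a \<in> Obj C" "q \<in> omap Q a" "q' \<in> omap Q a" "j a q = j a q'"
  shows "q = q'"
  using assms unfolding pw_pushout_def by blast

lemma pw_pushout_ij:
  assumes "pw_pushout C R P Q T \<alpha> \<beta> i j" "a \<in> Obj C" "p \<in> omap P a" "q \<in> omap Q a" "i a p = j a q"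
  obtains r where "r \<in> omap R a" "\<alpha> a r = p" "\<beta> a r = q"
  using assms unfolding pw_pushout_def by blast

lemma pw_pushout_ii:
  assumes "pw_pushout C R P Q T \<alpha> \<beta> i j" "a \<in> Obj C" "p \<in> omap P a" "p' \<in> omap P a" "i a p = i a p'"
  obtains "p = p'" | r r' where "r \<in> omap R a" "r' \<in> omap R a" "\<alpha> a r = p" "\<alpha> a r' = p'" "\<beta> a r = \<beta> a r'"
  using assms unfolding pw_pushout_def by blast

text \<open>\<open>E\<close> relates elements joined by one zigzag and is already transitive: where
  two zigzags meet, injectivity of \<open>\<alpha>\<close> shows that the inner elements of
  \<open>R\<close> have the same image under \<open>\<beta>\<close>, so the outer ones are joined
  directly.\<close>

lemma pw_pushout_ex:
  fixes C :: "('o, 'u) cat"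
  assumes U: "set_universe TYPE('u)" and C: "category C"
    and R: "presheaf C R" and P: "presheaf C P" and Q: "presheaf C Q"
    and \<alpha>: "psh_trans C R P \<alpha>" and \<beta>: "psh_trans C R Q \<beta>"
    and inj: "\<And>a. a \<in> Obj C \<Longrightarrow> inj_on (\<alpha> a) (omap R a)"
  obtains T i j where "pw_pushout C R P Q T \<alpha> \<beta> i j"
proof -
  define Z where "Z a = omap P a <+> omap Q a" for a
  define act :: "'o \<Rightarrow> 'o \<Rightarrow> 'u \<Rightarrow> 'u + 'u \<Rightarrow> 'u + 'u" where
    "act a b f = map_sum (amap P a b f) (amap Q a b f)" for a b f
  define E where "E a z z' \<longleftrightarrow> z = z' \<or>
    (\<exists>r\<in>omap R a. \<exists>r'\<in>omap R a. \<beta> a r = \<beta> a r' \<and> z \<in> {Inl (\<alpha> a r), Inr (\<beta> a r)} \<and> z' \<in> {Inl (\<alpha> a r'), Inr (\<beta> a r')})"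
    for a and z z' :: "'u + 'u"
  obtain T :: "('o, 'u) presheaf" and q where T: "presheaf C T" and Tq: "\<And>a. a \<in> Obj C \<Longrightarrow> omap T a = q a ` Z a"
    and qE: "\<And>a z z'. a \<in> Obj C \<Longrightarrow> z \<in> Z a \<Longrightarrow> z' \<in> Z a \<Longrightarrow> q a z = q a z' \<longleftrightarrow> E a z z'"
    and qn: "\<And>a b f z. arr C b a f \<Longrightarrow> z \<in> Z a \<Longrightarrow> amap T a b f (q a z) = q b (act a b f z)"
  proof (rule presheaf_quotient[OF C, of Z act E])
    show "Z a \<prec> (UNIV :: 'u set)" if "a \<in> Obj C" for a
      unfolding Z_def by (rule small_Plus[OF U psh_small[OF P that] psh_small[OF Q that]])
    show "act a b f z \<in> Z b" if "arr C b a f" "z \<in> Z a" for a b f z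
      using that psh_in[OF P] psh_in[OF Q] by (auto simp: Z_def act_def)
    show "E a z z" for a z by (simp add: E_def)
    show "E a z' z" if "E a z z'" for a z z' using that unfolding E_def by metis
    show "E a z z''" if a: "a \<in> Obj C" and 1: "E a z z'" and 2: "E a z' z''" for a z z' z''
    proof -
      consider "z = z'" | "z' = z''"
        | r r' s s' where "r \<in> omap R a" "r' \<in> omap R a" "s \<in> omap R a" "s' \<in> omap R a" "\<beta> a r = \<beta> a r'" "\<beta> a s = \<beta> a s'"
          "z \<in> {Inl (\<alpha> a r), Inr (\<beta> a r)}" "z' \<in> {Inl (\<alpha> a r'), Inr (\<beta> a r')}"
          "z' \<in> {Inl (\<alpha> a s), Inr (\<beta> a s)}" "z'' \<in> {Inl (\<alpha> a s'), Inr (\<beta> a s')}"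
        using 1 2 unfolding E_def by blast
      then show ?thesis
      proof cases
        case (3 r r' s s')
        have "\<beta> a r' = \<beta> a s" using 3(8,9) inj[OF a] 3(2,3) by (auto dest: inj_onD)
        then have "\<beta> a r = \<beta> a s'" using 3(5,6) by simp
        then show ?thesis using 3 unfolding E_def by blast
      qed (use 1 2 in auto)
    qed
    show "E b (act a b f z) (act a b f z')" if f: "arr C b a f" and E: "E a z z'" for a b f z z'
      using E unfolding E_def
    proof (elim disjE bexE conjE)
      fix r r' assume r: "r \<in> omap R a" "r' \<in> omap R a" "\<beta> a r = \<beta> a r'"
        and z: "z \<in> {Inl (\<alpha> a r), Inr (\<beta> a r)}" "z' \<in> {Inl (\<alpha> a r'), Inr (\<beta> a r')}"
      show "act a b f z = act a b f z' \<or> (\<exists>r\<in>omap R b. \<exists>r'\<in>omap R b. \<beta> b r = \<beta> b r' \<and>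
         act a b f z \<in> {Inl (\<alpha> b r), Inr (\<beta> b r)} \<and> act a b f z' \<in> {Inl (\<alpha> b r'), Inr (\<beta> b r')})"
        by (rule disjI2, rule bexI[of _ "amap R a b f r"], rule bexI[of _ "amap R a b f r'"])
          (use r z tr_nat[OF \<alpha> f] tr_nat[OF \<beta> f] psh_in[OF R f] in \<open>auto simp: act_def\<close>)
    qed simp
    show "act a a (Ident C a) z = z" if "a \<in> Obj C" "z \<in> Z a" for a z
      using that psh_id[OF P] psh_id[OF Q] by (auto simp: Z_def act_def)
    show "act b c g (act a b f z) = act a c (Comp C c b a f g) z"
      if "arr C b a f" "arr C c b g" "z \<in> Z a" for a b c f g z
      using that psh_comp[OF P] psh_comp[OF Q] by (auto simp: Z_def act_def)
  qed blast
  have Z_iff [simp]: "Inl p \<in> Z a \<longleftrightarrow> p \<in> omap P a" "Inr p' \<in> Z a \<longleftrightarrow> p' \<in> omap Q a" for p p' a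
    by (auto simp: Z_def)
  define i where "i = mk_tr C P (\<lambda>a p. q a (Inl p))"
  define j where "j = mk_tr C Q (\<lambda>a p. q a (Inr p))"
  have i: "psh_trans C P T i"
    unfolding i_def by (rule mk_trI[OF P]) (simp_all add: Tq qn act_def)
  have j: "psh_trans C Q T j"
    unfolding j_def by (rule mk_trI[OF Q]) (simp_all add: Tq qn act_def)
  have "pw_pushout C R P Q T \<alpha> \<beta> i j"
    unfolding pw_pushout_def
  proof (intro conjI R P Q T \<alpha> \<beta> i j ballI impI)
    fix a assume a: "a \<in> Obj C"
    have [simp]: "i a p = q a (Inl p)" if "p \<in> omap P a" for p using a that by (simp add: i_def)
    have [simp]: "j a p = q a (Inr p)" if "p \<in> omap Q a" for p using a that by (simp add: j_def)
    note [simp] = tr_in[OF \<alpha> a] tr_in[OF \<beta> a] qE[OF a]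
    show "i a (\<alpha> a r) = j a (\<beta> a r)" if "r \<in> omap R a" for r
      using that by (simp add: E_def) blast
    show "(\<exists>p\<in>omap P a. t = i a p) \<or> (\<exists>q\<in>omap Q a. t = j a q)" if "t \<in> omap T a" for t
      using that by (auto simp: Tq[OF a] Z_def)
    show "p = p'" if "p \<in> omap Q a" "p' \<in> omap Q a" "j a p = j a p'" for p p'
      using that by (auto simp: E_def)
    show "\<exists>r\<in>omap R a. \<alpha> a r = p \<and> \<beta> a r = p'" if "p \<in> omap P a" "p' \<in> omap Q a" "i a p = j a p'" for p p'
      using that by (auto simp: E_def)
    show "p = p' \<or> (\<exists>r\<in>omap R a. \<exists>r'\<in>omap R a. \<alpha> a r = p \<and> \<alpha> a r' = p' \<and> \<beta> a r = \<beta> a r')"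
      if "p \<in> omap P a" "p' \<in> omap P a" "i a p = i a p'" for p p'
      using that by (auto simp: E_def)
  qed
  then show ?thesis by (rule that)
qed

text \<open>The cocone is given by functions with naturality on elements rather than by arrows, so
  that families defined by composition in \<open>C\<close> can be used without being packaged as
  transformations.\<close>

lemma pw_pushout_desc:
  assumes po: "pw_pushout C R P Q T \<alpha> \<beta> i j" and F: "presheaf C F"
    and u: "\<And>a p. a \<in> Obj C \<Longrightarrow> p \<in> omap P a \<Longrightarrow> u a p \<in> omap F a"
      "\<And>a b f p. arr C b a f \<Longrightarrow> p \<in> omap P a \<Longrightarrow> u b (amap P a b f p) = amap F a b f (u a p)"
    and v: "\<And>a p. a \<in> Obj C \<Longrightarrow> p \<in> omap Q a \<Longrightarrow> v a p \<in> omap F a"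
      "\<And>a b f p. arr C b a f \<Longrightarrow> p \<in> omap Q a \<Longrightarrow> v b (amap Q a b f p) = amap F a b f (v a p)"
    and uv: "\<And>a r. a \<in> Obj C \<Longrightarrow> r \<in> omap R a \<Longrightarrow> u a (\<alpha> a r) = v a (\<beta> a r)"
  obtains h where "psh_trans C T F h" "\<And>a p. a \<in> Obj C \<Longrightarrow> p \<in> omap P a \<Longrightarrow> h a (i a p) = u a p"
    "\<And>a p. a \<in> Obj C \<Longrightarrow> p \<in> omap Q a \<Longrightarrow> h a (j a p) = v a p"
proof -
  note D = pw_pushoutD[OF po]
  define val where "val a t y \<longleftrightarrow> (\<exists>p\<in>omap P a. t = i a p \<and> y = u a p) \<or> (\<exists>q\<in>omap Q a. t = j a q \<and> y = v a q)" for a t y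
  have uniq: "y = y'" if a: "a \<in> Obj C" and y: "val a t y" "val a t y'" for a t y y'
  proof -
    have ij: "u a p = v a q" if "p \<in> omap P a" "q \<in> omap Q a" "i a p = j a q" for p q
      using pw_pushout_ij[OF po a that] uv[OF a] by metis
    have ii: "u a p = u a p'" if "p \<in> omap P a" "p' \<in> omap P a" "i a p = i a p'" for p p'
      by (rule pw_pushout_ii[OF po a that]) (use uv[OF a] in metis)+
    have jj: "v a p = v a p'" if "p \<in> omap Q a" "p' \<in> omap Q a" "j a p = j a p'" for p p'
      using pw_pushout_jj[OF po a that] by simp
    show ?thesis using y unfolding val_def
    proof (elim disjE bexE conjE)
      fix p p' assume "p \<in> omap P a" "p' \<in> omap P a" "t = i a p" "t = i a p'" "y = u a p" "y' = u a p'"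
      then show ?thesis using ii[of p p'] by simp
    next
      fix p q assume "p \<in> omap P a" "q \<in> omap Q a" "t = i a p" "t = j a q" "y = u a p" "y' = v a q"
      then show ?thesis using ij[of p q] by simp
    next
      fix p q assume "q \<in> omap P a" "p \<in> omap Q a" "t = j a p" "t = i a q" "y = v a p" "y' = u a q"
      then show ?thesis using ij[of q p] by simp
    next
      fix p p' assume "p \<in> omap Q a" "p' \<in> omap Q a" "t = j a p" "t = j a p'" "y = v a p" "y' = v a p'"
      then show ?thesis using jj[of p p'] by simp
    qed
  qed
  define h where "h = mk_tr C T (\<lambda>a t. THE y. val a t y)"
  have h: "h a t = y" if "a \<in> Obj C" "t \<in> omap T a" "val a t y" for a t y
    using that uniq[OF that(1)] by (simp add: h_def) (blast intro: the_equality)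
  have hi: "h a (i a p) = u a p" if "a \<in> Obj C" "p \<in> omap P a" for a p
    by (rule h[OF that(1) tr_in[OF D(7) that]]) (use that in \<open>auto simp: val_def\<close>)
  have hj: "h a (j a p) = v a p" if "a \<in> Obj C" "p \<in> omap Q a" for a p
    by (rule h[OF that(1) tr_in[OF D(8) that]]) (use that in \<open>auto simp: val_def\<close>)
  have "psh_trans C T F (mk_tr C T h)"
  proof (rule mk_trI[OF D(4)])
    fix a t assume a: "a \<in> Obj C" and t: "t \<in> omap T a"
    show "h a t \<in> omap F a"
      by (rule pw_pushout_cases[OF po a t]) (use hi[OF a] hj[OF a] u(1)[OF a] v(1)[OF a] in auto)
  next
    fix a b f t assume f: "arr C b a f" and t: "t \<in> omap T a"
    note o = arrD(1,2)[OF f]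
    show "h b (amap T a b f t) = amap F a b f (h a t)"
    proof (rule pw_pushout_cases[OF po o(2) t])
      fix p assume "p \<in> omap P a" "t = i a p"
      then show ?thesis
        using tr_nat[OF D(7) f, of p, symmetric] hi[OF o(1) psh_in[OF D(2) f]] hi[OF o(2)] u(2)[OF f] by simp
    next
      fix p assume "p \<in> omap Q a" "t = j a p"
      then show ?thesis
        using tr_nat[OF D(8) f, of p, symmetric] hj[OF o(1) psh_in[OF D(3) f]] hj[OF o(2)] v(2)[OF f] by simp
    qed
  qed
  moreover have "mk_tr C T h = h" by (auto simp: h_def mk_tr_def fun_eq_iff)
  ultimately show ?thesis using hi hj that by simp
qed

lemma pw_pushout_ext:
  assumes po: "pw_pushout C R P Q T \<alpha> \<beta> i j" and h: "psh_trans C T F h" "psh_trans C T F h'"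
    and "\<And>a p. a \<in> Obj C \<Longrightarrow> p \<in> omap P a \<Longrightarrow> h a (i a p) = h' a (i a p)"
    "\<And>a p. a \<in> Obj C \<Longrightarrow> p \<in> omap Q a \<Longrightarrow> h a (j a p) = h' a (j a p)"
  shows "h = h'"
proof (rule tr_eqI[OF h])
  fix a t assume a: "a \<in> Obj C" "t \<in> omap T a"
  show "h a t = h' a t" by (rule pw_pushout_cases[OF po a]) (use a assms(4,5) in auto)
qed

lemma presheaf_comp_eqI:
  assumes "\<And>a p. a \<in> Obj C \<Longrightarrow> p \<in> omap P a \<Longrightarrow> \<beta> a (\<alpha> a p) = \<delta> a (\<gamma> a p)"
  shows "Comp (presheaf_cat C) P Q R \<beta> \<alpha> = Comp (presheaf_cat C) P Q' R \<delta> \<gamma>"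
  unfolding presheaf_cat_Comp mk_tr_def using assms by (auto intro!: restrict_ext)

lemma presheaf_comp_eqD:
  assumes "Comp (presheaf_cat C) P Q R \<beta> \<alpha> = Comp (presheaf_cat C) P Q' R' \<delta> \<gamma>" "a \<in> Obj C" "p \<in> omap P a"
  shows "\<beta> a (\<alpha> a p) = \<delta> a (\<gamma> a p)"
  using fun_cong[OF fun_cong[OF assms(1), of a], of p] assms(2,3) by (simp add: presheaf_cat_Comp)

lemma presheaf_comp_eq_trI:
  assumes "psh_trans C P R \<gamma>" "psh_trans C P Q \<alpha>" "psh_trans C Q R \<beta>" "presheaf C P"
    "\<And>a p. a \<in> Obj C \<Longrightarrow> p \<in> omap P a \<Longrightarrow> \<beta> a (\<alpha> a p) = \<gamma> a p"
  shows "Comp (presheaf_cat C) P Q R \<beta> \<alpha> = \<gamma>"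
  by (rule tr_eqI[OF tr_comp[OF assms(4,2,3)] assms(1)]) (simp add: presheaf_cat_Comp assms(5))

lemma presheaf_comp_eq_trD:
  assumes "Comp (presheaf_cat C) P Q R \<beta> \<alpha> = \<gamma>" "a \<in> Obj C" "p \<in> omap P a"
  shows "\<beta> a (\<alpha> a p) = \<gamma> a p"
  using fun_cong[OF fun_cong[OF assms(1), of a], of p] assms(2,3) by (simp add: presheaf_cat_Comp)

text \<open>The description by elements mentions no ambient category, so it yields a pushout in
  every full subcategory that contains the four presheaves.\<close>

lemma pw_pushout_is_pushout:
  assumes po: "pw_pushout C R P Q T \<alpha> \<beta> i j" and S: "R \<in> S" "P \<in> S" "Q \<in> S" "T \<in> S"
  shows "is_pushout (full_subcat (presheaf_cat C) S) R P Q T \<alpha> \<beta> i j"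
proof -
  interpret E: cat "full_subcat (presheaf_cat C) S" by unfold_locales (rule category_psh)
  note D = pw_pushoutD[OF po]
  show ?thesis
  proof (rule E.poI)
    show "Comp (full_subcat (presheaf_cat C) S) R P T i \<alpha> = Comp (full_subcat (presheaf_cat C) S) R Q T j \<beta>"
      using D(9) by (simp add: presheaf_comp_eqI)
    fix F u v assume "arr (full_subcat (presheaf_cat C) S) P F u" "arr (full_subcat (presheaf_cat C) S) Q F v"
      and e: "Comp (full_subcat (presheaf_cat C) S) R P F u \<alpha> = Comp (full_subcat (presheaf_cat C) S) R Q F v \<beta>"
    then have F: "presheaf C F" "F \<in> S" and u: "psh_trans C P F u" and v: "psh_trans C Q F v"
      by (simp_all add: arr_psh)
    have e': "u a (\<alpha> a r) = v a (\<beta> a r)" if "a \<in> Obj C" "r \<in> omap R a" for a r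
      by (rule presheaf_comp_eqD[OF _ that]) (use e in simp)
    obtain h where h: "psh_trans C T F h" "\<And>a p. a \<in> Obj C \<Longrightarrow> p \<in> omap P a \<Longrightarrow> h a (i a p) = u a p"
      "\<And>a p. a \<in> Obj C \<Longrightarrow> p \<in> omap Q a \<Longrightarrow> h a (j a p) = v a p"
      using pw_pushout_desc[OF po F(1) tr_in[OF u] tr_nat[OF u] tr_in[OF v] tr_nat[OF v] e'] by blast
    show "\<exists>h. arr (full_subcat (presheaf_cat C) S) T F h \<and> Comp (full_subcat (presheaf_cat C) S) P T F h i = u \<and>
       Comp (full_subcat (presheaf_cat C) S) Q T F h j = v"
      using h F S D u v by (intro exI[of _ h]) (simp add: arr_psh presheaf_comp_eq_trI)
  next
    fix F h h' assume "arr (full_subcat (presheaf_cat C) S) T F h" "arr (full_subcat (presheaf_cat C) S) T F h'"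
      and e: "Comp (full_subcat (presheaf_cat C) S) P T F h i = Comp (full_subcat (presheaf_cat C) S) P T F h' i"
        "Comp (full_subcat (presheaf_cat C) S) Q T F h j = Comp (full_subcat (presheaf_cat C) S) Q T F h' j"
    then show "h = h'"
      using presheaf_comp_eqD[of C P T F h i T F h' i] presheaf_comp_eqD[of C Q T F h j T F h' j]
      by (intro pw_pushout_ext[OF po]) (auto simp: arr_psh)
  qed (use D S in \<open>simp_all add: arr_psh\<close>)
qed

lemma full_subcat_UNIV [simp]: "full_subcat D UNIV = D"
  by (simp add: full_subcat_def)

text \<open>The weight is specified by a universal property only. Comparing such a pushout with the
  one built by elements transfers the description along the comparison maps \<open>h\<close> and
  \<open>k\<close>.\<close>

lemma is_pushout_pw:
  fixes C :: "('o, 'u) cat"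
  assumes U: "set_universe TYPE('u)" and C: "category C"
    and po: "is_pushout (presheaf_cat C) R P Q T \<alpha> \<beta> i j"
    and inj: "\<And>a. a \<in> Obj C \<Longrightarrow> inj_on (\<alpha> a) (omap R a)"
  shows "pw_pushout C R P Q T \<alpha> \<beta> i j"
proof -
  interpret E: cat "presheaf_cat C" by unfold_locales (rule category_presheaf)
  have D: "presheaf C R" "presheaf C P" "presheaf C Q" "presheaf C T"
    "psh_trans C R P \<alpha>" "psh_trans C R Q \<beta>" "psh_trans C P T i" "psh_trans C Q T j"
    using po_arr[OF po] by (simp_all add: arr_def)
  have e: "i a (\<alpha> a r) = j a (\<beta> a r)" if "a \<in> Obj C" "r \<in> omap R a" for a r
    by (rule presheaf_comp_eqD[OF po_arr(5)[OF po] that])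
  obtain T0 i0 j0 where po0: "pw_pushout C R P Q T0 \<alpha> \<beta> i0 j0"
    by (rule pw_pushout_ex[OF U C D(1-3) D(5,6) inj]) auto
  note D0 = pw_pushoutD[OF po0]
  have po0': "is_pushout (presheaf_cat C) R P Q T0 \<alpha> \<beta> i0 j0"
    using pw_pushout_is_pushout[OF po0, of UNIV] by simp
  obtain h where h: "arr (presheaf_cat C) T T0 h" "Comp (presheaf_cat C) P T T0 h i = i0" "Comp (presheaf_cat C) Q T T0 h j = j0"
    using po_ex[OF po po_arr(3,4)[OF po0'] po_arr(5)[OF po0']] by blast
  obtain k where k: "arr (presheaf_cat C) T0 T k" "Comp (presheaf_cat C) P T0 T k i0 = i" "Comp (presheaf_cat C) Q T0 T k j0 = j"
    using po_ex[OF po0' po_arr(3,4)[OF po] po_arr(5)[OF po]] by blast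
  note [simp] = h(1) k(1) po_arr(3,4)[OF po] po_obj(4)[OF po]
  have "Comp (presheaf_cat C) T T0 T k h = Ident (presheaf_cat C) T"
    by (rule E.po_uniq[OF po, of T]) (simp_all add: E.assoc h k E.arr_id[OF po_obj(4)[OF po]] del: presheaf_cat_simps)
  note id = this
  have kh: "k a (h a t) = t" if "a \<in> Obj C" "t \<in> omap T a" for a t
    using presheaf_comp_eq_trD[OF id that] that by (simp add: presheaf_cat_Ident)
  have h_tr: "psh_trans C T T0 h" using h(1) by (simp add: arr_def)
  have hi: "h a (i a p) = i0 a p" "k a (i0 a p) = i a p" if "a \<in> Obj C" "p \<in> omap P a" for a p
    using presheaf_comp_eq_trD[OF h(2) that] presheaf_comp_eq_trD[OF k(2) that] by simp_all
  have hj: "h a (j a p) = j0 a p" "k a (j0 a p) = j a p" if "a \<in> Obj C" "p \<in> omap Q a" for a p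
    using presheaf_comp_eq_trD[OF h(3) that] presheaf_comp_eq_trD[OF k(3) that] by simp_all
  show ?thesis
    unfolding pw_pushout_def
  proof (intro conjI D ballI impI e)
    fix a assume a: "a \<in> Obj C"
    show "(\<exists>p\<in>omap P a. t = i a p) \<or> (\<exists>q\<in>omap Q a. t = j a q)" if t: "t \<in> omap T a" for t
      using pw_pushout_cases[OF po0 a tr_in[OF h_tr a t]] kh[OF a t] hi(2)[OF a] hj(2)[OF a] by metis
    show "q = q'" if "q \<in> omap Q a" "q' \<in> omap Q a" "j a q = j a q'" for q q'
      using pw_pushout_jj[OF po0 a that(1,2)] hj(1)[OF a] that by metis
    show "\<exists>r\<in>omap R a. \<alpha> a r = p \<and> \<beta> a r = q" if "p \<in> omap P a" "q \<in> omap Q a" "i a p = j a q" for p q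
      using pw_pushout_ij[OF po0 a that(1,2)] hi(1)[OF a] hj(1)[OF a] that by metis
    show "p = p' \<or> (\<exists>r\<in>omap R a. \<exists>r'\<in>omap R a. \<alpha> a r = p \<and> \<alpha> a r' = p' \<and> \<beta> a r = \<beta> a r')"
      if "p \<in> omap P a" "p' \<in> omap P a" "i a p = i a p'" for p p'
      using pw_pushout_ii[OF po0 a that(1,2)] hi(1)[OF a] that by metis
  qed
qed

definition pw_pullback where
  "pw_pullback C T P Q R p q u v \<longleftrightarrow>
     presheaf C T \<and> presheaf C P \<and> presheaf C Q \<and> presheaf C R \<and>
     psh_trans C T P p \<and> psh_trans C T Q q \<and> psh_trans C P R u \<and> psh_trans C Q R v \<and>
     (\<forall>a\<in>Obj C. (\<forall>t\<in>omap T a. u a (p a t) = v a (q a t)) \<and>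
       (\<forall>x\<in>omap P a. \<forall>y\<in>omap Q a. u a x = v a y \<longrightarrow> (\<exists>t\<in>omap T a. p a t = x \<and> q a t = y)) \<and>
       (\<forall>t\<in>omap T a. \<forall>t'\<in>omap T a. p a t = p a t' \<longrightarrow> q a t = q a t' \<longrightarrow> t = t'))"

text \<open>Compatible pairs do not have type \<open>'u\<close>; passing to the quotient by equality
  merely encodes them.\<close>

lemma pw_pullback_ex:
  fixes C :: "('o, 'u) cat"
  assumes U: "set_universe TYPE('u)" and C: "category C"
    and P: "presheaf C P" and Q: "presheaf C Q" and R: "presheaf C R"
    and u: "psh_trans C P R u" and v: "psh_trans C Q R v"
  obtains T p q where "pw_pullback C T P Q R p q u v"
proof -
  define Z where "Z a = {z \<in> omap P a \<times> omap Q a. u a (fst z) = v a (snd z)}" for a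
  define act :: "'o \<Rightarrow> 'o \<Rightarrow> 'u \<Rightarrow> 'u \<times> 'u \<Rightarrow> 'u \<times> 'u" where
    "act a b f = map_prod (amap P a b f) (amap Q a b f)" for a b f
  obtain T :: "('o, 'u) presheaf" and e where T: "presheaf C T" and Te: "\<And>a. a \<in> Obj C \<Longrightarrow> omap T a = e a ` Z a"
    and ee: "\<And>a z z'. a \<in> Obj C \<Longrightarrow> z \<in> Z a \<Longrightarrow> z' \<in> Z a \<Longrightarrow> e a z = e a z' \<longleftrightarrow> z = z'"
    and en: "\<And>a b f z. arr C b a f \<Longrightarrow> z \<in> Z a \<Longrightarrow> amap T a b f (e a z) = e b (act a b f z)"
  proof (rule presheaf_quotient[OF C, of Z act "\<lambda>a. (=)"])
    show "Z a \<prec> (UNIV :: 'u set)" if "a \<in> Obj C" for a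
      by (rule small_subset[OF _ small_Sigma[OF U psh_small[OF P that] psh_small[OF Q that]]]) (auto simp: Z_def)
    show "act a b f z \<in> Z b" if f: "arr C b a f" and z: "z \<in> Z a" for a b f z
      using z psh_in[OF P f] psh_in[OF Q f] tr_nat[OF u f] tr_nat[OF v f] by (auto simp: Z_def act_def)
    show "act a a (Ident C a) z = z" if "a \<in> Obj C" "z \<in> Z a" for a z
      using that psh_id[OF P] psh_id[OF Q] by (auto simp: Z_def act_def)
    show "act b c g (act a b f z) = act a c (Comp C c b a f g) z"
      if "arr C b a f" "arr C c b g" "z \<in> Z a" for a b c f g z
      using that psh_comp[OF P] psh_comp[OF Q] by (auto simp: Z_def act_def)
  qed (simp, blast+)
  define d where "d a t = (THE z. z \<in> Z a \<and> e a z = t)" for a t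
  have d: "d a (e a z) = z" if "a \<in> Obj C" "z \<in> Z a" for a z
    unfolding d_def by (rule the_equality) (use that ee[OF that(1)] in blast)+
  have dT: "d a t \<in> Z a \<and> e a (d a t) = t" if "a \<in> Obj C" "t \<in> omap T a" for a t
    using that d by (auto simp: Te)
  have dZ: "fst (d a t) \<in> omap P a" "snd (d a t) \<in> omap Q a" if "a \<in> Obj C" "t \<in> omap T a" for a t
    using dT[OF that] by (auto simp: Z_def)
  have dn: "d b (amap T a b f t) = act a b f (d a t)" if f: "arr C b a f" and t: "t \<in> omap T a" for a b f t
  proof -
    have "act a b f (d a t) \<in> Z b"
      using dT[OF arrD(2)[OF f] t] psh_in[OF P f] psh_in[OF Q f] tr_nat[OF u f] tr_nat[OF v f] by (auto simp: Z_def act_def)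
    then show ?thesis using en[OF f] dT[OF arrD(2)[OF f] t] d[OF arrD(1)[OF f]] by metis
  qed
  define p where "p = mk_tr C T (\<lambda>a t. fst (d a t))"
  define q where "q = mk_tr C T (\<lambda>a t. snd (d a t))"
  have p: "psh_trans C T P p" unfolding p_def
    by (rule mk_trI[OF T]) (use dZ dn in \<open>simp_all add: act_def\<close>)
  have q: "psh_trans C T Q q" unfolding q_def
    by (rule mk_trI[OF T]) (use dZ dn in \<open>simp_all add: act_def\<close>)
  have "pw_pullback C T P Q R p q u v"
    unfolding pw_pullback_def
  proof (intro conjI T P Q R p q u v ballI impI)
    fix a assume a: "a \<in> Obj C"
    show "u a (p a t) = v a (q a t)" if "t \<in> omap T a" for t
      using dT[OF a that] a that by (simp add: p_def q_def Z_def)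
    show "\<exists>t\<in>omap T a. p a t = x \<and> q a t = y" if "x \<in> omap P a" "y \<in> omap Q a" "u a x = v a y" for x y
    proof -
      have z: "(x, y) \<in> Z a" using that by (simp add: Z_def)
      then show ?thesis using a d[OF a z] by (intro bexI[of _ "e a (x, y)"]) (simp_all add: p_def q_def Te)
    qed
    show "t = t'" if "t \<in> omap T a" "t' \<in> omap T a" "p a t = p a t'" "q a t = q a t'" for t t'
    proof -
      have "d a t = d a t'" using that a by (simp add: p_def q_def prod_eq_iff)
      then show ?thesis using dT[OF a that(1)] dT[OF a that(2)] by metis
    qed
  qed
  then show ?thesis by (rule that)
qed

lemma pw_pullback_is_pullback:
  assumes pb: "pw_pullback C T P Q R p q u v" and S: "T \<in> S" "P \<in> S" "Q \<in> S" "R \<in> S"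
  shows "is_pullback (full_subcat (presheaf_cat C) S) T P Q R p q u v"
proof -
  interpret E: cat "full_subcat (presheaf_cat C) S" by unfold_locales (rule category_psh)
  have D: "presheaf C T" "presheaf C P" "presheaf C Q" "presheaf C R"
     "psh_trans C T P p" "psh_trans C T Q q" "psh_trans C P R u" "psh_trans C Q R v"
    and e: "\<And>a t. a \<in> Obj C \<Longrightarrow> t \<in> omap T a \<Longrightarrow> u a (p a t) = v a (q a t)"
    and ex: "\<And>a x y. a \<in> Obj C \<Longrightarrow> x \<in> omap P a \<Longrightarrow> y \<in> omap Q a \<Longrightarrow> u a x = v a y \<Longrightarrow> \<exists>t\<in>omap T a. p a t = x \<and> q a t = y"
    and un: "\<And>a t t'. a \<in> Obj C \<Longrightarrow> t \<in> omap T a \<Longrightarrow> t' \<in> omap T a \<Longrightarrow> p a t = p a t' \<Longrightarrow> q a t = q a t' \<Longrightarrow> t = t'"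
    using pb unfolding pw_pullback_def by simp_all
  show ?thesis
  proof (rule E.pbI)
    show "Comp (full_subcat (presheaf_cat C) S) T P R u p = Comp (full_subcat (presheaf_cat C) S) T Q R v q"
      using e by (simp add: presheaf_comp_eqI)
    fix F x y assume "arr (full_subcat (presheaf_cat C) S) F P x" "arr (full_subcat (presheaf_cat C) S) F Q y"
      and eq: "Comp (full_subcat (presheaf_cat C) S) F P R u x = Comp (full_subcat (presheaf_cat C) S) F Q R v y"
    then have F: "presheaf C F" "F \<in> S" and x: "psh_trans C F P x" and y: "psh_trans C F Q y"
      by (simp_all add: arr_psh)
    have e': "u a (x a r) = v a (y a r)" if "a \<in> Obj C" "r \<in> omap F a" for a r
      by (rule presheaf_comp_eqD[OF _ that]) (use eq in simp)
    define h where "h a r = (THE t. t \<in> omap T a \<and> p a t = x a r \<and> q a t = y a r)" for a r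
    have h: "h a r \<in> omap T a \<and> p a (h a r) = x a r \<and> q a (h a r) = y a r" if a: "a \<in> Obj C" and r: "r \<in> omap F a" for a r
      unfolding h_def
    proof (rule theI')
      obtain t where t: "t \<in> omap T a" "p a t = x a r" "q a t = y a r"
        using ex[OF a tr_in[OF x a r] tr_in[OF y a r] e'[OF a r]] by blast
      show "\<exists>!t. t \<in> omap T a \<and> p a t = x a r \<and> q a t = y a r"
        by (rule ex1I[of _ t]) (use t un[OF a] in auto)
    qed
    have hn: "h b (amap F a b f r) = amap T a b f (h a r)" if f: "arr C b a f" and r: "r \<in> omap F a" for a b f r
    proof -
      note o = arrD(1,2)[OF f]
      note h1 = h[OF o(2) r] and h2 = h[OF o(1) psh_in[OF F(1) f r]]
      show ?thesis
      proof (rule un[OF o(1)])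
        show "p b (h b (amap F a b f r)) = p b (amap T a b f (h a r))"
          using h1 h2 tr_nat[OF D(5) f] tr_nat[OF x f r] by simp
        show "q b (h b (amap F a b f r)) = q b (amap T a b f (h a r))"
          using h1 h2 tr_nat[OF D(6) f] tr_nat[OF y f r] by simp
      qed (use h1 h2 psh_in[OF D(1) f] in auto)
    qed
    have tr: "psh_trans C F T (mk_tr C F h)"
      by (rule mk_trI[OF F(1)]) (use h hn in auto)
    have "Comp (presheaf_cat C) F T P p (mk_tr C F h) = x"
      by (rule presheaf_comp_eq_trI[OF x tr D(5) F(1)]) (use h in simp)
    moreover have "Comp (presheaf_cat C) F T Q q (mk_tr C F h) = y"
      by (rule presheaf_comp_eq_trI[OF y tr D(6) F(1)]) (use h in simp)
    ultimately show "\<exists>h. arr (full_subcat (presheaf_cat C) S) F T h \<and> Comp (full_subcat (presheaf_cat C) S) F T P p h = x \<and>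
       Comp (full_subcat (presheaf_cat C) S) F T Q q h = y"
      using tr F S D by (intro exI[of _ "mk_tr C F h"]) (simp add: arr_psh)
  next
    fix F h h' assume "arr (full_subcat (presheaf_cat C) S) F T h" "arr (full_subcat (presheaf_cat C) S) F T h'"
      and eq: "Comp (full_subcat (presheaf_cat C) S) F T P p h = Comp (full_subcat (presheaf_cat C) S) F T P p h'"
        "Comp (full_subcat (presheaf_cat C) S) F T Q q h = Comp (full_subcat (presheaf_cat C) S) F T Q q h'"
    then have h: "psh_trans C F T h" "psh_trans C F T h'" by (simp_all add: arr_psh)
    show "h = h'"
    proof (rule tr_eqI[OF h])
      fix a r assume a: "a \<in> Obj C" "r \<in> omap F a"
      show "h a r = h' a r"
      proof (rule un[OF a(1) tr_in[OF h(1) a] tr_in[OF h(2) a]])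
        show "p a (h a r) = p a (h' a r)" by (rule presheaf_comp_eqD[OF _ a]) (use eq(1) in simp)
        show "q a (h a r) = q a (h' a r)" by (rule presheaf_comp_eqD[OF _ a]) (use eq(2) in simp)
      qed
    qed
  qed (use D S in \<open>simp_all add: arr_psh\<close>)
qed

section \<open>Representable and small presheaves\<close>

lemma rep_simps [simp]:
  "omap (representable C c) a = Hom C a c"
  "g \<in> Hom C a c \<Longrightarrow> amap (representable C c) a b f g = Comp C b a c g f"
  by (simp_all add: representable_def)

lemma yoneda_omap [simp]: "omap (yoneda C) c = representable C c"
  by (simp add: yoneda_def)

lemma yoneda_mk: "amap (yoneda C) c d f = mk_tr C (representable C c) (\<lambda>a g. Comp C a c d f g)"
  by (simp add: yoneda_def mk_tr_def)

lemma yoneda_amap [simp]: "a \<in> Obj C \<Longrightarrow> g \<in> Hom C a c \<Longrightarrow> amap (yoneda C) c d f a g = Comp C a c d f g"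
  by (simp add: yoneda_mk)

locale lfc_cat =
  fixes C :: "('o, 'u) cat"
  assumes U: "set_universe TYPE('u)" and ls: "locally_small C" and lfc: "finitely_complete C"

sublocale lfc_cat \<subseteq> fc_cat C
  using lfc by unfold_locales (auto simp: finitely_complete_def)

context lfc_cat begin

abbreviation psh :: "('o, 'u) presheaf set \<Rightarrow> (('o, 'u) presheaf, 'o \<Rightarrow> 'u \<Rightarrow> 'u) cat" where
  "psh T \<equiv> full_subcat (presheaf_cat C) T"

abbreviation "rep \<equiv> representable C"
abbreviation "yo \<equiv> amap (yoneda C)"

lemma Hom_arr: "a \<in> Obj C \<Longrightarrow> b \<in> Obj C \<Longrightarrow> f \<in> Hom C a b \<longleftrightarrow> arr C a b f"
  by (simp add: arr_def)

lemma presheaf_rep [simp]: "c \<in> Obj C \<Longrightarrow> presheaf C (rep c)"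
proof (rule presheafI[OF category])
  assume c: "c \<in> Obj C"
  show "omap (rep c) a \<prec> (UNIV :: 'u set)" if "a \<in> Obj C" for a
    using ls c that by (simp add: locally_small_def)
  show "amap (rep c) a b f \<in> omap (rep c) a \<rightarrow>\<^sub>E omap (rep c) b" if f: "arr C b a f" for a b f
  proof (rule PiE_I)
    fix g assume "g \<in> omap (rep c) a"
    then show "amap (rep c) a b f g \<in> omap (rep c) b"
      using arrD(3)[OF arr_comp[OF f, of c g]] arrD(2)[OF f] c by (simp add: arr_def)
  next
    fix g assume "g \<notin> omap (rep c) a"
    then show "amap (rep c) a b f g = undefined" by (simp add: representable_def)
  qed
  show "amap (rep c) a a (Ident C a) p = p" if "a \<in> Obj C" "p \<in> omap (rep c) a" for a p
    using that c by (simp add: Hom_arr)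
  show "amap (rep c) a d (Comp C d b a f g) p = amap (rep c) b d g (amap (rep c) a b f p)"
    if f: "arr C b a f" and g: "arr C d b g" and p: "p \<in> omap (rep c) a" for a b d f g p
  proof -
    have p': "arr C a c p" using p c arrD(2)[OF f] by (simp add: arr_def)
    then show ?thesis using f g arrD(3)[OF arr_comp[OF f p']] arrD(3)[OF p'] by (simp add: assoc)
  qed
qed

lemma trans_yo: "arr C c d f \<Longrightarrow> psh_trans C (rep c) (rep d) (yo c d f)"
  unfolding yoneda_mk
proof (rule mk_trI)
  assume f: "arr C c d f"
  note o = arrD(1,2)[OF f]
  show "presheaf C (rep c)" using o by simp
  show "Comp C a c d f p \<in> omap (rep d) a" if "a \<in> Obj C" "p \<in> omap (rep c) a" for a p
    using that o f by (simp add: Hom_arr)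
  fix a b k p assume k: "arr C b a k" and "p \<in> omap (rep c) a"
  then have p: "arr C a c p" using o arrD(2)[OF k] by (simp add: arr_def)
  show "Comp C b c d f (amap (rep c) a b k p) = amap (rep d) a b k (Comp C a c d f p)"
    using p k f arrD(3)[OF p] arrD(3)[OF arr_comp[OF p f]] by (simp add: assoc)
qed

text \<open>The arrow out of the representable at \<open>c\<close> that the Yoneda lemma assigns to
  the element \<open>p\<close>.\<close>

definition elt :: "('o, 'u) presheaf \<Rightarrow> 'o \<Rightarrow> 'u \<Rightarrow> 'o \<Rightarrow> 'u \<Rightarrow> 'u" where
  "elt P c p = mk_tr C (rep c) (\<lambda>a g. amap P c a g p)"

lemma elt [simp]: "arr C a c g \<Longrightarrow> elt P c p a g = amap P c a g p"
  by (simp add: elt_def arr_def)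

lemma trans_elt:
  assumes P: "presheaf C P" and c: "c \<in> Obj C" and p: "p \<in> omap P c"
  shows "psh_trans C (rep c) P (elt P c p)"
  unfolding elt_def
proof (rule mk_trI)
  show "amap P c a g p \<in> omap P a" if "a \<in> Obj C" "g \<in> omap (rep c) a" for a g
    using that psh_in[OF P _ p] c by (simp add: arr_def)
  fix a b f g assume f: "arr C b a f" and "g \<in> omap (rep c) a"
  then have g: "arr C a c g" using c arrD(2)[OF f] by (simp add: arr_def)
  show "amap P c b (amap (rep c) a b f g) p = amap P a b f (amap P c a g p)"
    using psh_comp'[OF P g f p] arrD(3)[OF g] by simp
qed (use c in simp)

lemma tr_rep:
  assumes \<alpha>: "psh_trans C (rep c) P \<alpha>" and g: "arr C a c g"
  shows "\<alpha> a g = amap P c a g (\<alpha> c (Ident C c))"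
  using tr_nat[OF \<alpha> g, of "Ident C c"] arr_id[OF arrD(2)[OF g]] g by (simp add: arr_def[of C c c])

lemma tr_rep_eqI:
  assumes "psh_trans C (rep c) P \<alpha>" "psh_trans C (rep c) P \<beta>" "c \<in> Obj C" "\<alpha> c (Ident C c) = \<beta> c (Ident C c)"
  shows "\<alpha> = \<beta>"
proof (rule tr_eqI[OF assms(1,2)])
  fix a g assume "a \<in> Obj C" "g \<in> omap (rep c) a"
  then have g: "arr C a c g" using assms(3) by (simp add: arr_def)
  show "\<alpha> a g = \<beta> a g"
    unfolding tr_rep[OF assms(1) g] tr_rep[OF assms(2) g] assms(4) ..
qed

lemma yoneda_functor:
  assumes T: "rep ` Obj C \<subseteq> T"
  shows "is_functor C (psh T) (yoneda C)"
proof (rule functorI[OF category category_psh])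
  show "omap (yoneda C) a \<in> Obj (psh T)" if "a \<in> Obj C" for a using that T by auto
  show "arr (psh T) (omap (yoneda C) a) (omap (yoneda C) b) (yo a b f)" if f: "arr C a b f" for a b f
    using trans_yo[OF f] T arrD(1,2)[OF f] by (auto simp: arr_psh)
  show "yo a a (Ident C a) = Ident (psh T) (omap (yoneda C) a)" if a: "a \<in> Obj C" for a
    by (simp add: yoneda_mk presheaf_cat_Ident mk_tr_def) (rule restrict_ext, rule restrict_ext, use a in \<open>simp add: Hom_arr\<close>)
  show "yo a c (Comp C a b c g f) =
    Comp (psh T) (omap (yoneda C) a) (omap (yoneda C) b) (omap (yoneda C) c) (yo b c g) (yo a b f)"
    if f: "arr C a b f" and g: "arr C b c g" for a b c f g
  proof -
    note o = arrD(1,2)[OF f] arrD(2)[OF g]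
    have "Comp (presheaf_cat C) (rep a) (rep b) (rep c) (yo b c g) (yo a b f) = yo a c (Comp C a b c g f)"
      by (rule presheaf_comp_eq_trI[OF trans_yo[OF arr_comp[OF f g]] trans_yo[OF f] trans_yo[OF g]])
        (use o f g in \<open>simp_all add: Hom_arr assoc\<close>)
    then show ?thesis by simp
  qed
qed

lemma yoneda_full:
  assumes c: "c \<in> Obj C" "d \<in> Obj C" and \<alpha>: "psh_trans C (rep c) (rep d) \<alpha>"
  obtains f where "arr C c d f" "\<alpha> = yo c d f"
proof -
  have f: "arr C c d (\<alpha> c (Ident C c))"
    using tr_in[OF \<alpha> c(1), of "Ident C c"] c arr_id[OF c(1)] by (simp add: arr_def)
  have "\<alpha> = yo c d (\<alpha> c (Ident C c))"
    by (rule tr_rep_eqI[OF \<alpha> trans_yo[OF f] c(1)]) (use f c arr_id[OF c(1)] in \<open>simp add: arr_def[of C c c]\<close>)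
  then show ?thesis using that f by blast
qed

text \<open>A cone of presheaves with vertex \<open>P\<close> makes each element of \<open>P\<close>
  over \<open>a\<close> into a cone in \<open>C\<close> with vertex \<open>a\<close>, hence into an
  arrow to \<open>x\<close>. Uniqueness of that arrow gives naturality.\<close>

lemma yoneda_limit:
  assumes T: "rep ` Obj C \<subseteq> T" and D: "is_functor J C D" and lim: "is_limit J C D x \<pi>"
  shows "is_limit J (psh T) (comp_func (yoneda C) D) (rep x) (\<lambda>j. yo x (omap D j) (\<pi> j))"
proof -
  interpret E: cat "psh T" by unfold_locales (rule category_psh)
  note yf = yoneda_functor[OF T]
  note D' = functor_comp_func[OF D yf]
  have x: "x \<in> Obj C" and \<pi>: "\<And>j. j \<in> Obj J \<Longrightarrow> arr C x (omap D j) (\<pi> j)"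
    and nat: "\<And>i j u. arr J i j u \<Longrightarrow> Comp C x (omap D i) (omap D j) (amap D i j u) (\<pi> i) = \<pi> j"
    using lim_cone[OF lim] by (simp_all add: cone_arr[OF D])
  note Dj = functor_obj[OF D]
  show ?thesis
  proof (rule E.limI[OF D'])
    show "is_cone J (psh T) (comp_func (yoneda C) D) (rep x) (\<lambda>j. yo x (omap D j) (\<pi> j))"
      unfolding cone_arr[OF D']
    proof (intro conjI ballI allI impI)
      show "rep x \<in> Obj (psh T)" using x T by auto
      show "arr (psh T) (rep x) (omap (comp_func (yoneda C) D) j) (yo x (omap D j) (\<pi> j))" if "j \<in> Obj J" for j
        using functor_arr[OF yf \<pi>[OF that]] by simp
      show "Comp (psh T) (rep x) (omap (comp_func (yoneda C) D) i) (omap (comp_func (yoneda C) D) j)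
          (amap (comp_func (yoneda C) D) i j u) (yo x (omap D i) (\<pi> i)) = yo x (omap D j) (\<pi> j)"
        if u: "arr J i j u" for i j u
        using functor_comp[OF yf \<pi>[OF arrD(1)[OF u]] functor_arr[OF D u]] nat[OF u] by simp
    qed
  next
    fix P \<rho> assume \<rho>: "is_cone J (psh T) (comp_func (yoneda C) D) P \<rho>"
    then have P: "presheaf C P" "P \<in> T" and \<rho>_tr: "\<And>j. j \<in> Obj J \<Longrightarrow> psh_trans C P (rep (omap D j)) (\<rho> j)"
      by (auto simp: cone_arr[OF D'] arr_psh)
    have \<rho>_nat: "Comp C a (omap D i) (omap D j) (amap D i j u) (\<rho> i a p) = \<rho> j a p"
      if u: "arr J i j u" and a: "a \<in> Obj C" and p: "p \<in> omap P a" for i j u a p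
    proof -
      have "Comp (presheaf_cat C) P (rep (omap D i)) (rep (omap D j)) (yo (omap D i) (omap D j) (amap D i j u)) (\<rho> i) = \<rho> j"
        using \<rho> u by (simp add: cone_arr[OF D'])
      from presheaf_comp_eq_trD[OF this a p] show ?thesis
        using tr_in[OF \<rho>_tr[OF arrD(1)[OF u]] a p] a by simp
    qed
    have cone: "is_cone J C D a (\<lambda>j. \<rho> j a p)" if a: "a \<in> Obj C" and p: "p \<in> omap P a" for a p
      unfolding cone_arr[OF D]
    proof (intro conjI a ballI allI impI)
      show "arr C a (omap D j) (\<rho> j a p)" if "j \<in> Obj J" for j
        using tr_in[OF \<rho>_tr[OF that] a p] Dj[OF that] a by (simp add: arr_def)
    qed (rule \<rho>_nat[OF _ a p])
    define h where "h a p = (SOME h. arr C a x h \<and> (\<forall>j\<in>Obj J. Comp C a x (omap D j) (\<pi> j) h = \<rho> j a p))" for a p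
    have h: "arr C a x (h a p) \<and> (\<forall>j\<in>Obj J. Comp C a x (omap D j) (\<pi> j) (h a p) = \<rho> j a p)"
      if a: "a \<in> Obj C" and p: "p \<in> omap P a" for a p
      unfolding h_def by (rule someI_ex) (rule lim_ex[OF lim cone[OF a p]], blast)
    have hn: "h b (amap P a b f p) = Comp C b a x (h a p) f" if f: "arr C b a f" and p: "p \<in> omap P a" for a b f p
    proof (rule lim_uniq[OF D lim])
      note o = arrD(1,2)[OF f]
      note 1 = h[OF o(2) p] and 2 = h[OF o(1) psh_in[OF P(1) f p]]
      show "arr C b x (h b (amap P a b f p))" "arr C b x (Comp C b a x (h a p) f)" using 1 2 f by auto
      fix j assume j: "j \<in> Obj J"
      have "\<rho> j a p \<in> Hom C a (omap D j)" using tr_in[OF \<rho>_tr[OF j] o(2) p] by simp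
      then show "Comp C b x (omap D j) (\<pi> j) (h b (amap P a b f p)) = Comp C b x (omap D j) (\<pi> j) (Comp C b a x (h a p) f)"
        using 1 2 j f \<pi>[OF j] tr_nat[OF \<rho>_tr[OF j] f p] by (simp add: assoc[symmetric])
    qed
    have tr: "psh_trans C P (rep x) (mk_tr C P h)"
    proof (rule mk_trI[OF P(1)])
      show "h a p \<in> omap (rep x) a" if "a \<in> Obj C" "p \<in> omap P a" for a p
        using h[OF that] that x by (simp add: Hom_arr)
      then show "h b (amap P a b f p) = amap (rep x) a b f (h a p)" if "arr C b a f" "p \<in> omap P a" for a b f p
        using hn[OF that] arrD(2)[OF that(1)] that(2) by simp
    qed
    have "Comp (presheaf_cat C) P (rep x) (rep (omap D j)) (yo x (omap D j) (\<pi> j)) (mk_tr C P h) = \<rho> j" if j: "j \<in> Obj J" for j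
      by (rule presheaf_comp_eq_trI[OF \<rho>_tr[OF j] tr trans_yo[OF \<pi>[OF j]] P(1)])
        (use h j x in \<open>simp add: arr_def[of C _ x]\<close>)
    then show "\<exists>h. arr (psh T) P (rep x) h \<and>
       (\<forall>j\<in>Obj J. Comp (psh T) P (rep x) (omap (comp_func (yoneda C) D) j) (yo x (omap D j) (\<pi> j)) h = \<rho> j)"
      using tr P x T by (intro exI[of _ "mk_tr C P h"]) (auto simp: arr_psh)
  next
    fix P h h' assume a: "arr (psh T) P (rep x) h" "arr (psh T) P (rep x) h'"
      and e: "\<And>j. j \<in> Obj J \<Longrightarrow> Comp (psh T) P (rep x) (omap (comp_func (yoneda C) D) j) (yo x (omap D j) (\<pi> j)) h =
         Comp (psh T) P (rep x) (omap (comp_func (yoneda C) D) j) (yo x (omap D j) (\<pi> j)) h'"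
    then have h: "psh_trans C P (rep x) h" "psh_trans C P (rep x) h'" by (simp_all add: arr_psh)
    show "h = h'"
    proof (rule tr_eqI[OF h])
      fix b p assume b: "b \<in> Obj C" "p \<in> omap P b"
      note i = tr_in[OF h(1) b] tr_in[OF h(2) b]
      show "h b p = h' b p"
      proof (rule lim_uniq[OF D lim])
        show "arr C b x (h b p)" "arr C b x (h' b p)" using i b x by (simp_all add: arr_def)
        show "Comp C b x (omap D j) (\<pi> j) (h b p) = Comp C b x (omap D j) (\<pi> j) (h' b p)" if "j \<in> Obj J" for j
          using presheaf_comp_eqD[OF _ b, of "rep x" "rep (omap D j)" "yo x (omap D j) (\<pi> j)" h "rep x" "rep (omap D j)"
              "yo x (omap D j) (\<pi> j)" h'] e[OF that] i b by simp
      qed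
    qed
  qed
qed

end

section \<open>Small presheaves as unique extensions from a small set of objects\<close>

definition ext_small :: "('o, 'u) cat \<Rightarrow> 'o set \<Rightarrow> ('o, 'u) presheaf \<Rightarrow> bool" where
  "ext_small C S P \<longleftrightarrow> presheaf C P \<and> S \<subseteq> Obj C \<and> S \<prec> (UNIV :: 'u set) \<and>
     (\<forall>G \<alpha>. presheaf C G \<longrightarrow> (\<forall>a\<in>S. \<forall>p\<in>omap P a. \<alpha> a p \<in> omap G a) \<longrightarrow>
        (\<forall>a\<in>S. \<forall>b\<in>S. \<forall>f\<in>Hom C b a. \<forall>p\<in>omap P a. \<alpha> b (amap P a b f p) = amap G a b f (\<alpha> a p)) \<longrightarrow>
        (\<exists>!\<beta>. psh_trans C P G \<beta> \<and> (\<forall>a\<in>S. \<forall>p\<in>omap P a. \<beta> a p = \<alpha> a p)))"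

lemma ext_ex:
  assumes "ext_small C S P" "presheaf C G" "\<And>a p. a \<in> S \<Longrightarrow> p \<in> omap P a \<Longrightarrow> \<alpha> a p \<in> omap G a"
    "\<And>a b f p. a \<in> S \<Longrightarrow> b \<in> S \<Longrightarrow> f \<in> Hom C b a \<Longrightarrow> p \<in> omap P a \<Longrightarrow> \<alpha> b (amap P a b f p) = amap G a b f (\<alpha> a p)"
  obtains \<beta> where "psh_trans C P G \<beta>" "\<And>a p. a \<in> S \<Longrightarrow> p \<in> omap P a \<Longrightarrow> \<beta> a p = \<alpha> a p"
proof -
  have "\<exists>!\<beta>. psh_trans C P G \<beta> \<and> (\<forall>a\<in>S. \<forall>p\<in>omap P a. \<beta> a p = \<alpha> a p)"
    using assms unfolding ext_small_def by simp
  then show ?thesis using that by blast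
qed

lemma ext_uniq:
  assumes P: "ext_small C S P" and G: "presheaf C G" and \<beta>: "psh_trans C P G \<beta>" "psh_trans C P G \<beta>'"
    and e: "\<And>a p. a \<in> S \<Longrightarrow> p \<in> omap P a \<Longrightarrow> \<beta> a p = \<beta>' a p"
  shows "\<beta> = \<beta>'"
proof -
  have S: "S \<subseteq> Obj C" using P by (simp add: ext_small_def)
  have "\<exists>!\<gamma>. psh_trans C P G \<gamma> \<and> (\<forall>a\<in>S. \<forall>p\<in>omap P a. \<gamma> a p = \<beta> a p)"
  proof -
    have "\<forall>a\<in>S. \<forall>p\<in>omap P a. \<beta> a p \<in> omap G a" using tr_in[OF \<beta>(1)] S by blast
    moreover have "\<forall>a\<in>S. \<forall>b\<in>S. \<forall>f\<in>Hom C b a. \<forall>p\<in>omap P a. \<beta> b (amap P a b f p) = amap G a b f (\<beta> a p)"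
      using tr_nat[OF \<beta>(1)] S unfolding arr_def by blast
    ultimately show ?thesis using P G unfolding ext_small_def by blast
  qed
  then show ?thesis using \<beta> e by metis
qed

lemma ext_smallI:
  fixes P :: "('o, 'u) presheaf"
  assumes P: "presheaf C P" and S: "S \<subseteq> Obj C" "S \<prec> (UNIV :: 'u set)"
    and ex: "\<And>G \<alpha>. presheaf C G \<Longrightarrow> (\<And>a p. a \<in> S \<Longrightarrow> p \<in> omap P a \<Longrightarrow> \<alpha> a p \<in> omap G a) \<Longrightarrow>
      (\<And>a b f p. a \<in> S \<Longrightarrow> b \<in> S \<Longrightarrow> f \<in> Hom C b a \<Longrightarrow> p \<in> omap P a \<Longrightarrow> \<alpha> b (amap P a b f p) = amap G a b f (\<alpha> a p)) \<Longrightarrow>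
      \<exists>\<beta>. psh_trans C P G \<beta> \<and> (\<forall>a\<in>S. \<forall>p\<in>omap P a. \<beta> a p = \<alpha> a p)"
    and un: "\<And>G \<beta> \<beta>'. presheaf C G \<Longrightarrow> psh_trans C P G \<beta> \<Longrightarrow> psh_trans C P G \<beta>' \<Longrightarrow>
      (\<And>a p. a \<in> S \<Longrightarrow> p \<in> omap P a \<Longrightarrow> \<beta> a p = \<beta>' a p) \<Longrightarrow> \<beta> = \<beta>'"
  shows "ext_small C S P"
  unfolding ext_small_def
proof (intro conjI P S allI impI)
  fix G \<alpha> assume G: "presheaf C G" and \<alpha>: "\<forall>a\<in>S. \<forall>p\<in>omap P a. \<alpha> a p \<in> omap G a"
    "\<forall>a\<in>S. \<forall>b\<in>S. \<forall>f\<in>Hom C b a. \<forall>p\<in>omap P a. \<alpha> b (amap P a b f p) = amap G a b f (\<alpha> a p)"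
  obtain \<beta> where \<beta>: "psh_trans C P G \<beta> \<and> (\<forall>a\<in>S. \<forall>p\<in>omap P a. \<beta> a p = \<alpha> a p)"
    using ex[OF G, of \<alpha>] \<alpha> by blast
  show "\<exists>!\<beta>. psh_trans C P G \<beta> \<and> (\<forall>a\<in>S. \<forall>p\<in>omap P a. \<beta> a p = \<alpha> a p)"
    by (rule ex1I[of _ \<beta>]) (use \<beta> un[OF G] in auto)
qed

lemma id_func_simps [simp]: "omap id_func a = a" "amap id_func a b f = f"
  by (simp_all add: id_func_def)

text \<open>The unit of the Kan extension is the identity, so the condition says that
  transformations given on \<open>S\<close> extend uniquely. \<open>ext_small\<close> states this
  for arbitrary functions, and the proof trades them for the extensional families that the functor
  category requires.\<close>

lemma small_presheaf_iff:
  fixes C :: "('o, 'u) cat"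
  assumes C: "category C"
  shows "small_presheaf C P \<longleftrightarrow> (\<exists>S. ext_small C S P)"
proof -
  have kan: "is_left_kan_extension (op_cat (full_subcat C S)) (op_cat C) Set_cat id_func
          (comp_func P id_func) P (\<lambda>a\<in>S. Ident Set_cat (omap P a)) \<longleftrightarrow> ext_small C S P"
    if P: "presheaf C P" and S: "S \<subseteq> Obj C" and small: "S \<prec> (UNIV :: 'u set)" for S
  proof -
    let ?B = "op_cat (full_subcat C S)"
    have B [simp]: "Obj ?B = S" using S by auto
    have I: "is_functor ?B (op_cat C) id_func"
      by (rule functorI[OF category_op[OF category_full_subcat[OF C]] category_op[OF C]])
        (use S in \<open>auto simp: id_func_def arr_def\<close>)
    note PI = functor_comp_func[OF I P]
    have [simp]: "Obj C \<inter> S = S" using S by auto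
    have nt: "nat_trans ?B Set_cat (comp_func P id_func) (comp_func G id_func) \<alpha> \<longleftrightarrow>
      \<alpha> \<in> extensional S \<and> (\<forall>a\<in>S. \<alpha> a \<in> omap P a \<rightarrow>\<^sub>E omap G a) \<and>
      (\<forall>a\<in>S. \<forall>b\<in>S. \<forall>f\<in>Hom C b a. \<forall>p\<in>omap P a. \<alpha> b (amap P a b f p) = amap G a b f (\<alpha> a p))" for G \<alpha>
    proof -
      have "compose (omap P a) (\<alpha> b) (amap P a b f) = compose (omap P a) (amap G a b f) (\<alpha> a) \<longleftrightarrow>
        (\<forall>p\<in>omap P a. \<alpha> b (amap P a b f p) = amap G a b f (\<alpha> a p))" for a b f
        by (auto simp: compose_def restrict_def fun_eq_iff)
      then show ?thesis unfolding nat_trans_def by simp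
    qed
    have \<eta>: "nat_trans ?B Set_cat (comp_func P id_func) (comp_func P id_func) (\<lambda>a\<in>S. Ident Set_cat (omap P a))"
    proof -
      have "amap P a b f p \<in> omap P b" if "a \<in> S" "b \<in> S" "f \<in> Hom C b a" "p \<in> omap P a" for a b f p
        by (rule psh_in[OF P _ that(4)]) (use that S in \<open>auto simp: arr_def\<close>)
      then show ?thesis unfolding nt by auto
    qed
    have eq: "(\<forall>a\<in>S. compose (omap P a) (\<beta> a) (\<lambda>x\<in>omap P a. x) = \<alpha> a) \<longleftrightarrow> (\<forall>a\<in>S. \<forall>p\<in>omap P a. \<beta> a p = \<alpha> a p)"
      if "\<forall>a\<in>S. \<alpha> a \<in> omap P a \<rightarrow>\<^sub>E omap G a" for \<beta> \<alpha> :: "'o \<Rightarrow> 'u \<Rightarrow> 'u" and G :: "('o, 'u) presheaf"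
    proof (rule ball_cong[OF refl])
      fix a assume "a \<in> S"
      then have "\<alpha> a \<in> extensional (omap P a)" using that by (auto simp: PiE_def)
      then show "(compose (omap P a) (\<beta> a) (\<lambda>x\<in>omap P a. x) = \<alpha> a) \<longleftrightarrow> (\<forall>p\<in>omap P a. \<beta> a p = \<alpha> a p)"
        by (auto simp: compose_def restrict_def fun_eq_iff extensional_def)
    qed
    have \<eta>_eq: "Comp Set_cat (omap (comp_func P id_func) a) (omap P (omap id_func a)) (omap G (omap id_func a)) (\<beta> (omap id_func a))
        ((\<lambda>a\<in>S. Ident Set_cat (omap P a)) a) = compose (omap P a) (\<beta> a) (\<lambda>x\<in>omap P a. x)"
      if "a \<in> S" for a \<beta> and G :: "('o, 'u) presheaf"
      using that by (simp add: id_func_def)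
    have "is_left_kan_extension ?B (op_cat C) Set_cat id_func (comp_func P id_func) P (\<lambda>a\<in>S. Ident Set_cat (omap P a)) \<longleftrightarrow>
      (\<forall>G \<alpha>. presheaf C G \<and> \<alpha> \<in> extensional S \<and> (\<forall>a\<in>S. \<alpha> a \<in> omap P a \<rightarrow>\<^sub>E omap G a) \<and>
      (\<forall>a\<in>S. \<forall>b\<in>S. \<forall>f\<in>Hom C b a. \<forall>p\<in>omap P a. \<alpha> b (amap P a b f p) = amap G a b f (\<alpha> a p)) \<longrightarrow>
      (\<exists>!\<beta>. psh_trans C P G \<beta> \<and> (\<forall>a\<in>S. compose (omap P a) (\<beta> a) (\<lambda>x\<in>omap P a. x) = \<alpha> a)))"
      unfolding is_left_kan_extension_def using I PI P \<eta> by (simp add: nt \<eta>_eq cong: ball_cong)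
    also have "\<dots> \<longleftrightarrow> (\<forall>G \<alpha>. presheaf C G \<and> \<alpha> \<in> extensional S \<and> (\<forall>a\<in>S. \<alpha> a \<in> omap P a \<rightarrow>\<^sub>E omap G a) \<and>
      (\<forall>a\<in>S. \<forall>b\<in>S. \<forall>f\<in>Hom C b a. \<forall>p\<in>omap P a. \<alpha> b (amap P a b f p) = amap G a b f (\<alpha> a p)) \<longrightarrow>
      (\<exists>!\<beta>. psh_trans C P G \<beta> \<and> (\<forall>a\<in>S. \<forall>p\<in>omap P a. \<beta> a p = \<alpha> a p)))"
    proof (intro arg_cong[where f = All] ext imp_cong refl, elim conjE)
      fix G :: "('o, 'u) presheaf" and \<alpha> :: "'o \<Rightarrow> 'u \<Rightarrow> 'u"
      assume "\<forall>a\<in>S. \<alpha> a \<in> omap P a \<rightarrow>\<^sub>E omap G a"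
      from eq[OF this] show "(\<exists>!\<beta>. psh_trans C P G \<beta> \<and> (\<forall>a\<in>S. compose (omap P a) (\<beta> a) (\<lambda>x\<in>omap P a. x) = \<alpha> a)) \<longleftrightarrow>
        (\<exists>!\<beta>. psh_trans C P G \<beta> \<and> (\<forall>a\<in>S. \<forall>p\<in>omap P a. \<beta> a p = \<alpha> a p))" by simp
    qed
    also have "\<dots> \<longleftrightarrow> ext_small C S P"
    proof
      assume l: "\<forall>G \<alpha>. presheaf C G \<and> \<alpha> \<in> extensional S \<and> (\<forall>a\<in>S. \<alpha> a \<in> omap P a \<rightarrow>\<^sub>E omap G a) \<and>
        (\<forall>a\<in>S. \<forall>b\<in>S. \<forall>f\<in>Hom C b a. \<forall>p\<in>omap P a. \<alpha> b (amap P a b f p) = amap G a b f (\<alpha> a p)) \<longrightarrow>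
        (\<exists>!\<beta>. psh_trans C P G \<beta> \<and> (\<forall>a\<in>S. \<forall>p\<in>omap P a. \<beta> a p = \<alpha> a p))"
      show "ext_small C S P"
        unfolding ext_small_def
      proof (intro conjI P S small allI impI)
        fix G \<alpha> assume G: "presheaf C G" and \<alpha>: "\<forall>a\<in>S. \<forall>p\<in>omap P a. \<alpha> a p \<in> omap G a"
          "\<forall>a\<in>S. \<forall>b\<in>S. \<forall>f\<in>Hom C b a. \<forall>p\<in>omap P a. \<alpha> b (amap P a b f p) = amap G a b f (\<alpha> a p)"
        define \<alpha>' where "\<alpha>' = (\<lambda>a\<in>S. \<lambda>p\<in>omap P a. \<alpha> a p)"
        have \<alpha>': "\<alpha>' a p = \<alpha> a p" if "a \<in> S" "p \<in> omap P a" for a p using that by (simp add: \<alpha>'_def)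
        have "\<exists>!\<beta>. psh_trans C P G \<beta> \<and> (\<forall>a\<in>S. \<forall>p\<in>omap P a. \<beta> a p = \<alpha>' a p)"
        proof (rule l[rule_format], intro conjI G ballI)
          show "\<alpha>' \<in> extensional S" by (simp add: \<alpha>'_def)
          show "\<alpha>' a \<in> omap P a \<rightarrow>\<^sub>E omap G a" if "a \<in> S" for a using \<alpha>(1) that by (simp add: \<alpha>'_def)
          show "\<alpha>' b (amap P a b f p) = amap G a b f (\<alpha>' a p)" if "a \<in> S" "b \<in> S" "f \<in> Hom C b a" "p \<in> omap P a" for a b f p
            using \<alpha>(2) that psh_in[OF P, of b a f p] S by (simp add: \<alpha>' arr_def subset_iff)
        qed
        then show "\<exists>!\<beta>. psh_trans C P G \<beta> \<and> (\<forall>a\<in>S. \<forall>p\<in>omap P a. \<beta> a p = \<alpha> a p)" by (simp add: \<alpha>')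
      qed
    next
      assume P': "ext_small C S P"
      show "\<forall>G \<alpha>. presheaf C G \<and> \<alpha> \<in> extensional S \<and> (\<forall>a\<in>S. \<alpha> a \<in> omap P a \<rightarrow>\<^sub>E omap G a) \<and>
        (\<forall>a\<in>S. \<forall>b\<in>S. \<forall>f\<in>Hom C b a. \<forall>p\<in>omap P a. \<alpha> b (amap P a b f p) = amap G a b f (\<alpha> a p)) \<longrightarrow>
        (\<exists>!\<beta>. psh_trans C P G \<beta> \<and> (\<forall>a\<in>S. \<forall>p\<in>omap P a. \<beta> a p = \<alpha> a p))"
      proof (intro allI impI, elim conjE)
        fix G \<alpha> assume G: "presheaf C G" and \<alpha>: "\<forall>a\<in>S. \<alpha> a \<in> omap P a \<rightarrow>\<^sub>E omap G a"
          and n: "\<forall>a\<in>S. \<forall>b\<in>S. \<forall>f\<in>Hom C b a. \<forall>p\<in>omap P a. \<alpha> b (amap P a b f p) = amap G a b f (\<alpha> a p)"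
        have "\<forall>a\<in>S. \<forall>p\<in>omap P a. \<alpha> a p \<in> omap G a" using \<alpha> by blast
        then show "\<exists>!\<beta>. psh_trans C P G \<beta> \<and> (\<forall>a\<in>S. \<forall>p\<in>omap P a. \<beta> a p = \<alpha> a p)"
          using P' G n unfolding ext_small_def by simp
      qed
    qed
    finally show ?thesis .
  qed
  show ?thesis
  proof
    assume "small_presheaf C P"
    then obtain S where "presheaf C P" "S \<subseteq> Obj C" "S \<prec> (UNIV :: 'u set)"
      "is_left_kan_extension (op_cat (full_subcat C S)) (op_cat C) Set_cat id_func
          (comp_func P id_func) P (\<lambda>a\<in>S. Ident Set_cat (omap P a))"
      unfolding small_presheaf_def by blast
    then show "\<exists>S. ext_small C S P" using kan by blast
  next
    assume "\<exists>S. ext_small C S P"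
    then obtain S where S: "ext_small C S P" by blast
    then have "presheaf C P" "S \<subseteq> Obj C" "S \<prec> (UNIV :: 'u set)" by (simp_all add: ext_small_def)
    then show "small_presheaf C P" unfolding small_presheaf_def using kan S by blast
  qed
qed

text \<open>
  If the set S is closed under finite limits, then each comma category x / S is cofiltered, so the
  left Kan extension from S is a pointwise filtered colimit.
\<close>

definition gen_small :: "('o, 'u) cat \<Rightarrow> 'o set \<Rightarrow> ('o, 'u) presheaf \<Rightarrow> bool" where
  "gen_small C S P \<longleftrightarrow> presheaf C P \<and>
     (\<forall>a\<in>Obj C. \<forall>p\<in>omap P a. \<exists>s\<in>S. \<exists>q\<in>omap P s. \<exists>h. arr C a s h \<and> p = amap P s a h q) \<and>
     (\<forall>a s s' q q' h h'. s \<in> S \<and> s' \<in> S \<and> q \<in> omap P s \<and> q' \<in> omap P s' \<and> arr C a s h \<and> arr C a s' h' \<and>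
        amap P s a h q = amap P s' a h' q' \<longrightarrow>
        (\<exists>t\<in>S. \<exists>l k k'. arr C a t l \<and> arr C t s k \<and> arr C t s' k' \<and> h = Comp C a t s k l \<and> h' = Comp C a t s' k' l \<and>
           amap P s t k q = amap P s' t k' q'))"

lemma gen_small_gen:
  assumes "gen_small C S P" "a \<in> Obj C" "p \<in> omap P a"
  obtains s q h where "s \<in> S" "q \<in> omap P s" "arr C a s h" "p = amap P s a h q"
  using assms unfolding gen_small_def by blast

lemma gen_small_rel:
  assumes "gen_small C S P" "s \<in> S" "s' \<in> S" "q \<in> omap P s" "q' \<in> omap P s'" "arr C a s h" "arr C a s' h'"
    "amap P s a h q = amap P s' a h' q'"
  obtains t l k k' where "t \<in> S" "arr C a t l" "arr C t s k" "arr C t s' k'"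
    "h = Comp C a t s k l" "h' = Comp C a t s' k' l" "amap P s t k q = amap P s' t k' q'"
  using assms unfolding gen_small_def by blast

text \<open>The values of an extension are forced, since every element is a restriction of one over
  \<open>S\<close>. They are well defined because two such presentations are linked by a single span
  in \<open>S\<close>.\<close>

lemma gen_small_ext_small:
  fixes P :: "('o, 'u) presheaf"
  assumes g: "gen_small C S P" and C: "category C" and S: "S \<subseteq> Obj C" "S \<prec> (UNIV :: 'u set)"
  shows "ext_small C S P"
proof -
  interpret cat C by unfold_locales fact
  have P: "presheaf C P" using g by (simp add: gen_small_def)
  show ?thesis
  proof (rule ext_smallI[OF P S])
    fix G \<alpha> assume G: "presheaf C G" and \<alpha>_in: "\<And>a p. a \<in> S \<Longrightarrow> p \<in> omap P a \<Longrightarrow> \<alpha> a p \<in> omap G a"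
      and \<alpha>_nat: "\<And>a b f p. a \<in> S \<Longrightarrow> b \<in> S \<Longrightarrow> f \<in> Hom C b a \<Longrightarrow> p \<in> omap P a \<Longrightarrow> \<alpha> b (amap P a b f p) = amap G a b f (\<alpha> a p)"
    define val where "val a p y \<longleftrightarrow> (\<exists>s\<in>S. \<exists>q\<in>omap P s. \<exists>h. arr C a s h \<and> p = amap P s a h q \<and> y = amap G s a h (\<alpha> s q))" for a p y
    have ex: "\<exists>y. val a p y" if "a \<in> Obj C" "p \<in> omap P a" for a p
      using gen_small_gen[OF g that] unfolding val_def by metis
    have uniq: "y = y'" if v: "val a p y" "val a p y'" for a p y y'
    proof -
      obtain s q h where s: "s \<in> S" "q \<in> omap P s" "arr C a s h" "p = amap P s a h q" "y = amap G s a h (\<alpha> s q)"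
        using v(1) unfolding val_def by blast
      obtain s' q' h' where s': "s' \<in> S" "q' \<in> omap P s'" "arr C a s' h'" "p = amap P s' a h' q'" "y' = amap G s' a h' (\<alpha> s' q')"
        using v(2) unfolding val_def by blast
      obtain t l k k' where t: "t \<in> S" "arr C a t l" "arr C t s k" "arr C t s' k'"
        "h = Comp C a t s k l" "h' = Comp C a t s' k' l" "amap P s t k q = amap P s' t k' q'"
        by (rule gen_small_rel[OF g s(1) s'(1) s(2) s'(2) s(3) s'(3)]) (use s s' in auto)
      have "y = amap G t a l (\<alpha> t (amap P s t k q))"
        using psh_comp[OF G t(3,2) \<alpha>_in[OF s(1,2)]] \<alpha>_nat[OF s(1) t(1) arrD(3)[OF t(3)] s(2)] by (simp add: s(5) t(5))
      moreover have "y' = amap G t a l (\<alpha> t (amap P s' t k' q'))"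
        using psh_comp[OF G t(4,2) \<alpha>_in[OF s'(1,2)]] \<alpha>_nat[OF s'(1) t(1) arrD(3)[OF t(4)] s'(2)] by (simp add: s'(5) t(6))
      ultimately show ?thesis by (simp add: t(7))
    qed
    define \<beta> where "\<beta> a p = (SOME y. val a p y)" for a p
    have \<beta>: "val a p (\<beta> a p)" if "a \<in> Obj C" "p \<in> omap P a" for a p
      unfolding \<beta>_def by (rule someI_ex[OF ex[OF that]])
    have val_in: "y \<in> omap G a" if "val a p y" for a p y
      using that \<alpha>_in psh_in[OF G] unfolding val_def by blast
    have val_nat: "val b (amap P a b f p) (amap G a b f y)" if f: "arr C b a f" and v: "val a p y" for a b f p y
    proof -
      obtain s q h where s: "s \<in> S" "q \<in> omap P s" "arr C a s h" "p = amap P s a h q" "y = amap G s a h (\<alpha> s q)"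
        using v unfolding val_def by blast
      have "arr C b s (Comp C b a s h f)" using s f by simp
      moreover have "amap P a b f p = amap P s b (Comp C b a s h f) q" using psh_comp[OF P s(3) f s(2)] s by simp
      moreover have "amap G a b f y = amap G s b (Comp C b a s h f) (\<alpha> s q)"
        using psh_comp[OF G s(3) f \<alpha>_in[OF s(1,2)]] s by simp
      ultimately show ?thesis using s(1,2) unfolding val_def by blast
    qed
    have "psh_trans C P G (mk_tr C P \<beta>)"
    proof (rule mk_trI[OF P])
      show "\<beta> a p \<in> omap G a" if "a \<in> Obj C" "p \<in> omap P a" for a p
        using val_in[OF \<beta>[OF that]] .
      show "\<beta> b (amap P a b f p) = amap G a b f (\<beta> a p)" if f: "arr C b a f" and p: "p \<in> omap P a" for a b f p
        by (rule uniq[OF \<beta>[OF arrD(1)[OF f] psh_in[OF P f p]] val_nat[OF f \<beta>[OF arrD(2)[OF f] p]]])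
    qed
    moreover have "mk_tr C P \<beta> a p = \<alpha> a p" if a: "a \<in> S" and p: "p \<in> omap P a" for a p
    proof -
      have o: "a \<in> Obj C" using a S by blast
      have "val a p (\<alpha> a p)" unfolding val_def
        by (rule bexI[OF _ a], rule bexI[OF _ p], rule exI[of _ "Ident C a"])
          (use o p psh_id[OF P o p] psh_id[OF G o \<alpha>_in[OF a p]] in simp)
      then show ?thesis using uniq[OF \<beta>[OF o p]] o p by simp
    qed
    ultimately show "\<exists>\<beta>. psh_trans C P G \<beta> \<and> (\<forall>a\<in>S. \<forall>p\<in>omap P a. \<beta> a p = \<alpha> a p)" by blast
  next
    fix G \<beta> \<beta>' assume G: "presheaf C G" and \<beta>: "psh_trans C P G \<beta>" "psh_trans C P G \<beta>'"
      and e: "\<And>a p. a \<in> S \<Longrightarrow> p \<in> omap P a \<Longrightarrow> \<beta> a p = \<beta>' a p"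
    show "\<beta> = \<beta>'"
    proof (rule tr_eqI[OF \<beta>])
      fix a p assume a: "a \<in> Obj C" "p \<in> omap P a"
      obtain s q h where s: "s \<in> S" "q \<in> omap P s" "arr C a s h" "p = amap P s a h q" by (rule gen_small_gen[OF g a])
      show "\<beta> a p = \<beta>' a p" using tr_nat[OF \<beta>(1) s(3,2)] tr_nat[OF \<beta>(2) s(3,2)] e[OF s(1,2)] s(4) by simp
    qed
  qed
qed

text \<open>The elements generated over \<open>S\<close> form a subpresheaf \<open>F\<close>. The
  identity on \<open>S\<close> extends to an arrow from \<open>P\<close> to \<open>F\<close>, whose
  composite with the inclusion is the identity of \<open>P\<close> by uniqueness, so
  \<open>F\<close> is all of \<open>P\<close>.\<close>

lemma ext_small_gen:
  fixes P :: "('o, 'u) presheaf"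
  assumes e: "ext_small C S P" and C: "category C" and a: "a \<in> Obj C" and p: "p \<in> omap P a"
  obtains s q h where "s \<in> S" "q \<in> omap P s" "arr C a s h" "p = amap P s a h q"
proof -
  interpret cat C by unfold_locales fact
  have P: "presheaf C P" and S: "S \<subseteq> Obj C" using e by (simp_all add: ext_small_def)
  define F0 where "F0 a = {p. \<exists>s\<in>S. \<exists>q\<in>omap P s. \<exists>h. arr C a s h \<and> p = amap P s a h q}" for a
  define F :: "('o, 'u) presheaf" where "F = \<lparr>omap = F0, amap = (\<lambda>a b f. \<lambda>p\<in>F0 a. amap P a b f p)\<rparr>"
  have F0: "F0 a \<subseteq> omap P a" for a using psh_in[OF P] by (auto simp: F0_def)
  have F0_act: "amap P a b f p \<in> F0 b" if f: "arr C b a f" and p: "p \<in> F0 a" for a b f p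
  proof -
    obtain s q h where s: "s \<in> S" "q \<in> omap P s" "arr C a s h" "p = amap P s a h q" using p by (auto simp: F0_def)
    have "amap P a b f p = amap P s b (Comp C b a s h f) q" using psh_comp[OF P s(3) f s(2)] s(4) by simp
    moreover have "arr C b s (Comp C b a s h f)" using f s by simp
    ultimately show ?thesis using s unfolding F0_def by blast
  qed
  have [simp]: "omap F a = F0 a" "p \<in> F0 a \<Longrightarrow> amap F a b f p = amap P a b f p" for a b f p
    by (simp_all add: F_def)
  have F: "presheaf C F"
  proof (rule presheafI[OF C])
    show "omap F a \<prec> (UNIV :: 'u set)" if "a \<in> Obj C" for a
      using small_subset[OF F0 psh_small[OF P that]] by simp
    show "amap F a b f \<in> omap F a \<rightarrow>\<^sub>E omap F b" if f: "arr C b a f" for a b f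
      by (rule PiE_I) (use F0_act[OF f] in \<open>auto simp: F_def\<close>)
    show "amap F a a (Ident C a) p = p" if "a \<in> Obj C" "p \<in> omap F a" for a p
      using that psh_id[OF P] F0 by (auto simp: subset_iff)
    show "amap F a c (Comp C c b a f g) p = amap F b c g (amap F a b f p)"
      if "arr C b a f" "arr C c b g" "p \<in> omap F a" for a b c f g p
      using that psh_comp[OF P] F0 F0_act by (auto simp: subset_iff)
  qed
  have S_in: "p \<in> F0 s" if "s \<in> S" "p \<in> omap P s" for s p
  proof -
    have s: "s \<in> Obj C" using that S by blast
    show ?thesis unfolding F0_def
      by (intro CollectI bexI[OF _ that(1)] bexI[OF _ that(2)] exI[of _ "Ident C s"]) (use s psh_id[OF P s that(2)] in simp)
  qed
  obtain \<beta> where \<beta>: "psh_trans C P F \<beta>" "\<And>a p. a \<in> S \<Longrightarrow> p \<in> omap P a \<Longrightarrow> \<beta> a p = p"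
    using ext_ex[OF e F, of "\<lambda>a p. p"] S_in by auto
  have inc: "psh_trans C F P (mk_tr C F (\<lambda>a p. p))"
    by (rule mk_trI[OF F]) (use F0 in auto)
  have "Comp (presheaf_cat C) P F P (mk_tr C F (\<lambda>a p. p)) \<beta> = mk_tr C P (\<lambda>a p. p)"
  proof (rule ext_uniq[OF e P tr_comp[OF P \<beta>(1) inc]])
    show "psh_trans C P P (mk_tr C P (\<lambda>a p. p))" using tr_ident[OF P] by (simp add: presheaf_cat_Ident)
    show "Comp (presheaf_cat C) P F P (mk_tr C F (\<lambda>a p. p)) \<beta> a p = mk_tr C P (\<lambda>a p. p) a p"
      if "a \<in> S" "p \<in> omap P a" for a p
      using that S S_in[OF that] \<beta>(2)[OF that] by (auto simp: presheaf_cat_Comp)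
  qed
  from presheaf_comp_eq_trD[OF this a p] have "\<beta> a p = p"
    using tr_in[OF \<beta>(1) a p] a p by simp
  then have "p \<in> F0 a" using tr_in[OF \<beta>(1) a p] by simp
  then show ?thesis using that unfolding F0_def by blast
qed

text \<open>A transformation on \<open>T\<close> is extended from its restriction to
  \<open>S\<close>; the result is correct on all of \<open>T\<close> because elements over
  \<open>T\<close> are generated over \<open>S\<close>. This lets several small presheaves share one
  set closed under finite limits.\<close>

lemma ext_small_mono:
  fixes P :: "('o, 'u) presheaf"
  assumes e: "ext_small C S P" and C: "category C" and T: "S \<subseteq> T" "T \<subseteq> Obj C" "T \<prec> (UNIV :: 'u set)"
  shows "ext_small C T P"
proof -
  have P: "presheaf C P" and S: "S \<subseteq> Obj C" using e by (simp_all add: ext_small_def)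
  show ?thesis
  proof (rule ext_smallI[OF P T(2,3)])
    fix G \<alpha> assume G: "presheaf C G" and \<alpha>_in: "\<And>a p. a \<in> T \<Longrightarrow> p \<in> omap P a \<Longrightarrow> \<alpha> a p \<in> omap G a"
      and \<alpha>_nat: "\<And>a b f p. a \<in> T \<Longrightarrow> b \<in> T \<Longrightarrow> f \<in> Hom C b a \<Longrightarrow> p \<in> omap P a \<Longrightarrow> \<alpha> b (amap P a b f p) = amap G a b f (\<alpha> a p)"
    obtain \<beta> where \<beta>: "psh_trans C P G \<beta>" "\<And>a p. a \<in> S \<Longrightarrow> p \<in> omap P a \<Longrightarrow> \<beta> a p = \<alpha> a p"
    proof (rule ext_ex[OF e G, of \<alpha>])
      show "\<alpha> a p \<in> omap G a" if "a \<in> S" "p \<in> omap P a" for a p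
        using that T \<alpha>_in by blast
      show "\<alpha> b (amap P a b f p) = amap G a b f (\<alpha> a p)" if "a \<in> S" "b \<in> S" "f \<in> Hom C b a" "p \<in> omap P a" for a b f p
        by (rule \<alpha>_nat) (use that T in auto)
    qed (rule that, assumption, simp)
    have "\<beta> a p = \<alpha> a p" if a: "a \<in> T" and p: "p \<in> omap P a" for a p
    proof -
      have "a \<in> Obj C" using a T by blast
      then obtain s q h where s: "s \<in> S" "q \<in> omap P s" "arr C a s h" "p = amap P s a h q"
        using ext_small_gen[OF e C _ p] by blast
      have "s \<in> T" using s T by blast
      then show ?thesis
        using tr_nat[OF \<beta>(1) s(3,2)] \<alpha>_nat[OF _ a arrD(3)[OF s(3)] s(2)] \<beta>(2)[OF s(1,2)] s(4) by simp
    qed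
    then show "\<exists>\<beta>. psh_trans C P G \<beta> \<and> (\<forall>a\<in>T. \<forall>p\<in>omap P a. \<beta> a p = \<alpha> a p)" using \<beta>(1) by blast
  next
    fix G \<beta> \<beta>' assume G: "presheaf C G" and \<beta>: "psh_trans C P G \<beta>" "psh_trans C P G \<beta>'"
      and "\<And>a p. a \<in> T \<Longrightarrow> p \<in> omap P a \<Longrightarrow> \<beta> a p = \<beta>' a p"
    then show "\<beta> = \<beta>'" using T by (intro ext_uniq[OF e G \<beta>]) auto
  qed
qed

section \<open>Cofiltered comma categories and pullbacks of small presheaves\<close>

context fl_sub begin

text \<open>With \<open>sub_join\<close> this is the cofilteredness of the category of arrows from
  \<open>a\<close> into \<open>S\<close>: parallel arrows are merged by an equalizer in
  \<open>S\<close>, and two arrows are dominated by one arrow into a product in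
  \<open>S\<close>.\<close>

lemma sub_coequalize:
  assumes "w \<in> S" "s \<in> S" "arr C w s k" "arr C w s k'" "arr C a w l" "Comp C a w s k l = Comp C a w s k' l"
  obtains e i l' where "e \<in> S" "arr C e w i" "arr C a e l'" "l = Comp C a e w i l'" "Comp C e w s k i = Comp C e w s k' i"
proof -
  obtain e i where e: "e \<in> S" "arr C e w i" "Comp C e w s k i = Comp C e w s k' i"
    and ex: "\<And>Q u. arr C Q w u \<Longrightarrow> Comp C Q w s k u = Comp C Q w s k' u \<Longrightarrow> \<exists>h. arr C Q e h \<and> Comp C Q e w i h = u"
    by (rule sub_equalizer[OF assms(1-4)]) blast
  obtain l' where "arr C a e l'" "Comp C a e w i l' = l" using ex[OF assms(5,6)] by blast
  then show ?thesis using that e by metis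
qed

lemma sub_join:
  assumes "s \<in> S" "t \<in> S" "arr C a s h" "arr C a t k"
  obtains w p q l where "w \<in> S" "arr C w s p" "arr C w t q" "arr C a w l" "h = Comp C a w s p l" "k = Comp C a w t q l"
proof -
  obtain w p q where w: "w \<in> S" "arr C w s p" "arr C w t q"
    and ex: "\<And>Q u v. arr C Q s u \<Longrightarrow> arr C Q t v \<Longrightarrow> \<exists>h. arr C Q w h \<and> Comp C Q w s p h = u \<and> Comp C Q w t q h = v"
    by (rule sub_product[OF assms(1,2)]) blast
  obtain l where "arr C a w l" "Comp C a w s p l = h" "Comp C a w t q l = k" using ex[OF assms(3,4)] by blast
  then show ?thesis using that w by metis
qed

end

text \<open>The pointwise colimit \<open>G\<close> of triples is built explicitly. The unit over
  \<open>S\<close> extends to an arrow from \<open>P\<close> to \<open>G\<close>, which sends the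
  restriction of \<open>q\<close> along \<open>h\<close> to the class of the triple. Two
  presentations of one element of \<open>P\<close> therefore have related triples, and this is the
  second clause of \<open>gen_small\<close>.\<close>

lemma ext_small_gen_small:
  fixes P :: "('o, 'u) presheaf"
  assumes U: "set_universe TYPE('u)" and C: "locally_small C" and e: "ext_small C S P" and S: "fl_closed C S"
  shows "gen_small C S P"
proof -
  interpret fl_sub C S using C S by unfold_locales (auto simp: locally_small_def)
  have P: "presheaf C P" and small: "S \<prec> (UNIV :: 'u set)" using e by (simp_all add: ext_small_def)
  define Z where "Z a = (SIGMA s:S. Hom C a s \<times> omap P s)" for a
  define act :: "'o \<Rightarrow> 'o \<Rightarrow> 'u \<Rightarrow> 'o \<times> 'u \<times> 'u \<Rightarrow> 'o \<times> 'u \<times> 'u" where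
    "act a b f = (\<lambda>(s, h, q). (s, Comp C b a s h f, q))" for a b f
  define rel where "rel a s h q s' h' q' \<longleftrightarrow> (\<exists>t\<in>S. \<exists>l k k'. arr C a t l \<and> arr C t s k \<and> arr C t s' k' \<and>
      h = Comp C a t s k l \<and> h' = Comp C a t s' k' l \<and> amap P s t k q = amap P s' t k' q')" for a s h q s' h' q'
  define E where "E a = (\<lambda>(s, h, q) (s', h', q'). rel a s h q s' h' q')" for a
  have Z: "(s, h, q) \<in> Z a \<longleftrightarrow> s \<in> S \<and> arr C a s h \<and> q \<in> omap P s" if "a \<in> Obj C" for a s h q
    using that by (auto simp: Z_def arr_def)
  have rel_refl: "rel a s h q s h q" if "s \<in> S" "arr C a s h" for a s h q
    using that unfolding rel_def by (intro bexI[of _ s] exI[of _ h] exI[of _ "Ident C s"]) auto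
  have rel_sym: "rel a s' h' q' s h q" if "rel a s h q s' h' q'" for a s h q s' h' q'
    using that unfolding rel_def by metis
  have rel_trans: "rel a s h q s'' h'' q''"
    if r: "rel a s h q s' h' q'" "rel a s' h' q' s'' h'' q''" and s: "s' \<in> S" and q: "q \<in> omap P s" "q' \<in> omap P s'" "q'' \<in> omap P s''"
    for a s h q s' h' q' s'' h'' q''
  proof -
    obtain t l k k' where t: "t \<in> S" "arr C a t l" "arr C t s k" "arr C t s' k'"
      "h = Comp C a t s k l" "h' = Comp C a t s' k' l" "amap P s t k q = amap P s' t k' q'"
      using r(1) unfolding rel_def by blast
    obtain t2 l2 k2 k2' where t2: "t2 \<in> S" "arr C a t2 l2" "arr C t2 s' k2" "arr C t2 s'' k2'"
      "h' = Comp C a t2 s' k2 l2" "h'' = Comp C a t2 s'' k2' l2" "amap P s' t2 k2 q' = amap P s'' t2 k2' q''"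
      using r(2) unfolding rel_def by blast
    \<comment> \<open>Two linking spans that share the middle object \<open>s'\<close> are composed
      by a pullback over it, and this pullback stays in \<open>S\<close>.\<close>
    obtain w r1 r2 where w: "w \<in> S" and pb: "is_pullback C w t t2 s' r1 r2 k' k2"
      by (rule sub_pb[OF t(1) t2(1) s t(4) t2(3)])
    note [simp] = t(2,3,4) t2(2,3,4) pb_arr(1,2)[OF pb]
    have "Comp C a t s' k' l = Comp C a t2 s' k2 l2" using t(6) t2(5) by simp
    then obtain l3 where l3 [simp]: "arr C a w l3" "Comp C a w t r1 l3 = l" "Comp C a w t2 r2 l3 = l2"
      by (rule pb_ex[OF pb t(2) t2(2)])
    have "amap P s w (Comp C w t s k r1) q = amap P t w r1 (amap P s' t k' q')"
      using psh_comp[OF P t(3) pb_arr(1)[OF pb] q(1)] t(7) by simp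
    also have "\<dots> = amap P t2 w r2 (amap P s' t2 k2 q')"
      using psh_comp[OF P t(4) pb_arr(1)[OF pb] q(2)] psh_comp[OF P t2(3) pb_arr(2)[OF pb] q(2)] pb_arr(5)[OF pb] by simp
    also have "\<dots> = amap P s'' w (Comp C w t2 s'' k2' r2) q''"
      using psh_comp[OF P t2(4) pb_arr(2)[OF pb] q(3)] t2(7) by simp
    finally show ?thesis
      unfolding rel_def
      by (intro bexI[OF _ w] exI[of _ l3] exI[of _ "Comp C w t s k r1"] exI[of _ "Comp C w t2 s'' k2' r2"])
        (simp add: assoc t(5) t2(6))
  qed
  obtain G :: "('o, 'u) presheaf" and c where G: "presheaf C G" and Gc: "\<And>a. a \<in> Obj C \<Longrightarrow> omap G a = c a ` Z a"
    and cE: "\<And>a z z'. a \<in> Obj C \<Longrightarrow> z \<in> Z a \<Longrightarrow> z' \<in> Z a \<Longrightarrow> c a z = c a z' \<longleftrightarrow> E a z z'"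
    and cn: "\<And>a b f z. arr C b a f \<Longrightarrow> z \<in> Z a \<Longrightarrow> amap G a b f (c a z) = c b (act a b f z)"
  proof (rule presheaf_quotient[OF category, of Z act E])
    show "Z a \<prec> (UNIV :: 'u set)" if "a \<in> Obj C" for a
      unfolding Z_def
      by (rule small_Sigma[OF U small], rule small_Sigma[OF U])
        (use C that psh_small[OF P] sub_obj in \<open>auto simp: locally_small_def\<close>)
    show "act a b f z \<in> Z b" if f: "arr C b a f" and z: "z \<in> Z a" for a b f z
      using z Z[OF arrD(2)[OF f]] Z[OF arrD(1)[OF f]] f by (cases z) (simp add: act_def)
    show "E a z z" if "a \<in> Obj C" "z \<in> Z a" for a z
      using that Z[OF that(1)] rel_refl by (cases z) (simp add: E_def)
    show "E a z' z" if "a \<in> Obj C" "z \<in> Z a" "z' \<in> Z a" "E a z z'" for a z z'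
      using that(4) rel_sym by (cases z, cases z') (simp add: E_def)
    show "E a z z''" if "a \<in> Obj C" "z \<in> Z a" "z' \<in> Z a" "z'' \<in> Z a" "E a z z'" "E a z' z''" for a z z' z''
    proof -
      obtain s h q where z: "z = (s, h, q)" by (cases z)
      obtain s' h' q' where z': "z' = (s', h', q')" by (cases z')
      obtain s'' h'' q'' where z'': "z'' = (s'', h'', q'')" by (cases z'')
      show ?thesis using that Z[OF that(1)] rel_trans[of a s h q s' h' q' s'' h'' q''] by (simp add: z z' z'' E_def)
    qed
    show "E b (act a b f z) (act a b f z')" if f: "arr C b a f" and z: "z \<in> Z a" "z' \<in> Z a" and E: "E a z z'" for a b f z z'
    proof -
      obtain s h q where z: "z = (s, h, q)" by (cases z)
      obtain s' h' q' where z': "z' = (s', h', q')" by (cases z')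
      obtain t l k k' where t: "t \<in> S" "arr C a t l" "arr C t s k" "arr C t s' k'"
        "h = Comp C a t s k l" "h' = Comp C a t s' k' l" "amap P s t k q = amap P s' t k' q'"
        using E unfolding E_def z z' rel_def by auto
      then have "rel b s (Comp C b a s h f) q s' (Comp C b a s' h' f) q'"
        using f unfolding rel_def by (intro bexI[of _ t] exI[of _ "Comp C b a t l f"] exI[of _ k] exI[of _ k']) (auto simp: assoc)
      then show ?thesis by (simp add: E_def act_def z z')
    qed
    show "act a a (Ident C a) z = z" if "a \<in> Obj C" "z \<in> Z a" for a z
      using that(2) Z[OF that(1)] by (cases z) (simp add: act_def)
    show "act b c g (act a b f z) = act a c (Comp C c b a f g) z"
      if f: "arr C b a f" and g: "arr C c b g" and z: "z \<in> Z a" for a b c f g z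
      using z Z[OF arrD(2)[OF f]] f g by (cases z) (simp add: act_def assoc)
  qed blast
  have unit_nat: "c b (b, Ident C b, amap P a b f q) = amap G a b f (c a (a, Ident C a, q))"
    if a: "a \<in> S" and b: "b \<in> S" and f: "f \<in> Hom C b a" and q: "q \<in> omap P a" for a b f q
  proof -
    have f': "arr C b a f" using a b f by (simp add: arr_def)
    have "rel b b (Ident C b) (amap P a b f q) a f q"
      unfolding rel_def
      by (intro bexI[OF _ b] exI[of _ "Ident C b"] exI[of _ f]) (use a b f' psh_id[OF P _ psh_in[OF P f' q]] in simp)
    then have "c b (b, Ident C b, amap P a b f q) = c b (a, f, q)"
      using cE[of b "(b, Ident C b, amap P a b f q)" "(a, f, q)"] a b f' q psh_in[OF P f' q] by (simp add: Z E_def)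
    then show ?thesis using cn[OF f', of "(a, Ident C a, q)"] a b f' q by (simp add: Z act_def)
  qed
  obtain \<beta> where \<beta>: "psh_trans C P G \<beta>" "\<And>a q. a \<in> S \<Longrightarrow> q \<in> omap P a \<Longrightarrow> \<beta> a q = c a (a, Ident C a, q)"
    by (rule ext_ex[OF e G, of "\<lambda>a q. c a (a, Ident C a, q)"]) (use unit_nat in \<open>auto simp: Gc Z\<close>)
  have \<beta>_val: "\<beta> a (amap P s a h q) = c a (s, h, q)" if s: "s \<in> S" and h: "arr C a s h" and q: "q \<in> omap P s" for a s h q
    using tr_nat[OF \<beta>(1) h q] \<beta>(2)[OF s q] cn[OF h, of "(s, Ident C s, q)"] s h q by (simp add: Z act_def)
  show ?thesis
    unfolding gen_small_def
  proof (intro conjI P allI ballI impI; (elim conjE)?)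
    fix a p assume "a \<in> Obj C" "p \<in> omap P a"
    then show "\<exists>s\<in>S. \<exists>q\<in>omap P s. \<exists>h. arr C a s h \<and> p = amap P s a h q"
      using ext_small_gen[OF e category] by metis
  next
    fix a s s' q q' h h' assume s: "s \<in> S" "s' \<in> S" and q: "q \<in> omap P s" "q' \<in> omap P s'"
      and h: "arr C a s h" "arr C a s' h'" and eq: "amap P s a h q = amap P s' a h' q'"
    have "c a (s, h, q) = c a (s', h', q')"
      using \<beta>_val[OF s(1) h(1) q(1)] \<beta>_val[OF s(2) h(2) q(2)] eq by simp
    then have "rel a s h q s' h' q'"
      using cE[of a "(s, h, q)" "(s', h', q')"] s q h arrD(1)[OF h(1)] by (simp add: Z E_def)
    then show "\<exists>t\<in>S. \<exists>l k k'. arr C a t l \<and> arr C t s k \<and> arr C t s' k' \<and> h = Comp C a t s k l \<and>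
      h' = Comp C a t s' k' l \<and> amap P s t k q = amap P s' t k' q'" by (simp only: rel_def)
  qed
qed

text \<open>Filtered colimits commute with finite limits in sets. An element of the pullback, or an
  equality of two elements, is first presented coordinatewise over \<open>S\<close>; joins and
  equalizers in \<open>S\<close> then bring the presentations to a common stage at which both
  coordinates are compatible.\<close>

lemma gen_small_pullback:
  fixes C :: "('o, 'u) cat"
  assumes C: "category C" and S: "fl_closed C S"
    and g: "gen_small C S P" "gen_small C S Q" "gen_small C S R"
    and pb: "pw_pullback C T P Q R p q u v"
  shows "gen_small C S T"
proof -
  interpret fl_sub C S using C S by unfold_locales
  have D: "presheaf C T" "presheaf C P" "presheaf C Q" "presheaf C R"
     "psh_trans C T P p" "psh_trans C T Q q" "psh_trans C P R u" "psh_trans C Q R v"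
    and e: "\<And>a t. a \<in> Obj C \<Longrightarrow> t \<in> omap T a \<Longrightarrow> u a (p a t) = v a (q a t)"
    and ex: "\<And>a x y. a \<in> Obj C \<Longrightarrow> x \<in> omap P a \<Longrightarrow> y \<in> omap Q a \<Longrightarrow> u a x = v a y \<Longrightarrow> \<exists>t\<in>omap T a. p a t = x \<and> q a t = y"
    and un: "\<And>a t t'. a \<in> Obj C \<Longrightarrow> t \<in> omap T a \<Longrightarrow> t' \<in> omap T a \<Longrightarrow> p a t = p a t' \<Longrightarrow> q a t = q a t' \<Longrightarrow> t = t'"
    using pb unfolding pw_pullback_def by simp_all
  show ?thesis
    unfolding gen_small_def
  proof (intro conjI D(1) ballI allI impI; (elim conjE)?)
    fix a t assume a: "a \<in> Obj C" and t: "t \<in> omap T a"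
    obtain s1 x h1 where s1: "s1 \<in> S" "x \<in> omap P s1" "arr C a s1 h1" "p a t = amap P s1 a h1 x"
      by (rule gen_small_gen[OF g(1) a tr_in[OF D(5) a t]])
    obtain s2 y h2 where s2: "s2 \<in> S" "y \<in> omap Q s2" "arr C a s2 h2" "q a t = amap Q s2 a h2 y"
      by (rule gen_small_gen[OF g(2) a tr_in[OF D(6) a t]])
    obtain s r1 r2 h where s: "s \<in> S" "arr C s s1 r1" "arr C s s2 r2" "arr C a s h"
      "h1 = Comp C a s s1 r1 h" "h2 = Comp C a s s2 r2 h"
      by (rule sub_join[OF s1(1) s2(1) s1(3) s2(3)])
    note so = sub_obj[OF s(1)]
    define x' where "x' = amap P s1 s r1 x"
    define y' where "y' = amap Q s2 s r2 y"
    have x': "x' \<in> omap P s" "p a t = amap P s a h x'"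
      using psh_in[OF D(2) s(2) s1(2)] psh_comp[OF D(2) s(2,4) s1(2)] s1(4) s(5) by (simp_all add: x'_def)
    have y': "y' \<in> omap Q s" "q a t = amap Q s a h y'"
      using psh_in[OF D(3) s(3) s2(2)] psh_comp[OF D(3) s(3,4) s2(2)] s2(4) s(6) by (simp_all add: y'_def)
    note ux = tr_in[OF D(7) so x'(1)] and vy = tr_in[OF D(8) so y'(1)]
    have "amap R s a h (u s x') = amap R s a h (v s y')"
      using e[OF a t] tr_nat[OF D(7) s(4) x'(1)] tr_nat[OF D(8) s(4) y'(1)] x' y' by simp
    then obtain w l k k' where w: "w \<in> S" "arr C a w l" "arr C w s k" "arr C w s k'"
      "h = Comp C a w s k l" "h = Comp C a w s k' l" "amap R s w k (u s x') = amap R s w k' (v s y')"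
      by (rule gen_small_rel[OF g(3) s(1) s(1) ux vy s(4) s(4)])
    \<comment> \<open>The link in \<open>R\<close> may compare the two coordinates along different
      arrows \<open>k\<close> and \<open>k'\<close>. Both give back \<open>h\<close> after
      \<open>l\<close>, so an equalizer merges them while \<open>h\<close> still factors through
      it.\<close>
    have "Comp C a w s k l = Comp C a w s k' l" using w(5,6) by simp
    then obtain z i l' where z: "z \<in> S" "arr C z w i" "arr C a z l'" "l = Comp C a z w i l'"
      "Comp C z w s k i = Comp C z w s k' i"
      by (rule sub_coequalize[OF w(1) s(1) w(3,4,2)])
    note zo = sub_obj[OF z(1)]
    define k0 where "k0 = Comp C z w s k i"
    have k0: "arr C z s k0" and h: "h = Comp C a z s k0 l'"
      using w z by (simp_all add: k0_def assoc)
    have "amap R s z k0 (u s x') = amap R s z k0 (v s y')"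
      using psh_comp[OF D(4) w(3) z(2) ux] psh_comp[OF D(4) w(4) z(2) vy] w(7) z(5) by (simp add: k0_def)
    then have "u z (amap P s z k0 x') = v z (amap Q s z k0 y')"
      using tr_nat[OF D(7) k0 x'(1)] tr_nat[OF D(8) k0 y'(1)] by simp
    then obtain t0 where t0: "t0 \<in> omap T z" "p z t0 = amap P s z k0 x'" "q z t0 = amap Q s z k0 y'"
      using ex[OF zo psh_in[OF D(2) k0 x'(1)] psh_in[OF D(3) k0 y'(1)]] by blast
    have "t = amap T z a l' t0"
    proof (rule un[OF a t psh_in[OF D(1) z(3) t0(1)]])
      show "p a t = p a (amap T z a l' t0)"
        using tr_nat[OF D(5) z(3) t0(1)] t0(2) psh_comp[OF D(2) k0 z(3) x'(1)] x'(2) h by simp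
      show "q a t = q a (amap T z a l' t0)"
        using tr_nat[OF D(6) z(3) t0(1)] t0(3) psh_comp[OF D(3) k0 z(3) y'(1)] y'(2) h by simp
    qed
    then show "\<exists>s\<in>S. \<exists>q\<in>omap T s. \<exists>h. arr C a s h \<and> t = amap T s a h q"
      using z t0 by blast
  next
    fix a s s' t t' h h' assume s: "s \<in> S" and s': "s' \<in> S" and t: "t \<in> omap T s" and t': "t' \<in> omap T s'"
      and h: "arr C a s h" and h': "arr C a s' h'" and eq: "amap T s a h t = amap T s' a h' t'"
    note so = sub_obj[OF s] and so' = sub_obj[OF s']
    note pt = tr_in[OF D(5) so t] tr_in[OF D(5) so' t'] and qt = tr_in[OF D(6) so t] tr_in[OF D(6) so' t']
    have "amap P s a h (p s t) = amap P s' a h' (p s' t')"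
      using tr_nat[OF D(5) h t] tr_nat[OF D(5) h' t'] eq by simp
    then obtain w1 l1 k1 k1' where w1: "w1 \<in> S" "arr C a w1 l1" "arr C w1 s k1" "arr C w1 s' k1'"
      "h = Comp C a w1 s k1 l1" "h' = Comp C a w1 s' k1' l1" "amap P s w1 k1 (p s t) = amap P s' w1 k1' (p s' t')"
      by (rule gen_small_rel[OF g(1) s s' pt h h'])
    have "amap Q s a h (q s t) = amap Q s' a h' (q s' t')"
      using tr_nat[OF D(6) h t] tr_nat[OF D(6) h' t'] eq by simp
    then obtain w2 l2 k2 k2' where w2: "w2 \<in> S" "arr C a w2 l2" "arr C w2 s k2" "arr C w2 s' k2'"
      "h = Comp C a w2 s k2 l2" "h' = Comp C a w2 s' k2' l2" "amap Q s w2 k2 (q s t) = amap Q s' w2 k2' (q s' t')"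
      by (rule gen_small_rel[OF g(2) s s' qt h h'])
    \<comment> \<open>The links found for the two coordinates are joined, and two successive
      equalizers make the arrows to \<open>s\<close>, and then those to \<open>s'\<close>,
      coincide.\<close>
    obtain w n1 n2 l where w: "w \<in> S" "arr C w w1 n1" "arr C w w2 n2" "arr C a w l"
      "l1 = Comp C a w w1 n1 l" "l2 = Comp C a w w2 n2 l"
      by (rule sub_join[OF w1(1) w2(1) w1(2) w2(2)])
    have "Comp C a w s (Comp C w w1 s k1 n1) l = Comp C a w s (Comp C w w2 s k2 n2) l"
      using w w1 w2 by (simp add: assoc)
    then obtain z1 i1 m1 where z1: "z1 \<in> S" "arr C z1 w i1" "arr C a z1 m1" "l = Comp C a z1 w i1 m1"
      "Comp C z1 w s (Comp C w w1 s k1 n1) i1 = Comp C z1 w s (Comp C w w2 s k2 n2) i1"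
      by (rule sub_coequalize[OF w(1) s _ _ w(4), rotated 2]) (use w w1 w2 in auto)
    have "Comp C a w s' (Comp C w w1 s' k1' n1) l = Comp C a w s' (Comp C w w2 s' k2' n2) l"
      using w w1 w2 by (simp add: assoc)
    then have "Comp C a z1 s' (Comp C z1 w s' (Comp C w w1 s' k1' n1) i1) m1 =
        Comp C a z1 s' (Comp C z1 w s' (Comp C w w2 s' k2' n2) i1) m1"
      using w w1 w2 z1 by (simp add: assoc)
    then obtain z i m where z: "z \<in> S" "arr C z z1 i" "arr C a z m" "m1 = Comp C a z z1 i m"
      "Comp C z z1 s' (Comp C z1 w s' (Comp C w w1 s' k1' n1) i1) i = Comp C z z1 s' (Comp C z1 w s' (Comp C w w2 s' k2' n2) i1) i"
      by (rule sub_coequalize[OF z1(1) s' _ _ z1(3), rotated 2]) (use w w1 w2 z1 in auto)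
    define r where "r = Comp C z z1 w i1 i"
    define r1 where "r1 = Comp C z w w1 n1 r"
    define r2 where "r2 = Comp C z w w2 n2 r"
    note [simp] = w(2,3) z(2) z1(2) w1(2,3,4) w2(2,3,4) w(4) z1(3) z(3)
    have r [simp]: "arr C z w r" "arr C z w1 r1" "arr C z w2 r2" by (simp_all add: r_def r1_def r2_def)
    define k where "k = Comp C z w1 s k1 r1"
    define k' where "k' = Comp C z w1 s' k1' r1"
    have k: "arr C z s k" "arr C z s' k'" by (simp_all add: k_def k'_def)
    have k2: "k = Comp C z w2 s k2 r2"
      using arg_cong[OF z1(5), of "\<lambda>y. Comp C z z1 s y i"] by (simp add: k_def r1_def r2_def r_def assoc)
    have k2': "k' = Comp C z w2 s' k2' r2"
      using z(5) by (simp add: k'_def r1_def r2_def r_def assoc)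
    have hk: "h = Comp C a z s k m" "h' = Comp C a z s' k' m"
      using w1(5,6) w(5) z1(4) z(4) by (simp_all add: k_def k'_def r1_def r_def assoc)
    have "amap T s z k t = amap T s' z k' t'"
    proof (rule un[OF sub_obj[OF z(1)] psh_in[OF D(1) k(1) t] psh_in[OF D(1) k(2) t']])
      have "amap P s z k (p s t) = amap P s' z k' (p s' t')"
        using psh_comp[OF D(2) w1(3) r(2) pt(1)] psh_comp[OF D(2) w1(4) r(2) pt(2)] w1(7) by (simp add: k_def k'_def)
      then show "p z (amap T s z k t) = p z (amap T s' z k' t')"
        using tr_nat[OF D(5) k(1) t] tr_nat[OF D(5) k(2) t'] by simp
      have "amap Q s z k (q s t) = amap Q s' z k' (q s' t')"
        using psh_comp[OF D(3) w2(3) r(3) qt(1)] psh_comp[OF D(3) w2(4) r(3) qt(2)] w2(7) by (simp add: k2 k2')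
      then show "q z (amap T s z k t) = q z (amap T s' z k' t')"
        using tr_nat[OF D(6) k(1) t] tr_nat[OF D(6) k(2) t'] by simp
    qed
    then show "\<exists>z\<in>S. \<exists>l k k'. arr C a z l \<and> arr C z s k \<and> arr C z s' k' \<and> h = Comp C a z s k l \<and>
      h' = Comp C a z s' k' l \<and> amap T s z k t = amap T s' z k' t'"
      using z(1,3) k hk by blast
  qed
qed

text \<open>Left Kan extension commutes with colimits: a transformation over \<open>S\<close> is
  extended along both coprojections, the extensions agree on \<open>R\<close> by uniqueness there,
  and the pushout assembles them.\<close>

lemma ext_small_pushout:
  fixes P :: "('o, 'u) presheaf"
  assumes e: "ext_small C S R" "ext_small C S P" "ext_small C S Q"
    and po: "pw_pushout C R P Q T \<alpha> \<beta> i j"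
  shows "ext_small C S T"
proof -
  note D = pw_pushoutD[OF po]
  have S: "S \<subseteq> Obj C" "S \<prec> (UNIV :: 'u set)" using e by (simp_all add: ext_small_def)
  have o: "a \<in> Obj C" if "a \<in> S" for a using that S by blast
  show ?thesis
  proof (rule ext_smallI[OF D(4) S])
    fix G t assume G: "presheaf C G" and t_in: "\<And>a x. a \<in> S \<Longrightarrow> x \<in> omap T a \<Longrightarrow> t a x \<in> omap G a"
      and t_nat: "\<And>a b f x. a \<in> S \<Longrightarrow> b \<in> S \<Longrightarrow> f \<in> Hom C b a \<Longrightarrow> x \<in> omap T a \<Longrightarrow> t b (amap T a b f x) = amap G a b f (t a x)"
    have P: "\<exists>u. psh_trans C P G u \<and> (\<forall>a\<in>S. \<forall>x\<in>omap P a. u a x = t a (i a x))"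
    proof (rule ext_ex[OF e(2) G, of "\<lambda>a x. t a (i a x)"])
      show "t a (i a x) \<in> omap G a" if "a \<in> S" "x \<in> omap P a" for a x
        by (rule t_in[OF that(1) tr_in[OF D(7) o[OF that(1)] that(2)]])
      show "t b (i b (amap P a b f x)) = amap G a b f (t a (i a x))"
        if "a \<in> S" "b \<in> S" "f \<in> Hom C b a" "x \<in> omap P a" for a b f x
        using t_nat[OF that(1-3) tr_in[OF D(7) o[OF that(1)] that(4)]] tr_nat[OF D(7), of b a f x] that o by (simp add: arr_def)
    qed blast
    have Q: "\<exists>u. psh_trans C Q G u \<and> (\<forall>a\<in>S. \<forall>x\<in>omap Q a. u a x = t a (j a x))"
    proof (rule ext_ex[OF e(3) G, of "\<lambda>a x. t a (j a x)"])
      show "t a (j a x) \<in> omap G a" if "a \<in> S" "x \<in> omap Q a" for a x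
        by (rule t_in[OF that(1) tr_in[OF D(8) o[OF that(1)] that(2)]])
      show "t b (j b (amap Q a b f x)) = amap G a b f (t a (j a x))"
        if "a \<in> S" "b \<in> S" "f \<in> Hom C b a" "x \<in> omap Q a" for a b f x
        using t_nat[OF that(1-3) tr_in[OF D(8) o[OF that(1)] that(4)]] tr_nat[OF D(8), of b a f x] that o by (simp add: arr_def)
    qed blast
    obtain u where u: "psh_trans C P G u" "\<And>a x. a \<in> S \<Longrightarrow> x \<in> omap P a \<Longrightarrow> u a x = t a (i a x)" using P by blast
    obtain v where v: "psh_trans C Q G v" "\<And>a x. a \<in> S \<Longrightarrow> x \<in> omap Q a \<Longrightarrow> v a x = t a (j a x)" using Q by blast
    have "Comp (presheaf_cat C) R P G u \<alpha> = Comp (presheaf_cat C) R Q G v \<beta>"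
    proof (rule ext_uniq[OF e(1) G tr_comp[OF D(1,5) u(1)] tr_comp[OF D(1,6) v(1)]])
      fix a r assume a: "a \<in> S" and r: "r \<in> omap R a"
      show "Comp (presheaf_cat C) R P G u \<alpha> a r = Comp (presheaf_cat C) R Q G v \<beta> a r"
        using u(2)[OF a tr_in[OF D(5) o[OF a] r]] v(2)[OF a tr_in[OF D(6) o[OF a] r]] D(9)[OF o[OF a] r] o[OF a] r
        by (simp add: presheaf_cat_Comp)
    qed
    note uv = presheaf_comp_eqD[OF this]
    obtain h where h: "psh_trans C T G h" "\<And>a p. a \<in> Obj C \<Longrightarrow> p \<in> omap P a \<Longrightarrow> h a (i a p) = u a p"
      "\<And>a p. a \<in> Obj C \<Longrightarrow> p \<in> omap Q a \<Longrightarrow> h a (j a p) = v a p"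
      by (rule pw_pushout_desc[OF po G tr_in[OF u(1)] tr_nat[OF u(1)] tr_in[OF v(1)] tr_nat[OF v(1)] uv]) auto
    have "h a x = t a x" if a: "a \<in> S" and x: "x \<in> omap T a" for a x
      by (rule pw_pushout_cases[OF po o[OF a] x]) (use h u(2)[OF a] v(2)[OF a] o[OF a] in auto)
    then show "\<exists>h. psh_trans C T G h \<and> (\<forall>a\<in>S. \<forall>x\<in>omap T a. h a x = t a x)" using h(1) by blast
  next
    fix G h h' assume G: "presheaf C G" and h: "psh_trans C T G h" "psh_trans C T G h'"
      and eq: "\<And>a x. a \<in> S \<Longrightarrow> x \<in> omap T a \<Longrightarrow> h a x = h' a x"
    have P: "Comp (presheaf_cat C) P T G h i = Comp (presheaf_cat C) P T G h' i"
      by (rule ext_uniq[OF e(2) G tr_comp[OF D(2,7) h(1)] tr_comp[OF D(2,7) h(2)]])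
        (use eq tr_in[OF D(7) o] o in \<open>simp add: presheaf_cat_Comp\<close>)
    have Q: "Comp (presheaf_cat C) Q T G h j = Comp (presheaf_cat C) Q T G h' j"
      by (rule ext_uniq[OF e(3) G tr_comp[OF D(3,8) h(1)] tr_comp[OF D(3,8) h(2)]])
        (use eq tr_in[OF D(8) o] o in \<open>simp add: presheaf_cat_Comp\<close>)
    show "h = h'"
      by (rule pw_pushout_ext[OF po h presheaf_comp_eqD[OF P] presheaf_comp_eqD[OF Q]])
  qed
qed

section \<open>The category of small presheaves\<close>

context lfc_cat begin

abbreviation "small \<equiv> {P. small_presheaf C P}"

lemma small_presheaf_cat_psh: "small_presheaf_cat C = psh small"
  by (simp add: small_presheaf_cat_def)

lemma small_is_presheaf: "small_presheaf C P \<Longrightarrow> presheaf C P"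
  by (simp add: small_presheaf_def)

lemma small_rep: "c \<in> Obj C \<Longrightarrow> small_presheaf C (rep c)"
proof -
  assume c: "c \<in> Obj C"
  have "ext_small C {c} (rep c)"
  proof (rule ext_smallI)
    show "{c} \<prec> (UNIV :: 'u set)" by (rule small_finite[OF U]) simp
    fix G \<alpha> assume G: "presheaf C G" and \<alpha>: "\<And>a p. a \<in> {c} \<Longrightarrow> p \<in> omap (rep c) a \<Longrightarrow> \<alpha> a p \<in> omap G a"
      "\<And>a b f p. a \<in> {c} \<Longrightarrow> b \<in> {c} \<Longrightarrow> f \<in> Hom C b a \<Longrightarrow> p \<in> omap (rep c) a \<Longrightarrow> \<alpha> b (amap (rep c) a b f p) = amap G a b f (\<alpha> a p)"
    have i: "Ident C c \<in> Hom C c c" using arr_id[OF c] by (simp add: arr_def)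
    have "elt G c (\<alpha> c (Ident C c)) c p = \<alpha> c p" if p: "p \<in> Hom C c c" for p
      using \<alpha>(2)[of c c p "Ident C c"] i p c by (simp add: Hom_arr)
    then show "\<exists>\<beta>. psh_trans C (rep c) G \<beta> \<and> (\<forall>a\<in>{c}. \<forall>p\<in>omap (rep c) a. \<beta> a p = \<alpha> a p)"
      using trans_elt[OF G c \<alpha>(1)[of c "Ident C c"]] i by (intro exI[of _ "elt G c (\<alpha> c (Ident C c))"]) simp
  next
    fix G \<beta> \<beta>' assume "psh_trans C (rep c) G \<beta>" "psh_trans C (rep c) G \<beta>'"
      and "\<And>a p. a \<in> {c} \<Longrightarrow> p \<in> omap (rep c) a \<Longrightarrow> \<beta> a p = \<beta>' a p"
    then show "\<beta> = \<beta>'" using arr_id[OF c] c by (intro tr_rep_eqI[of c G \<beta> \<beta>']) (auto simp: arr_def)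
  qed (use c in auto)
  then show ?thesis unfolding small_presheaf_iff[OF category] by blast
qed

lemma small_common:
  assumes "small_presheaf C P" "small_presheaf C Q" "small_presheaf C R"
  obtains S where "fl_closed C S" "ext_small C S P" "ext_small C S Q" "ext_small C S R"
proof -
  obtain S1 S2 S3 where S: "ext_small C S1 P" "ext_small C S2 Q" "ext_small C S3 R"
    using assms unfolding small_presheaf_iff[OF category] by blast
  have "S1 \<union> (S2 \<union> S3) \<prec> (UNIV :: 'u set)" "S1 \<union> (S2 \<union> S3) \<subseteq> Obj C"
    using S by (auto simp: ext_small_def intro!: small_Un[OF U])
  then obtain T where T: "S1 \<union> (S2 \<union> S3) \<subseteq> T" "T \<prec> (UNIV :: 'u set)" "fl_closed C T"
    using small_fl_hull[OF U ls lfc] by blast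
  have "T \<subseteq> Obj C" using T(3) by (simp add: fl_closed_def)
  then show ?thesis
    using that[OF T(3)] T(1,2) ext_small_mono[OF S(1) category] ext_small_mono[OF S(2) category] ext_small_mono[OF S(3) category]
    by simp
qed

lemma small_pushout:
  assumes "small_presheaf C R" "small_presheaf C P" "small_presheaf C Q" "pw_pushout C R P Q T \<alpha> \<beta> i j"
  shows "small_presheaf C T"
proof -
  obtain S where "ext_small C S R" "ext_small C S P" "ext_small C S Q" by (rule small_common[OF assms(1-3)])
  then have "ext_small C S T" using ext_small_pushout assms(4) by blast
  then show ?thesis unfolding small_presheaf_iff[OF category] by blast
qed

text \<open>A common generating set closed under finite limits allows a change between the two forms
  of smallness: \<open>gen_small\<close> handles the pullback, and the result is read back as an
  extension property.\<close>

lemma small_pullback: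
  assumes "small_presheaf C P" "small_presheaf C Q" "small_presheaf C R" "pw_pullback C T P Q R p q u v"
  shows "small_presheaf C T"
proof -
  obtain S where S: "fl_closed C S" "ext_small C S P" "ext_small C S Q" "ext_small C S R"
    by (rule small_common[OF assms(1-3)])
  have "gen_small C S T"
    by (rule gen_small_pullback[OF category S(1) _ _ _ assms(4)]; rule ext_small_gen_small[OF U ls _ S(1)]) (use S in simp_all)
  then have "ext_small C S T"
    using S(2) by (intro gen_small_ext_small[OF _ category]) (auto simp: ext_small_def)
  then show ?thesis unfolding small_presheaf_iff[OF category] by blast
qed

text \<open>Finite limits reduce to a terminal object and pullbacks. The representable at a terminal
  object of \<open>C\<close> is terminal, and pointwise pullbacks stay small.\<close>

lemma finitely_complete_small: "finitely_complete (psh small)"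
proof -
  have "fl_closed (psh small) (Obj (psh small))"
    unfolding fl_closed_def
  proof (intro conjI ballI allI impI subset_refl)
    obtain t where t: "t \<in> Obj C" "\<And>y. y \<in> Obj C \<Longrightarrow> \<exists>!h. h \<in> Hom C y t" using terminal_ex by blast
    define th where "th y = (THE h. h \<in> Hom C y t)" for y
    have th: "th y \<in> Hom C y t" "h \<in> Hom C y t \<Longrightarrow> h = th y" if "y \<in> Obj C" for y h
      using theI'[OF t(2)[OF that]] t(2)[OF that] unfolding th_def by blast+
    show "\<exists>t\<in>Obj (psh small). \<forall>y\<in>Obj (psh small). \<exists>!h. h \<in> Hom (psh small) y t"
    proof (intro bexI[of _ "rep t"] ballI)
      show "rep t \<in> Obj (psh small)" using t(1) small_rep by simp
      fix P assume "P \<in> Obj (psh small)"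
      then have P: "presheaf C P" by simp
      have tr: "psh_trans C P (rep t) (mk_tr C P (\<lambda>a p. th a))"
      proof (rule mk_trI[OF P])
        show "th a \<in> omap (rep t) a" if "a \<in> Obj C" for a using th that by simp
        show "th b = amap (rep t) a b f (th a)" if f: "arr C b a f" for a b f
        proof -
          have "arr C a t (th a)" using th(1) arrD(2)[OF f] t(1) by (simp add: arr_def)
          then have "arr C b t (Comp C b a t (th a) f)" using f by simp
          then show ?thesis using th(2)[OF arrD(1)[OF f] arrD(3)] th(1)[OF arrD(2)[OF f]] by simp
        qed
      qed
      show "\<exists>!h. h \<in> Hom (psh small) P (rep t)"
      proof (rule ex1I[of _ "mk_tr C P (\<lambda>a p. th a)"])
        show "mk_tr C P (\<lambda>a p. th a) \<in> Hom (psh small) P (rep t)" using tr by simp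
        fix h assume "h \<in> Hom (psh small) P (rep t)"
        then have h: "psh_trans C P (rep t) h" by simp
        show "h = mk_tr C P (\<lambda>a p. th a)"
          by (rule tr_eqI[OF h tr]) (use tr_in[OF h] th(2) in simp)
      qed
    qed
  next
    fix P Q R u v assume o: "P \<in> Obj (psh small)" "Q \<in> Obj (psh small)" "R \<in> Obj (psh small)"
      and uv: "arr (psh small) P R u \<and> arr (psh small) Q R v"
    have P: "presheaf C P" "presheaf C Q" "presheaf C R" and uv': "psh_trans C P R u" "psh_trans C Q R v"
      using uv by (simp_all add: arr_psh)
    obtain T p q where T: "pw_pullback C T P Q R p q u v"
      by (rule pw_pullback_ex[OF U category P uv'])
    have small_T: "small_presheaf C T" by (rule small_pullback[OF _ _ _ T]) (use o in simp_all)
    have "is_pullback (psh small) T P Q R p q u v"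
      by (rule pw_pullback_is_pullback[OF T]) (use o small_T in simp_all)
    then show "\<exists>T\<in>Obj (psh small). \<exists>p q. is_pullback (psh small) T P Q R p q u v"
      by (intro bexI[OF _ pb_obj(1)] exI)
  qed
  then interpret E: fl_sub "psh small" "Obj (psh small)"
    by unfold_locales (rule category_psh)
  show ?thesis by (rule E.sub_finitely_complete) simp
qed

end

section \<open>Limits in full subcategories and uniqueness of weighted colimits\<close>

lemma cone_full_subcat:
  "is_cone J (full_subcat E S) D x \<pi> \<longleftrightarrow> x \<in> S \<and> is_cone J E D x \<pi>"
  by (auto simp: is_cone_def)

lemma limit_full_subcat:
  "is_limit J E D x \<pi> \<Longrightarrow> x \<in> S \<Longrightarrow> is_limit J (full_subcat E S) D x \<pi>"
  by (simp add: is_limit_def cone_full_subcat)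

lemma functor_full_subcat:
  "category E \<Longrightarrow> is_functor J (full_subcat E S) D \<longleftrightarrow> is_functor J E D \<and> (\<forall>j\<in>Obj J. omap D j \<in> S)"
  by (auto simp: is_functor_def category_full_subcat)

lemma finitely_complete_full_subcat:
  assumes E: "finitely_complete E" and S: "closed_under_finite_limits E S"
  shows "finitely_complete (full_subcat E S)"
  unfolding finitely_complete_def
proof (intro conjI allI impI)
  have cat: "category E" using E by (simp add: finitely_complete_def)
  show "category (full_subcat E S)" by (rule category_full_subcat[OF cat])
  fix J :: "(nat, nat) cat" and D assume a: "finite_category J \<and> is_functor J (full_subcat E S) D"
  then have D: "is_functor J E D" "\<forall>j\<in>Obj J. omap D j \<in> S" by (simp_all add: functor_full_subcat[OF cat])
  obtain x \<pi> where x: "is_limit J E D x \<pi>"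
    using E[unfolded finitely_complete_def, THEN conjunct2, THEN spec, of J, THEN spec, of D] a D(1) by blast
  have "x \<in> S"
    using S[unfolded closed_under_finite_limits_def, THEN spec, of J, THEN spec, of D, THEN spec, of x, THEN spec, of \<pi>]
      a D x by blast
  then show "\<exists>x \<pi>. is_limit J (full_subcat E S) D x \<pi>" using limit_full_subcat[OF x] by blast
qed

text \<open>\<open>closed_under_lex_colimits\<close> speaks of an arbitrary weighted colimit, while
  membership is established for the one built from a pushout; repleteness bridges the two along this
  isomorphism.\<close>

lemma weighted_colimit_iso:
  assumes E: "category E" and D: "is_functor K E D"
    and x: "is_weighted_colimit K \<phi> E D x \<gamma>" and y: "is_weighted_colimit K \<phi> E D y \<delta>"
  shows "\<exists>i. is_iso E x y i"
proof -
  interpret cat E by unfold_locales fact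
  have o: "x \<in> Obj E" "y \<in> Obj E" using x y by (auto simp: is_weighted_colimit_def weighted_cocone_def)
  have c: "arr E (omap D k) x (\<gamma> k s)" "arr E (omap D k) y (\<delta> k s)" if "k \<in> Obj K" "s \<in> omap \<phi> k" for k s
    using x y that functor_obj[OF D] o by (auto simp: is_weighted_colimit_def weighted_cocone_def arr_def)
  have hx: "\<exists>!h. h \<in> Hom E x z \<and> (\<forall>k\<in>Obj K. \<forall>s\<in>omap \<phi> k. Comp E (omap D k) x z h (\<gamma> k s) = \<zeta> k s)"
    if "weighted_cocone K \<phi> E D z \<zeta>" for z \<zeta> using x that by (simp add: is_weighted_colimit_def)
  have hy: "\<exists>!h. h \<in> Hom E y z \<and> (\<forall>k\<in>Obj K. \<forall>s\<in>omap \<phi> k. Comp E (omap D k) y z h (\<delta> k s) = \<zeta> k s)"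
    if "weighted_cocone K \<phi> E D z \<zeta>" for z \<zeta> using y that by (simp add: is_weighted_colimit_def)
  have cx: "weighted_cocone K \<phi> E D x \<gamma>" and cy: "weighted_cocone K \<phi> E D y \<delta>"
    using x y by (simp_all add: is_weighted_colimit_def)
  obtain f where f: "f \<in> Hom E x y" "\<And>k s. k \<in> Obj K \<Longrightarrow> s \<in> omap \<phi> k \<Longrightarrow> Comp E (omap D k) x y f (\<gamma> k s) = \<delta> k s"
    using hx[OF cy] by blast
  obtain g where g: "g \<in> Hom E y x" "\<And>k s. k \<in> Obj K \<Longrightarrow> s \<in> omap \<phi> k \<Longrightarrow> Comp E (omap D k) y x g (\<delta> k s) = \<gamma> k s"
    using hy[OF cx] by blast
  have fg [simp]: "arr E x y f" "arr E y x g" using f(1) g(1) o by (simp_all add: arr_def)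
  have "Comp E x y x g f = Ident E x"
  proof -
    have "Comp E x y x g f \<in> Hom E x x" "Ident E x \<in> Hom E x x"
      using arrD(3)[OF arr_comp[OF fg]] arrD(3)[OF arr_id[OF o(1)]] by simp_all
    moreover have "Comp E (omap D k) x x (Comp E x y x g f) (\<gamma> k s) = \<gamma> k s" "Comp E (omap D k) x x (Ident E x) (\<gamma> k s) = \<gamma> k s"
      if "k \<in> Obj K" "s \<in> omap \<phi> k" for k s
      using c[OF that] f(2)[OF that] g(2)[OF that] by (simp_all add: assoc)
    ultimately show ?thesis using hx[OF cx] by blast
  qed
  moreover have "Comp E y x y f g = Ident E y"
  proof -
    have "Comp E y x y f g \<in> Hom E y y" "Ident E y \<in> Hom E y y"
      using arrD(3)[OF arr_comp[OF fg(2,1)]] arrD(3)[OF arr_id[OF o(2)]] by simp_all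
    moreover have "Comp E (omap D k) y y (Comp E y x y f g) (\<delta> k s) = \<delta> k s" "Comp E (omap D k) y y (Ident E y) (\<delta> k s) = \<delta> k s"
      if "k \<in> Obj K" "s \<in> omap \<phi> k" for k s
      using c[OF that] f(2)[OF that] g(2)[OF that] by (simp_all add: assoc)
    ultimately show ?thesis using hy[OF cy] by blast
  qed
  ultimately show ?thesis using f(1) g(1) unfolding is_iso_def by blast
qed

text \<open>
  By the Yoneda lemma, cocones weighted by a pushout of representables are cocones under the
  image of the span.
\<close>

lemma (in lfc_cat) weighted_colimit_of_pushout:
  assumes m: "arr C X A m" and f: "arr C X B f"
    and pw: "pw_pushout C (rep X) (rep A) (rep B) \<phi> (yo X A m) (yo X B f) i j"
    and D: "is_functor C E D"
    and po: "is_pushout E (omap D X) (omap D A) (omap D B) x (amap D X A m) (amap D X B f) g n"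
  shows "\<exists>\<gamma>. is_weighted_colimit C \<phi> E D x \<gamma>"
proof -
  interpret E: cat E using functor_cat(2)[OF D] by unfold_locales
  note P = pw_pushoutD[OF pw]
  note o [simp] = arrD(1,2)[OF m] arrD(2)[OF f]
  note [simp] = po_arr(3,4)[OF po] functor_arr[OF D]
  note D_comp = functor_comp[OF D]
  have ij: "i a (Comp C a X A m r) = j a (Comp C a X B f r)" if "arr C a X r" for a r
    using P(9)[OF arrD(1)[OF that], of r] that by (simp add: arr_def)
  have i_nat: "amap \<phi> a b h (i a u) = i b (Comp C b a A u h)" if "arr C b a h" "arr C a A u" for a b h u
    using tr_nat[OF P(7) that(1), of u] arrD(3)[OF that(2)] by simp
  have j_nat: "amap \<phi> a b h (j a u) = j b (Comp C b a B u h)" if "arr C b a h" "arr C a B u" for a b h u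
    using tr_nat[OF P(8) that(1), of u] arrD(3)[OF that(2)] by simp
  have iA: "i A (Ident C A) \<in> omap \<phi> A" and jB: "j B (Ident C B) \<in> omap \<phi> B"
    using tr_in[OF P(7), of A] tr_in[OF P(8), of B] arrD(3)[OF arr_id] by simp_all
  \<comment> \<open>An element of the weight over \<open>k\<close> comes from an arrow to
    \<open>A\<close> or to \<open>B\<close>. The cocone applies \<open>D\<close> to this arrow and
    continues with the coprojection \<open>g\<close> or \<open>n\<close>. The elementwise
    description of the weight makes this relation single-valued.\<close>
  define val where "val k s y \<longleftrightarrow> (\<exists>u. arr C k A u \<and> s = i k u \<and> y = Comp E (omap D k) (omap D A) x g (amap D k A u)) \<or>
    (\<exists>v. arr C k B v \<and> s = j k v \<and> y = Comp E (omap D k) (omap D B) x n (amap D k B v))" for k s y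
  have vA: "val k (i k u) (Comp E (omap D k) (omap D A) x g (amap D k A u))" if "arr C k A u" for k u
    using that unfolding val_def by blast
  have vB: "val k (j k v) (Comp E (omap D k) (omap D B) x n (amap D k B v))" if "arr C k B v" for k v
    using that unfolding val_def by blast
  have gm: "Comp E (omap D k) (omap D A) x g (amap D k A (Comp C k X A m c)) =
      Comp E (omap D k) (omap D B) x n (amap D k B (Comp C k X B f c))" if "arr C k X c" for k c
    using E.po_square[OF po functor_arr[OF D that]] by (simp add: D_comp[OF that m] D_comp[OF that f])
  have ex: "\<exists>y. val k s y" if "k \<in> Obj C" "s \<in> omap \<phi> k" for k s
  proof (rule pw_pushout_cases[OF pw that])
    fix u assume "u \<in> omap (rep A) k" "s = i k u"
    then show ?thesis using vA[of k u] that(1) by (auto simp: arr_def)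
  next
    fix u assume "u \<in> omap (rep B) k" "s = j k u"
    then show ?thesis using vB[of k u] that(1) by (auto simp: arr_def)
  qed
  have uniq: "y = y'" if y: "val k s y" "val k s y'" for k s y y'
  proof -
    have AA: "Comp E (omap D k) (omap D A) x g (amap D k A u) = Comp E (omap D k) (omap D A) x g (amap D k A u')"
      if u: "arr C k A u" "arr C k A u'" and e: "i k u = i k u'" for u u'
    proof -
      have u': "u \<in> omap (rep A) k" "u' \<in> omap (rep A) k" using u by (simp_all add: arr_def)
      show ?thesis
      proof (rule pw_pushout_ii[OF pw arrD(1)[OF u(1)] u' e])
        fix r r' assume r: "r \<in> omap (rep X) k" "r' \<in> omap (rep X) k" "yo X A m k r = u" "yo X A m k r' = u'"
          "yo X B f k r = yo X B f k r'"
        then have "arr C k X r" "arr C k X r'" "u = Comp C k X A m r" "u' = Comp C k X A m r'" "Comp C k X B f r = Comp C k X B f r'"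
          using arrD(1)[OF u(1)] by (simp_all add: arr_def)
        then show ?thesis by (simp add: gm)
      qed simp
    qed
    have AB: "Comp E (omap D k) (omap D A) x g (amap D k A u) = Comp E (omap D k) (omap D B) x n (amap D k B v)"
      if u: "arr C k A u" and v: "arr C k B v" and e: "i k u = j k v" for u v
    proof -
      have u': "u \<in> omap (rep A) k" "v \<in> omap (rep B) k" using u v by (simp_all add: arr_def)
      show ?thesis
      proof (rule pw_pushout_ij[OF pw arrD(1)[OF u] u' e])
        fix r assume r: "r \<in> omap (rep X) k" "yo X A m k r = u" "yo X B f k r = v"
        then have "arr C k X r" "u = Comp C k X A m r" "v = Comp C k X B f r"
          using arrD(1)[OF u] by (simp_all add: arr_def)
        then show ?thesis by (simp add: gm)
      qed
    qed
    have BB: "v = v'" if v: "arr C k B v" "arr C k B v'" and e: "j k v = j k v'" for v v'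
      by (rule pw_pushout_jj[OF pw arrD(1)[OF v(1)] _ _ e]) (use v in \<open>simp_all add: arr_def\<close>)
    show ?thesis
      using y unfolding val_def
    proof (elim disjE exE conjE)
      fix u u' assume "arr C k A u" "arr C k A u'" "s = i k u" "s = i k u'"
        "y = Comp E (omap D k) (omap D A) x g (amap D k A u)" "y' = Comp E (omap D k) (omap D A) x g (amap D k A u')"
      then show ?thesis using AA[of u u'] by simp
    next
      fix u v assume "arr C k A u" "arr C k B v" "s = i k u" "s = j k v"
        "y = Comp E (omap D k) (omap D A) x g (amap D k A u)" "y' = Comp E (omap D k) (omap D B) x n (amap D k B v)"
      then show ?thesis using AB[of u v] by simp
    next
      fix v u assume "arr C k B v" "arr C k A u" "s = j k v" "s = i k u"
        "y = Comp E (omap D k) (omap D B) x n (amap D k B v)" "y' = Comp E (omap D k) (omap D A) x g (amap D k A u)"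
      then show ?thesis using AB[of u v] by simp
    next
      fix v v' assume "arr C k B v" "arr C k B v'" "s = j k v" "s = j k v'"
        "y = Comp E (omap D k) (omap D B) x n (amap D k B v)" "y' = Comp E (omap D k) (omap D B) x n (amap D k B v')"
      then show ?thesis using BB[of v v'] by simp
    qed
  qed
  define \<gamma> where "\<gamma> k s = (SOME y. val k s y)" for k s
  have \<gamma>: "val k s (\<gamma> k s)" if "k \<in> Obj C" "s \<in> omap \<phi> k" for k s
    unfolding \<gamma>_def by (rule someI_ex[OF ex[OF that]])
  have \<gamma>_eq: "\<gamma> k s = y" if "val k s y" for k s y
    unfolding \<gamma>_def by (rule some_equality) (use that uniq in auto)
  have val_arr: "arr E (omap D k) x y" if "val k s y" for k s y
    using that unfolding val_def by auto
  have val_nat: "val k (amap \<phi> l k h s) (Comp E (omap D k) (omap D l) x y (amap D k l h))" if h: "arr C k l h" and v: "val l s y" for k l h s y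
    using v unfolding val_def[of l]
  proof (elim disjE exE conjE)
    fix u assume "arr C l A u" "s = i l u" "y = Comp E (omap D l) (omap D A) x g (amap D l A u)"
    then show ?thesis using vA[OF arr_comp[OF h, of A u]] h by (simp add: i_nat D_comp E.assoc)
  next
    fix v assume "arr C l B v" "s = j l v" "y = Comp E (omap D l) (omap D B) x n (amap D l B v)"
    then show ?thesis using vB[OF arr_comp[OF h, of B v]] h by (simp add: j_nat D_comp E.assoc)
  qed
  have "is_weighted_colimit C \<phi> E D x \<gamma>"
    unfolding is_weighted_colimit_def
  proof (intro conjI allI impI)
    show "weighted_cocone C \<phi> E D x \<gamma>"
      unfolding weighted_cocone_def
    proof (intro conjI ballI)
      show "x \<in> Obj E" by (rule po_obj(4)[OF po])
      show "\<gamma> k s \<in> Hom E (omap D k) x" if "k \<in> Obj C" "s \<in> omap \<phi> k" for k s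
        by (rule arrD(3)[OF val_arr[OF \<gamma>[OF that]]])
      fix k l h s assume "k \<in> Obj C" "l \<in> Obj C" "h \<in> Hom C k l" "s \<in> omap \<phi> l"
      then show "\<gamma> k (amap \<phi> l k h s) = Comp E (omap D k) (omap D l) x (\<gamma> l s) (amap D k l h)"
        using \<gamma>_eq[OF val_nat[OF _ \<gamma>]] by (simp add: arr_def)
    qed
  next
    fix y \<delta> assume d: "weighted_cocone C \<phi> E D y \<delta>"
    have \<delta>_arr: "arr E (omap D k) y (\<delta> k s)" if "k \<in> Obj C" "s \<in> omap \<phi> k" for k s
      using d that functor_obj[OF D] by (auto simp: weighted_cocone_def arr_def)
    have \<delta>_nat: "\<delta> k (amap \<phi> l k h s) = Comp E (omap D k) (omap D l) y (\<delta> l s) (amap D k l h)"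
      if "arr C k l h" "s \<in> omap \<phi> l" for k l h s
      using d that by (auto simp: weighted_cocone_def arr_def)
    have dA: "\<delta> k (i k u) = Comp E (omap D k) (omap D A) y (\<delta> A (i A (Ident C A))) (amap D k A u)" if "arr C k A u" for k u
      using \<delta>_nat[OF that iA] that by (simp add: i_nat)
    have dB: "\<delta> k (j k u) = Comp E (omap D k) (omap D B) y (\<delta> B (j B (Ident C B))) (amap D k B u)" if "arr C k B u" for k u
      using \<delta>_nat[OF that jB] that by (simp add: j_nat)
    have "Comp E (omap D X) (omap D A) y (\<delta> A (i A (Ident C A))) (amap D X A m) =
      Comp E (omap D X) (omap D B) y (\<delta> B (j B (Ident C B))) (amap D X B f)"
      using dA[OF m] dB[OF f] ij[of X "Ident C X"] m f by simp
    then obtain h where h: "arr E x y h" "Comp E (omap D A) x y h g = \<delta> A (i A (Ident C A))"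
      "Comp E (omap D B) x y h n = \<delta> B (j B (Ident C B))"
      by (rule po_ex[OF po, rotated 2]) (use \<delta>_arr iA jB in auto)
    have hval: "Comp E (omap D k) x y h z = \<delta> k s" if "val k s z" for k s z
      using that unfolding val_def
    proof (elim disjE exE conjE)
      fix u assume u: "arr C k A u" "s = i k u" "z = Comp E (omap D k) (omap D A) x g (amap D k A u)"
      show ?thesis using dA[OF u(1)] E.comp_tri[OF h(2), of "omap D k" "amap D k A u"] h(1) u by simp
    next
      fix u assume u: "arr C k B u" "s = j k u" "z = Comp E (omap D k) (omap D B) x n (amap D k B u)"
      show ?thesis using dB[OF u(1)] E.comp_tri[OF h(3), of "omap D k" "amap D k B u"] h(1) u by simp
    qed
    show "\<exists>!h. h \<in> Hom E x y \<and> (\<forall>k\<in>Obj C. \<forall>s\<in>omap \<phi> k. Comp E (omap D k) x y h (\<gamma> k s) = \<delta> k s)"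
    proof (rule ex1I[of _ h])
      show "h \<in> Hom E x y \<and> (\<forall>k\<in>Obj C. \<forall>s\<in>omap \<phi> k. Comp E (omap D k) x y h (\<gamma> k s) = \<delta> k s)"
        using hval \<gamma> arrD(3)[OF h(1)] by blast
      fix h' assume h': "h' \<in> Hom E x y \<and> (\<forall>k\<in>Obj C. \<forall>s\<in>omap \<phi> k. Comp E (omap D k) x y h' (\<gamma> k s) = \<delta> k s)"
      have g': "\<gamma> A (i A (Ident C A)) = g" "\<gamma> B (j B (Ident C B)) = n"
        using \<gamma>_eq[OF vA[OF arr_id]] \<gamma>_eq[OF vB[OF arr_id]] by (simp_all add: functor_id[OF D])
      show "h' = h"
      proof (rule E.po_uniq[OF po _ h(1)])
        show "arr E x y h'" using h' arrD(1,2)[OF h(1)] by (simp add: arr_def)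
        show "Comp E (omap D A) x y h' g = Comp E (omap D A) x y h g" using h'[THEN conjunct2, THEN bspec, OF o(2), THEN bspec, OF iA] g'(1) h(2) by simp
        show "Comp E (omap D B) x y h' n = Comp E (omap D B) x y h n" using h'[THEN conjunct2, THEN bspec, OF o(3), THEN bspec, OF jB] g'(2) h(3) by simp
      qed
    qed
  qed
  then show ?thesis by blast
qed

section \<open>Reflecting presheaves to an adhesive category\<close>

context lfc_cat begin

lemma tr_rep_arr:
  "psh_trans C P (rep c) \<theta> \<Longrightarrow> c \<in> Obj C \<Longrightarrow> a \<in> Obj C \<Longrightarrow> p \<in> omap P a \<Longrightarrow> arr C a c (\<theta> a p)"
  using tr_in[of C P "rep c" \<theta> a p] by (simp add: arr_def)

lemma tr_rep_nat:
  assumes "psh_trans C P (rep c) \<theta>" "arr C b a k" "p \<in> omap P a"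
  shows "\<theta> b (amap P a b k p) = Comp C b a c (\<theta> a p) k"
  using tr_nat[OF assms] tr_in[OF assms(1) arrD(2)[OF assms(2)] assms(3)] by simp

text \<open>By the Yoneda lemma a compatible family of elements over \<open>a\<close> is a cone from
  the representable at \<open>a\<close>. Representables lie in \<open>T\<close>, so the limit in the
  full subcategory classifies such cones; with \<open>limit_elt_uniq\<close>, limits there can be
  handled by elements.\<close>

lemma limit_elt_ex:
  assumes T: "rep ` Obj C \<subseteq> T" and D: "is_functor J (psh T) D" and lim: "is_limit J (psh T) D x \<pi>"
    and a: "a \<in> Obj C" and e: "\<And>j. j \<in> Obj J \<Longrightarrow> e j \<in> omap (omap D j) a"
    and nat: "\<And>i j u. arr J i j u \<Longrightarrow> amap D i j u a (e i) = e j"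
  obtains p where "p \<in> omap x a" "\<And>j. j \<in> Obj J \<Longrightarrow> \<pi> j a p = e j"
proof -
  have Dj: "presheaf C (omap D j)" "omap D j \<in> T" if "j \<in> Obj J" for j using functor_obj[OF D that] by simp_all
  have Du: "psh_trans C (omap D i) (omap D j) (amap D i j u)" if "arr J i j u" for i j u
    using functor_arr[OF D that] by (simp add: arr_psh)
  have "is_cone J (psh T) D (rep a) (\<lambda>j. elt (omap D j) a (e j))"
    unfolding cone_arr[OF D]
  proof (intro conjI ballI allI impI)
    show "rep a \<in> Obj (psh T)" using a T by auto
    show "arr (psh T) (rep a) (omap D j) (elt (omap D j) a (e j))" if "j \<in> Obj J" for j
      using trans_elt[OF Dj(1)[OF that] a e[OF that]] Dj[OF that] a T by (auto simp: arr_psh)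
    fix i j u assume u: "arr J i j u"
    note i = arrD(1)[OF u] and j = arrD(2)[OF u]
    have "Comp (presheaf_cat C) (rep a) (omap D i) (omap D j) (amap D i j u) (elt (omap D i) a (e i)) = elt (omap D j) a (e j)"
    proof (rule presheaf_comp_eq_trI[OF trans_elt[OF Dj(1)[OF j] a e[OF j]] trans_elt[OF Dj(1)[OF i] a e[OF i]] Du[OF u]])
      fix b g assume b: "b \<in> Obj C" "g \<in> omap (rep a) b"
      then have g: "arr C b a g" using a by (simp add: arr_def)
      show "amap D i j u b (elt (omap D i) a (e i) b g) = elt (omap D j) a (e j) b g"
        using tr_nat[OF Du[OF u] g e[OF i]] g by (simp add: nat[OF u])
    qed (use a in simp)
    then show "Comp (psh T) (rep a) (omap D i) (omap D j) (amap D i j u) (elt (omap D i) a (e i)) = elt (omap D j) a (e j)"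
      by simp
  qed
  then obtain h where h: "arr (psh T) (rep a) x h"
    "\<And>j. j \<in> Obj J \<Longrightarrow> Comp (psh T) (rep a) x (omap D j) (\<pi> j) h = elt (omap D j) a (e j)"
    by (rule lim_ex[OF lim]) blast
  have i: "Ident C a \<in> omap (rep a) a" using arrD(3)[OF arr_id[OF a]] by simp
  show ?thesis
  proof (rule that)
    show "h a (Ident C a) \<in> omap x a"
      using h(1) tr_in[OF _ a i] by (simp add: arr_psh)
    show "\<pi> j a (h a (Ident C a)) = e j" if j: "j \<in> Obj J" for j
    proof -
      have "Comp (presheaf_cat C) (rep a) x (omap D j) (\<pi> j) h = elt (omap D j) a (e j)" using h(2)[OF j] by simp
      from presheaf_comp_eq_trD[OF this a i] show ?thesis using psh_id[OF Dj(1)[OF j] a e[OF j]] a by simp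
    qed
  qed
qed

lemma limit_elt_uniq:
  assumes T: "rep ` Obj C \<subseteq> T" and D: "is_functor J (psh T) D" and lim: "is_limit J (psh T) D x \<pi>"
    and a: "a \<in> Obj C" and p: "p \<in> omap x a" "p' \<in> omap x a" and e: "\<And>j. j \<in> Obj J \<Longrightarrow> \<pi> j a p = \<pi> j a p'"
  shows "p = p'"
proof -
  interpret E: cat "psh T" by unfold_locales (rule category_psh)
  have x: "presheaf C x" "x \<in> T" and \<pi>: "\<And>j. j \<in> Obj J \<Longrightarrow> psh_trans C x (omap D j) (\<pi> j)"
    using lim_cone[OF lim] by (auto simp: cone_arr[OF D] arr_psh)
  have "elt x a p = elt x a p'"
  proof (rule E.lim_uniq[OF D lim])
    show "arr (psh T) (rep a) x (elt x a p)" "arr (psh T) (rep a) x (elt x a p')"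
      using trans_elt[OF x(1) a] p x a T by (auto simp: arr_psh)
    fix j assume j: "j \<in> Obj J"
    have "Comp (presheaf_cat C) (rep a) x (omap D j) (\<pi> j) (elt x a p) = Comp (presheaf_cat C) (rep a) x (omap D j) (\<pi> j) (elt x a p')"
    proof (rule presheaf_comp_eqI)
      fix b g assume b: "b \<in> Obj C" "g \<in> omap (rep a) b"
      then have g: "arr C b a g" using a by (simp add: arr_def)
      show "\<pi> j b (elt x a p b g) = \<pi> j b (elt x a p' b g)"
        using tr_nat[OF \<pi>[OF j] g p(1)] tr_nat[OF \<pi>[OF j] g p(2)] g by (simp add: e[OF j])
    qed
    then show "Comp (psh T) (rep a) x (omap D j) (\<pi> j) (elt x a p) = Comp (psh T) (rep a) x (omap D j) (\<pi> j) (elt x a p')"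
      by simp
  qed
  then have "elt x a p a (Ident C a) = elt x a p' a (Ident C a)" by simp
  then show ?thesis using psh_id[OF x(1) a p(1)] psh_id[OF x(1) a p(2)] a by simp
qed

end

section \<open>Presheaves locally isomorphic to a representable\<close>

locale adh_lfc = lfc_cat C + adh C for C :: "('o, 'u) cat"
begin

text \<open>Covers are intersected one after another. The premise on restriction ensures that a
  later refinement does not destroy what an earlier one has secured.\<close>

lemma cov_finite_ball:
  assumes "finite I" "Z \<in> Obj C" "\<And>i. i \<in> I \<Longrightarrow> cov Z (R i)"
    "\<And>i x k y l. i \<in> I \<Longrightarrow> arr C x Z k \<Longrightarrow> arr C y x l \<Longrightarrow> R i x k \<Longrightarrow> R i y (Comp C y x Z k l)"
  shows "cov Z (\<lambda>x k. \<forall>i\<in>I. R i x k)"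
  using assms(1,3,4)
proof (induction I)
  case empty
  show ?case by (rule cov.base[OF assms(2)]) simp
next
  case (insert i I)
  have rest: "cov Z (\<lambda>x k. \<forall>i\<in>I. R i x k)"
    by (rule insert.IH) (use insert.prems in blast)+
  show ?case
  proof (rule cov_bind[of Z "R i"])
    show "cov Z (R i)" using insert.prems by simp
    fix x k assume k: "arr C x Z k" and r: "R i x k"
    show "cov x (\<lambda>y l. \<forall>j\<in>insert i I. R j y (Comp C y x Z k l))"
      by (rule cov_mono[OF cov_pull[OF rest k]]) (use insert.prems(2)[OF _ k _ r] in auto)
  qed
qed

text \<open>The local isomorphisms to representables are the units of the adjunction to be constructed.\<close>

definition lociso :: "('o, 'u) presheaf \<Rightarrow> 'o \<Rightarrow> ('o \<Rightarrow> 'u \<Rightarrow> 'u) \<Rightarrow> bool" where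
  "lociso P c \<theta> \<longleftrightarrow> presheaf C P \<and> c \<in> Obj C \<and> psh_trans C P (rep c) \<theta> \<and>
     (\<forall>Z h. arr C Z c h \<longrightarrow> cov Z (\<lambda>x k. \<exists>p\<in>omap P x. \<theta> x p = Comp C x Z c h k)) \<and>
     (\<forall>Z\<in>Obj C. \<forall>p\<in>omap P Z. \<forall>p'\<in>omap P Z. \<theta> Z p = \<theta> Z p' \<longrightarrow> cov Z (\<lambda>x k. amap P Z x k p = amap P Z x k p'))"

lemma lociso_D:
  assumes "lociso P c \<theta>"
  shows "presheaf C P" "c \<in> Obj C" "psh_trans C P (rep c) \<theta>"
  using assms by (simp_all add: lociso_def)

lemma lociso_surj:
  "lociso P c \<theta> \<Longrightarrow> arr C Z c h \<Longrightarrow> cov Z (\<lambda>x k. \<exists>p\<in>omap P x. \<theta> x p = Comp C x Z c h k)"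
  unfolding lociso_def by blast

lemma lociso_inj:
  "lociso P c \<theta> \<Longrightarrow> Z \<in> Obj C \<Longrightarrow> p \<in> omap P Z \<Longrightarrow> p' \<in> omap P Z \<Longrightarrow> \<theta> Z p = \<theta> Z p' \<Longrightarrow>
    cov Z (\<lambda>x k. amap P Z x k p = amap P Z x k p')"
  unfolding lociso_def by blast

lemma lociso_ext:
  assumes l: "lociso P c \<theta>" and u: "arr C c e u" and v: "arr C c e v"
    and eq: "\<And>a p. a \<in> Obj C \<Longrightarrow> p \<in> omap P a \<Longrightarrow> Comp C a c e u (\<theta> a p) = Comp C a c e v (\<theta> a p)"
  shows "u = v"
proof (rule cov_eq[OF lociso_surj[OF l arr_id[OF lociso_D(2)[OF l]]] u v])
  fix x k assume k: "arr C x c k" and "\<exists>p\<in>omap P x. \<theta> x p = Comp C x c c (Ident C c) k"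
  then obtain p where "p \<in> omap P x" "\<theta> x p = k" by auto
  then show "Comp C x c e u k = Comp C x c e v k" using eq[OF arrD(1)[OF k]] by metis
qed

text \<open>A local isomorphism to a representable is a universal arrow. On an arrow
  \<open>k\<close> with preimage \<open>p\<close> the value must be that of \<open>\<alpha>\<close>
  at \<open>p\<close>; by local injectivity it depends only on \<open>k\<close>, and arrows into
  \<open>e\<close> glue.\<close>

lemma lociso_desc:
  assumes l: "lociso P c \<theta>" and e: "e \<in> Obj C" and \<alpha>: "psh_trans C P (rep e) \<alpha>"
  obtains u where "arr C c e u" "\<And>a p. a \<in> Obj C \<Longrightarrow> p \<in> omap P a \<Longrightarrow> Comp C a c e u (\<theta> a p) = \<alpha> a p"
proof -
  note P = lociso_D[OF l]
  have wd: "\<alpha> x p = \<alpha> x p'" if x: "x \<in> Obj C" and p: "p \<in> omap P x" "p' \<in> omap P x" and eq: "\<theta> x p = \<theta> x p'" for x p p'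
  proof (rule cov_eq[OF lociso_inj[OF l x p eq]])
    show "arr C x e (\<alpha> x p)" "arr C x e (\<alpha> x p')" using tr_rep_arr[OF \<alpha> e x] p by simp_all
    fix y k assume k: "arr C y x k" and "amap P x y k p = amap P x y k p'"
    then show "Comp C y x e (\<alpha> x p) k = Comp C y x e (\<alpha> x p') k"
      using tr_rep_nat[OF \<alpha> k p(1)] tr_rep_nat[OF \<alpha> k p(2)] by simp
  qed
  obtain u where u: "arr C c e u"
    and cu: "cov c (\<lambda>x k. \<exists>p\<in>omap P x. \<theta> x p = k \<and> Comp C x c e u k = \<alpha> x p)"
  proof (rule cov_glue_unique[of c e "\<lambda>x k w. \<exists>p\<in>omap P x. \<theta> x p = k \<and> w = \<alpha> x p"])
    show "cov c (\<lambda>x k. \<exists>w. arr C x e w \<and> (\<exists>p\<in>omap P x. \<theta> x p = k \<and> w = \<alpha> x p))"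
    proof (rule cov_mono[OF lociso_surj[OF l arr_id[OF P(2)]]])
      fix x k assume k: "arr C x c k" and "\<exists>p\<in>omap P x. \<theta> x p = Comp C x c c (Ident C c) k"
      then obtain p where "p \<in> omap P x" "\<theta> x p = k" by auto
      then show "\<exists>w. arr C x e w \<and> (\<exists>p\<in>omap P x. \<theta> x p = k \<and> w = \<alpha> x p)"
        using tr_rep_arr[OF \<alpha> e arrD(1)[OF k]] by blast
    qed
    show "w = w'" if "arr C x c k" "\<exists>p\<in>omap P x. \<theta> x p = k \<and> w = \<alpha> x p" "\<exists>p\<in>omap P x. \<theta> x p = k \<and> w' = \<alpha> x p" for x k w w'
      using that wd[OF arrD(1)[OF that(1)]] by metis
    fix x k y l w assume kl: "arr C x c k" "arr C y x l" and "\<exists>p\<in>omap P x. \<theta> x p = k \<and> w = \<alpha> x p"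
    then obtain p where p: "p \<in> omap P x" "\<theta> x p = k" "w = \<alpha> x p" by blast
    show "\<exists>p\<in>omap P y. \<theta> y p = Comp C y x c k l \<and> Comp C y x e w l = \<alpha> y p"
      using tr_rep_nat[OF P(3) kl(2) p(1)] tr_rep_nat[OF \<alpha> kl(2) p(1)] psh_in[OF P(1) kl(2) p(1)] p(2,3)
      by (intro bexI[of _ "amap P x y l p"]) simp_all
  qed
  \<comment> \<open>The glued \<open>u\<close> is known to be correct at some local preimage
    \<open>p'\<close>. Independence of the preimage allows \<open>p'\<close> to be replaced by the
    restriction of \<open>p\<close>.\<close>
  have "Comp C a c e u (\<theta> a p) = \<alpha> a p" if a: "a \<in> Obj C" and p: "p \<in> omap P a" for a p
  proof -
    note h = tr_rep_arr[OF P(3,2) a p]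
    show ?thesis
    proof (rule cov_eq[OF cov_pull[OF cu h]])
      show "arr C a e (Comp C a c e u (\<theta> a p))" "arr C a e (\<alpha> a p)" using u h tr_rep_arr[OF \<alpha> e a p] by simp_all
      fix x k assume k: "arr C x a k"
        and "\<exists>p'\<in>omap P x. \<theta> x p' = Comp C x a c (\<theta> a p) k \<and> Comp C x c e u (Comp C x a c (\<theta> a p) k) = \<alpha> x p'"
      then obtain p' where p': "p' \<in> omap P x" "\<theta> x p' = Comp C x a c (\<theta> a p) k"
        "Comp C x c e u (Comp C x a c (\<theta> a p) k) = \<alpha> x p'" by blast
      have "\<alpha> x p' = \<alpha> x (amap P a x k p)"
        by (rule wd[OF arrD(1)[OF k] p'(1) psh_in[OF P(1) k p]]) (simp add: p'(2) tr_rep_nat[OF P(3) k p])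
      then show "Comp C x a e (Comp C a c e u (\<theta> a p)) k = Comp C x a e (\<alpha> a p) k"
        using p'(3) u h k by (simp add: assoc tr_rep_nat[OF \<alpha> k p])
    qed
  qed
  then show ?thesis using u that by blast
qed

lemma lociso_iso:
  assumes \<theta>: "lociso P c \<theta>" and \<psi>: "lociso P d \<psi>"
  obtains h where "iso c d h" "\<And>a p. a \<in> Obj C \<Longrightarrow> p \<in> omap P a \<Longrightarrow> Comp C a c d h (\<theta> a p) = \<psi> a p"
proof -
  obtain h where h: "arr C c d h" "\<And>a p. a \<in> Obj C \<Longrightarrow> p \<in> omap P a \<Longrightarrow> Comp C a c d h (\<theta> a p) = \<psi> a p"
    by (rule lociso_desc[OF \<theta> lociso_D(2,3)[OF \<psi>]]) blast
  obtain k where k: "arr C d c k" "\<And>a p. a \<in> Obj C \<Longrightarrow> p \<in> omap P a \<Longrightarrow> Comp C a d c k (\<psi> a p) = \<theta> a p"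
    by (rule lociso_desc[OF \<psi> lociso_D(2,3)[OF \<theta>]]) blast
  note o [simp] = lociso_D(2)[OF \<theta>] lociso_D(2)[OF \<psi>]
  note [simp] = tr_rep_arr[OF lociso_D(3,2)[OF \<theta>]] tr_rep_arr[OF lociso_D(3,2)[OF \<psi>]] h(1) k(1)
  have "Comp C c d c k h = Ident C c" by (rule lociso_ext[OF \<theta>, of c]) (simp_all add: assoc h(2) k(2))
  moreover have "Comp C d c d h k = Ident C d" by (rule lociso_ext[OF \<psi>, of d]) (simp_all add: assoc h(2) k(2))
  ultimately have "iso c d h" by (intro isoI[of _ _ _ k]) simp_all
  then show ?thesis using h(2) that by blast
qed

lemma lociso_rep: "c \<in> Obj C \<Longrightarrow> lociso (rep c) c (mk_tr C (rep c) (\<lambda>a g. g))"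
  unfolding lociso_def
proof (intro conjI allI impI ballI)
  assume c: "c \<in> Obj C"
  show "presheaf C (rep c)" "c \<in> Obj C" using c by simp_all
  show "psh_trans C (rep c) (rep c) (mk_tr C (rep c) (\<lambda>a g. g))"
    using tr_ident[OF presheaf_rep[OF c]] by (simp add: presheaf_cat_Ident)
  show "cov Z (\<lambda>x k. \<exists>p\<in>omap (rep c) x. mk_tr C (rep c) (\<lambda>a g. g) x p = Comp C x Z c h k)" if h: "arr C Z c h" for Z h
  proof (rule cov.base[OF arrD(1)[OF h]])
    fix x k assume k: "arr C x Z k"
    show "\<exists>p\<in>omap (rep c) x. mk_tr C (rep c) (\<lambda>a g. g) x p = Comp C x Z c h k"
      using arrD[OF arr_comp[OF k h]] by (intro bexI[of _ "Comp C x Z c h k"]) simp_all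
  qed
  show "cov Z (\<lambda>x k. amap (rep c) Z x k p = amap (rep c) Z x k p')"
    if "Z \<in> Obj C" "p \<in> omap (rep c) Z" "p' \<in> omap (rep c) Z" "mk_tr C (rep c) (\<lambda>a g. g) Z p = mk_tr C (rep c) (\<lambda>a g. g) Z p'" for Z p p'
    using that by (intro cov.base) simp_all
qed

text \<open>The span of representing objects inherits a monic leg and so has a pushout
  \<open>D\<close> in \<open>C\<close>. Coprojections cover \<open>D\<close>, which gives local
  surjectivity of the induced \<open>\<tau>\<close>. Local injectivity splits by the origin of the
  two elements: two from \<open>Q\<close> use monicity of \<open>n\<close>, one from each side uses
  that the square is a pullback, and two from \<open>P\<close> use \<open>po_kernel\<close>.\<close>

lemma lociso_pushout:
  assumes pw: "pw_pushout C R P Q T \<alpha> \<beta> i j" and inj: "\<And>a. a \<in> Obj C \<Longrightarrow> inj_on (\<alpha> a) (omap R a)"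
    and lR: "lociso R X \<theta>" and lP: "lociso P A \<phi>" and lQ: "lociso Q B \<psi>"
  shows "\<exists>D \<tau>. lociso T D \<tau>"
proof -
  note pD = pw_pushoutD[OF pw]
  note o [simp] = lociso_D(2)[OF lR] lociso_D(2)[OF lP] lociso_D(2)[OF lQ]
  note t = lociso_D(3)[OF lR] lociso_D(3)[OF lP] lociso_D(3)[OF lQ]
  note t_arr [simp] = tr_rep_arr[OF t(1) o(1)] tr_rep_arr[OF t(2) o(2)] tr_rep_arr[OF t(3) o(3)]
  note tin [simp] = tr_in[OF pD(5)] tr_in[OF pD(6)] tr_in[OF pD(7)] tr_in[OF pD(8)]
  obtain m where m [simp]: "arr C X A m"
    and mt: "\<And>a r. a \<in> Obj C \<Longrightarrow> r \<in> omap R a \<Longrightarrow> Comp C a X A m (\<theta> a r) = \<phi> a (\<alpha> a r)"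
    by (rule lociso_desc[OF lR o(2) tr_comp[OF pD(1) pD(5) t(2)]]) (simp add: presheaf_cat_Comp)
  obtain f where f [simp]: "arr C X B f"
    and ft: "\<And>a r. a \<in> Obj C \<Longrightarrow> r \<in> omap R a \<Longrightarrow> Comp C a X B f (\<theta> a r) = \<psi> a (\<beta> a r)"
    by (rule lociso_desc[OF lR o(3) tr_comp[OF pD(1) pD(6) t(3)]]) (simp add: presheaf_cat_Comp)
  have nR: "\<theta> y (amap R x y l r) = Comp C y x X (\<theta> x r) l" if "arr C y x l" "r \<in> omap R x" for x y l r
    using tr_rep_nat[OF t(1) that] .
  have nP: "\<phi> y (amap P x y l r) = Comp C y x A (\<phi> x r) l" if "arr C y x l" "r \<in> omap P x" for x y l r
    using tr_rep_nat[OF t(2) that] .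
  have nQ: "\<psi> y (amap Q x y l r) = Comp C y x B (\<psi> x r) l" if "arr C y x l" "r \<in> omap Q x" for x y l r
    using tr_rep_nat[OF t(3) that] .
  \<comment> \<open>Two arrows with equal image in \<open>A\<close> are lifted locally to elements
    of \<open>R\<close>. The images of these in \<open>P\<close> agree only on a further cover,
    where pointwise injectivity of \<open>\<alpha>\<close> makes the elements themselves
    agree.\<close>
  have m_mono: "is_mono C X A m"
  proof (rule monoI[OF m])
    fix Z u v assume u [simp]: "arr C Z X u" and v [simp]: "arr C Z X v" and e: "Comp C Z X A m u = Comp C Z X A m v"
    show "u = v"
    proof (rule cov_eq[OF lociso_surj[OF lR u] u v])
      fix x k assume k [simp]: "arr C x Z k" and "\<exists>r\<in>omap R x. \<theta> x r = Comp C x Z X u k"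
      then obtain r where r: "r \<in> omap R x" "\<theta> x r = Comp C x Z X u k" by blast
      have vk: "arr C x X (Comp C x Z X v k)" and uk: "arr C x X (Comp C x Z X u k)" by simp_all
      show "Comp C x Z X u k = Comp C x Z X v k"
      proof (rule cov_eq[OF lociso_surj[OF lR vk] uk vk])
        fix y l assume l [simp]: "arr C y x l" and "\<exists>s\<in>omap R y. \<theta> y s = Comp C y x X (Comp C x Z X v k) l"
        then obtain s where s: "s \<in> omap R y" "\<theta> y s = Comp C y x X (Comp C x Z X v k) l" by blast
        note x = arrD(1)[OF k] and y = arrD(1)[OF l]
        define r' where "r' = amap R x y l r"
        have r': "r' \<in> omap R y" "\<theta> y r' = Comp C y x X (Comp C x Z X u k) l"
          using psh_in[OF pD(1) l r(1)] nR[OF l r(1)] r(2) by (simp_all add: r'_def)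
        have eq: "\<phi> y (\<alpha> y r') = \<phi> y (\<alpha> y s)"
          using comp_eq_extend[OF e, of x k] by (simp add: mt[OF y, symmetric] r' s assoc comp_eq_extend[OF e])
        have "\<theta> y r' = \<theta> y s"
        proof (rule cov_eq[OF lociso_inj[OF lP y tin(1)[OF y r'(1)] tin(1)[OF y s(1)] eq]])
          fix z g assume g: "arr C z y g" and "amap P y z g (\<alpha> y r') = amap P y z g (\<alpha> y s)"
          then have "\<alpha> z (amap R y z g r') = \<alpha> z (amap R y z g s)"
            using tr_nat[OF pD(5) g] r'(1) s(1) by simp
          then have "amap R y z g r' = amap R y z g s"
            using inj_onD[OF inj[OF arrD(1)[OF g]]] psh_in[OF pD(1) g] r'(1) s(1) by blast
          then show "Comp C z y X (\<theta> y r') g = Comp C z y X (\<theta> y s) g"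
            using nR[OF g r'(1)] nR[OF g s(1)] by simp
        qed (use y r' s in simp_all)
        then show "Comp C y x X (Comp C x Z X u k) l = Comp C y x X (Comp C x Z X v k) l" using r' s by simp
      qed
    qed
  qed
  obtain D g n where po: "is_pushout C X A B D m f g n" by (rule po_exists[OF m f m_mono])
  note [simp] = po_arr(3,4)[OF po] po_obj(4)[OF po]
  note pb = po_is_pb[OF po m_mono] and n_mono = po_mono[OF po m_mono]
  obtain \<tau> where \<tau>: "psh_trans C T (rep D) \<tau>"
    and \<tau>i: "\<And>a p. a \<in> Obj C \<Longrightarrow> p \<in> omap P a \<Longrightarrow> \<tau> a (i a p) = Comp C a A D g (\<phi> a p)"
    and \<tau>j: "\<And>a p. a \<in> Obj C \<Longrightarrow> p \<in> omap Q a \<Longrightarrow> \<tau> a (j a p) = Comp C a B D n (\<psi> a p)"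
  proof (rule pw_pushout_desc[OF pw, of "rep D" "\<lambda>a p. Comp C a A D g (\<phi> a p)" "\<lambda>a p. Comp C a B D n (\<psi> a p)"])
    show "Comp C a A D g (\<phi> a p) \<in> omap (rep D) a" if "a \<in> Obj C" "p \<in> omap P a" for a p
      using arrD(3)[OF arr_comp[OF t_arr(2)[OF that], of D g]] by simp
    then show "Comp C b A D g (\<phi> b (amap P a b h p)) = amap (rep D) a b h (Comp C a A D g (\<phi> a p))"
      if "arr C b a h" "p \<in> omap P a" for a b h p
      using that arrD(2)[OF that(1)] by (simp add: nP assoc)
    show "Comp C a B D n (\<psi> a p) \<in> omap (rep D) a" if "a \<in> Obj C" "p \<in> omap Q a" for a p
      using arrD(3)[OF arr_comp[OF t_arr(3)[OF that], of D n]] by simp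
    then show "Comp C b B D n (\<psi> b (amap Q a b h p)) = amap (rep D) a b h (Comp C a B D n (\<psi> a p))"
      if "arr C b a h" "p \<in> omap Q a" for a b h p
      using that arrD(2)[OF that(1)] by (simp add: nQ assoc)
    show "Comp C a A D g (\<phi> a (\<alpha> a r)) = Comp C a B D n (\<psi> a (\<beta> a r))" if "a \<in> Obj C" "r \<in> omap R a" for a r
      using po_square[OF po t_arr(1)[OF that]] that by (simp add: mt ft)
  qed simp_all
  have iPT: "i y (amap P x y l p) = amap T x y l (i x p)" if "arr C y x l" "p \<in> omap P x" for x y l p
    by (rule tr_nat[OF pD(7) that])
  have jQT: "j y (amap Q x y l p) = amap T x y l (j x p)" if "arr C y x l" "p \<in> omap Q x" for x y l p
    by (rule tr_nat[OF pD(8) that])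
  \<comment> \<open>A local preimage \<open>r\<close> of \<open>c\<close> in \<open>R\<close> and
    the restriction of \<open>p\<close> have the same image in \<open>A\<close>, so they agree in
    \<open>P\<close> after one more refinement.\<close>
  have lift: "cov Z (\<lambda>x k. \<exists>r\<in>omap R x. \<theta> x r = Comp C x Z X c k \<and> amap P Z x k p = \<alpha> x r)"
    if p: "p \<in> omap P Z" and c [simp]: "arr C Z X c" and e: "Comp C Z X A m c = \<phi> Z p" for Z p c
  proof (rule cov_bind[OF lociso_surj[OF lR c]])
    fix x k assume k [simp]: "arr C x Z k" and "\<exists>r\<in>omap R x. \<theta> x r = Comp C x Z X c k"
    then obtain r where r: "r \<in> omap R x" "\<theta> x r = Comp C x Z X c k" by blast
    note x = arrD(1)[OF k] and Z = arrD(2)[OF k]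
    note pk = psh_in[OF pD(2) k p]
    have "\<phi> x (\<alpha> x r) = \<phi> x (amap P Z x k p)"
      using comp_tri[OF e c m k] by (simp add: mt[OF x r(1), symmetric] r(2) nP[OF k p])
    from lociso_inj[OF lP x tin(1)[OF x r(1)] pk this]
    show "cov x (\<lambda>y l. \<exists>r\<in>omap R y. \<theta> y r = Comp C y Z X c (Comp C y x Z k l) \<and> amap P Z y (Comp C y x Z k l) p = \<alpha> y r)"
    proof (rule cov_mono)
      fix y l assume l [simp]: "arr C y x l" and "amap P x y l (\<alpha> x r) = amap P x y l (amap P Z x k p)"
      then show "\<exists>r\<in>omap R y. \<theta> y r = Comp C y Z X c (Comp C y x Z k l) \<and> amap P Z y (Comp C y x Z k l) p = \<alpha> y r"
        using psh_in[OF pD(1) l r(1)] nR[OF l r(1)] r(2) tr_nat[OF pD(5) l r(1)] psh_comp[OF pD(2) k l p]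
        by (intro bexI[of _ "amap R x y l r"]) (simp_all add: assoc)
    qed
  qed
  have surj: "cov Z (\<lambda>x k. \<exists>p\<in>omap T x. \<tau> x p = Comp C x Z D h k)" if h [simp]: "arr C Z D h" for Z h
  proof (rule cov_bind[OF cov_coprojections[OF po m_mono h]], elim disjE exE conjE)
    fix x k l assume k [simp]: "arr C x Z k" and l [simp]: "arr C x A l" and e: "Comp C x A D g l = Comp C x Z D h k"
    show "cov x (\<lambda>y q. \<exists>p\<in>omap T y. \<tau> y p = Comp C y Z D h (Comp C y x Z k q))"
    proof (rule cov_mono[OF lociso_surj[OF lP l]])
      fix y q assume q [simp]: "arr C y x q" and "\<exists>p\<in>omap P y. \<phi> y p = Comp C y x A l q"
      then obtain p where "p \<in> omap P y" "\<phi> y p = Comp C y x A l q" by blast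
      then show "\<exists>p\<in>omap T y. \<tau> y p = Comp C y Z D h (Comp C y x Z k q)"
        using comp_eq_extend[OF e q] arrD(1)[OF q] by (intro bexI[of _ "i y p"]) (simp_all add: \<tau>i)
    qed
  next
    fix x k l assume k [simp]: "arr C x Z k" and l [simp]: "arr C x B l" and e: "Comp C x B D n l = Comp C x Z D h k"
    show "cov x (\<lambda>y q. \<exists>p\<in>omap T y. \<tau> y p = Comp C y Z D h (Comp C y x Z k q))"
    proof (rule cov_mono[OF lociso_surj[OF lQ l]])
      fix y q assume q [simp]: "arr C y x q" and "\<exists>p\<in>omap Q y. \<psi> y p = Comp C y x B l q"
      then obtain p where "p \<in> omap Q y" "\<psi> y p = Comp C y x B l q" by blast
      then show "\<exists>p\<in>omap T y. \<tau> y p = Comp C y Z D h (Comp C y x Z k q)"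
        using comp_eq_extend[OF e q] arrD(1)[OF q] by (intro bexI[of _ "j y p"]) (simp_all add: \<tau>j)
    qed
  qed
  have jj: "cov Z (\<lambda>x k. amap T Z x k (j Z q) = amap T Z x k (j Z q'))"
    if Z: "Z \<in> Obj C" and q: "q \<in> omap Q Z" "q' \<in> omap Q Z" and e: "\<tau> Z (j Z q) = \<tau> Z (j Z q')" for Z q q'
  proof -
    have "\<psi> Z q = \<psi> Z q'"
      by (rule mono_cancel[OF n_mono, of Z]) (use Z q e in \<open>simp_all add: \<tau>j\<close>)
    from lociso_inj[OF lQ Z q this] show ?thesis
      by (rule cov_mono) (use q in \<open>simp add: jQT[symmetric]\<close>)
  qed
  have ij: "cov Z (\<lambda>x k. amap T Z x k (i Z p) = amap T Z x k (j Z q))"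
    if Z: "Z \<in> Obj C" and p: "p \<in> omap P Z" and q: "q \<in> omap Q Z" and e: "\<tau> Z (i Z p) = \<tau> Z (j Z q)" for Z p q
  proof -
    have "Comp C Z A D g (\<phi> Z p) = Comp C Z B D n (\<psi> Z q)" using e Z p q by (simp add: \<tau>i \<tau>j)
    then obtain c where c [simp]: "arr C Z X c" "Comp C Z X A m c = \<phi> Z p" "Comp C Z X B f c = \<psi> Z q"
      by (rule pb_ex[OF pb, rotated 2]) (use Z p q in auto)
    show ?thesis
    proof (rule cov_bind[OF lift[OF p c(1,2)]])
      fix x k assume k [simp]: "arr C x Z k" and "\<exists>r\<in>omap R x. \<theta> x r = Comp C x Z X c k \<and> amap P Z x k p = \<alpha> x r"
      then obtain r where r: "r \<in> omap R x" "\<theta> x r = Comp C x Z X c k" "amap P Z x k p = \<alpha> x r" by blast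
      note x = arrD(1)[OF k]
      have "\<psi> x (\<beta> x r) = \<psi> x (amap Q Z x k q)"
        using comp_tri[OF c(3) c(1) f k] by (simp add: ft[OF x r(1), symmetric] r(2) nQ[OF k q])
      from lociso_inj[OF lQ x tin(2)[OF x r(1)] psh_in[OF pD(3) k q] this]
      show "cov x (\<lambda>y l. amap T Z y (Comp C y x Z k l) (i Z p) = amap T Z y (Comp C y x Z k l) (j Z q))"
      proof (rule cov_mono)
        fix y l assume l: "arr C y x l" and "amap Q x y l (\<beta> x r) = amap Q x y l (amap Q Z x k q)"
        then have "amap T x y l (j x (\<beta> x r)) = amap T x y l (j x (amap Q Z x k q))"
          using jQT[OF l] tin(2)[OF x r(1)] psh_in[OF pD(3) k q] by metis
        then have "amap T x y l (amap T Z x k (i Z p)) = amap T x y l (amap T Z x k (j Z q))"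
          using iPT[OF k p] jQT[OF k q] r(3) pD(9)[OF x r(1)] by simp
        then show "amap T Z y (Comp C y x Z k l) (i Z p) = amap T Z y (Comp C y x Z k l) (j Z q)"
          using psh_comp[OF pD(4) k l] Z p q by simp
      qed
    qed
  qed
  have ii: "cov Z (\<lambda>x k. amap T Z x k (i Z p) = amap T Z x k (i Z p'))"
    if Z: "Z \<in> Obj C" and p: "p \<in> omap P Z" "p' \<in> omap P Z" and e: "\<tau> Z (i Z p) = \<tau> Z (i Z p')" for Z p p'
  proof -
    have g: "Comp C Z A D g (\<phi> Z p) = Comp C Z A D g (\<phi> Z p')" using e Z p by (simp add: \<tau>i)
    have pa: "arr C Z A (\<phi> Z p)" "arr C Z A (\<phi> Z p')" using Z p by simp_all
    show ?thesis
    proof (rule cov_bind[OF po_kernel[OF po m_mono pa g]], elim disjE exE conjE)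
      fix x k assume k [simp]: "arr C x Z k" and "Comp C x Z A (\<phi> Z p) k = Comp C x Z A (\<phi> Z p') k"
      then have "\<phi> x (amap P Z x k p) = \<phi> x (amap P Z x k p')" using nP[OF k] p by simp
      from lociso_inj[OF lP arrD(1)[OF k] psh_in[OF pD(2) k p(1)] psh_in[OF pD(2) k p(2)] this]
      show "cov x (\<lambda>y l. amap T Z y (Comp C y x Z k l) (i Z p) = amap T Z y (Comp C y x Z k l) (i Z p'))"
      proof (rule cov_mono)
        fix y l assume l: "arr C y x l" and eq: "amap P x y l (amap P Z x k p) = amap P x y l (amap P Z x k p')"
        have "amap P Z y (Comp C y x Z k l) p = amap P Z y (Comp C y x Z k l) p'"
          using eq psh_comp[OF pD(2) k l] p by simp
        then show "amap T Z y (Comp C y x Z k l) (i Z p) = amap T Z y (Comp C y x Z k l) (i Z p')"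
          using iPT[OF arr_comp[OF l k]] p by metis
      qed
    next
      \<comment> \<open>Both elements of \<open>P\<close> come locally from \<open>R\<close>, over
        \<open>c\<close> and over \<open>c'\<close>. The elements of \<open>R\<close> have equal
        images in \<open>B\<close>, hence locally equal images in \<open>Q\<close>, and the presheaf
        pushout identifies the original elements through \<open>Q\<close>.\<close>
      fix x k c c' assume k [simp]: "arr C x Z k" and c [simp]: "arr C x X c" "arr C x X c'"
        and mc: "Comp C x X A m c = Comp C x Z A (\<phi> Z p) k" "Comp C x X A m c' = Comp C x Z A (\<phi> Z p') k"
        and fc: "Comp C x X B f c = Comp C x X B f c'"
      note x = arrD(1)[OF k]
      define s s' where "s = amap P Z x k p" and "s' = amap P Z x k p'"
      have s: "s \<in> omap P x" "s' \<in> omap P x" using psh_in[OF pD(2) k] p by (simp_all add: s_def s'_def)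
      have ms: "Comp C x X A m c = \<phi> x s" "Comp C x X A m c' = \<phi> x s'"
        using mc nP[OF k] p by (simp_all add: s_def s'_def)
      have "cov x (\<lambda>y l. amap T x y l (i x s) = amap T x y l (i x s'))"
      proof (rule cov_bind[OF lift[OF s(1) c(1) ms(1)]])
        fix y l assume l [simp]: "arr C y x l" and "\<exists>r\<in>omap R y. \<theta> y r = Comp C y x X c l \<and> amap P x y l s = \<alpha> y r"
        then obtain r where r: "r \<in> omap R y" "\<theta> y r = Comp C y x X c l" "amap P x y l s = \<alpha> y r" by blast
        show "cov y (\<lambda>z w. amap T x z (Comp C z y x l w) (i x s) = amap T x z (Comp C z y x l w) (i x s'))"
        proof (rule cov_bind[OF cov_pull[OF lift[OF s(2) c(2) ms(2)] l]])
          fix z w assume w [simp]: "arr C z y w"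
            and "\<exists>r\<in>omap R z. \<theta> z r = Comp C z x X c' (Comp C z y x l w) \<and> amap P x z (Comp C z y x l w) s' = \<alpha> z r"
          then obtain r' where r': "r' \<in> omap R z" "\<theta> z r' = Comp C z x X c' (Comp C z y x l w)"
            "amap P x z (Comp C z y x l w) s' = \<alpha> z r'" by blast
          note z = arrD(1)[OF w]
          define r1 where "r1 = amap R y z w r"
          have r1: "r1 \<in> omap R z" "\<theta> z r1 = Comp C z x X c (Comp C z y x l w)" "amap P x z (Comp C z y x l w) s = \<alpha> z r1"
            using psh_in[OF pD(1) w r(1)] nR[OF w r(1)] r(2,3) tr_nat[OF pD(5) w r(1)] psh_comp[OF pD(2) l w s(1)]
            by (simp_all add: r1_def assoc)
          have "\<psi> z (\<beta> z r1) = \<psi> z (\<beta> z r')"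
            using comp_eq_extend[OF fc, of z "Comp C z y x l w"] by (simp add: ft[OF z, symmetric] r1 r')
          from lociso_inj[OF lQ z tin(2)[OF z r1(1)] tin(2)[OF z r'(1)] this]
          show "cov z (\<lambda>y' l'. amap T x y' (Comp C y' y x l (Comp C y' z y w l')) (i x s) =
             amap T x y' (Comp C y' y x l (Comp C y' z y w l')) (i x s'))"
          proof (rule cov_mono)
            fix v h assume h [simp]: "arr C v z h" and eq: "amap Q z v h (\<beta> z r1) = amap Q z v h (\<beta> z r')"
            have lw: "arr C z x (Comp C z y x l w)" by simp
            have "amap T z v h (j z (\<beta> z r1)) = amap T z v h (j z (\<beta> z r'))"
              using jQT[OF h] tin(2)[OF z] r1(1) r'(1) eq by metis
            then have "amap T z v h (i z (\<alpha> z r1)) = amap T z v h (i z (\<alpha> z r'))"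
              using pD(9)[OF z] r1(1) r'(1) by simp
            then have "amap T z v h (amap T x z (Comp C z y x l w) (i x s)) = amap T z v h (amap T x z (Comp C z y x l w) (i x s'))"
              using iPT[OF lw] s r1(3) r'(3) by metis
            then show "amap T x v (Comp C v y x l (Comp C v z y w h)) (i x s) = amap T x v (Comp C v y x l (Comp C v z y w h)) (i x s')"
              using psh_comp[OF pD(4) lw h] x s by (simp add: assoc)
          qed
        qed
      qed
      then show "cov x (\<lambda>y l. amap T Z y (Comp C y x Z k l) (i Z p) = amap T Z y (Comp C y x Z k l) (i Z p'))"
        by (rule cov_mono) (use psh_comp[OF pD(4) k] iPT[OF k] p Z in \<open>simp add: s_def s'_def\<close>)
    qed
  qed
  have "cov Z (\<lambda>x k. amap T Z x k t = amap T Z x k t')"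
    if Z: "Z \<in> Obj C" and tt: "t \<in> omap T Z" "t' \<in> omap T Z" and e: "\<tau> Z t = \<tau> Z t'" for Z t t'
  proof (rule pw_pushout_cases[OF pw Z tt(1)]; rule pw_pushout_cases[OF pw Z tt(2)])
    fix p p' assume "p \<in> omap P Z" "t = i Z p" "p' \<in> omap P Z" "t' = i Z p'"
    then show ?thesis using ii[OF Z] e by simp
  next
    fix p q assume "p \<in> omap P Z" "t = i Z p" "q \<in> omap Q Z" "t' = j Z q"
    then show ?thesis using ij[OF Z] e by simp
  next
    fix q p assume "q \<in> omap Q Z" "t = j Z q" "p \<in> omap P Z" "t' = i Z p"
    then have "cov Z (\<lambda>x k. amap T Z x k t' = amap T Z x k t)" using ij[OF Z] e by simp
    then show ?thesis by (rule cov_mono) simp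
  next
    fix q q' assume "q \<in> omap Q Z" "t = j Z q" "q' \<in> omap Q Z" "t' = j Z q'"
    then show ?thesis using jj[OF Z] e by simp
  qed
  then have "lociso T D \<tau>"
    unfolding lociso_def using pD(4) \<tau> surj by simp
  then show ?thesis by blast
qed

text \<open>Elements of a limit are compatible families, and finitely many covers have a common
  refinement. To lift an arrow into \<open>y\<close>, one refinement supplies an element at every
  object of \<open>J\<close>, and a second makes these elements compatible along every arrow of
  \<open>J\<close>.\<close>

lemma lociso_limit:
  assumes T: "rep ` Obj C \<subseteq> T" and J: "finite_category J" and D: "is_functor J (psh T) D"
    and lim: "is_limit J (psh T) D x \<pi>" and F: "is_functor J C F"
    and l: "\<And>j. j \<in> Obj J \<Longrightarrow> lociso (omap D j) (omap F j) (\<theta> j)"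
    and nat: "\<And>i j u a p. arr J i j u \<Longrightarrow> a \<in> Obj C \<Longrightarrow> p \<in> omap (omap D i) a \<Longrightarrow>
      \<theta> j a (amap D i j u a p) = Comp C a (omap F i) (omap F j) (amap F i j u) (\<theta> i a p)"
    and y: "is_limit J C F y \<rho>"
  obtains \<psi> where "lociso x y \<psi>"
    "\<And>j a p. j \<in> Obj J \<Longrightarrow> a \<in> Obj C \<Longrightarrow> p \<in> omap x a \<Longrightarrow> Comp C a y (omap F j) (\<rho> j) (\<psi> a p) = \<theta> j a (\<pi> j a p)"
proof -
  have x: "presheaf C x" "x \<in> T" and \<pi>: "\<And>j. j \<in> Obj J \<Longrightarrow> psh_trans C x (omap D j) (\<pi> j)"
    and \<pi>_nat: "\<And>i j u. arr J i j u \<Longrightarrow> Comp (presheaf_cat C) x (omap D i) (omap D j) (amap D i j u) (\<pi> i) = \<pi> j"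
    using lim_cone[OF lim] by (auto simp: cone_arr[OF D] arr_psh)
  have y': "y \<in> Obj C" and \<rho>: "\<And>j. j \<in> Obj J \<Longrightarrow> arr C y (omap F j) (\<rho> j)"
    and \<rho>_nat: "\<And>i j u. arr J i j u \<Longrightarrow> Comp C y (omap F i) (omap F j) (amap F i j u) (\<rho> i) = \<rho> j"
    using lim_cone[OF y] by (simp_all add: cone_arr[OF F])
  note Fj = functor_obj[OF F]
  have Dj: "presheaf C (omap D j)" if "j \<in> Obj J" for j using functor_obj[OF D that] by simp
  have Du: "psh_trans C (omap D i) (omap D j) (amap D i j u)" if "arr J i j u" for i j u
    using functor_arr[OF D that] by (simp add: arr_psh)
  note \<theta> = lociso_D(3)[OF l]
  have \<theta>_arr: "arr C a (omap F j) (\<theta> j a p)" if "j \<in> Obj J" "a \<in> Obj C" "p \<in> omap (omap D j) a" for j a p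
    by (rule tr_rep_arr[OF \<theta>[OF that(1)] Fj[OF that(1)] that(2,3)])
  have cone: "is_cone J C F a (\<lambda>j. \<theta> j a (\<pi> j a p))" if a: "a \<in> Obj C" and p: "p \<in> omap x a" for a p
    unfolding cone_arr[OF F]
  proof (intro conjI a ballI allI impI)
    show "arr C a (omap F j) (\<theta> j a (\<pi> j a p))" if "j \<in> Obj J" for j
      by (rule \<theta>_arr[OF that a tr_in[OF \<pi>[OF that] a p]])
    fix i j u assume u: "arr J i j u"
    show "Comp C a (omap F i) (omap F j) (amap F i j u) (\<theta> i a (\<pi> i a p)) = \<theta> j a (\<pi> j a p)"
      using nat[OF u a tr_in[OF \<pi>[OF arrD(1)[OF u]] a p]] presheaf_comp_eq_trD[OF \<pi>_nat[OF u] a p] by simp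
  qed
  define h where "h a p = (SOME h. arr C a y h \<and> (\<forall>j\<in>Obj J. Comp C a y (omap F j) (\<rho> j) h = \<theta> j a (\<pi> j a p)))" for a p
  have h: "arr C a y (h a p) \<and> (\<forall>j\<in>Obj J. Comp C a y (omap F j) (\<rho> j) (h a p) = \<theta> j a (\<pi> j a p))"
    if a: "a \<in> Obj C" and p: "p \<in> omap x a" for a p
    unfolding h_def by (rule someI_ex) (rule lim_ex[OF y cone[OF a p]], blast)
  have tr: "psh_trans C x (rep y) (mk_tr C x h)"
  proof (rule mk_trI[OF x(1)])
    show "h a p \<in> omap (rep y) a" if "a \<in> Obj C" "p \<in> omap x a" for a p
      using h[OF that] by (simp add: arr_def)
    fix a b f p assume f: "arr C b a f" and p: "p \<in> omap x a"
    note o = arrD(1,2)[OF f]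
    note 1 = h[OF o(2) p] and 2 = h[OF o(1) psh_in[OF x(1) f p]]
    have "h b (amap x a b f p) = Comp C b a y (h a p) f"
    proof (rule lim_uniq[OF F y])
      show "arr C b y (h b (amap x a b f p))" "arr C b y (Comp C b a y (h a p) f)" using 1 2 f by auto
      fix j assume j: "j \<in> Obj J"
      show "Comp C b y (omap F j) (\<rho> j) (h b (amap x a b f p)) = Comp C b y (omap F j) (\<rho> j) (Comp C b a y (h a p) f)"
        using 1 2 j f \<rho>[OF j] tr_nat[OF \<pi>[OF j] f p] tr_rep_nat[OF \<theta>[OF j] f tr_in[OF \<pi>[OF j] o(2) p]]
        by (simp add: assoc[symmetric])
    qed
    then show "h b (amap x a b f p) = amap (rep y) a b f (h a p)" using 1 by (simp add: arr_def)
  qed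
  define \<psi> where "\<psi> = mk_tr C x h"
  have \<psi>: "Comp C a y (omap F j) (\<rho> j) (\<psi> a p) = \<theta> j a (\<pi> j a p)" "arr C a y (\<psi> a p)"
    if "j \<in> Obj J" "a \<in> Obj C" "p \<in> omap x a" for j a p
    using h[OF that(2,3)] that by (simp_all add: \<psi>_def)
  have finJ: "finite (Obj J)" "finite {(i, j, u). arr J i j u}"
  proof -
    show "finite (Obj J)" using J by (simp add: finite_category_def)
    show "finite {(i, j, u). arr J i j u}"
    proof (rule finite_subset)
      show "{(i, j, u). arr J i j u} \<subseteq> (\<Union>i\<in>Obj J. \<Union>j\<in>Obj J. (\<lambda>u. (i, j, u)) ` Hom J i j)"
        by (auto simp: arr_def)
      show "finite (\<Union>i\<in>Obj J. \<Union>j\<in>Obj J. (\<lambda>u. (i, j, u)) ` Hom J i j)"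
        using J by (simp add: finite_category_def)
    qed
  qed
  have "lociso x y \<psi>"
    unfolding lociso_def
  proof (intro conjI x(1) y' allI impI ballI)
    show "psh_trans C x (rep y) \<psi>" using tr by (simp add: \<psi>_def)
  next
    fix Z p p' assume Z: "Z \<in> Obj C" and p: "p \<in> omap x Z" "p' \<in> omap x Z" and e: "\<psi> Z p = \<psi> Z p'"
    have "cov Z (\<lambda>a k. \<forall>j\<in>Obj J. amap (omap D j) Z a k (\<pi> j Z p) = amap (omap D j) Z a k (\<pi> j Z p'))"
    proof (rule cov_finite_ball[OF finJ(1) Z])
      fix j assume j: "j \<in> Obj J"
      show "cov Z (\<lambda>a k. amap (omap D j) Z a k (\<pi> j Z p) = amap (omap D j) Z a k (\<pi> j Z p'))"
        by (rule lociso_inj[OF l[OF j] Z tr_in[OF \<pi>[OF j] Z p(1)] tr_in[OF \<pi>[OF j] Z p(2)]])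
          (use \<psi>(1)[OF j Z] p e in metis)
      fix a k b q assume "arr C a Z k" "arr C b a q" "amap (omap D j) Z a k (\<pi> j Z p) = amap (omap D j) Z a k (\<pi> j Z p')"
      then show "amap (omap D j) Z b (Comp C b a Z k q) (\<pi> j Z p) = amap (omap D j) Z b (Comp C b a Z k q) (\<pi> j Z p')"
        using psh_comp'[OF Dj[OF j]] tr_in[OF \<pi>[OF j] Z] p by simp
    qed
    then show "cov Z (\<lambda>a k. amap x Z a k p = amap x Z a k p')"
    proof (rule cov_mono)
      fix a k assume k: "arr C a Z k"
        and e: "\<forall>j\<in>Obj J. amap (omap D j) Z a k (\<pi> j Z p) = amap (omap D j) Z a k (\<pi> j Z p')"
      show "amap x Z a k p = amap x Z a k p'"
        by (rule limit_elt_uniq[OF T D lim arrD(1)[OF k] psh_in[OF x(1) k p(1)] psh_in[OF x(1) k p(2)]])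
          (use e tr_nat[OF \<pi> k] p in simp)
    qed
  next
    fix Z g assume g: "arr C Z y g"
    note Z = arrD(1)[OF g]
    have "cov Z (\<lambda>a k. \<forall>j\<in>Obj J. \<exists>p\<in>omap (omap D j) a. \<theta> j a p = Comp C a Z (omap F j) (Comp C Z y (omap F j) (\<rho> j) g) k)"
    proof (rule cov_finite_ball[OF finJ(1) Z])
      fix j assume j: "j \<in> Obj J"
      show "cov Z (\<lambda>a k. \<exists>p\<in>omap (omap D j) a. \<theta> j a p = Comp C a Z (omap F j) (Comp C Z y (omap F j) (\<rho> j) g) k)"
        by (rule lociso_surj[OF l[OF j] arr_comp[OF g \<rho>[OF j]]])
      fix a k b q assume k: "arr C a Z k" and q: "arr C b a q"
        and "\<exists>p\<in>omap (omap D j) a. \<theta> j a p = Comp C a Z (omap F j) (Comp C Z y (omap F j) (\<rho> j) g) k"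
      then obtain p where p: "p \<in> omap (omap D j) a" "\<theta> j a p = Comp C a Z (omap F j) (Comp C Z y (omap F j) (\<rho> j) g) k" by blast
      show "\<exists>p\<in>omap (omap D j) b. \<theta> j b p = Comp C b Z (omap F j) (Comp C Z y (omap F j) (\<rho> j) g) (Comp C b a Z k q)"
        using psh_in[OF Dj[OF j] q p(1)] tr_rep_nat[OF \<theta>[OF j] q p(1)] p(2) k q g \<rho>[OF j]
        by (intro bexI[of _ "amap (omap D j) a b q p"]) (simp_all add: assoc)
    qed
    then show "cov Z (\<lambda>a k. \<exists>p\<in>omap x a. \<psi> a p = Comp C a Z y g k)"
    proof (rule cov_bind)
      fix a k assume k: "arr C a Z k"
        and "\<forall>j\<in>Obj J. \<exists>p\<in>omap (omap D j) a. \<theta> j a p = Comp C a Z (omap F j) (Comp C Z y (omap F j) (\<rho> j) g) k"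
      then obtain e where e: "\<And>j. j \<in> Obj J \<Longrightarrow> e j \<in> omap (omap D j) a"
        "\<And>j. j \<in> Obj J \<Longrightarrow> \<theta> j a (e j) = Comp C a Z (omap F j) (Comp C Z y (omap F j) (\<rho> j) g) k" by metis
      note a = arrD(1)[OF k]
      \<comment> \<open>The lifts \<open>e\<close> were chosen independently at the objects of
        \<open>J\<close>. They are compatible after the local isomorphisms are applied, hence on a
        cover for each of the finitely many arrows.\<close>
      have "cov a (\<lambda>b q. \<forall>t\<in>{(i, j, u). arr J i j u}. case t of (i, j, u) \<Rightarrow>
        amap (omap D j) a b q (amap D i j u a (e i)) = amap (omap D j) a b q (e j))"
      proof (rule cov_finite_ball[OF finJ(2) a])
        fix t assume "t \<in> {(i, j, u). arr J i j u}"
        then obtain i j u where t: "t = (i, j, u)" and u: "arr J i j u" by auto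
        note i = arrD(1)[OF u] and j = arrD(2)[OF u]
        have Dei: "amap D i j u a (e i) \<in> omap (omap D j) a" by (rule tr_in[OF Du[OF u] a e(1)[OF i]])
        have "\<theta> j a (amap D i j u a (e i)) = \<theta> j a (e j)"
          using nat[OF u a e(1)[OF i]] e(2)[OF i] e(2)[OF j] \<rho>_nat[OF u] k g \<rho>[OF i] functor_arr[OF F u]
          by (simp add: assoc[symmetric])
        then show "cov a (\<lambda>b q. case t of (i, j, u) \<Rightarrow> amap (omap D j) a b q (amap D i j u a (e i)) = amap (omap D j) a b q (e j))"
          using lociso_inj[OF l[OF j] a Dei e(1)[OF j]] by (simp add: t)
        fix b q c r assume "arr C b a q" "arr C c b r"
          "case t of (i, j, u) \<Rightarrow> amap (omap D j) a b q (amap D i j u a (e i)) = amap (omap D j) a b q (e j)"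
        then show "case t of (i, j, u) \<Rightarrow> amap (omap D j) a c (Comp C c b a q r) (amap D i j u a (e i)) = amap (omap D j) a c (Comp C c b a q r) (e j)"
          using psh_comp'[OF Dj[OF j]] Dei e(1)[OF j] by (simp add: t)
      qed
      then show "cov a (\<lambda>b q. \<exists>p\<in>omap x b. \<psi> b p = Comp C b Z y g (Comp C b a Z k q))"
      proof (rule cov_mono)
        fix b q assume q: "arr C b a q" and c: "\<forall>t\<in>{(i, j, u). arr J i j u}. case t of (i, j, u) \<Rightarrow>
          amap (omap D j) a b q (amap D i j u a (e i)) = amap (omap D j) a b q (e j)"
        note b = arrD(1)[OF q]
        obtain p where p: "p \<in> omap x b" "\<And>j. j \<in> Obj J \<Longrightarrow> \<pi> j b p = amap (omap D j) a b q (e j)"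
        proof (rule limit_elt_ex[OF T D lim b, of "\<lambda>j. amap (omap D j) a b q (e j)"])
          show "amap (omap D j) a b q (e j) \<in> omap (omap D j) b" if "j \<in> Obj J" for j
            by (rule psh_in[OF Dj[OF that] q e(1)[OF that]])
          show "amap D i j u b (amap (omap D i) a b q (e i)) = amap (omap D j) a b q (e j)" if u: "arr J i j u" for i j u
            using tr_nat[OF Du[OF u] q e(1)[OF arrD(1)[OF u]]] c u by auto
        qed blast
        have \<psi>p: "arr C b y (\<psi> b p)" using h[OF b p(1)] b p(1) by (simp add: \<psi>_def)
        have "\<psi> b p = Comp C b Z y g (Comp C b a Z k q)"
        proof (rule lim_uniq[OF F y \<psi>p])
          show "arr C b y (Comp C b Z y g (Comp C b a Z k q))" using g k q by simp
          fix j assume j: "j \<in> Obj J"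
          show "Comp C b y (omap F j) (\<rho> j) (\<psi> b p) = Comp C b y (omap F j) (\<rho> j) (Comp C b Z y g (Comp C b a Z k q))"
            using \<psi>(1)[OF j b p(1)] p(2)[OF j] tr_rep_nat[OF \<theta>[OF j] q e(1)[OF j]] e(2)[OF j] g k q \<rho>[OF j]
            by (simp add: assoc)
        qed
        then show "\<exists>p\<in>omap x b. \<psi> b p = Comp C b Z y g (Comp C b a Z k q)" using p(1) by blast
      qed
    qed
  qed
  then show ?thesis by (rule that) (use \<psi>(1) in blast)
qed

end

section \<open>The closure of the representables\<close>

context lfc_cat begin

definition closure_l :: "'u weight set \<Rightarrow> ('o, 'u) presheaf set" where
  "closure_l \<Phi> = \<Inter>{S. S \<subseteq> Obj (psh small) \<and> rep ` Obj C \<subseteq> S \<and> replete (psh small) S \<and>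
     closed_under_finite_limits (psh small) S \<and> closed_under_lex_colimits \<Phi> (psh small) S}"

lemma Phi_l_psh: "Phi_l \<Phi> C = psh (small \<inter> closure_l \<Phi>)"
  by (simp add: Phi_l_def closure_l_def small_presheaf_cat_psh full_subcat_full_subcat)

lemma closure_l_least:
  assumes "S \<subseteq> Obj (psh small)" "rep ` Obj C \<subseteq> S" "replete (psh small) S"
    "closed_under_finite_limits (psh small) S" "closed_under_lex_colimits \<Phi> (psh small) S"
  shows "closure_l \<Phi> \<subseteq> S"
  unfolding closure_l_def using assms by (intro Inter_lower) simp

lemma closure_l_rep: "c \<in> Obj C \<Longrightarrow> rep c \<in> closure_l \<Phi>"
  unfolding closure_l_def by blast

text \<open>Every class in the intersection contains \<open>closure_l\<close>, so a diagram in the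
  intersection is a diagram in that class, whose own closure property applies.\<close>

lemma closure_l_limits: "closed_under_finite_limits (psh small) (closure_l \<Phi>)"
  unfolding closed_under_finite_limits_def
proof (intro allI impI, elim conjE)
  fix J :: "(nat, nat) cat" and D x \<pi>
  assume J: "finite_category J" "is_functor J (psh small) D" "\<forall>j\<in>Obj J. omap D j \<in> closure_l \<Phi>" "is_limit J (psh small) D x \<pi>"
  show "x \<in> closure_l \<Phi>"
    unfolding closure_l_def
  proof (rule InterI, elim CollectE conjE)
    fix S assume S: "rep ` Obj C \<subseteq> S" "S \<subseteq> Obj (psh small)" "replete (psh small) S"
      "closed_under_lex_colimits \<Phi> (psh small) S" and lim: "closed_under_finite_limits (psh small) S"
    then have "closure_l \<Phi> \<subseteq> S" by (intro closure_l_least)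
    then have "\<forall>j\<in>Obj J. omap D j \<in> S" using J(3) by blast
    then show "x \<in> S"
      using lim[unfolded closed_under_finite_limits_def, THEN spec, of J, THEN spec, of D, THEN spec, of x, THEN spec, of \<pi>] J
      by blast
  qed
qed

lemma closure_l_colimits:
  assumes "(K, \<phi>) \<in> \<Phi>" "lex K (psh small) D" "\<forall>k\<in>Obj K. omap D k \<in> closure_l \<Phi>"
    "is_weighted_colimit K \<phi> (psh small) D x \<gamma>"
  shows "x \<in> closure_l \<Phi>"
  unfolding closure_l_def
proof (rule InterI, elim CollectE conjE)
  fix S assume S: "rep ` Obj C \<subseteq> S" "S \<subseteq> Obj (psh small)" "replete (psh small) S"
    "closed_under_finite_limits (psh small) S" and c: "closed_under_lex_colimits \<Phi> (psh small) S"
  then have "closure_l \<Phi> \<subseteq> S" by (intro closure_l_least)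
  then have "\<forall>k\<in>Obj K. omap D k \<in> S" using assms(3) by blast
  then show "x \<in> S"
    using c[unfolded closed_under_lex_colimits_def, THEN spec, of K, THEN spec, of \<phi>, THEN spec, of D,
        THEN spec, of x, THEN spec, of \<gamma>] assms by blast
qed

lemma rep_small_closure: "rep ` Obj C \<subseteq> small \<inter> closure_l \<Phi>"
  using small_rep closure_l_rep by auto

lemma yo_inj: "is_mono C X A m \<Longrightarrow> arr C X A m \<Longrightarrow> a \<in> Obj C \<Longrightarrow> inj_on (yo X A m a) (omap (rep X) a)"
proof (rule inj_onI)
  fix u v assume m: "is_mono C X A m" "arr C X A m" and a: "a \<in> Obj C" and u: "u \<in> omap (rep X) a" "v \<in> omap (rep X) a"
    and e: "yo X A m a u = yo X A m a v"
  have uv: "arr C a X u" "arr C a X v" using u a m(2) by (auto simp: arr_def)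
  show "u = v" by (rule mono_cancel[OF m(1) uv]) (use e a u in simp)
qed

text \<open>Monicity is tested on representables: two elements with the same image are two arrows
  from a representable with the same composite.\<close>

lemma psh_mono_inj:
  assumes T: "rep ` Obj C \<subseteq> T" and m: "is_mono (psh T) R P \<alpha>" and \<alpha>: "arr (psh T) R P \<alpha>" and a: "a \<in> Obj C"
  shows "inj_on (\<alpha> a) (omap R a)"
proof (rule inj_onI)
  fix r r' assume r: "r \<in> omap R a" "r' \<in> omap R a" and e: "\<alpha> a r = \<alpha> a r'"
  have R: "presheaf C R" "R \<in> T" and \<alpha>': "psh_trans C R P \<alpha>" using \<alpha> by (simp_all add: arr_psh)
  have E: "arr (psh T) (rep a) R (elt R a r)" "arr (psh T) (rep a) R (elt R a r')"
    using trans_elt[OF R(1) a] r R a T by (auto simp: arr_psh)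
  have "Comp (presheaf_cat C) (rep a) R P \<alpha> (elt R a r) = Comp (presheaf_cat C) (rep a) R P \<alpha> (elt R a r')"
  proof (rule presheaf_comp_eqI)
    fix b g assume "b \<in> Obj C" "g \<in> omap (rep a) b"
    then have g: "arr C b a g" using a by (simp add: arr_def)
    show "\<alpha> b (elt R a r b g) = \<alpha> b (elt R a r' b g)"
      using tr_nat[OF \<alpha>' g r(1)] tr_nat[OF \<alpha>' g r(2)] g e by simp
  qed
  then have "elt R a r = elt R a r'" by (intro mono_cancel[OF m E]) simp
  then have "elt R a r a (Ident C a) = elt R a r' a (Ident C a)" by simp
  then show "r = r'" using psh_id[OF R(1) a r(1)] psh_id[OF R(1) a r(2)] a by simp
qed

lemma pw_pushout_yo:
  assumes m: "is_mono C X A m" "arr C X A m" and f: "arr C X B f"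
  obtains T i j where "pw_pushout C (rep X) (rep A) (rep B) T (yo X A m) (yo X B f) i j" "small_presheaf C T"
proof -
  note o = arrD(1,2)[OF m(2)] arrD(2)[OF f]
  obtain T i j where T: "pw_pushout C (rep X) (rep A) (rep B) T (yo X A m) (yo X B f) i j"
    by (rule pw_pushout_ex[OF U category presheaf_rep[OF o(1)] presheaf_rep[OF o(2)] presheaf_rep[OF o(3)]
        trans_yo[OF m(2)] trans_yo[OF f] yo_inj[OF m]])
  have "small_presheaf C T" by (rule small_pushout[OF _ _ _ T]) (use small_rep o in auto)
  then show ?thesis using that T by blast
qed

lemma lex_yoneda: "lex C (psh small) (yoneda C)"
  unfolding lex_def
proof (intro conjI allI impI)
  have T: "rep ` Obj C \<subseteq> small" using small_rep by auto
  show "finitely_complete C" by (rule lfc)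
  show "finitely_complete (psh small)" by (rule finitely_complete_small)
  show "is_functor C (psh small) (yoneda C)" by (rule yoneda_functor[OF T])
  fix J :: "(nat, nat) cat" and D x \<pi> assume "finite_category J \<and> is_functor J C D \<and> is_limit J C D x \<pi>"
  then show "is_limit J (psh small) (comp_func (yoneda C) D) (omap (yoneda C) x) (\<lambda>j. yo x (omap D j) (\<pi> j))"
    using yoneda_limit[OF T, of J D x \<pi>] by (simp only: yoneda_omap)
qed

end

text \<open>Since \<open>m\<close> is monic, its image under the Yoneda embedding is pointwise
  injective, so the pushout that defines the weight admits the description by elements.\<close>

lemma adh_weight_pw:
  fixes K :: "('u, 'u) cat"
  assumes U: "set_universe TYPE('u)" and w: "is_adh_weight (K, \<phi>)"
  obtains A X B m f i j where "lfc_cat K" "free_lex_on_mono_span K (A, X, B, m, f)"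
    "is_mono K X A m" "arr K X A m" "arr K X B f"
    "pw_pushout K (representable K X) (representable K A) (representable K B) \<phi> (amap (yoneda K) X A m) (amap (yoneda K) X B f) i j"
proof -
  have K: "lfc_cat K"
    using U w by unfold_locales (auto simp: is_adh_weight_def lex_weight_def small_category_def)
  then interpret K: lfc_cat K .
  obtain A X B m f i j where s: "free_lex_on_mono_span K (A, X, B, m, f)"
    and po: "is_pushout (presheaf_cat K) (representable K X) (representable K A) (representable K B) \<phi>
      (amap (yoneda K) X A m) (amap (yoneda K) X B f) i j"
    using w unfolding is_adh_weight_def by auto
  have sp: "(A, X, B, m, f) \<in> Obj (mono_span_cat K)" using s by (simp add: free_lex_on_mono_span_def)
  then have m: "is_mono K X A m" "arr K X A m" and f: "arr K X B f"
    by (auto simp: mono_span_cat_def is_mono_def arr_def)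
  have "pw_pushout K (representable K X) (representable K A) (representable K B) \<phi> (amap (yoneda K) X A m) (amap (yoneda K) X B f) i j"
    by (rule is_pushout_pw[OF U K.category po K.yo_inj[OF m]])
  then show ?thesis using that[OF K s m f] by blast
qed

section \<open>Closure properties of the reflected presheaves, and the reflection\<close>

context adh_lfc begin

text \<open>The class to which the closure is compared. Smallness is part of it because the closure
  is formed inside the small presheaves.\<close>

definition reflected :: "('o, 'u) presheaf set" where
  "reflected = {P. small_presheaf C P \<and> (\<exists>c \<theta>. lociso P c \<theta>)}"

lemma reflected_rep: "rep ` Obj C \<subseteq> reflected"
  using small_rep lociso_rep by (auto simp: reflected_def)

lemma reflected_replete: "replete (psh small) reflected"
  unfolding replete_def
proof (intro ballI impI, elim exE)
  interpret E: cat "psh small" by unfold_locales (rule category_psh)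
  fix P Q i assume P: "P \<in> reflected" and Q: "Q \<in> Obj (psh small)" and i: "is_iso (psh small) P Q i"
  obtain c \<theta> where l: "lociso P c \<theta>" using P by (auto simp: reflected_def)
  have "E.iso P Q i" using P Q i small_is_presheaf by (auto simp: E.iso_def arr_def is_iso_def reflected_def)
  then obtain k where i: "arr (psh small) P Q i" and k: "arr (psh small) Q P k"
    and ki: "Comp (psh small) P Q P k i = Ident (psh small) P" and ik: "Comp (psh small) Q P Q i k = Ident (psh small) Q"
    by (rule E.isoE)
  have tr: "presheaf C P" "presheaf C Q" "psh_trans C P Q i" "psh_trans C Q P k" using i k by (simp_all add: arr_psh)
  have ki': "k a (i a p) = p" if "a \<in> Obj C" "p \<in> omap P a" for a p
    using presheaf_comp_eq_trD[OF _ that, of Q P k i "Ident (presheaf_cat C) P"] ki that by (simp add: presheaf_cat_Ident)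
  have ik': "i a (k a p) = p" if "a \<in> Obj C" "p \<in> omap Q a" for a p
    using presheaf_comp_eq_trD[OF _ that, of P Q i k "Ident (presheaf_cat C) Q"] ik that by (simp add: presheaf_cat_Ident)
  have "lociso Q c (Comp (presheaf_cat C) Q P (rep c) \<theta> k)"
    unfolding lociso_def
  proof (intro conjI tr(2) lociso_D(2)[OF l] tr_comp[OF tr(2,4) lociso_D(3)[OF l]] allI impI ballI)
    fix Z h assume h: "arr C Z c h"
    show "cov Z (\<lambda>x e. \<exists>p\<in>omap Q x. Comp (presheaf_cat C) Q P (rep c) \<theta> k x p = Comp C x Z c h e)"
    proof (rule cov_mono[OF lociso_surj[OF l h]])
      fix x e assume e: "arr C x Z e" and "\<exists>p\<in>omap P x. \<theta> x p = Comp C x Z c h e"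
      then obtain p where "p \<in> omap P x" "\<theta> x p = Comp C x Z c h e" by blast
      then show "\<exists>p\<in>omap Q x. Comp (presheaf_cat C) Q P (rep c) \<theta> k x p = Comp C x Z c h e"
        using arrD(1)[OF e] tr_in[OF tr(3)] by (intro bexI[of _ "i x p"]) (simp_all add: presheaf_cat_Comp ki')
    qed
  next
    fix Z p p' assume Z: "Z \<in> Obj C" and p: "p \<in> omap Q Z" "p' \<in> omap Q Z"
      and e: "Comp (presheaf_cat C) Q P (rep c) \<theta> k Z p = Comp (presheaf_cat C) Q P (rep c) \<theta> k Z p'"
    have "\<theta> Z (k Z p) = \<theta> Z (k Z p')" using e Z p by (simp add: presheaf_cat_Comp)
    from lociso_inj[OF l Z tr_in[OF tr(4) Z p(1)] tr_in[OF tr(4) Z p(2)] this]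
    show "cov Z (\<lambda>x e. amap Q Z x e p = amap Q Z x e p')"
    proof (rule cov_mono)
      fix x e assume e: "arr C x Z e" and "amap P Z x e (k Z p) = amap P Z x e (k Z p')"
      then have "i x (k x (amap Q Z x e p)) = i x (k x (amap Q Z x e p'))"
        using tr_nat[OF tr(4) e] p by simp
      then show "amap Q Z x e p = amap Q Z x e p'"
        using ik'[OF arrD(1)[OF e]] psh_in[OF tr(2) e] p by simp
    qed
  qed
  then show "Q \<in> reflected" using Q by (auto simp: reflected_def)
qed

lemma reflected_limits: "closed_under_finite_limits (psh small) reflected"
  unfolding closed_under_finite_limits_def
proof (intro allI impI, elim conjE)
  fix J :: "(nat, nat) cat" and D x \<pi>
  assume J: "finite_category J" and D: "is_functor J (psh small) D"
    and DS: "\<forall>j\<in>Obj J. omap D j \<in> reflected" and lim: "is_limit J (psh small) D x \<pi>"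
  have "\<forall>j\<in>Obj J. \<exists>c \<theta>. lociso (omap D j) c \<theta>" using DS by (auto simp: reflected_def)
  then obtain c \<theta> where l: "\<And>j. j \<in> Obj J \<Longrightarrow> lociso (omap D j) (c j) (\<theta> j)" by metis
  have Dj: "presheaf C (omap D j)" if "j \<in> Obj J" for j using functor_obj[OF D that] by simp
  have Du: "psh_trans C (omap D i) (omap D j) (amap D i j u)" if "arr J i j u" for i j u
    using functor_arr[OF D that] by (simp add: arr_psh)
  \<comment> \<open>The representing objects form a diagram in \<open>C\<close>: each arrow of
    \<open>D\<close> induces an arrow between them by universality of the local isomorphisms, and
    functoriality follows from uniqueness.\<close>
  define Fa where "Fa i j u = (SOME v. arr C (c i) (c j) v \<and> (\<forall>a\<in>Obj C. \<forall>p\<in>omap (omap D i) a.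
    Comp C a (c i) (c j) v (\<theta> i a p) = \<theta> j a (amap D i j u a p)))" for i j u
  have Fa: "arr C (c i) (c j) (Fa i j u) \<and> (\<forall>a\<in>Obj C. \<forall>p\<in>omap (omap D i) a.
    Comp C a (c i) (c j) (Fa i j u) (\<theta> i a p) = \<theta> j a (amap D i j u a p))" if u: "arr J i j u" for i j u
  proof -
    note i = arrD(1)[OF u] and j = arrD(2)[OF u]
    obtain v where v: "arr C (c i) (c j) v" "\<And>a p. a \<in> Obj C \<Longrightarrow> p \<in> omap (omap D i) a \<Longrightarrow>
        Comp C a (c i) (c j) v (\<theta> i a p) = Comp (presheaf_cat C) (omap D i) (omap D j) (rep (c j)) (\<theta> j) (amap D i j u) a p"
      using lociso_desc[OF l[OF i] lociso_D(2)[OF l[OF j]] tr_comp[OF Dj[OF i] Du[OF u] lociso_D(3)[OF l[OF j]]]] by metis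
    show ?thesis
      unfolding Fa_def by (rule someI[of _ v]) (use v in \<open>simp add: presheaf_cat_Comp\<close>)
  qed
  define F where "F = \<lparr>omap = c, amap = Fa\<rparr>"
  have F [simp]: "omap F = c" "amap F = Fa" by (simp_all add: F_def)
  have F_functor: "is_functor J C F"
  proof (rule functorI[OF functor_cat(1)[OF D] category])
    show "omap F a \<in> Obj C" if "a \<in> Obj J" for a using lociso_D(2)[OF l[OF that]] by simp
    show "arr C (omap F a) (omap F b) (amap F a b f)" if "arr J a b f" for a b f using Fa[OF that] by simp
    show "amap F j j (Ident J j) = Ident C (omap F j)" if j: "j \<in> Obj J" for j
    proof -
      interpret J: cat J by unfold_locales (rule functor_cat(1)[OF D])
      note cj = lociso_D(2,3)[OF l[OF j]]
      have "Fa j j (Ident J j) = Ident C (c j)"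
        by (rule lociso_ext[OF l[OF j], of "c j"])
          (use Fa[OF J.arr_id[OF j]] tr_rep_arr[OF cj(2,1)] cj(1) j functor_id[OF D j] in \<open>auto simp: presheaf_cat_Ident\<close>)
      then show ?thesis by simp
    qed
    show "amap F i k (Comp J i j k v u) = Comp C (omap F i) (omap F j) (omap F k) (amap F j k v) (amap F i j u)"
      if u: "arr J i j u" and v: "arr J j k v" for i j k u v
    proof -
      interpret J: cat J by unfold_locales (rule functor_cat(1)[OF D])
      note li = l[OF arrD(1)[OF u]]
      note f = Fa[OF u] Fa[OF v] Fa[OF J.arr_comp[OF u v]]
      have "Fa i k (Comp J i j k v u) = Comp C (c i) (c j) (c k) (Fa j k v) (Fa i j u)"
      proof (rule lociso_ext[OF li])
        fix a p assume a: "a \<in> Obj C" and p: "p \<in> omap (omap D i) a"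
        note pa = tr_rep_arr[OF lociso_D(3,2)[OF li] a p] tr_in[OF Du[OF u] a p]
        show "Comp C a (c i) (c k) (Fa i k (Comp J i j k v u)) (\<theta> i a p) = Comp C a (c i) (c k) (Comp C (c i) (c j) (c k) (Fa j k v) (Fa i j u)) (\<theta> i a p)"
          using f a p pa functor_comp[OF D u v] by (simp add: assoc presheaf_cat_Comp)
      qed (use f in auto)
      then show ?thesis by simp
    qed
  qed
  obtain y \<rho> where y: "is_limit J C F y \<rho>"
    using fc[unfolded finitely_complete_def, THEN conjunct2, THEN spec, of J, THEN spec, of F] J F_functor by blast
  have "rep ` Obj C \<subseteq> small" using small_rep by auto
  then obtain \<psi> where "lociso x y \<psi>"
    by (rule lociso_limit[OF _ J D lim F_functor _ _ y, of \<theta>]) (use l Fa in auto)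
  then show "x \<in> reflected"
    using lim by (auto simp: reflected_def is_limit_def is_cone_def)
qed

text \<open>A lex diagram on \<open>K\<close> sends the generic monomorphism to a monomorphism of
  presheaves, which is pointwise injective, so \<open>lociso_pushout\<close> applies to the image of
  the generic span. By the Yoneda lemma the weighted colimit is that pushout up to
  isomorphism.\<close>

lemma reflected_colimits:
  fixes K :: "('u, 'u) cat" and \<phi> :: "('u, 'u) presheaf"
  assumes w: "is_adh_weight (K, \<phi>)"
  shows "closed_under_lex_colimits {(K, \<phi>)} (psh small) reflected"
  unfolding closed_under_lex_colimits_def
proof (intro allI impI, elim conjE)
  fix K' :: "('u, 'u) cat" and \<phi>' D x \<gamma>
  assume "(K', \<phi>') \<in> {(K, \<phi>)}" and D: "lex K' (psh small) D" and DS: "\<forall>k\<in>Obj K'. omap D k \<in> reflected"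
    and x: "is_weighted_colimit K' \<phi>' (psh small) D x \<gamma>"
  then have K' [simp]: "K' = K" "\<phi>' = \<phi>" by simp_all
  interpret E: cat "psh small" by unfold_locales (rule category_psh)
  have T: "rep ` Obj C \<subseteq> small" using small_rep by auto
  obtain A X B m f i j where K: "lfc_cat K" and m: "is_mono K X A m" "arr K X A m" and f: "arr K X B f"
    and pw: "pw_pushout K (representable K X) (representable K A) (representable K B) \<phi> (amap (yoneda K) X A m) (amap (yoneda K) X B f) i j"
    by (rule adh_weight_pw[OF U w])
  interpret K: lfc_cat K by fact
  have DK: "lex K (psh small) D" using D by simp
  note F = lex_functor[OF DK]
  note Dm = functor_arr[OF F m(2)] and Df = functor_arr[OF F f]
  have d: "presheaf C (omap D X)" "presheaf C (omap D A)" "presheaf C (omap D B)"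
    "omap D X \<in> small" "omap D A \<in> small" "omap D B \<in> small"
    "psh_trans C (omap D X) (omap D A) (amap D X A m)" "psh_trans C (omap D X) (omap D B) (amap D X B f)"
    using Dm Df by (simp_all add: arr_psh)
  have inj: "inj_on (amap D X A m a) (omap (omap D X) a)" if "a \<in> Obj C" for a
    by (rule psh_mono_inj[OF T lex_mono[OF DK m] Dm that])
  obtain P g n where P: "pw_pushout C (omap D X) (omap D A) (omap D B) P (amap D X A m) (amap D X B f) g n"
    by (rule pw_pushout_ex[OF U category d(1-3) d(7,8) inj])
  have small_P: "small_presheaf C P" by (rule small_pushout[OF _ _ _ P]) (use d in auto)
  then have "is_pushout (psh small) (omap D X) (omap D A) (omap D B) P (amap D X A m) (amap D X B f) g n"
    by (intro pw_pushout_is_pushout[OF P]) (use d in auto)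
  from K.weighted_colimit_of_pushout[OF m(2) f pw F this] obtain \<delta> where \<delta>: "is_weighted_colimit K \<phi> (psh small) D P \<delta>" by blast
  have o: "X \<in> Obj K" "A \<in> Obj K" "B \<in> Obj K" using arrD(1,2)[OF m(2)] arrD(2)[OF f] by simp_all
  have "\<exists>c \<theta>. lociso (omap D k) c \<theta>" if "k \<in> Obj K" for k using DS that by (simp add: reflected_def)
  then obtain cX tX cA tA cB tB where "lociso (omap D X) cX tX" "lociso (omap D A) cA tA" "lociso (omap D B) cB tB"
    using o by metis
  then have "\<exists>c \<theta>. lociso P c \<theta>" using lociso_pushout[OF P inj] by blast
  then have P_refl: "P \<in> reflected" using small_P by (simp add: reflected_def)
  have x': "is_weighted_colimit K \<phi> (psh small) D x \<gamma>" using x by simp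
  have "\<exists>i. is_iso (psh small) P x i" by (rule weighted_colimit_iso[OF category_psh F \<delta> x'])
  moreover have "x \<in> Obj (psh small)" using x by (auto simp: is_weighted_colimit_def weighted_cocone_def)
  ultimately show "x \<in> reflected" using reflected_replete P_refl unfolding replete_def by blast
qed

text \<open>Minimality of the closure puts it inside \<open>reflected\<close>. Choosing one local
  isomorphism for each presheaf gives both the object part of the left adjoint and the unit; the
  action on arrows and the counit are forced by universality, the counit at \<open>c\<close> being
  the arrow that undoes the unit at the representable of \<open>c\<close>.\<close>

lemma adhesive_imp_exact:
  fixes K :: "('u, 'u) cat" and \<phi> :: "('u, 'u) presheaf"
  assumes w: "is_adh_weight (K, \<phi>)"
  shows "Phi_exact {(K, \<phi>)} C"
proof -
  define T where "T = small \<inter> closure_l {(K, \<phi>)}"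
  have Phi: "Phi_l {(K, \<phi>)} C = psh T" by (simp add: Phi_l_psh T_def)
  have repT: "rep ` Obj C \<subseteq> T" unfolding T_def by (rule rep_small_closure)
  have "reflected \<subseteq> Obj (psh small)" using small_is_presheaf by (auto simp: reflected_def)
  then have "closure_l {(K, \<phi>)} \<subseteq> reflected"
    by (intro closure_l_least reflected_rep reflected_replete reflected_limits reflected_colimits w)
  then have "\<forall>P\<in>T. \<exists>c \<theta>. lociso P c \<theta>" by (auto simp: T_def reflected_def)
  then obtain cc th where l: "\<And>P. P \<in> T \<Longrightarrow> lociso P (cc P) (th P)" by metis
  interpret E: cat "psh T" by unfold_locales (rule category_psh)
  \<comment> \<open>Lexness of \<open>L\<close> requires finite limits in its domain. They are those
    of small presheaves, under which the closure is closed.\<close>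
  have fcE: "finitely_complete (psh T)"
    using finitely_complete_full_subcat[OF finitely_complete_small closure_l_limits]
    by (simp add: T_def full_subcat_full_subcat)
  define La where "La P Q \<alpha> = (SOME v. arr C (cc P) (cc Q) v \<and> (\<forall>a\<in>Obj C. \<forall>p\<in>omap P a.
    Comp C a (cc P) (cc Q) v (th P a p) = th Q a (\<alpha> a p)))" for P Q \<alpha>
  have La: "arr C (cc P) (cc Q) (La P Q \<alpha>) \<and> (\<forall>a\<in>Obj C. \<forall>p\<in>omap P a.
    Comp C a (cc P) (cc Q) (La P Q \<alpha>) (th P a p) = th Q a (\<alpha> a p))" if \<alpha>: "arr (psh T) P Q \<alpha>" for P Q \<alpha>
  proof -
    have P: "presheaf C P" "P \<in> T" "Q \<in> T" "psh_trans C P Q \<alpha>" using \<alpha> by (simp_all add: arr_psh)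
    obtain v where v: "arr C (cc P) (cc Q) v" "\<And>a p. a \<in> Obj C \<Longrightarrow> p \<in> omap P a \<Longrightarrow>
        Comp C a (cc P) (cc Q) v (th P a p) = Comp (presheaf_cat C) P Q (rep (cc Q)) (th Q) \<alpha> a p"
      using lociso_desc[OF l[OF P(2)] lociso_D(2)[OF l[OF P(3)]] tr_comp[OF P(1,4) lociso_D(3)[OF l[OF P(3)]]]] by metis
    show ?thesis
      unfolding La_def by (rule someI[of _ v]) (use v in \<open>simp add: presheaf_cat_Comp\<close>)
  qed
  define L where "L = \<lparr>omap = cc, amap = La\<rparr>"
  have L [simp]: "omap L = cc" "amap L = La" by (simp_all add: L_def)
  have th_arr: "arr C a (cc P) (th P a p)" if "P \<in> T" "a \<in> Obj C" "p \<in> omap P a" for P a p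
    by (rule tr_rep_arr[OF lociso_D(3,2)[OF l[OF that(1)]] that(2,3)])
  have cc: "cc P \<in> Obj C" if "P \<in> T" for P by (rule lociso_D(2)[OF l[OF that]])
  have L_functor: "is_functor (psh T) C L"
  proof (rule functorI[OF category_psh category])
    show "omap L P \<in> Obj C" if "P \<in> Obj (psh T)" for P using cc that by simp
    show "arr C (omap L P) (omap L Q) (amap L P Q \<alpha>)" if "arr (psh T) P Q \<alpha>" for P Q \<alpha> using La[OF that] by simp
    show "amap L P P (Ident (psh T) P) = Ident C (omap L P)" if P: "P \<in> Obj (psh T)" for P
    proof -
      have PT: "P \<in> T" using P by simp
      have "La P P (Ident (psh T) P) = Ident C (cc P)"
        by (rule lociso_ext[OF l[OF PT], of "cc P"])
          (use La[OF E.arr_id[OF P]] th_arr[OF PT] cc[OF PT] in \<open>auto simp: presheaf_cat_Ident\<close>)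
      then show ?thesis by simp
    qed
    show "amap L P R (Comp (psh T) P Q R \<beta> \<alpha>) = Comp C (omap L P) (omap L Q) (omap L R) (amap L Q R \<beta>) (amap L P Q \<alpha>)"
      if \<alpha>: "arr (psh T) P Q \<alpha>" and \<beta>: "arr (psh T) Q R \<beta>" for P Q R \<alpha> \<beta>
    proof -
      have P: "P \<in> T" "psh_trans C P Q \<alpha>" using \<alpha> by (simp_all add: arr_psh)
      note f = La[OF \<alpha>] La[OF \<beta>] La[OF E.arr_comp[OF \<alpha> \<beta>]]
      have "La P R (Comp (psh T) P Q R \<beta> \<alpha>) = Comp C (cc P) (cc Q) (cc R) (La Q R \<beta>) (La P Q \<alpha>)"
      proof (rule lociso_ext[OF l[OF P(1)]])
        fix a p assume a: "a \<in> Obj C" and p: "p \<in> omap P a"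
        note pa = th_arr[OF P(1) a p] tr_in[OF P(2) a p]
        show "Comp C a (cc P) (cc R) (La P R (Comp (psh T) P Q R \<beta> \<alpha>)) (th P a p) =
          Comp C a (cc P) (cc R) (Comp C (cc P) (cc Q) (cc R) (La Q R \<beta>) (La P Q \<alpha>)) (th P a p)"
          using f a p pa by (simp add: assoc presheaf_cat_Comp)
      qed (use f in auto)
      then show ?thesis by simp
    qed
  qed
  have repT': "rep c \<in> T" if "c \<in> Obj C" for c using repT that by blast
  define \<eta> where "\<eta> = (\<lambda>P\<in>Obj (psh T). th P)"
  have \<eta> [simp]: "\<eta> P = th P" if "presheaf C P" "P \<in> T" for P using that by (simp add: \<eta>_def)
  define \<epsilon> where "\<epsilon> = (\<lambda>c\<in>Obj C. SOME v. arr C (cc (rep c)) c v \<and>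
    (\<forall>a\<in>Obj C. \<forall>g\<in>omap (rep c) a. Comp C a (cc (rep c)) c v (th (rep c) a g) = g))"
  have \<epsilon>: "arr C (cc (rep c)) c (\<epsilon> c) \<and> (\<forall>a\<in>Obj C. \<forall>g\<in>omap (rep c) a. Comp C a (cc (rep c)) c (\<epsilon> c) (th (rep c) a g) = g)"
    if c: "c \<in> Obj C" for c
  proof -
    obtain v where v: "arr C (cc (rep c)) c v" "\<And>a g. a \<in> Obj C \<Longrightarrow> g \<in> omap (rep c) a \<Longrightarrow>
        Comp C a (cc (rep c)) c v (th (rep c) a g) = Ident (presheaf_cat C) (rep c) a g"
      using lociso_desc[OF l[OF repT'[OF c]] c tr_ident[OF presheaf_rep[OF c]]] by metis
    have ex: "\<exists>v. arr C (cc (rep c)) c v \<and> (\<forall>a\<in>Obj C. \<forall>g\<in>omap (rep c) a. Comp C a (cc (rep c)) c v (th (rep c) a g) = g)"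
      using v by (intro exI[of _ v]) (simp add: presheaf_cat_Ident)
    have "\<epsilon> c = (SOME v. arr C (cc (rep c)) c v \<and>
        (\<forall>a\<in>Obj C. \<forall>g\<in>omap (rep c) a. Comp C a (cc (rep c)) c v (th (rep c) a g) = g))"
      using c by (simp add: \<epsilon>_def)
    then show ?thesis using someI_ex[OF ex] by simp
  qed
  note yf = yoneda_functor[OF repT]
  have adj: "adjunction (psh T) C L (yoneda C) \<eta> \<epsilon>"
    unfolding adjunction_def
  proof (intro conjI L_functor yf ballI)
    show "nat_trans (psh T) (psh T) id_func (comp_func (yoneda C) L) \<eta>"
      unfolding nat_trans_def
    proof (intro conjI ballI)
      show "\<eta> \<in> extensional (Obj (psh T))" by (simp add: \<eta>_def)
      show "\<eta> P \<in> Hom (psh T) (omap id_func P) (omap (comp_func (yoneda C) L) P)" if "P \<in> Obj (psh T)" for P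
        using that lociso_D(3)[OF l] by simp
      fix P Q \<alpha> assume P: "P \<in> Obj (psh T)" "Q \<in> Obj (psh T)" and "\<alpha> \<in> Hom (psh T) P Q"
      then have \<alpha>: "arr (psh T) P Q \<alpha>" by (simp add: arr_def)
      have "Comp (presheaf_cat C) P Q (rep (cc Q)) (th Q) \<alpha> = Comp (presheaf_cat C) P (rep (cc P)) (rep (cc Q)) (yo (cc P) (cc Q) (La P Q \<alpha>)) (th P)"
        by (rule presheaf_comp_eqI) (use La[OF \<alpha>] P arrD(3)[OF th_arr] in simp)
      then show "Comp (psh T) (omap id_func P) (omap id_func Q) (omap (comp_func (yoneda C) L) Q) (\<eta> Q) (amap id_func P Q \<alpha>) =
          Comp (psh T) (omap id_func P) (omap (comp_func (yoneda C) L) P) (omap (comp_func (yoneda C) L) Q)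
            (amap (comp_func (yoneda C) L) P Q \<alpha>) (\<eta> P)"
        using P by simp
    qed
    show "nat_trans C C (comp_func L (yoneda C)) id_func \<epsilon>"
      unfolding nat_trans_def
    proof (intro conjI ballI)
      show "\<epsilon> \<in> extensional (Obj C)" by (simp add: \<epsilon>_def)
      show "\<epsilon> c \<in> Hom C (omap (comp_func L (yoneda C)) c) (omap id_func c)" if "c \<in> Obj C" for c
        using arrD(3)[OF conjunct1[OF \<epsilon>[OF that]]] by simp
      fix c d f assume c: "c \<in> Obj C" "d \<in> Obj C" and "f \<in> Hom C c d"
      then have f: "arr C c d f" by (simp add: arr_def)
      have y: "arr (psh T) (rep c) (rep d) (yo c d f)" using functor_arr[OF yf f] by simp
      note Ly = La[OF y]
      have "Comp C (cc (rep c)) (cc (rep d)) d (\<epsilon> d) (La (rep c) (rep d) (yo c d f)) = Comp C (cc (rep c)) c d f (\<epsilon> c)"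
      proof (rule lociso_ext[OF l[OF repT'[OF c(1)]]])
        fix a g assume a: "a \<in> Obj C" and g: "g \<in> omap (rep c) a"
        then have g': "arr C a c g" using c by (simp add: arr_def)
        note t = th_arr[OF repT'[OF c(1)] a g]
        have "Comp C a c d f g \<in> omap (rep d) a" using arrD(3)[OF arr_comp[OF g' f]] by simp
        then show "Comp C a (cc (rep c)) d (Comp C (cc (rep c)) (cc (rep d)) d (\<epsilon> d) (La (rep c) (rep d) (yo c d f))) (th (rep c) a g) =
          Comp C a (cc (rep c)) d (Comp C (cc (rep c)) c d f (\<epsilon> c)) (th (rep c) a g)"
          using Ly \<epsilon>[OF c(1)] \<epsilon>[OF c(2)] a g t f by (simp add: assoc)
      qed (use Ly \<epsilon>[OF c(1)] \<epsilon>[OF c(2)] f in auto)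
      then show "Comp C (omap (comp_func L (yoneda C)) c) (omap (comp_func L (yoneda C)) d) (omap id_func d) (\<epsilon> d) (amap (comp_func L (yoneda C)) c d f) =
          Comp C (omap (comp_func L (yoneda C)) c) (omap id_func c) (omap id_func d) (amap id_func c d f) (\<epsilon> c)"
        by simp
    qed
  next
    fix P assume "P \<in> Obj (psh T)"
    then have P: "P \<in> T" "presheaf C P" by simp_all
    note c = cc[OF P(1)]
    have \<theta>: "arr (psh T) P (rep (cc P)) (th P)"
      using lociso_D[OF l[OF P(1)]] P repT'[OF c] by (simp add: arr_psh)
    note Lt = La[OF \<theta>]
    have "Comp C (cc P) (cc (rep (cc P))) (cc P) (\<epsilon> (cc P)) (La P (rep (cc P)) (th P)) = Ident C (cc P)"
    proof (rule lociso_ext[OF l[OF P(1)]])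
      fix a p assume a: "a \<in> Obj C" and p: "p \<in> omap P a"
      note t = th_arr[OF P(1) a p]
      show "Comp C a (cc P) (cc P) (Comp C (cc P) (cc (rep (cc P))) (cc P) (\<epsilon> (cc P)) (La P (rep (cc P)) (th P))) (th P a p) =
        Comp C a (cc P) (cc P) (Ident C (cc P)) (th P a p)"
        using Lt \<epsilon>[OF c] a p t arrD(3)[OF t] by (simp add: assoc)
    qed (use Lt \<epsilon>[OF c] c in auto)
    then show "Comp C (omap L P) (omap L (omap (yoneda C) (omap L P))) (omap L P) (\<epsilon> (omap L P))
        (amap L P (omap (yoneda C) (omap L P)) (\<eta> P)) = Ident C (omap L P)"
      using P by simp
  next
    fix c assume c: "c \<in> Obj C"
    note R = repT'[OF c] presheaf_rep[OF c]
    have "Comp (presheaf_cat C) (rep c) (rep (cc (rep c))) (rep c) (yo (cc (rep c)) c (\<epsilon> c)) (th (rep c)) = Ident (presheaf_cat C) (rep c)"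
    proof (rule presheaf_comp_eq_trI[OF tr_ident[OF R(2)] lociso_D(3)[OF l[OF R(1)]] trans_yo R(2)])
      show "arr C (cc (rep c)) c (\<epsilon> c)" using \<epsilon>[OF c] by simp
      fix a g assume a: "a \<in> Obj C" and g: "g \<in> omap (rep c) a"
      show "yo (cc (rep c)) c (\<epsilon> c) a (th (rep c) a g) = Ident (presheaf_cat C) (rep c) a g"
        using \<epsilon>[OF c] a g arrD(3)[OF th_arr[OF R(1) a g]] by (simp add: presheaf_cat_Ident)
    qed
    then show "Comp (psh T) (omap (yoneda C) c) (omap (yoneda C) (omap L (omap (yoneda C) c))) (omap (yoneda C) c)
         (yo (omap L (omap (yoneda C) c)) c (\<epsilon> c)) (\<eta> (omap (yoneda C) c)) = Ident (psh T) (omap (yoneda C) c)"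
      using R by simp
  qed
  have "lex (psh T) C L"
    unfolding lex_def
  proof (intro conjI fcE lfc L_functor allI impI, elim conjE)
    fix J :: "(nat, nat) cat" and D x \<pi>
    assume J: "finite_category J" and D: "is_functor J (psh T) D" and lim: "is_limit J (psh T) D x \<pi>"
    note F = functor_comp_func[OF D L_functor]
    obtain y \<rho> where y: "is_limit J C (comp_func L D) y \<rho>"
      using fc[unfolded finitely_complete_def, THEN conjunct2, THEN spec, of J, THEN spec, of "comp_func L D"] J F by blast
    have DT: "omap D j \<in> T" if "j \<in> Obj J" for j using functor_obj[OF D that] by simp
    have xT: "x \<in> T" "presheaf C x" and \<pi>: "\<And>j. j \<in> Obj J \<Longrightarrow> arr (psh T) x (omap D j) (\<pi> j)"
      using lim_cone[OF lim] by (auto simp: cone_arr[OF D])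
    obtain \<psi> where \<psi>: "lociso x y \<psi>"
      "\<And>j a p. j \<in> Obj J \<Longrightarrow> a \<in> Obj C \<Longrightarrow> p \<in> omap x a \<Longrightarrow> Comp C a y (omap (comp_func L D) j) (\<rho> j) (\<psi> a p) = th (omap D j) a (\<pi> j a p)"
    proof (rule lociso_limit[OF repT J D lim F _ _ y, of "\<lambda>j. th (omap D j)"])
      show "lociso (omap D j) (omap (comp_func L D) j) (th (omap D j))" if "j \<in> Obj J" for j
        using l[OF DT[OF that]] by simp
      show "th (omap D j) a (amap D i j u a p) = Comp C a (omap (comp_func L D) i) (omap (comp_func L D) j) (amap (comp_func L D) i j u) (th (omap D i) a p)"
        if "arr J i j u" "a \<in> Obj C" "p \<in> omap (omap D i) a" for i j u a p
        using La[OF functor_arr[OF D that(1)]] that(2,3) by simp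
    qed blast
    obtain h where h: "iso (cc x) y h" "\<And>a p. a \<in> Obj C \<Longrightarrow> p \<in> omap x a \<Longrightarrow> Comp C a (cc x) y h (th x a p) = \<psi> a p"
      by (rule lociso_iso[OF l[OF xT(1)] \<psi>(1)]) blast
    \<comment> \<open>The chosen local isomorphism at the limit presheaf and the one from
      \<open>lociso_limit\<close> are both universal, so the image of the limit cone differs from a
      limit cone in \<open>C\<close> by the isomorphism \<open>h\<close>.\<close>
    have "is_limit J C (comp_func L D) (cc x) (\<lambda>j. La x (omap D j) (\<pi> j))"
    proof (rule lim_transport[OF F y h(1)])
      fix j assume j: "j \<in> Obj J"
      have \<rho>: "arr C y (cc (omap D j)) (\<rho> j)" using lim_cone[OF y] j by (simp add: cone_arr[OF F])
      note Lp = La[OF \<pi>[OF j]]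
      have "La x (omap D j) (\<pi> j) = Comp C (cc x) y (cc (omap D j)) (\<rho> j) h"
      proof (rule lociso_ext[OF l[OF xT(1)]])
        fix a p assume a: "a \<in> Obj C" and p: "p \<in> omap x a"
        show "Comp C a (cc x) (cc (omap D j)) (La x (omap D j) (\<pi> j)) (th x a p) =
          Comp C a (cc x) (cc (omap D j)) (Comp C (cc x) y (cc (omap D j)) (\<rho> j) h) (th x a p)"
          using Lp a p \<psi>(2)[OF j a p] h(2)[OF a p] \<rho> iso_arr[OF h(1)] th_arr[OF xT(1) a p] by (simp add: assoc)
      qed (use Lp \<rho> iso_arr[OF h(1)] in auto)
      then show "La x (omap D j) (\<pi> j) = Comp C (cc x) y (omap (comp_func L D) j) (\<rho> j) h" by simp
    qed
    then show "is_limit J C (comp_func L D) (omap L x) (\<lambda>j. amap L x (omap D j) (\<pi> j))" by simp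
  qed
  then show ?thesis
    unfolding Phi_exact_def Phi using adj lfc by blast
qed

end

section \<open>Exact categories are adhesive\<close>

context cat begin

lemma iso_comp:
  assumes f: "iso a b f" and g: "iso b c g" shows "iso a c (Comp C a b c g f)"
proof -
  obtain f' where f' [simp]: "arr C a b f" "arr C b a f'" "Comp C a b a f' f = Ident C a" "Comp C b a b f f' = Ident C b"
    by (rule isoE[OF f])
  obtain g' where g' [simp]: "arr C b c g" "arr C c b g'" "Comp C b c b g' g = Ident C b" "Comp C c b c g g' = Ident C c"
    by (rule isoE[OF g])
  have "Comp C a c a (Comp C c b a f' g') (Comp C a b c g f) = Ident C a"
    using comp_tri[OF g'(3,1,2) f'(1)] by (simp add: assoc)
  moreover have "Comp C c a c (Comp C a b c g f) (Comp C c b a f' g') = Ident C c"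
    using comp_tri[OF f'(4,2,1) g'(2)] by (simp add: assoc)
  ultimately show ?thesis by (intro isoI[of _ _ _ "Comp C c b a f' g'"]) simp_all
qed

lemma iso_ident: "a \<in> Obj C \<Longrightarrow> iso a a (Ident C a)"
  by (intro isoI[of _ _ _ "Ident C a"]) simp_all

lemma iso_inv:
  assumes "iso a b f" obtains g where "iso b a g" "Comp C a b a g f = Ident C a" "Comp C b a b f g = Ident C b"
proof -
  obtain g where g: "arr C a b f" "arr C b a g" "Comp C a b a g f = Ident C a" "Comp C b a b f g = Ident C b"
    by (rule isoE[OF assms])
  then have "iso b a g" by (intro isoI[of _ _ _ f])
  then show ?thesis using that g by blast
qed

lemma iso_cancel_left:
  assumes f: "arr C a b f" and g: "iso b c g" and gf: "iso a c (Comp C a b c g f)"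
  shows "iso a b f"
proof -
  obtain k where k: "iso c b k" "Comp C b c b k g = Ident C b" by (rule iso_inv[OF g])
  have "iso a b (Comp C a c b k (Comp C a b c g f))" by (rule iso_comp[OF gf k(1)])
  then show ?thesis using comp_tri[OF k(2) iso_arr[OF g] iso_arr[OF k(1)] f] f by simp
qed

end

lemma functor_iso:
  assumes F: "is_functor C D F" and f: "cat.iso C a b f"
  shows "cat.iso D (omap F a) (omap F b) (amap F a b f)"
proof -
  interpret C: cat C by unfold_locales (rule functor_cat(1)[OF F])
  interpret D: cat D by unfold_locales (rule functor_cat(2)[OF F])
  obtain g where g: "arr C a b f" "arr C b a g" "Comp C a b a g f = Ident C a" "Comp C b a b f g = Ident C b"
    by (rule C.isoE[OF f])
  show ?thesis
    by (rule D.isoI[OF functor_arr[OF F g(1)] functor_arr[OF F g(2)]])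
      (use functor_comp[OF F g(1,2)] functor_comp[OF F g(2,1)] functor_id[OF F] g arrD[OF g(1)] in simp_all)
qed

text \<open>
  Transporting a small full subcategory of C to a category with objects of type 'u makes the
  universal property of the weight applicable to spans in C.
\<close>

lemma (in lfc_cat) mono_span_functor:
  fixes K :: "('u, 'u) cat"
  assumes free: "free_lex_on_mono_span K (A0, X0, B0, m0, f0)"
    and m: "is_mono C X A m" "arr C X A m" and f: "arr C X B f"
  obtains F ia ix ib where "lex K C F"
    "iso (omap F A0) A ia" "iso (omap F X0) X ix" "iso (omap F B0) B ib"
    "Comp C (omap F X0) (omap F A0) A ia (amap F X0 A0 m0) = Comp C (omap F X0) X A m ix"
    "Comp C (omap F X0) (omap F B0) B ib (amap F X0 B0 f0) = Comp C (omap F X0) X B f ix"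
proof -
  have "{A, X, B} \<subseteq> Obj C" "{A, X, B} \<prec> (UNIV :: 'u set)"
    using arrD(1,2)[OF m(2)] arrD(2)[OF f] small_finite[OF U, of "{A, X, B}"] by auto
  then obtain S where S: "{A, X, B} \<subseteq> S" "S \<prec> (UNIV :: 'u set)" "fl_closed C S"
    by (rule small_fl_hull[OF U ls lfc])
  obtain E :: "('u, 'u) cat" and G where E: "locally_small E" and G: "lex E C G" and GS: "omap G ` Obj E = S"
    and Ga: "\<And>a b f. amap G a b f = f" and EH: "\<And>a b. Hom E a b = Hom C (omap G a) (omap G b)"
    and EC: "\<And>a b c f g. Comp E a b c g f = Comp C (omap G a) (omap G b) (omap G c) g f"
    and EI: "\<And>a. Ident E a = Ident C (omap G a)"
    by (rule small_copy[OF ls lfc S(2,3)]) blast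
  have "A \<in> omap G ` Obj E" "X \<in> omap G ` Obj E" "B \<in> omap G ` Obj E" using GS S(1) by auto
  then obtain a x b where o: "a \<in> Obj E" "x \<in> Obj E" "b \<in> Obj E" and Go [simp]: "omap G a = A" "omap G x = X" "omap G b = B"
    by blast
  have G_obj: "omap G e \<in> Obj C" if "e \<in> Obj E" for e using functor_obj[OF lex_functor[OF G] that] .
  have "is_mono E x a m"
    using m G_obj unfolding is_mono_def by (auto simp: EH EC arr_def)
  then have s: "(a, x, b, m, f) \<in> Obj (mono_span_cat E)"
    using o f by (simp add: mono_span_cat_def EH arr_def)
  have fcE: "finitely_complete E" using G by (simp add: lex_def)
  have "is_equivalence (lex_fun_cat K E) (mono_span_cat E) (eval_span (A0, X0, B0, m0, f0))"
    using free[unfolded free_lex_on_mono_span_def, THEN conjunct2, THEN conjunct2, THEN conjunct2, THEN spec, of E] E fcE by simp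
  \<comment> \<open>Essential surjectivity of evaluation realizes the span by a lex functor, up to
    an isomorphism of spans.\<close>
  then obtain F i where F: "F \<in> Obj (lex_fun_cat K E)"
    and i: "is_iso (mono_span_cat E) (omap (eval_span (A0, X0, B0, m0, f0)) F) (a, x, b, m, f) i"
    unfolding is_equivalence_def by (elim conjE) (drule bspec[OF _ s], elim bexE exE)
  have F_lex: "lex K E F" using F by (simp add: lex_fun_cat_def)
  obtain ia ix ib where i_eq: "i = (ia, ix, ib)" by (cases i)
  have o0: "A0 \<in> Obj K" "X0 \<in> Obj K" "B0 \<in> Obj K"
    using free by (simp_all add: free_lex_on_mono_span_def mono_span_cat_def)
  note Fo = functor_obj[OF lex_functor[OF F_lex] o0(1)] functor_obj[OF lex_functor[OF F_lex] o0(2)]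
    functor_obj[OF lex_functor[OF F_lex] o0(3)]
  from i obtain ja jx jb where j:
    "ia \<in> Hom E (omap F A0) a" "ix \<in> Hom E (omap F X0) x" "ib \<in> Hom E (omap F B0) b"
    "ja \<in> Hom E a (omap F A0)" "jx \<in> Hom E x (omap F X0)" "jb \<in> Hom E b (omap F B0)"
    "Comp E (omap F X0) (omap F A0) a ia (amap F X0 A0 m0) = Comp E (omap F X0) x a m ix"
    "Comp E (omap F X0) (omap F B0) b ib (amap F X0 B0 f0) = Comp E (omap F X0) x b f ix"
    "Comp E (omap F A0) a (omap F A0) ja ia = Ident E (omap F A0)" "Comp E a (omap F A0) a ia ja = Ident E a"
    "Comp E (omap F X0) x (omap F X0) jx ix = Ident E (omap F X0)" "Comp E x (omap F X0) x ix jx = Ident E x"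
    "Comp E (omap F B0) b (omap F B0) jb ib = Ident E (omap F B0)" "Comp E b (omap F B0) b ib jb = Ident E b"
    by (auto simp: is_iso_def i_eq mono_span_cat_def eval_span_def)
  show ?thesis
  proof (rule that[of "comp_func G F" ia ix ib])
    show "lex K C (comp_func G F)" by (rule lex_comp[OF F_lex G])
    show "iso (omap (comp_func G F) A0) A ia"
      by (rule isoI[of _ _ _ ja]) (use j o Fo G_obj arrD(1,2)[OF m(2)] arrD(2)[OF f] in \<open>simp_all add: EH EC EI arr_def\<close>)
    show "iso (omap (comp_func G F) X0) X ix"
      by (rule isoI[of _ _ _ jx]) (use j o Fo G_obj arrD(1,2)[OF m(2)] arrD(2)[OF f] in \<open>simp_all add: EH EC EI arr_def\<close>)
    show "iso (omap (comp_func G F) B0) B ib"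
      by (rule isoI[of _ _ _ jb]) (use j o Fo G_obj arrD(1,2)[OF m(2)] arrD(2)[OF f] in \<open>simp_all add: EH EC EI arr_def\<close>)
  qed (use j in \<open>simp_all add: EC Ga\<close>)
qed

text \<open>Up to isomorphism the span is the image of the generic span under a lex functor.
  Following that functor by the Yoneda embedding gives a lex diagram of representables, and its
  colimit weighted by \<open>\<phi>\<close> is the presheaf pushout \<open>T\<close>.\<close>

lemma (in lfc_cat) pw_pushout_in_closure:
  fixes K :: "('u, 'u) cat" and \<phi> :: "('u, 'u) presheaf"
  assumes w: "is_adh_weight (K, \<phi>)" and m: "is_mono C X A m" "arr C X A m" and f: "arr C X B f"
    and T: "pw_pushout C (rep X) (rep A) (rep B) T (yo X A m) (yo X B f) i j" and small_T: "small_presheaf C T"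
  shows "T \<in> closure_l {(K, \<phi>)}"
proof -
  interpret E: cat "psh small" by unfold_locales (rule category_psh)
  obtain A0 X0 B0 m0 f0 i0 j0 where K: "lfc_cat K" and free: "free_lex_on_mono_span K (A0, X0, B0, m0, f0)"
    and m0: "is_mono K X0 A0 m0" "arr K X0 A0 m0" and f0: "arr K X0 B0 f0"
    and pw: "pw_pushout K (representable K X0) (representable K A0) (representable K B0) \<phi>
      (amap (yoneda K) X0 A0 m0) (amap (yoneda K) X0 B0 f0) i0 j0"
    by (rule adh_weight_pw[OF U w])
  interpret K: lfc_cat K by fact
  obtain F ia ix ib where F: "lex K C F"
    and iso: "iso (omap F A0) A ia" "iso (omap F X0) X ix" "iso (omap F B0) B ib"
    and nat: "Comp C (omap F X0) (omap F A0) A ia (amap F X0 A0 m0) = Comp C (omap F X0) X A m ix"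
      "Comp C (omap F X0) (omap F B0) B ib (amap F X0 B0 f0) = Comp C (omap F X0) X B f ix"
    by (rule mono_span_functor[OF free m f])
  note o = arrD(1,2)[OF m(2)] arrD(2)[OF f]
  note D = lex_comp[OF F lex_yoneda]
  note yf = lex_functor[OF lex_yoneda] and Ff = lex_functor[OF F] and Df = lex_functor[OF D]
  have "is_pushout (psh small) (rep X) (rep A) (rep B) T (yo X A m) (yo X B f) i j"
    by (rule pw_pushout_is_pushout[OF T]) (use small_rep o small_T in auto)
  note po = this
  note y = functor_iso[OF yf iso(1)] functor_iso[OF yf iso(2)] functor_iso[OF yf iso(3)]
  have y': "E.iso (rep (omap F A0)) (rep A) (yo (omap F A0) A ia)" "E.iso (rep (omap F X0)) (rep X) (yo (omap F X0) X ix)"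
    "E.iso (rep (omap F B0)) (rep B) (yo (omap F B0) B ib)" using y by simp_all
  define i' where "i' = Comp (psh small) (rep (omap F A0)) (rep A) T i (yo (omap F A0) A ia)"
  define j' where "j' = Comp (psh small) (rep (omap F B0)) (rep B) T j (yo (omap F B0) B ib)"
  note ip = po_arr(3,4)[OF po]
  have i': "arr (psh small) (rep (omap F A0)) T i'" "arr (psh small) (rep (omap F B0)) T j'"
    unfolding i'_def j'_def by (rule E.arr_comp[OF E.iso_arr[OF y'(1)] ip(1)], rule E.arr_comp[OF E.iso_arr[OF y'(3)] ip(2)])
  have "is_pushout (psh small) (omap (comp_func (yoneda C) F) X0) (omap (comp_func (yoneda C) F) A0) (omap (comp_func (yoneda C) F) B0) T
    (amap (comp_func (yoneda C) F) X0 A0 m0) (amap (comp_func (yoneda C) F) X0 B0 f0) i' j'"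
  proof (rule E.po_transport[OF po])
    show "E.iso (omap (comp_func (yoneda C) F) X0) (rep X) (yo (omap F X0) X ix)" using y' by simp
    show "E.iso (omap (comp_func (yoneda C) F) A0) (rep A) (yo (omap F A0) A ia)" using y' by simp
    show "E.iso (omap (comp_func (yoneda C) F) B0) (rep B) (yo (omap F B0) B ib)" using y' by simp
    show "E.iso T T (Ident (psh small) T)" by (rule E.iso_ident[OF po_obj(4)[OF po]])
    show "arr (psh small) (omap (comp_func (yoneda C) F) X0) (omap (comp_func (yoneda C) F) A0) (amap (comp_func (yoneda C) F) X0 A0 m0)"
      by (rule functor_arr[OF Df m0(2)])
    show "arr (psh small) (omap (comp_func (yoneda C) F) X0) (omap (comp_func (yoneda C) F) B0) (amap (comp_func (yoneda C) F) X0 B0 f0)"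
      by (rule functor_arr[OF Df f0])
    show "arr (psh small) (omap (comp_func (yoneda C) F) A0) T i'" "arr (psh small) (omap (comp_func (yoneda C) F) B0) T j'"
      using i' by simp_all
    show "Comp (psh small) (omap (comp_func (yoneda C) F) X0) (omap (comp_func (yoneda C) F) A0) (rep A) (yo (omap F A0) A ia) (amap (comp_func (yoneda C) F) X0 A0 m0) =
      Comp (psh small) (omap (comp_func (yoneda C) F) X0) (rep X) (rep A) (yo X A m) (yo (omap F X0) X ix)"
      using functor_comp[OF yf functor_arr[OF Ff m0(2)] iso_arr[OF iso(1)]] functor_comp[OF yf iso_arr[OF iso(2)] m(2)] nat(1) by simp
    show "Comp (psh small) (omap (comp_func (yoneda C) F) X0) (omap (comp_func (yoneda C) F) B0) (rep B) (yo (omap F B0) B ib) (amap (comp_func (yoneda C) F) X0 B0 f0) =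
      Comp (psh small) (omap (comp_func (yoneda C) F) X0) (rep X) (rep B) (yo X B f) (yo (omap F X0) X ix)"
      using functor_comp[OF yf functor_arr[OF Ff f0] iso_arr[OF iso(3)]] functor_comp[OF yf iso_arr[OF iso(2)] f] nat(2) by simp
    show "Comp (psh small) (omap (comp_func (yoneda C) F) A0) T T (Ident (psh small) T) i' =
      Comp (psh small) (omap (comp_func (yoneda C) F) A0) (rep A) T i (yo (omap F A0) A ia)"
      using E.id_left[OF i'(1)] by (simp add: i'_def)
    show "Comp (psh small) (omap (comp_func (yoneda C) F) B0) T T (Ident (psh small) T) j' =
      Comp (psh small) (omap (comp_func (yoneda C) F) B0) (rep B) T j (yo (omap F B0) B ib)"
      using E.id_left[OF i'(2)] by (simp add: j'_def)
  qed
  from K.weighted_colimit_of_pushout[OF m0(2) f0 pw Df this] obtain \<gamma>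
    where \<gamma>: "is_weighted_colimit K \<phi> (psh small) (comp_func (yoneda C) F) T \<gamma>" by blast
  show ?thesis
    by (rule closure_l_colimits[OF _ D _ \<gamma>]) (use functor_obj[OF Ff] closure_l_rep in simp_all)
qed

text \<open>This isolates what exactness supplies: a full subcategory \<open>T0\<close> of
  presheaves that contains the representables and the small pushouts of representables along
  monomorphisms, with a lex left adjoint to the Yoneda embedding.\<close>

locale lex_reflection = lfc_cat C for C :: "('o, 'u) cat" +
  fixes T0 :: "('o, 'u) presheaf set" and L \<eta> \<epsilon>
  assumes rep_T0: "rep ` Obj C \<subseteq> T0"
    and adj: "adjunction (psh T0) C L (yoneda C) \<eta> \<epsilon>"
    and lex_L: "lex (psh T0) C L"
    and pushout_T0: "\<And>X A B m f T i j. is_mono C X A m \<Longrightarrow> arr C X A m \<Longrightarrow> arr C X B f \<Longrightarrow>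
      pw_pushout C (rep X) (rep A) (rep B) T (yo X A m) (yo X B f) i j \<Longrightarrow> small_presheaf C T \<Longrightarrow> T \<in> T0"
begin

sublocale E: cat "psh T0"
  by unfold_locales (rule category_psh)

lemma L_functor: "is_functor (psh T0) C L"
  by (rule lex_functor[OF lex_L])

lemma L_obj [simp]: "presheaf C P \<Longrightarrow> P \<in> T0 \<Longrightarrow> omap L P \<in> Obj C"
  using functor_obj[OF L_functor, of P] by simp

lemma rep_obj [simp]: "c \<in> Obj C \<Longrightarrow> rep c \<in> T0"
  using rep_T0 by blast

lemma \<eta>: "presheaf C P \<Longrightarrow> P \<in> T0 \<Longrightarrow> psh_trans C P (rep (omap L P)) (\<eta> P)"
  using adj by (simp add: adjunction_def nat_trans_def)

lemma \<eta>_arr: "presheaf C P \<Longrightarrow> P \<in> T0 \<Longrightarrow> a \<in> Obj C \<Longrightarrow> p \<in> omap P a \<Longrightarrow> arr C a (omap L P) (\<eta> P a p)"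
  by (rule tr_rep_arr[OF \<eta> L_obj])

lemma \<eta>_nat:
  assumes \<alpha>: "arr (psh T0) P Q \<alpha>" and a: "a \<in> Obj C" "p \<in> omap P a"
  shows "\<eta> Q a (\<alpha> a p) = Comp C a (omap L P) (omap L Q) (amap L P Q \<alpha>) (\<eta> P a p)"
proof -
  have P: "presheaf C P" "P \<in> T0" "presheaf C Q" "Q \<in> T0" "psh_trans C P Q \<alpha>" using \<alpha> by (simp_all add: arr_psh)
  have "Comp (presheaf_cat C) P Q (rep (omap L Q)) (\<eta> Q) \<alpha> =
    Comp (presheaf_cat C) P (rep (omap L P)) (rep (omap L Q)) (yo (omap L P) (omap L Q) (amap L P Q \<alpha>)) (\<eta> P)"
    using adj P by (simp add: adjunction_def nat_trans_def)
  from presheaf_comp_eqD[OF this a] show ?thesis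
    using arrD(3)[OF \<eta>_arr[OF P(1,2) a]] a by simp
qed

lemma \<epsilon>_arr: "c \<in> Obj C \<Longrightarrow> arr C (omap L (rep c)) c (\<epsilon> c)"
  using adj by (simp add: adjunction_def nat_trans_def arr_def)

lemma \<epsilon>_nat:
  assumes f: "arr C c d f"
  shows "Comp C (omap L (rep c)) (omap L (rep d)) d (\<epsilon> d) (amap L (rep c) (rep d) (yo c d f)) =
    Comp C (omap L (rep c)) c d f (\<epsilon> c)"
  using adj f by (simp add: adjunction_def nat_trans_def arr_def)

lemma triangle_L:
  assumes "presheaf C P" "P \<in> T0"
  shows "Comp C (omap L P) (omap L (rep (omap L P))) (omap L P) (\<epsilon> (omap L P)) (amap L P (rep (omap L P)) (\<eta> P)) = Ident C (omap L P)"
  using adj assms by (simp add: adjunction_def)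

lemma triangle_y:
  assumes c: "c \<in> Obj C" and g: "arr C a c g"
  shows "Comp C a (omap L (rep c)) c (\<epsilon> c) (\<eta> (rep c) a g) = g"
proof -
  have "Comp (presheaf_cat C) (rep c) (rep (omap L (rep c))) (rep c) (yo (omap L (rep c)) c (\<epsilon> c)) (\<eta> (rep c)) = Ident (presheaf_cat C) (rep c)"
    using adj c by (simp add: adjunction_def)
  from presheaf_comp_eq_trD[OF this arrD(1)[OF g], of g] show ?thesis
    using g arrD[OF g] arrD(3)[OF \<eta>_arr[OF presheaf_rep[OF c] rep_obj[OF c] arrD(1)[OF g], of g]] c
    by (simp add: presheaf_cat_Ident)
qed

text \<open>The transpose of \<open>\<alpha>\<close> is its image under \<open>L\<close> followed by
  the counit. The equation is naturality of the unit and a triangle identity, read on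
  elements.\<close>

lemma L_desc:
  assumes P: "presheaf C P" "P \<in> T0" and e: "e \<in> Obj C" and \<alpha>: "psh_trans C P (rep e) \<alpha>"
  obtains u where "arr C (omap L P) e u" "\<And>a p. a \<in> Obj C \<Longrightarrow> p \<in> omap P a \<Longrightarrow> Comp C a (omap L P) e u (\<eta> P a p) = \<alpha> a p"
proof -
  have \<alpha>': "arr (psh T0) P (rep e) \<alpha>" using P e \<alpha> by (simp add: arr_psh)
  note La = functor_arr[OF L_functor \<alpha>']
  have "Comp C a (omap L P) e (Comp C (omap L P) (omap L (rep e)) e (\<epsilon> e) (amap L P (rep e) \<alpha>)) (\<eta> P a p) = \<alpha> a p"
    if a: "a \<in> Obj C" and p: "p \<in> omap P a" for a p
    using La \<epsilon>_arr[OF e] \<eta>_arr[OF P a p] \<eta>_nat[OF \<alpha>' a p] triangle_y[OF e tr_rep_arr[OF \<alpha> e a p]] by (simp add: assoc)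
  then show ?thesis using La \<epsilon>_arr[OF e] by (intro that[of "Comp C (omap L P) (omap L (rep e)) e (\<epsilon> e) (amap L P (rep e) \<alpha>)"]) auto
qed

text \<open>An arrow out of the reflection of \<open>P\<close> is recovered from its transpose: the
  triangle identity at \<open>P\<close> and naturality of the counit rewrite \<open>w\<close> as the
  counit after the image under \<open>L\<close> of the composite of the unit with the Yoneda image
  of \<open>w\<close>.\<close>

lemma L_ext:
  assumes P: "presheaf C P" "P \<in> T0" and u: "arr C (omap L P) e u" and v: "arr C (omap L P) e v"
    and eq: "\<And>a p. a \<in> Obj C \<Longrightarrow> p \<in> omap P a \<Longrightarrow> Comp C a (omap L P) e u (\<eta> P a p) = Comp C a (omap L P) e v (\<eta> P a p)"
  shows "u = v"
proof -
  note o = L_obj[OF P] arrD(2)[OF u]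
  have h: "arr (psh T0) P (rep (omap L P)) (\<eta> P)" using P \<eta>[OF P] o by (simp add: arr_psh)
  have y: "arr (psh T0) (rep (omap L P)) (rep e) (yo (omap L P) e w)" if "arr C (omap L P) e w" for w
    using trans_yo[OF that] o by (simp add: arr_psh)
  have w: "w = Comp C (omap L P) (omap L (rep e)) e (\<epsilon> e)
      (amap L P (rep e) (Comp (psh T0) P (rep (omap L P)) (rep e) (yo (omap L P) e w) (\<eta> P)))"
    if w: "arr C (omap L P) e w" for w
  proof -
    note Lh = functor_arr[OF L_functor h] and Ly = functor_arr[OF L_functor y[OF w]]
    have "w = Comp C (omap L P) (omap L P) e w (Comp C (omap L P) (omap L (rep (omap L P))) (omap L P) (\<epsilon> (omap L P)) (amap L P (rep (omap L P)) (\<eta> P)))"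
      using triangle_L[OF P] w by simp
    also have "\<dots> = Comp C (omap L P) (omap L (rep (omap L P))) e (Comp C (omap L (rep (omap L P))) (omap L P) e w (\<epsilon> (omap L P)))
        (amap L P (rep (omap L P)) (\<eta> P))"
      using w \<epsilon>_arr[OF o(1)] Lh by (simp add: assoc)
    also have "\<dots> = Comp C (omap L P) (omap L (rep (omap L P))) e (Comp C (omap L (rep (omap L P))) (omap L (rep e)) e (\<epsilon> e)
        (amap L (rep (omap L P)) (rep e) (yo (omap L P) e w))) (amap L P (rep (omap L P)) (\<eta> P))"
      using \<epsilon>_nat[OF w] by simp
    also have "\<dots> = Comp C (omap L P) (omap L (rep e)) e (\<epsilon> e) (Comp C (omap L P) (omap L (rep (omap L P))) (omap L (rep e))
        (amap L (rep (omap L P)) (rep e) (yo (omap L P) e w)) (amap L P (rep (omap L P)) (\<eta> P)))"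
      by (rule assoc[OF Lh Ly \<epsilon>_arr[OF o(2)]])
    finally show ?thesis using functor_comp[OF L_functor h y[OF w]] by simp
  qed
  have "Comp (presheaf_cat C) P (rep (omap L P)) (rep e) (yo (omap L P) e u) (\<eta> P) = Comp (presheaf_cat C) P (rep (omap L P)) (rep e) (yo (omap L P) e v) (\<eta> P)"
    by (rule presheaf_comp_eqI) (use eq arrD(3)[OF \<eta>_arr[OF P]] in simp)
  then show ?thesis using w[OF u] w[OF v] by simp
qed

text \<open>A universal arrow from \<open>P\<close> to the Yoneda embedding, stated on elements. The
  unit supplies one, and for presheaf pushouts universality of a comparison will mean that the
  square in \<open>C\<close> is a pushout.\<close>

definition universal :: "('o, 'u) presheaf \<Rightarrow> 'o \<Rightarrow> ('o \<Rightarrow> 'u \<Rightarrow> 'u) \<Rightarrow> bool" where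
  "universal P c \<theta> \<longleftrightarrow>
     (\<forall>e \<alpha>. e \<in> Obj C \<and> psh_trans C P (rep e) \<alpha> \<longrightarrow>
        (\<exists>u. arr C c e u \<and> (\<forall>a\<in>Obj C. \<forall>p\<in>omap P a. Comp C a c e u (\<theta> a p) = \<alpha> a p))) \<and>
     (\<forall>e u v. arr C c e u \<and> arr C c e v \<and>
        (\<forall>a\<in>Obj C. \<forall>p\<in>omap P a. Comp C a c e u (\<theta> a p) = Comp C a c e v (\<theta> a p)) \<longrightarrow> u = v)"

lemma universal_ex:
  assumes "universal P c \<theta>" "e \<in> Obj C" "psh_trans C P (rep e) \<alpha>"
  obtains u where "arr C c e u" "\<And>a p. a \<in> Obj C \<Longrightarrow> p \<in> omap P a \<Longrightarrow> Comp C a c e u (\<theta> a p) = \<alpha> a p"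
proof -
  have "\<exists>u. arr C c e u \<and> (\<forall>a\<in>Obj C. \<forall>p\<in>omap P a. Comp C a c e u (\<theta> a p) = \<alpha> a p)"
    using assms(1)[unfolded universal_def, THEN conjunct1, THEN spec, of e, THEN spec, of \<alpha>] assms(2,3) by simp
  then show ?thesis using that by blast
qed

lemma universal_uniq:
  assumes "universal P c \<theta>" "arr C c e u" "arr C c e v"
    "\<And>a p. a \<in> Obj C \<Longrightarrow> p \<in> omap P a \<Longrightarrow> Comp C a c e u (\<theta> a p) = Comp C a c e v (\<theta> a p)"
  shows "u = v"
  using assms(1)[unfolded universal_def, THEN conjunct2, THEN spec, of e, THEN spec, of u, THEN spec, of v] assms(2-) by simp

lemma universal_\<eta>:
  assumes P: "presheaf C P" "P \<in> T0" shows "universal P (omap L P) (\<eta> P)"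
  unfolding universal_def
proof (intro conjI allI impI; elim conjE)
  fix e \<alpha> assume "e \<in> Obj C" "psh_trans C P (rep e) \<alpha>"
  then show "\<exists>u. arr C (omap L P) e u \<and> (\<forall>a\<in>Obj C. \<forall>p\<in>omap P a. Comp C a (omap L P) e u (\<eta> P a p) = \<alpha> a p)"
    using L_desc[OF P] by metis
next
  fix e u v assume "arr C (omap L P) e u" "arr C (omap L P) e v"
    "\<forall>a\<in>Obj C. \<forall>p\<in>omap P a. Comp C a (omap L P) e u (\<eta> P a p) = Comp C a (omap L P) e v (\<eta> P a p)"
  then show "u = v" using L_ext[OF P] by metis
qed

lemma universal_rep: "c \<in> Obj C \<Longrightarrow> universal (rep c) c (mk_tr C (rep c) (\<lambda>a g. g))"
  unfolding universal_def
proof (intro conjI allI impI; elim conjE)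
  fix e \<alpha> assume c: "c \<in> Obj C" and e: "e \<in> Obj C" and \<alpha>: "psh_trans C (rep c) (rep e) \<alpha>"
  obtain f where f: "arr C c e f" "\<alpha> = yo c e f" by (rule yoneda_full[OF c e \<alpha>])
  then show "\<exists>u. arr C c e u \<and> (\<forall>a\<in>Obj C. \<forall>p\<in>omap (rep c) a. Comp C a c e u (mk_tr C (rep c) (\<lambda>a g. g) a p) = \<alpha> a p)"
    by (intro exI[of _ f]) simp
next
  fix e u v assume c: "c \<in> Obj C" and u: "arr C c e u" and v: "arr C c e v"
    and eq: "\<forall>a\<in>Obj C. \<forall>p\<in>omap (rep c) a. Comp C a c e u (mk_tr C (rep c) (\<lambda>a g. g) a p) = Comp C a c e v (mk_tr C (rep c) (\<lambda>a g. g) a p)"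
  have "Comp C c c e u (Ident C c) = Comp C c c e v (Ident C c)"
    using eq[THEN bspec, OF c, THEN bspec, of "Ident C c"] arrD(3)[OF arr_id[OF c]] c by simp
  then show "u = v" using u v by simp
qed

text \<open>The arrow \<open>w\<close> on the right is the comparison that carries the unit to
  \<open>\<theta>\<close>. Universal arrows out of \<open>P\<close> differ by an isomorphism, and
  composing a universal arrow with an isomorphism leaves it universal.\<close>

lemma universal_iff_iso:
  assumes \<theta>: "arr (psh T0) P (rep c) \<theta>" and c: "c \<in> Obj C"
  shows "universal P c \<theta> \<longleftrightarrow> iso (omap L P) c (Comp C (omap L P) (omap L (rep c)) c (\<epsilon> c) (amap L P (rep c) \<theta>))"
proof -
  define w where "w = Comp C (omap L P) (omap L (rep c)) c (\<epsilon> c) (amap L P (rep c) \<theta>)"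
  have P: "presheaf C P" "P \<in> T0" and t: "psh_trans C P (rep c) \<theta>" using \<theta> by (simp_all add: arr_psh)
  note La = functor_arr[OF L_functor \<theta>]
  have w [simp]: "arr C (omap L P) c w" using La \<epsilon>_arr[OF c] by (simp add: w_def)
  have w\<eta>: "Comp C a (omap L P) c w (\<eta> P a p) = \<theta> a p" if a: "a \<in> Obj C" and p: "p \<in> omap P a" for a p
    using La \<epsilon>_arr[OF c] \<eta>_arr[OF P a p] \<eta>_nat[OF \<theta> a p] triangle_y[OF c tr_rep_arr[OF t c a p]]
    by (simp add: w_def assoc)
  have "universal P c \<theta> \<longleftrightarrow> iso (omap L P) c w"
  proof
    assume u: "universal P c \<theta>"
    obtain v where v [simp]: "arr C c (omap L P) v"
      and v\<theta>: "\<And>a p. a \<in> Obj C \<Longrightarrow> p \<in> omap P a \<Longrightarrow> Comp C a c (omap L P) v (\<theta> a p) = \<eta> P a p"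
      by (rule universal_ex[OF u L_obj[OF P] \<eta>[OF P]]) blast
    have "Comp C (omap L P) c (omap L P) v w = Ident C (omap L P)"
      by (rule L_ext[OF P, of "omap L P"]) (use P w\<eta> v\<theta> \<eta>_arr[OF P] in \<open>simp_all add: assoc\<close>)
    moreover have "Comp C c (omap L P) c w v = Ident C c"
      by (rule universal_uniq[OF u, of c]) (use P c w\<eta> v\<theta> tr_rep_arr[OF t c] in \<open>simp_all add: assoc\<close>)
    ultimately show "iso (omap L P) c w" by (intro isoI[of _ _ _ v]) simp_all
  next
    assume "iso (omap L P) c w"
    then obtain w' where w' [simp]: "arr C c (omap L P) w'" and w'w: "Comp C (omap L P) c (omap L P) w' w = Ident C (omap L P)"
      and ww': "Comp C c (omap L P) c w w' = Ident C c" by (rule isoE)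
    have w'\<theta>: "Comp C a c (omap L P) w' (\<theta> a p) = \<eta> P a p" if a: "a \<in> Obj C" and p: "p \<in> omap P a" for a p
      using comp_tri[OF w'w w w' \<eta>_arr[OF P a p]] w\<eta>[OF a p] \<eta>_arr[OF P a p] by simp
    show "universal P c \<theta>"
      unfolding universal_def
    proof (intro conjI allI impI; elim conjE)
      fix e \<alpha> assume e: "e \<in> Obj C" and \<alpha>: "psh_trans C P (rep e) \<alpha>"
      obtain u where u: "arr C (omap L P) e u" "\<And>a p. a \<in> Obj C \<Longrightarrow> p \<in> omap P a \<Longrightarrow> Comp C a (omap L P) e u (\<eta> P a p) = \<alpha> a p"
        by (rule L_desc[OF P e \<alpha>]) blast
      show "\<exists>u. arr C c e u \<and> (\<forall>a\<in>Obj C. \<forall>p\<in>omap P a. Comp C a c e u (\<theta> a p) = \<alpha> a p)"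
        using u tr_rep_arr[OF t c] by (intro exI[of _ "Comp C c (omap L P) e u w'"]) (simp add: assoc w'\<theta>)
    next
      fix e u v assume u: "arr C c e u" and v: "arr C c e v"
        and eq: "\<forall>a\<in>Obj C. \<forall>p\<in>omap P a. Comp C a c e u (\<theta> a p) = Comp C a c e v (\<theta> a p)"
      have "Comp C (omap L P) c e u w = Comp C (omap L P) c e v w"
        by (rule L_ext[OF P, where e = e]) (use u v eq \<eta>_arr[OF P] w\<eta> in \<open>simp_all add: assoc\<close>)
      then have "Comp C c (omap L P) e (Comp C (omap L P) c e u w) w' = Comp C c (omap L P) e (Comp C (omap L P) c e v w) w'" by simp
      then show "u = v" using u v by (simp add: assoc ww')
    qed
  qed
  then show ?thesis by (simp only: w_def)
qed

text \<open>The identity of a representable is universal by the Yoneda lemma, and the comparison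
  belonging to it is the counit.\<close>

lemma \<epsilon>_iso: "c \<in> Obj C \<Longrightarrow> iso (omap L (rep c)) c (\<epsilon> c)"
proof -
  assume c: "c \<in> Obj C"
  have "arr (psh T0) (rep c) (rep c) (Ident (psh T0) (rep c))" by (rule E.arr_id) (use c in simp)
  from universal_iff_iso[OF this c] show ?thesis
    using universal_rep[OF c] functor_id[OF L_functor, of "rep c"] \<epsilon>_arr[OF c] c by (simp add: presheaf_cat_Ident)
qed

text \<open>Since the counit is invertible, universality becomes invertibility of the image under
  \<open>L\<close>, a condition that passes along pullback squares preserved by
  \<open>L\<close>.\<close>

lemma universal_iff_L_iso:
  assumes \<theta>: "arr (psh T0) P (rep c) \<theta>" and c: "c \<in> Obj C"
  shows "universal P c \<theta> \<longleftrightarrow> iso (omap L P) (omap L (rep c)) (amap L P (rep c) \<theta>)"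
  unfolding universal_iff_iso[OF \<theta> c]
  using iso_comp[OF _ \<epsilon>_iso[OF c]] iso_cancel_left[OF functor_arr[OF L_functor \<theta>] \<epsilon>_iso[OF c]] by blast

text \<open>By the Yoneda lemma, arrows from the presheaf pushout \<open>T\<close> to the
  representable at \<open>e\<close> are cocones with vertex \<open>e\<close> under the span in
  \<open>C\<close>. Universality of \<open>\<theta>\<close> therefore says exactly that
  \<open>D\<close> classifies these cocones.\<close>

lemma universal_iff_pushout:
  assumes m: "is_mono C X A m" "arr C X A m" and f: "arr C X B f" and g: "arr C A D g" and n: "arr C B D n"
    and T: "pw_pushout C (rep X) (rep A) (rep B) T (yo X A m) (yo X B f) i j" and T0: "T \<in> T0"
    and \<theta>: "psh_trans C T (rep D) \<theta>"
    and \<theta>i: "\<And>a p. a \<in> Obj C \<Longrightarrow> p \<in> omap (rep A) a \<Longrightarrow> \<theta> a (i a p) = Comp C a A D g p"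
    and \<theta>j: "\<And>a p. a \<in> Obj C \<Longrightarrow> p \<in> omap (rep B) a \<Longrightarrow> \<theta> a (j a p) = Comp C a B D n p"
  shows "universal T D \<theta> \<longleftrightarrow> is_pushout C X A B D m f g n"
proof -
  note tD = pw_pushoutD[OF T]
  note [simp] = m(2) f g n
  note o [simp] = arrD(1,2)[OF m(2)] arrD(2)[OF f] arrD(2)[OF g]
  have idA: "Ident C A \<in> omap (rep A) A" and idB: "Ident C B \<in> omap (rep B) B"
    using arrD(3)[OF arr_id] by simp_all
  have sq: "Comp C X A D g m = Comp C X B D n f"
    using tD(9)[OF o(1), of "Ident C X"] arrD(3)[OF arr_id[OF o(1)]] \<theta>i[OF o(1), of m] \<theta>j[OF o(1), of f] arrD(3)[OF m(2)] arrD(3)[OF f]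
    by simp
  have desc: "\<exists>\<alpha>. psh_trans C T (rep e) \<alpha> \<and> (\<forall>a\<in>Obj C. \<forall>p\<in>omap (rep A) a. \<alpha> a (i a p) = Comp C a A e u p) \<and>
      (\<forall>a\<in>Obj C. \<forall>p\<in>omap (rep B) a. \<alpha> a (j a p) = Comp C a B e v p)"
    if u: "arr C A e u" and v: "arr C B e v" and uv: "Comp C X A e u m = Comp C X B e v f" for e u v
  proof (rule pw_pushout_desc[OF T, of "rep e" "yo A e u" "yo B e v"])
    show "presheaf C (rep e)" using arrD(2)[OF u] by simp
    show "yo A e u a p \<in> omap (rep e) a" if "a \<in> Obj C" "p \<in> omap (rep A) a" for a p
      by (rule tr_in[OF trans_yo[OF u] that])
    show "yo A e u b (amap (rep A) a b h p) = amap (rep e) a b h (yo A e u a p)" if "arr C b a h" "p \<in> omap (rep A) a" for a b h p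
      by (rule tr_nat[OF trans_yo[OF u] that])
    show "yo B e v a p \<in> omap (rep e) a" if "a \<in> Obj C" "p \<in> omap (rep B) a" for a p
      by (rule tr_in[OF trans_yo[OF v] that])
    show "yo B e v b (amap (rep B) a b h p) = amap (rep e) a b h (yo B e v a p)" if "arr C b a h" "p \<in> omap (rep B) a" for a b h p
      by (rule tr_nat[OF trans_yo[OF v] that])
    show "yo A e u a (yo X A m a r) = yo B e v a (yo X B f a r)" if a: "a \<in> Obj C" and r: "r \<in> omap (rep X) a" for a r
    proof -
      have r': "arr C a X r" using r a by (simp add: arr_def)
      show ?thesis
        using comp_eq_extend[OF uv r' m(2) u f v] arrD(3)[OF arr_comp[OF r' m(2)]] arrD(3)[OF arr_comp[OF r' f]] a r by simp
    qed
    fix h assume "psh_trans C T (rep e) h" "\<And>a p. a \<in> Obj C \<Longrightarrow> p \<in> omap (rep A) a \<Longrightarrow> h a (i a p) = yo A e u a p"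
      "\<And>a p. a \<in> Obj C \<Longrightarrow> p \<in> omap (rep B) a \<Longrightarrow> h a (j a p) = yo B e v a p"
    then show ?thesis by (intro exI[of _ h]) simp
  qed
  have comp_i: "Comp C a D e w (\<theta> a (i a p)) = Comp C a A e (Comp C A D e w g) p"
    if "arr C D e w" "a \<in> Obj C" "p \<in> omap (rep A) a" for a e w p
    using that \<theta>i[OF that(2,3)] by (simp add: assoc arr_def[of C a A])
  have comp_j: "Comp C a D e w (\<theta> a (j a p)) = Comp C a B e (Comp C B D e w n) p"
    if "arr C D e w" "a \<in> Obj C" "p \<in> omap (rep B) a" for a e w p
    using that \<theta>j[OF that(2,3)] by (simp add: assoc arr_def[of C a B])
  have in_T: "i A (Ident C A) \<in> omap T A" "j B (Ident C B) \<in> omap T B"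
    using tr_in[OF tD(7) o(2) idA] tr_in[OF tD(8) o(3) idB] by simp_all
  show ?thesis
  proof
    assume u: "universal T D \<theta>"
    show "is_pushout C X A B D m f g n"
    proof (rule poI)
      fix e u v assume uv [simp]: "arr C A e u" "arr C B e v" and e: "Comp C X A e u m = Comp C X B e v f"
      obtain \<alpha> where \<alpha>: "psh_trans C T (rep e) \<alpha>" "\<forall>a\<in>Obj C. \<forall>p\<in>omap (rep A) a. \<alpha> a (i a p) = Comp C a A e u p"
        "\<forall>a\<in>Obj C. \<forall>p\<in>omap (rep B) a. \<alpha> a (j a p) = Comp C a B e v p"
        using desc[OF uv e] by blast
      obtain w where w [simp]: "arr C D e w"
        and w\<theta>: "\<And>a p. a \<in> Obj C \<Longrightarrow> p \<in> omap T a \<Longrightarrow> Comp C a D e w (\<theta> a p) = \<alpha> a p"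
        by (rule universal_ex[OF \<open>universal T D \<theta>\<close> arrD(2)[OF uv(1)] \<alpha>(1)]) blast
      have "Comp C A D e w g = u"
        using w\<theta>[OF o(2) in_T(1)] \<alpha>(2)[THEN bspec, OF o(2), THEN bspec, OF idA] comp_i[OF w o(2) idA] by simp
      moreover have "Comp C B D e w n = v"
        using w\<theta>[OF o(3) in_T(2)] \<alpha>(3)[THEN bspec, OF o(3), THEN bspec, OF idB] comp_j[OF w o(3) idB] by simp
      ultimately show "\<exists>h. arr C D e h \<and> Comp C A D e h g = u \<and> Comp C B D e h n = v" using w by blast
    next
      fix e h h' assume h [simp]: "arr C D e h" "arr C D e h'"
        and eq: "Comp C A D e h g = Comp C A D e h' g" "Comp C B D e h n = Comp C B D e h' n"
      show "h = h'"
      proof (rule universal_uniq[OF u h])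
        fix a p assume a: "a \<in> Obj C" and p: "p \<in> omap T a"
        show "Comp C a D e h (\<theta> a p) = Comp C a D e h' (\<theta> a p)"
          by (rule pw_pushout_cases[OF T a p]) (use comp_i[OF h(1) a] comp_i[OF h(2) a] comp_j[OF h(1) a] comp_j[OF h(2) a] eq in simp_all)
      qed
    qed (use sq in simp_all)
  next
    assume po: "is_pushout C X A B D m f g n"
    show "universal T D \<theta>"
      unfolding universal_def
    proof (intro conjI allI impI; elim conjE)
      fix e \<alpha> assume e: "e \<in> Obj C" and \<alpha>: "psh_trans C T (rep e) \<alpha>"
      obtain u where u: "arr C A e u" "Comp (presheaf_cat C) (rep A) T (rep e) \<alpha> i = yo A e u"
        by (rule yoneda_full[OF o(2) e tr_comp[OF tD(2,7) \<alpha>]])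
      obtain v where v: "arr C B e v" "Comp (presheaf_cat C) (rep B) T (rep e) \<alpha> j = yo B e v"
        by (rule yoneda_full[OF o(3) e tr_comp[OF tD(3,8) \<alpha>]])
      have ui: "\<alpha> a (i a p) = Comp C a A e u p" if "a \<in> Obj C" "p \<in> omap (rep A) a" for a p
        using presheaf_comp_eq_trD[OF u(2) that] that by simp
      have vj: "\<alpha> a (j a p) = Comp C a B e v p" if "a \<in> Obj C" "p \<in> omap (rep B) a" for a p
        using presheaf_comp_eq_trD[OF v(2) that] that by simp
      have "Comp C X A e u m = Comp C X B e v f"
        using tD(9)[OF o(1), of "Ident C X"] arrD(3)[OF arr_id[OF o(1)]] ui[OF o(1), of m] vj[OF o(1), of f] arrD(3)[OF m(2)] arrD(3)[OF f]
        by simp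
      then obtain w where w: "arr C D e w" "Comp C A D e w g = u" "Comp C B D e w n = v"
        by (rule po_ex[OF po u(1) v(1)])
      have "Comp C a D e w (\<theta> a p) = \<alpha> a p" if a: "a \<in> Obj C" and p: "p \<in> omap T a" for a p
        by (rule pw_pushout_cases[OF T a p]) (use comp_i[OF w(1) a] comp_j[OF w(1) a] ui[OF a] vj[OF a] w in simp_all)
      then show "\<exists>u. arr C D e u \<and> (\<forall>a\<in>Obj C. \<forall>p\<in>omap T a. Comp C a D e u (\<theta> a p) = \<alpha> a p)" using w(1) by blast
    next
      fix e u v assume u: "arr C D e u" and v: "arr C D e v"
        and eq: "\<forall>a\<in>Obj C. \<forall>p\<in>omap T a. Comp C a D e u (\<theta> a p) = Comp C a D e v (\<theta> a p)"
      show "u = v"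
      proof (rule po_uniq[OF po u v])
        show "Comp C A D e u g = Comp C A D e v g"
          using eq[THEN bspec, OF o(2), THEN bspec, OF in_T(1)] comp_i[OF u o(2) idA] comp_i[OF v o(2) idA] u v by simp
        show "Comp C B D e u n = Comp C B D e v n"
          using eq[THEN bspec, OF o(3), THEN bspec, OF in_T(2)] comp_j[OF u o(3) idB] comp_j[OF v o(3) idB] u v by simp
      qed
    qed
  qed
qed

end

section \<open>Pushouts in the base category\<close>

context lex_reflection begin

lemma comparison:
  assumes m: "is_mono C X A m" "arr C X A m" and f: "arr C X B f" and g: "arr C A D g" and n: "arr C B D n"
    and comm: "Comp C X A D g m = Comp C X B D n f"
    and T: "pw_pushout C (rep X) (rep A) (rep B) T (yo X A m) (yo X B f) i j"
  obtains \<theta> where "psh_trans C T (rep D) \<theta>"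
    "\<And>a p. a \<in> Obj C \<Longrightarrow> p \<in> omap (rep A) a \<Longrightarrow> \<theta> a (i a p) = Comp C a A D g p"
    "\<And>a p. a \<in> Obj C \<Longrightarrow> p \<in> omap (rep B) a \<Longrightarrow> \<theta> a (j a p) = Comp C a B D n p"
proof (rule pw_pushout_desc[OF T, of "rep D" "yo A D g" "yo B D n"])
  show "presheaf C (rep D)" using arrD(2)[OF g] by simp
  show "yo A D g a p \<in> omap (rep D) a" if "a \<in> Obj C" "p \<in> omap (rep A) a" for a p
    by (rule tr_in[OF trans_yo[OF g] that])
  show "yo A D g b (amap (rep A) a b h p) = amap (rep D) a b h (yo A D g a p)" if "arr C b a h" "p \<in> omap (rep A) a" for a b h p
    by (rule tr_nat[OF trans_yo[OF g] that])
  show "yo B D n a p \<in> omap (rep D) a" if "a \<in> Obj C" "p \<in> omap (rep B) a" for a p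
    by (rule tr_in[OF trans_yo[OF n] that])
  show "yo B D n b (amap (rep B) a b h p) = amap (rep D) a b h (yo B D n a p)" if "arr C b a h" "p \<in> omap (rep B) a" for a b h p
    by (rule tr_nat[OF trans_yo[OF n] that])
  show "yo A D g a (yo X A m a r) = yo B D n a (yo X B f a r)" if a: "a \<in> Obj C" and r: "r \<in> omap (rep X) a" for a r
  proof -
    have r': "arr C a X r" using r a arrD(1)[OF f] by (simp add: arr_def)
    show ?thesis
      using comp_eq_extend[OF comm r' m(2) g f n] arrD(3)[OF arr_comp[OF r' m(2)]] arrD(3)[OF arr_comp[OF r' f]] a r by simp
  qed
  fix h assume "psh_trans C T (rep D) h" "\<And>a p. a \<in> Obj C \<Longrightarrow> p \<in> omap (rep A) a \<Longrightarrow> h a (i a p) = yo A D g a p"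
    "\<And>a p. a \<in> Obj C \<Longrightarrow> p \<in> omap (rep B) a \<Longrightarrow> h a (j a p) = yo B D n a p"
  then show ?thesis using that by simp
qed

text \<open>Reflecting the presheaf pushout of the representables gives the vertex; the
  coprojections correspond to the presheaf coprojections followed by the unit.\<close>

lemma pushout_exists:
  assumes m: "is_mono C X A m" "arr C X A m" and f: "arr C X B f"
  shows "\<exists>D g n. is_pushout C X A B D m f g n"
proof -
  note o = arrD(1,2)[OF m(2)] arrD(2)[OF f]
  obtain T i j where T: "pw_pushout C (rep X) (rep A) (rep B) T (yo X A m) (yo X B f) i j" and small_T: "small_presheaf C T"
    by (rule pw_pushout_yo[OF m f])
  note tD = pw_pushoutD[OF T]
  have T0: "T \<in> T0" by (rule pushout_T0[OF m f T small_T])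
  note D = L_obj[OF tD(4) T0] and \<eta>T = \<eta>[OF tD(4) T0]
  obtain g where g: "arr C A (omap L T) g" "Comp (presheaf_cat C) (rep A) T (rep (omap L T)) (\<eta> T) i = yo A (omap L T) g"
    by (rule yoneda_full[OF o(2) D tr_comp[OF tD(2,7) \<eta>T]])
  obtain n where n: "arr C B (omap L T) n" "Comp (presheaf_cat C) (rep B) T (rep (omap L T)) (\<eta> T) j = yo B (omap L T) n"
    by (rule yoneda_full[OF o(3) D tr_comp[OF tD(3,8) \<eta>T]])
  have "is_pushout C X A B (omap L T) m f g n"
    by (rule iffD1[OF universal_iff_pushout[OF m f g(1) n(1) T T0 \<eta>T] universal_\<eta>[OF tD(4) T0]])
      (use presheaf_comp_eq_trD[OF g(2)] presheaf_comp_eq_trD[OF n(2)] in simp_all)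
  then show ?thesis by blast
qed

text \<open>In sets a pushout along an injection is a pullback, and so it is for presheaves.
  \<open>L\<close> preserves this pullback. The counits and the comparison at \<open>T\<close>,
  invertible because the square in \<open>C\<close> is a pushout, carry it to the given
  square.\<close>

lemma pushout_is_pullback:
  assumes po: "is_pushout C X A B D m f g n" and m: "is_mono C X A m"
  shows "is_pullback C X A B D m f g n"
proof -
  note a = po_arr(1-4)[OF po] and o = po_obj[OF po]
  obtain T i j where T: "pw_pushout C (rep X) (rep A) (rep B) T (yo X A m) (yo X B f) i j" and small_T: "small_presheaf C T"
    by (rule pw_pushout_yo[OF m a(1,2)])
  note tD = pw_pushoutD[OF T]
  have T0: "T \<in> T0" by (rule pushout_T0[OF m a(1,2) T small_T])
  obtain \<theta> where \<theta>: "psh_trans C T (rep D) \<theta>"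
    "\<And>a p. a \<in> Obj C \<Longrightarrow> p \<in> omap (rep A) a \<Longrightarrow> \<theta> a (i a p) = Comp C a A D g p"
    "\<And>a p. a \<in> Obj C \<Longrightarrow> p \<in> omap (rep B) a \<Longrightarrow> \<theta> a (j a p) = Comp C a B D n p"
    by (rule comparison[OF m a po_arr(5)[OF po] T]) blast
  have \<theta>': "arr (psh T0) T (rep D) \<theta>" using \<theta>(1) tD(4) T0 o by (simp add: arr_psh)
  have "universal T D \<theta>"
    using universal_iff_pushout[OF m a T T0 \<theta>] po by simp
  then have w: "iso (omap L T) D (Comp C (omap L T) (omap L (rep D)) D (\<epsilon> D) (amap L T (rep D) \<theta>))"
    using universal_iff_iso[OF \<theta>' o(4)] by simp
  have "pw_pullback C (rep X) (rep A) (rep B) T (yo X A m) (yo X B f) i j"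
    unfolding pw_pullback_def
  proof (intro conjI tD(1-8) ballI impI)
    fix c assume c: "c \<in> Obj C"
    show "i c (yo X A m c r) = j c (yo X B f c r)" if "r \<in> omap (rep X) c" for r using tD(9)[OF c that] .
    show "\<exists>r\<in>omap (rep X) c. yo X A m c r = x \<and> yo X B f c r = y"
      if "x \<in> omap (rep A) c" "y \<in> omap (rep B) c" "i c x = j c y" for x y
      using pw_pushout_ij[OF T c that] by metis
    show "r = r'" if "r \<in> omap (rep X) c" "r' \<in> omap (rep X) c" "yo X A m c r = yo X A m c r'" for r r'
      using inj_onD[OF yo_inj[OF m a(1) c] that(3,1,2)] .
  qed
  then have "is_pullback (psh T0) (rep X) (rep A) (rep B) T (yo X A m) (yo X B f) i j"
    by (rule pw_pullback_is_pullback) (use o T0 in simp_all)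
  from lex_pb[OF lex_L this]
  have pb: "is_pullback C (omap L (rep X)) (omap L (rep A)) (omap L (rep B)) (omap L T)
     (amap L (rep X) (rep A) (yo X A m)) (amap L (rep X) (rep B) (yo X B f)) (amap L (rep A) T i) (amap L (rep B) T j)" .
  have ia: "arr (psh T0) (rep A) T i" "arr (psh T0) (rep B) T j" using tD o T0 by (simp_all add: arr_psh)
  have \<theta>i: "Comp (psh T0) (rep A) T (rep D) \<theta> i = yo A D g"
    using presheaf_comp_eq_trI[OF trans_yo[OF a(3)] tD(7) \<theta>(1) tD(2)] \<theta>(2) by simp
  have \<theta>j: "Comp (psh T0) (rep B) T (rep D) \<theta> j = yo B D n"
    using presheaf_comp_eq_trI[OF trans_yo[OF a(4)] tD(8) \<theta>(1) tD(3)] \<theta>(3) by simp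
  show ?thesis
  proof (rule pb_transport[OF pb \<epsilon>_iso[OF o(1)] \<epsilon>_iso[OF o(2)] \<epsilon>_iso[OF o(3)] w a])
    show "Comp C (omap L (rep X)) X A m (\<epsilon> X) = Comp C (omap L (rep X)) (omap L (rep A)) A (\<epsilon> A) (amap L (rep X) (rep A) (yo X A m))"
      using \<epsilon>_nat[OF a(1)] by simp
    show "Comp C (omap L (rep X)) X B f (\<epsilon> X) = Comp C (omap L (rep X)) (omap L (rep B)) B (\<epsilon> B) (amap L (rep X) (rep B) (yo X B f))"
      using \<epsilon>_nat[OF a(2)] by simp
    show "Comp C (omap L (rep A)) A D g (\<epsilon> A) = Comp C (omap L (rep A)) (omap L T) D
        (Comp C (omap L T) (omap L (rep D)) D (\<epsilon> D) (amap L T (rep D) \<theta>)) (amap L (rep A) T i)"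
      using \<epsilon>_nat[OF a(3)] functor_comp[OF L_functor ia(1) \<theta>'] functor_arr[OF L_functor ia(1)] functor_arr[OF L_functor \<theta>']
        \<epsilon>_arr[OF o(4)] \<theta>i by (simp add: assoc)
    show "Comp C (omap L (rep B)) B D n (\<epsilon> B) = Comp C (omap L (rep B)) (omap L T) D
        (Comp C (omap L T) (omap L (rep D)) D (\<epsilon> D) (amap L T (rep D) \<theta>)) (amap L (rep B) T j)"
      using \<epsilon>_nat[OF a(4)] functor_comp[OF L_functor ia(2) \<theta>'] functor_arr[OF L_functor ia(2)] functor_arr[OF L_functor \<theta>']
        \<epsilon>_arr[OF o(4)] \<theta>j by (simp add: assoc)
  qed
qed

text \<open>
  The presheaf pushouts T' and T over the two faces form a pullback along the image of d, since
  this holds for sets; then L transports the universality of the comparison from T to T'.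
\<close>

lemma pushout_stable:
  assumes po: "is_pushout C X A B D m f g n" and m: "is_mono C X A m"
    and pX: "is_pullback C X' A' X A m' x a m" and pB: "is_pullback C X' B' X B f' x b f"
    and pA: "is_pullback C A' D' A D g' a d g" and pD: "is_pullback C B' D' B D n' b d n"
    and top: "Comp C X' A' D' g' m' = Comp C X' B' D' n' f'"
  shows "is_pushout C X' A' B' D' m' f' g' n'"
proof -
  note r = po_arr(1-4)[OF po] and o [simp] = po_obj[OF po]
  note r' = pb_arr(1)[OF pX] pb_arr(1)[OF pB] pb_arr(1)[OF pA] pb_arr(1)[OF pD]
  note v = pb_arr(2)[OF pX] pb_arr(2)[OF pA] pb_arr(2)[OF pD] pb_arr(3)[OF pA]
  note [simp] = r r' v
  note o' [simp] = pb_obj(1,2)[OF pA] pb_obj(1)[OF pX] pb_obj(1)[OF pD]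
  have m': "is_mono C X' A' m'" using pb_mono[OF iffD1[OF is_pullback_swap pX] m] .
  obtain T i j where T: "pw_pushout C (rep X) (rep A) (rep B) T (yo X A m) (yo X B f) i j" and small_T: "small_presheaf C T"
    by (rule pw_pushout_yo[OF m r(1,2)])
  obtain T' i' j' where T': "pw_pushout C (rep X') (rep A') (rep B') T' (yo X' A' m') (yo X' B' f') i' j'" and small_T': "small_presheaf C T'"
    by (rule pw_pushout_yo[OF m' r'(1,2)])
  note tD = pw_pushoutD[OF T] and tD' = pw_pushoutD[OF T']
  have T0: "T \<in> T0" by (rule pushout_T0[OF m r(1,2) T small_T])
  have T0': "T' \<in> T0" by (rule pushout_T0[OF m' r'(1,2) T' small_T'])
  obtain \<theta> where \<theta>: "psh_trans C T (rep D) \<theta>"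
    "\<And>c p. c \<in> Obj C \<Longrightarrow> p \<in> omap (rep A) c \<Longrightarrow> \<theta> c (i c p) = Comp C c A D g p"
    "\<And>c p. c \<in> Obj C \<Longrightarrow> p \<in> omap (rep B) c \<Longrightarrow> \<theta> c (j c p) = Comp C c B D n p"
    by (rule comparison[OF m r po_arr(5)[OF po] T]) blast
  obtain \<theta>' where \<theta>': "psh_trans C T' (rep D') \<theta>'"
    "\<And>c p. c \<in> Obj C \<Longrightarrow> p \<in> omap (rep A') c \<Longrightarrow> \<theta>' c (i' c p) = Comp C c A' D' g' p"
    "\<And>c p. c \<in> Obj C \<Longrightarrow> p \<in> omap (rep B') c \<Longrightarrow> \<theta>' c (j' c p) = Comp C c B' D' n' p"
    by (rule comparison[OF m' r' top T']) blast
  have \<theta>i: "\<theta> c (i c p) = Comp C c A D g p" if "arr C c A p" for c p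
    using \<theta>(2)[OF arrD(1)[OF that], of p] arrD(3)[OF that] by simp
  have \<theta>j: "\<theta> c (j c p) = Comp C c B D n p" if "arr C c B p" for c p
    using \<theta>(3)[OF arrD(1)[OF that], of p] arrD(3)[OF that] by simp
  have \<theta>'i: "\<theta>' c (i' c p) = Comp C c A' D' g' p" if "arr C c A' p" for c p
    using \<theta>'(2)[OF arrD(1)[OF that], of p] arrD(3)[OF that] by simp
  have \<theta>'j: "\<theta>' c (j' c p) = Comp C c B' D' n' p" if "arr C c B' p" for c p
    using \<theta>'(3)[OF arrD(1)[OF that], of p] arrD(3)[OF that] by simp
  have ij: "i c (Comp C c X A m r) = j c (Comp C c X B f r)" if "arr C c X r" for c r
    using tD(9)[OF arrD(1)[OF that], of r] arrD[OF that] by simp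
  have ij': "i' c (Comp C c X' A' m' r) = j' c (Comp C c X' B' f' r)" if "arr C c X' r" for c r
    using tD'(9)[OF arrD(1)[OF that], of r] arrD[OF that] by simp
  have i_nat: "amap T c e h (i c u) = i e (Comp C e c A u h)" if "arr C e c h" "arr C c A u" for c e h u
    using tr_nat[OF tD(7) that(1), of u] arrD(3)[OF that(2)] by simp
  have j_nat: "amap T c e h (j c u) = j e (Comp C e c B u h)" if "arr C e c h" "arr C c B u" for c e h u
    using tr_nat[OF tD(8) that(1), of u] arrD(3)[OF that(2)] by simp
  obtain \<tau> where \<tau>: "psh_trans C T' T \<tau>"
    and \<tau>i0: "\<And>c p. c \<in> Obj C \<Longrightarrow> p \<in> omap (rep A') c \<Longrightarrow> \<tau> c (i' c p) = i c (Comp C c A' A a p)"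
    and \<tau>j0: "\<And>c p. c \<in> Obj C \<Longrightarrow> p \<in> omap (rep B') c \<Longrightarrow> \<tau> c (j' c p) = j c (Comp C c B' B b p)"
  proof (rule pw_pushout_desc[OF T' tD(4), of "\<lambda>c p. i c (Comp C c A' A a p)" "\<lambda>c p. j c (Comp C c B' B b p)"])
    show "i c (Comp C c A' A a p) \<in> omap T c" if "c \<in> Obj C" "p \<in> omap (rep A') c" for c p
      using tr_in[OF tD(7) that(1), of "Comp C c A' A a p"] arrD(3)[OF arr_comp[OF _ v(2), of c p]] that by (simp add: arr_def[of C c A'])
    show "j c (Comp C c B' B b p) \<in> omap T c" if "c \<in> Obj C" "p \<in> omap (rep B') c" for c p
      using tr_in[OF tD(8) that(1), of "Comp C c B' B b p"] arrD(3)[OF arr_comp[OF _ v(3), of c p]] that by (simp add: arr_def[of C c B'])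
    show "i e (Comp C e A' A a (amap (rep A') c e h p)) = amap T c e h (i c (Comp C c A' A a p))"
      if h: "arr C e c h" and p: "p \<in> omap (rep A') c" for c e h p
    proof -
      have "arr C c A' p" using p arrD(2)[OF h] by (simp add: arr_def)
      then show ?thesis using h p by (simp add: i_nat assoc)
    qed
    show "j e (Comp C e B' B b (amap (rep B') c e h p)) = amap T c e h (j c (Comp C c B' B b p))"
      if h: "arr C e c h" and p: "p \<in> omap (rep B') c" for c e h p
    proof -
      have "arr C c B' p" using p arrD(2)[OF h] by (simp add: arr_def)
      then show ?thesis using h p by (simp add: j_nat assoc)
    qed
    show "i c (Comp C c A' A a (yo X' A' m' c q)) = j c (Comp C c B' B b (yo X' B' f' c q))"
      if c: "c \<in> Obj C" and q: "q \<in> omap (rep X') c" for c q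
    proof -
      have "arr C c X' q" using q c by (simp add: arr_def)
      then show ?thesis using c q by (simp add: pb_square[OF pX] pb_square[OF pB] ij)
    qed
  qed blast
  have \<tau>i: "\<tau> c (i' c p) = i c (Comp C c A' A a p)" if "arr C c A' p" for c p
    using \<tau>i0[OF arrD(1)[OF that], of p] arrD(3)[OF that] by simp
  have \<tau>j: "\<tau> c (j' c p) = j c (Comp C c B' B b p)" if "arr C c B' p" for c p
    using \<tau>j0[OF arrD(1)[OF that], of p] arrD(3)[OF that] by simp
  have elt': thesis
    if c: "c \<in> Obj C" and t: "t \<in> omap T' c"
      and "\<And>p. arr C c A' p \<Longrightarrow> t = i' c p \<Longrightarrow> thesis" "\<And>p. arr C c B' p \<Longrightarrow> t = j' c p \<Longrightarrow> thesis" for c t thesis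
    by (rule pw_pushout_cases[OF T' c t]) (use that c in \<open>auto simp: arr_def\<close>)
  have elt: thesis
    if c: "c \<in> Obj C" and t: "t \<in> omap T c"
      and "\<And>p. arr C c A p \<Longrightarrow> t = i c p \<Longrightarrow> thesis" "\<And>p. arr C c B p \<Longrightarrow> t = j c p \<Longrightarrow> thesis" for c t thesis
    by (rule pw_pushout_cases[OF T c t]) (use that c in \<open>auto simp: arr_def\<close>)
  have in_T': "i' c p \<in> omap T' c" if "arr C c A' p" for c p
    using tr_in[OF tD'(7) arrD(1)[OF that], of p] arrD(3)[OF that] by simp
  have jn_T': "j' c p \<in> omap T' c" if "arr C c B' p" for c p
    using tr_in[OF tD'(8) arrD(1)[OF that], of p] arrD(3)[OF that] by simp
  have ij_eq: thesis
    if p: "arr C c A p" and q: "arr C c B q" and e: "i c p = j c q"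
      and r: "\<And>r. arr C c X r \<Longrightarrow> Comp C c X A m r = p \<Longrightarrow> Comp C c X B f r = q \<Longrightarrow> thesis" for c p q thesis
    by (rule pw_pushout_ij[OF T arrD(1)[OF p] _ _ e]) (use p q r arrD(1)[OF p] in \<open>auto simp: arr_def\<close>)
  have ii_eq: thesis
    if p: "arr C c A p" and q: "arr C c A q" and e: "i c p = i c q" and 1: "p = q \<Longrightarrow> thesis"
      and r: "\<And>r r'. arr C c X r \<Longrightarrow> arr C c X r' \<Longrightarrow> Comp C c X A m r = p \<Longrightarrow> Comp C c X A m r' = q \<Longrightarrow>
        Comp C c X B f r = Comp C c X B f r' \<Longrightarrow> thesis" for c p q thesis
    by (rule pw_pushout_ii[OF T arrD(1)[OF p] _ _ e]) (use p q 1 r arrD(1)[OF p] in \<open>auto simp: arr_def\<close>)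
  have jj_eq: "p = q" if p: "arr C c B p" and q: "arr C c B q" and e: "j c p = j c q" for c p q
    by (rule pw_pushout_jj[OF T arrD(1)[OF p] _ _ e]) (use p q in \<open>auto simp: arr_def\<close>)
  have dA: "Comp C c D' D d (Comp C c A' D' g' p) = Comp C c A D g (Comp C c A' A a p)" if "arr C c A' p" for c p
    using pb_square[OF pA that] .
  have dB: "Comp C c D' D d (Comp C c B' D' n' p) = Comp C c B D n (Comp C c B' B b p)" if "arr C c B' p" for c p
    using pb_square[OF pD that] .
  \<comment> \<open>The element of \<open>X\<close> that witnesses the agreement in \<open>T\<close>
    lifts to \<open>X'\<close> through the rear face over \<open>A\<close>; the front face over
    \<open>B\<close> shows that the image of the lift in \<open>B'\<close> is
    \<open>t\<close>.\<close>
  have mixed: "i' c s = j' c t"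
    if s [simp]: "arr C c A' s" and t [simp]: "arr C c B' t" and e: "i c (Comp C c A' A a s) = j c (Comp C c B' B b t)"
      and e': "Comp C c A' D' g' s = Comp C c B' D' n' t" for c s t
  proof (rule ij_eq[OF _ _ e])
    fix q assume q [simp]: "arr C c X q" "Comp C c X A m q = Comp C c A' A a s" "Comp C c X B f q = Comp C c B' B b t"
    obtain z where z [simp]: "arr C c X' z" "Comp C c X' A' m' z = s" "Comp C c X' X x z = q"
      by (rule pb_ex[OF pX s q(1)]) auto
    have "Comp C c X' B' f' z = t"
      by (rule pb_uniq[OF pD]) (use comp_eq_extend[OF top z(1)] e' pb_square[OF pB z(1)] in simp_all)
    then show ?thesis using ij'[OF z(1)] by simp
  qed simp_all
  have "pw_pullback C T' T (rep D') (rep D) \<tau> \<theta>' \<theta> (yo D' D d)"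
    unfolding pw_pullback_def
  proof (intro conjI tD'(4) tD(4) \<tau> \<theta>'(1) \<theta>(1) trans_yo v(4) ballI impI)
    show "presheaf C (rep D')" "presheaf C (rep D)" by simp_all
    fix c assume c: "c \<in> Obj C"
    show "\<theta> c (\<tau> c t) = yo D' D d c (\<theta>' c t)" if t: "t \<in> omap T' c" for t
    proof (rule elt'[OF c t])
      fix p assume p: "arr C c A' p" "t = i' c p"
      then show ?thesis using c arrD(3)[OF arr_comp[OF p(1) r'(3)]] by (simp add: \<tau>i \<theta>i \<theta>'i dA)
    next
      fix p assume p: "arr C c B' p" "t = j' c p"
      then show ?thesis using c arrD(3)[OF arr_comp[OF p(1) r'(4)]] by (simp add: \<tau>j \<theta>j \<theta>'j dB)
    qed
    show "\<exists>t\<in>omap T' c. \<tau> c t = s \<and> \<theta>' c t = k" if s: "s \<in> omap T c" and k: "k \<in> omap (rep D') c" and e: "\<theta> c s = yo D' D d c k" for s k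
    proof (rule elt[OF c s])
      have k': "arr C c D' k" using k c by (simp add: arr_def)
      fix p assume p: "arr C c A p" "s = i c p"
      then have "Comp C c D' D d k = Comp C c A D g p" using e k c by (simp add: \<theta>i)
      then obtain z where "arr C c A' z" "Comp C c A' D' g' z = k" "Comp C c A' A a z = p"
        by (rule pb_ex[OF pA k' p(1)])
      then show ?thesis using p by (intro bexI[of _ "i' c z"]) (simp_all add: \<tau>i \<theta>'i in_T')
    next
      have k': "arr C c D' k" using k c by (simp add: arr_def)
      fix p assume p: "arr C c B p" "s = j c p"
      then have "Comp C c D' D d k = Comp C c B D n p" using e k c by (simp add: \<theta>j)
      then obtain z where "arr C c B' z" "Comp C c B' D' n' z = k" "Comp C c B' B b z = p"
        by (rule pb_ex[OF pD k' p(1)])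
      then show ?thesis using p by (intro bexI[of _ "j' c z"]) (simp_all add: \<tau>j \<theta>'j jn_T')
    qed
    show "t = t'" if t: "t \<in> omap T' c" "t' \<in> omap T' c" and e: "\<tau> c t = \<tau> c t'" "\<theta>' c t = \<theta>' c t'" for t t'
    proof (rule elt'[OF c t(1)]; rule elt'[OF c t(2)])
      fix p q assume p [simp]: "arr C c A' p" and tp: "t = i' c p" and q [simp]: "arr C c A' q" and tq: "t' = i' c q"
      have ei: "i c (Comp C c A' A a p) = i c (Comp C c A' A a q)" and eg: "Comp C c A' D' g' p = Comp C c A' D' g' q"
        using e by (simp_all add: tp tq \<tau>i \<theta>'i)
      show ?thesis
      proof (rule ii_eq[OF _ _ ei])
        assume "Comp C c A' A a p = Comp C c A' A a q"
        then show ?thesis using pb_uniq[OF pA p q eg] tp tq by simp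
      next
        \<comment> \<open>The two elements differ in \<open>A\<close> but meet in \<open>T\<close>
          through \<open>s\<close> and \<open>s'\<close>. Lifting \<open>s\<close> to
          \<open>X'\<close> replaces the first element by one from \<open>B'\<close>, which reduces
          the claim to the mixed case.\<close>
        fix s s' assume s [simp]: "arr C c X s" "arr C c X s'" "Comp C c X A m s = Comp C c A' A a p"
          "Comp C c X A m s' = Comp C c A' A a q" and sf: "Comp C c X B f s = Comp C c X B f s'"
        obtain z where z [simp]: "arr C c X' z" "Comp C c X' A' m' z = p" "Comp C c X' X x z = s"
          by (rule pb_ex[OF pX p s(1)]) auto
        have "i c (Comp C c A' A a q) = j c (Comp C c B' B b (Comp C c X' B' f' z))"
          using ij[OF s(2)] by (simp add: pb_square[OF pB z(1)] sf)
        moreover have "Comp C c A' D' g' q = Comp C c B' D' n' (Comp C c X' B' f' z)"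
          using comp_eq_extend[OF top z(1)] by (simp add: eg)
        ultimately have "i' c q = j' c (Comp C c X' B' f' z)"
          by (intro mixed) simp_all
        then show ?thesis using ij'[OF z(1)] tp tq by simp
      qed simp_all
    next
      fix p q assume p [simp]: "arr C c A' p" and tp: "t = i' c p" and q [simp]: "arr C c B' q" and tq: "t' = j' c q"
      show ?thesis using mixed[OF p q] e by (simp add: tp tq \<tau>i \<tau>j \<theta>'i \<theta>'j)
    next
      fix q p assume q [simp]: "arr C c B' q" and tq: "t = j' c q" and p [simp]: "arr C c A' p" and tp: "t' = i' c p"
      show ?thesis using mixed[OF p q] e by (simp add: tp tq \<tau>i \<tau>j \<theta>'i \<theta>'j)
    next
      fix p q assume p [simp]: "arr C c B' p" and tp: "t = j' c p" and q [simp]: "arr C c B' q" and tq: "t' = j' c q"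
      have "Comp C c B' B b p = Comp C c B' B b q"
        by (rule jj_eq[of c]) (use e in \<open>simp_all add: tp tq \<tau>j\<close>)
      moreover have "Comp C c B' D' n' p = Comp C c B' D' n' q" using e by (simp add: tp tq \<theta>'j)
      ultimately have "p = q" using pb_uniq[OF pD p q] by blast
      then show ?thesis using tp tq by simp
    qed
  qed
  then have "is_pullback (psh T0) T' T (rep D') (rep D) \<tau> \<theta>' \<theta> (yo D' D d)"
    by (rule pw_pullback_is_pullback) (use T0 T0' in simp_all)
  from lex_pb[OF lex_L this] have pb: "is_pullback C (omap L T') (omap L T) (omap L (rep D')) (omap L (rep D))
     (amap L T' T \<tau>) (amap L T' (rep D') \<theta>') (amap L T (rep D) \<theta>) (amap L (rep D') (rep D) (yo D' D d))" .
  have \<theta>_arr: "arr (psh T0) T (rep D) \<theta>" "arr (psh T0) T' (rep D') \<theta>'"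
    using \<theta>(1) \<theta>'(1) tD(4) tD'(4) T0 T0' by (simp_all add: arr_psh)
  have "universal T D \<theta>" using universal_iff_pushout[OF m r T T0 \<theta>] po by simp
  then have "iso (omap L T) (omap L (rep D)) (amap L T (rep D) \<theta>)"
    using universal_iff_L_iso[OF \<theta>_arr(1)] by simp
  \<comment> \<open>An isomorphism pulls back to an isomorphism, so invertibility passes from the
    lower comparison to the upper one.\<close>
  then have "iso (omap L T') (omap L (rep D')) (amap L T' (rep D') \<theta>')" by (rule pb_of_iso[OF pb])
  then have "universal T' D' \<theta>'" using universal_iff_L_iso[OF \<theta>_arr(2)] by simp
  then show ?thesis using universal_iff_pushout[OF m' r' T' T0' \<theta>'] by simp
qed

text \<open>The preceding lemmas take the first leg to be monic; when it is the second one, the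
  squares and cubes are reflected.\<close>

lemma pushouts_exact:
  "has_pushouts_along_monos C \<and> stable_pushouts_along_monos C \<and> pushouts_along_monos_are_pullbacks C"
proof (intro conjI)
  show "has_pushouts_along_monos C"
    unfolding has_pushouts_along_monos_def
  proof (intro ballI impI)
    fix X A B m f assume o: "X \<in> Obj C" "A \<in> Obj C" "B \<in> Obj C" "m \<in> Hom C X A" "f \<in> Hom C X B"
      and mf: "is_mono C X A m \<or> is_mono C X B f"
    have a: "arr C X A m" "arr C X B f" using o by (simp_all add: arr_def)
    from mf show "\<exists>D g n. is_pushout C X A B D m f g n"
    proof
      assume "is_mono C X A m"
      then show ?thesis using pushout_exists a by blast
    next
      assume "is_mono C X B f"
      then obtain D g n where "is_pushout C X B A D f m g n" using pushout_exists[OF _ a(2,1)] by blast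
      then have "is_pushout C X A B D m f n g" by (rule iffD1[OF is_pushout_swap])
      then show ?thesis by blast
    qed
  qed
  show "pushouts_along_monos_are_pullbacks C"
    unfolding pushouts_along_monos_are_pullbacks_def pushout_along_mono_def
  proof (intro allI impI, elim conjE disjE)
    fix X A B D m f g n assume po: "is_pushout C X A B D m f g n"
    show "is_pullback C X A B D m f g n" if "is_mono C X A m" by (rule pushout_is_pullback[OF po that])
    show "is_pullback C X A B D m f g n" if "is_mono C X B f"
      by (rule iffD1[OF is_pullback_swap pushout_is_pullback[OF iffD1[OF is_pushout_swap po] that]])
  qed
  show "stable_pushouts_along_monos C"
    unfolding stable_pushouts_along_monos_def pushout_along_mono_def
  proof (intro allI impI, elim conjE disjE)
    fix X A B D m f g n X' A' B' D' m' f' g' n' x a b d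
    assume cube: "comm_cube C X A B D m f g n X' A' B' D' m' f' g' n' x a b d"
      and po: "is_pushout C X A B D m f g n" and pX: "is_pullback C X' A' X A m' x a m" and pB: "is_pullback C X' B' X B f' x b f"
      and pA: "is_pullback C A' D' A D g' a d g" and pD: "is_pullback C B' D' B D n' b d n"
    have top: "Comp C X' A' D' g' m' = Comp C X' B' D' n' f'"
      using cube by (simp add: comm_cube_def comm_square_def)
    show "is_pushout C X' A' B' D' m' f' g' n'" if "is_mono C X A m"
      by (rule pushout_stable[OF po that pX pB pA pD top])
    show "is_pushout C X' A' B' D' m' f' g' n'" if "is_mono C X B f"
      by (rule iffD1[OF is_pushout_swap pushout_stable[OF iffD1[OF is_pushout_swap po] that pB pX pD pA top[symmetric]]])
  qed
qed

end

text \<open>Instantiates \<open>lex_reflection\<close> with the closure that defines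
  \<open>Phi_l\<close>; the pushouts required to lie in it are provided by
  \<open>pw_pushout_in_closure\<close>.\<close>

lemma (in lfc_cat) exact_imp_pushouts:
  fixes K :: "('u, 'u) cat" and \<phi> :: "('u, 'u) presheaf"
  assumes w: "is_adh_weight (K, \<phi>)" and ex: "Phi_exact {(K, \<phi>)} C"
  shows "has_pushouts_along_monos C \<and> stable_pushouts_along_monos C \<and> pushouts_along_monos_are_pullbacks C"
proof -
  obtain L \<eta> \<epsilon> where "adjunction (psh (small \<inter> closure_l {(K, \<phi>)})) C L (yoneda C) \<eta> \<epsilon>" "lex (psh (small \<inter> closure_l {(K, \<phi>)})) C L"
    using ex unfolding Phi_exact_def Phi_l_psh by blast
  then interpret lex_reflection C "small \<inter> closure_l {(K, \<phi>)}" L \<eta> \<epsilon>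
    by unfold_locales (use rep_small_closure pw_pushout_in_closure[OF w] in auto)
  show ?thesis by (rule pushouts_exact)
qed

theorem proposition5p8:
  fixes C :: "('o, 'u) cat" and K :: "('u, 'u) cat" and \<phi> :: "('u, 'u) presheaf"
  assumes "set_universe TYPE('u)"
    and "locally_small C" and "finitely_complete C"
    and "is_adh_weight (K, \<phi>)"
  shows "(Phi_exact {(K, \<phi>)} C \<longleftrightarrow> adhesive C) \<and>
    (adhesive C \<longleftrightarrow>
       has_pushouts_along_monos C \<and> stable_pushouts_along_monos C \<and>
       pushouts_along_monos_are_pullbacks C)"
proof -
  interpret lfc_cat C using assms(1-3) by unfold_locales
  note iff = adhesive_iff_stable[OF assms(3)]
  have "adhesive C" if "Phi_exact {(K, \<phi>)} C"
    using exact_imp_pushouts[OF assms(4) that] iff by blast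
  moreover have "Phi_exact {(K, \<phi>)} C" if "adhesive C"
  proof -
    interpret adh_lfc C using that unfolding iff by unfold_locales auto
    show ?thesis by (rule adhesive_imp_exact[OF assms(4)])
  qed
  ultimately show ?thesis using iff by blast
qed

end
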